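(* Let $B$ be a tropical affine torus and $X=X(B)=T^*B/T^*_{\mathbb Z}B$. There is an isomorphism of abelian groups $$F^0\mathrm{Cob}_{\mathrm{fib}}(X)/F^1\mathrm{Cob}_{\mathrm{fib}}(X)\;\cong\;H_0(B),$$ where $F^\bullet\mathrm{Cob}_{\mathrm{fib}}(X)$ is the parallelotope filtration.
   Context: **Tropical affine tori.** A tropical affine torus of dimension $n$ is $B=\mathbb R^n/\Lambda$, with $\Lambda\subset\mathbb R^n$ a rank-$n$ lattice acting by translation, equipped with the lattice $T_{\mathbb Z}B\subset TB$ induced by $\mathbb Z^n\subset\mathbb R^n$, and the dual lattice $T^*_{\mathbb Z}B\subset T^*B$. $m:B\times B\to B$ is the group structure induced from $\mathbb R^n$. $H_0(B)=H_0(B;\mathbb Z)$. **Symplectic torus.** $X(B)=T^*B/T^*_{\mathbb Z}B$ carries the symplectic form $\omega=\sum_i dq_i\wedge dp_i$ induced from $T^*B$; the projection $\pi:X(B)\to B$ is a Lagrangian torus fibration with fibers $F_b=\pi^{-1}(b)$. **Cobordism group.** Let $\mathcal L$ be the collection of embedded, weakly-exact ($\omega(\pi_2(X,L))=0$), oriented Lagrangians in $X$ equipped with a Spin structure. Let $\mathcal L_{cob}$ be the collection of properly immersed (with clean self-intersections), oriented, Spin Lagrangians $V\subset (X\times\mathbb C,\omega\oplus\omega_{\mathbb C})$ such that, outside the preimage of some compact subset of $\mathbb C$, $V=\bigsqcup_{j}\big(L_j^-\times(\mathbb R_-+i\,j)\big)\sqcup\bigsqcup_j\big(L_j^+\times(\mathbb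 R_++i\,j)\big)$ for finite tuples $(L_j^-)$, $(L_j^+)$ of elements of $\mathcal L$, with orientations and Spin structures restricting compatibly. $\mathrm{Cob}(X)$ is the quotient of the free abelian group $\mathbb Z\langle\mathcal L\rangle$ by the relations $\sum_j L_j^-=\sum_j L_j^+$ whenever there is such a cobordism between $(L_j^-)$ and $(L_j^+)$. **Filtration.** $\mathrm{Cob}_{\mathrm{fib}}(X)\subset\mathrm{Cob}(X)$ is the subgroup generated by the fibers $F_b$ (all carrying the same orientation and Spin structure under the translations of $B$). The Pontryagin product $\star$ on $\mathrm{Cob}_{\mathrm{fib}}(X)$ is the (well-defined) bilinear operation with $F_b\star F_{b'}=F_{m(b,b')}$. $\mathrm{Cob}_{\mathrm{fib}}(X)_{\hom}$ is the subgroup generated by differences $F_p-F_q$. The parallelotope filtration is $F^i\mathrm{Cob}_{\mathrm{fib}}(X):=(\mathrm{Cob}_{\mathrm{fib}}(X)_{\hom})^{\star i}$, the subgroup generated by $i$-fold $\star$-products of elements of $\mathrm{Cob}_{\mathrm{fib}}(X)_{\hom}$, with $F^0\mathrm{Cob}_{\mathrm{fib}}(X):=\mathrm{Cob}_{\mathrm{fib}}(X)$. *)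

theory Defs
  imports "HOL-Analysis.Analysis" "HOL-Homology.Homology"
begin

section \<open>Smooth maps between open subsets of Euclidean spaces\<close>

primrec Ck_on ::
  "nat \<Rightarrow> 'a::euclidean_space set \<Rightarrow> ('a \<Rightarrow> 'b::euclidean_space) \<Rightarrow> bool" where
  "Ck_on 0 S f \<longleftrightarrow> continuous_on S f"
| "Ck_on (Suc k) S f \<longleftrightarrow>
     (\<forall>x\<in>S. f differentiable (at x)) \<and> (\<forall>v. Ck_on k S (\<lambda>x. frechet_derivative f (at x) v))"

definition smooth_on :: "'a::euclidean_space set \<Rightarrow> ('a \<Rightarrow> 'b::euclidean_space) \<Rightarrow> bool" where
  "smooth_on S f \<longleftrightarrow> (\<forall>k. Ck_on k S f)"


section \<open>Lattices and tori\<close>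

definition full_lattice :: "(real^'n) set \<Rightarrow> bool" where
  "full_lattice \<Lambda> \<longleftrightarrow>
     (\<exists>v :: 'n \<Rightarrow> real^'n. inj v \<and> independent (range v) \<and>
        \<Lambda> = {(\<Sum>i\<in>UNIV. of_int (c i) *\<^sub>R v i) | c. True})"

definition int_lattice :: "(real^'n) set" where
  "int_lattice = {v. \<forall>i. v $ i \<in> \<int>}"

definition dual_lattice :: "(real^'n) set \<Rightarrow> (real^'n) set" where
  "dual_lattice M = {p. \<forall>v\<in>M. p \<bullet> v \<in> \<int>}"

text \<open>The points of the quotient of a vector space by a lattice are the cosets.\<close>

definition quot_proj :: "'e::euclidean_space set \<Rightarrow> 'e \<Rightarrow> 'e set" where
  "quot_proj G z = (+) z ` G"

definition quot_top :: "'e::euclidean_space set \<Rightarrow> 'e set topology" where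
  "quot_top G = topology (\<lambda>U. U \<subseteq> range (quot_proj G) \<and> open (quot_proj G -` U))"

lemma openin_quot_top:
  "openin (quot_top G) U \<longleftrightarrow> U \<subseteq> range (quot_proj G) \<and> open (quot_proj G -` U)"
proof -
  have "istopology (\<lambda>U. U \<subseteq> range (quot_proj G) \<and> open (quot_proj G -` U))"
    unfolding istopology_def by (auto simp: vimage_Union)
  then show ?thesis
    by (simp add: quot_top_def topology_inverse')
qed

definition base_top :: "(real^'n) set \<Rightarrow> (real^'n) set topology" where
  "base_top \<Lambda> = quot_top \<Lambda>"

definition base_add :: "(real^'n) set \<Rightarrow> (real^'n) set \<Rightarrow> (real^'n) set" where
  "base_add b b' = {x + y | x y. x \<in> b \<and> y \<in> b'}"

text \<open>In the global coordinates \<open>(q, p)\<close>, the cotangent bundle of \<open>B\<close> is the quotient of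
  \<open>real^'n \<times> real^'n\<close> by \<open>\<Lambda> \<times> {0}\<close>, and the covector lattice at every point is the dual
  of the integer lattice.  Hence \<open>X(B)\<close> is the quotient of \<open>real^'n \<times> real^'n\<close> by the
  following lattice.\<close>

type_synonym 'n phase = "(real^'n) \<times> (real^'n)"
type_synonym 'n pt = "'n phase set"

definition phase_lattice :: "(real^'n) set \<Rightarrow> 'n phase set" where
  "phase_lattice \<Lambda> = \<Lambda> \<times> dual_lattice int_lattice"

definition X_proj :: "(real^'n) set \<Rightarrow> 'n phase \<Rightarrow> 'n pt" where
  "X_proj \<Lambda> = quot_proj (phase_lattice \<Lambda>)"

definition X_top :: "(real^'n) set \<Rightarrow> 'n pt topology" where
  "X_top \<Lambda> = quot_top (phase_lattice \<Lambda>)"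

definition XC_proj :: "(real^'n) set \<Rightarrow> 'n phase \<times> complex \<Rightarrow> 'n pt \<times> complex" where
  "XC_proj \<Lambda> = map_prod (X_proj \<Lambda>) id"

definition XC_top :: "(real^'n) set \<Rightarrow> ('n pt \<times> complex) topology" where
  "XC_top \<Lambda> = prod_topology (X_top \<Lambda>) euclidean"

text \<open>As points are cosets, the projection \<open>X(B) \<rightarrow> B\<close> is the image under \<^const>\<open>fst\<close>.\<close>

definition X_fiber :: "(real^'n) set \<Rightarrow> (real^'n) set \<Rightarrow> 'n pt set" where
  "X_fiber \<Lambda> b = {x \<in> topspace (X_top \<Lambda>). fst ` x = b}"

text \<open>\<open>\<Sum>i. dq\<^sub>i \<and> dp\<^sub>i\<close>, and its sum with \<open>dx \<and> dy\<close>.\<close>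

definition omega :: "'n::finite phase \<Rightarrow> 'n phase \<Rightarrow> real" where
  "omega u w = fst u \<bullet> snd w - snd u \<bullet> fst w"

definition omegaC :: "'n::finite phase \<times> complex \<Rightarrow> 'n phase \<times> complex \<Rightarrow> real" where
  "omegaC u w = omega (fst u) (fst w) +
     (Re (snd u) * Im (snd w) - Im (snd u) * Re (snd w))"


section \<open>Immersed manifolds, orientations and Spin structures\<close>

text \<open>The targets \<open>X\<close> and \<open>X \<times> \<complex>\<close> are quotients \<open>P : 'e \<rightarrow> 'x\<close> of a vector space by a
  discrete group of translations, so smoothness is tested on local lifts along \<open>P\<close> and every
  tangent space of the target is \<open>'e\<close>.  An \<open>m\<close>-manifold immersed by \<open>f\<close> is given by the topology
  \<open>T\<close> of its domain and the map \<open>f\<close>: its smooth structure is the unique one for which \<open>f\<close> is an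
  immersion, and its charts are the \<open>\<psi>\<close> below, whose transition maps are automatically smooth.
  The index type \<open>'m\<close> has \<open>m\<close> elements.\<close>

definition immersion_chart ::
  "('e::euclidean_space \<Rightarrow> 'x) \<Rightarrow> 'v topology \<Rightarrow> ('v \<Rightarrow> 'x) \<Rightarrow>
   (real^'m) set \<Rightarrow> (real^'m \<Rightarrow> 'v) \<Rightarrow> (real^'m \<Rightarrow> 'e) \<Rightarrow> bool" where
  "immersion_chart P T f W \<psi> F \<longleftrightarrow>
     open W \<and> embedding_map (top_of_set W) T \<psi> \<and> openin T (\<psi> ` W) \<and>
     smooth_on W F \<and> (\<forall>y\<in>W. inj (frechet_derivative F (at y)) \<and> P (F y) = f (\<psi> y))"

definition immersed_manifold ::
  "'m::finite itself \<Rightarrow> ('e::euclidean_space \<Rightarrow> 'x) \<Rightarrow> 'v topology \<Rightarrow> ('v \<Rightarrow> 'x) \<Rightarrow> bool" where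
  "immersed_manifold _ P T f \<longleftrightarrow>
     Hausdorff_space T \<and> second_countable T \<and>
     (\<forall>x\<in>topspace T. \<exists>(W :: (real^'m) set) \<psi> F. immersion_chart P T f W \<psi> F \<and> x \<in> \<psi> ` W)"

text \<open>All frames of the tangent spaces of an immersed manifold, as frames in \<open>'e\<close>.\<close>

definition frames ::
  "('e::euclidean_space \<Rightarrow> 'x) \<Rightarrow> 'v topology \<Rightarrow> ('v \<Rightarrow> 'x) \<Rightarrow> ('v \<times> ('e, 'm::finite) vec) set" where
  "frames P T f =
     {(x, e). \<exists>(W :: (real^'m) set) \<psi> F y. immersion_chart P T f W \<psi> F \<and> y \<in> W \<and> x = \<psi> y \<and>
        (\<forall>i. e $ i \<in> range (frechet_derivative F (at y))) \<and>
        inj (\<lambda>i. e $ i) \<and> independent (range (\<lambda>i. e $ i))}"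

definition frame_top :: "'v topology \<Rightarrow> ('v \<times> ('e::euclidean_space, 'm::finite) vec) set \<Rightarrow>
    ('v \<times> ('e, 'm::finite) vec) topology" where
  "frame_top T Q = subtopology (prod_topology T euclidean) Q"

text \<open>An orientation is given by its set of positive frames: an open subset of the frame bundle
  which meets every fibre in exactly one orbit of the matrices of positive determinant.\<close>

definition orientation ::
  "('e::euclidean_space \<Rightarrow> 'x) \<Rightarrow> 'v topology \<Rightarrow> ('v \<Rightarrow> 'x) \<Rightarrow> ('v \<times> ('e, 'm::finite) vec) set \<Rightarrow> bool" where
  "orientation P T f Q \<longleftrightarrow>
     openin (frame_top T (frames P T f)) Q \<and>
     (\<forall>x\<in>topspace T. \<exists>e. (x, e) \<in> Q) \<and>
     (\<forall>x e. (x, e) \<in> Q \<longrightarrow>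
        {e'. (x, e') \<in> Q} =
        {e'. \<exists>A :: real^'m^'m. det A > 0 \<and> (\<forall>i. e' $ i = (\<Sum>j\<in>UNIV. A $ i $ j *\<^sub>R e $ j))})"

text \<open>A Spin structure (up to isomorphism) on an oriented vector bundle of rank \<open>m\<close> is a double
  cover of its bundle \<open>Q\<close> of positive frames, that is, a class in \<open>H\<^sup>1(Q; \<int>/2)\<close>, which is
  nontrivial on every fibre if \<open>m \<ge> 2\<close>; for \<open>m = 1\<close> it is an arbitrary double cover, as usual.
  Here \<open>H\<^sup>1(Q; \<int>/2) = Hom(H\<^sub>1(Q), \<int>/2)\<close>, and homomorphisms are normalised outside the
  carrier.\<close>

type_synonym ('v, 'e, 'm) spin = "('v \<times> ('e, 'm::finite) vec) chain set \<Rightarrow> int"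

definition spin_structure ::
  "'v topology \<Rightarrow> ('v \<times> ('e::euclidean_space, 'm::finite) vec) set \<Rightarrow> ('v, 'e, 'm) spin \<Rightarrow> bool" where
  "spin_structure T Q \<sigma> \<longleftrightarrow>
     \<sigma> \<in> hom (homology_group 1 (frame_top T Q)) (integer_mod_group 2) \<and>
     \<sigma> \<in> extensional (carrier (homology_group 1 (frame_top T Q))) \<and>
     (2 \<le> CARD('m) \<longrightarrow>
       (\<forall>x\<in>topspace T.
          let Qx = {z \<in> Q. fst z = x} in
          \<exists>c\<in>carrier (homology_group 1 (frame_top T Qx)).
            \<sigma> (hom_induced 1 (frame_top T Qx) {} (frame_top T Q) {} id c) \<noteq> 0))"

definition spin_pullback ::
  "'a topology \<Rightarrow> 'b topology \<Rightarrow> ('a \<Rightarrow> 'b) \<Rightarrow> ('b chain set \<Rightarrow> int) \<Rightarrow> ('a chain set \<Rightarrow> int)" where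
  "spin_pullback Y Z g \<sigma> =
     restrict (\<lambda>c. \<sigma> (hom_induced 1 Y {} Z {} g c)) (carrier (homology_group 1 Y))"

text \<open>The dimension of the immersed manifolds will be half the dimension of the target.\<close>

definition isotropic_frames :: "('e \<Rightarrow> 'e \<Rightarrow> real) \<Rightarrow> ('v \<times> ('e, 'm::finite) vec) set \<Rightarrow> bool" where
  "isotropic_frames w Q \<longleftrightarrow> (\<forall>(x, e)\<in>Q. \<forall>i j. w (e $ i) (e $ j) = 0)"

text \<open>Clean self-intersections: the fibre product \<open>{(x, y). f x = f y}\<close> is a submanifold of the
  square of the domain, with tangent spaces the fibre products of the tangent spaces.  In charts,
  \<open>\<Phi>\<close> is a local diffeomorphism with inverse \<open>\<Psi>\<close> which flattens it to the subspace \<open>K\<close>.\<close>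

definition clean_self_intersections ::
  "'m::finite itself \<Rightarrow> ('e::euclidean_space \<Rightarrow> 'x) \<Rightarrow> 'v topology \<Rightarrow> ('v \<Rightarrow> 'x) \<Rightarrow> bool" where
  "clean_self_intersections _ P T f \<longleftrightarrow>
     (\<forall>(W :: (real^'m) set) \<psi> F (W' :: (real^'m) set) \<psi>' F' a b.
        immersion_chart P T f W \<psi> F \<and> immersion_chart P T f W' \<psi>' F' \<and>
        a \<in> W \<and> b \<in> W' \<and> f (\<psi> a) = f (\<psi>' b) \<longrightarrow>
        (\<exists>N (\<Phi> :: (real^'m) \<times> (real^'m) \<Rightarrow> (real^'m) \<times> (real^'m)) \<Psi> K.
           let D = {(y, y') \<in> N. f (\<psi> y) = f (\<psi>' y')} in
           open N \<and> (a, b) \<in> N \<and> N \<subseteq> W \<times> W' \<and>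
           open (\<Phi> ` N) \<and> smooth_on N \<Phi> \<and> smooth_on (\<Phi> ` N) \<Psi> \<and> (\<forall>z\<in>N. \<Psi> (\<Phi> z) = z) \<and>
           subspace K \<and> \<Phi> ` D = \<Phi> ` N \<inter> K \<and>
           (\<forall>(y, y')\<in>D.
              {u. frechet_derivative \<Phi> (at (y, y')) u \<in> K} =
              {(v, v'). frechet_derivative F (at y) v = frechet_derivative F' (at y') v'})))"


section \<open>Lagrangian branes\<close>

text \<open>A disc in \<open>X\<close> lifts to the universal cover, and every class in \<open>\<pi>\<^sub>2(X, L)\<close> has a smooth
  representative; \<open>u\<close> is the lift.\<close>

definition weakly_exact :: "(real^'n) set \<Rightarrow> 'n pt set \<Rightarrow> bool" where
  "weakly_exact \<Lambda> L \<longleftrightarrow>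
     (\<forall>(u :: complex \<Rightarrow> 'n phase) S.
        open S \<and> cball 0 1 \<subseteq> S \<and> smooth_on S u \<and> (\<forall>z\<in>sphere 0 1. X_proj \<Lambda> (u z) \<in> L) \<longrightarrow>
        integral (cball 0 1)
          (\<lambda>z. omega (frechet_derivative u (at z) 1) (frechet_derivative u (at z) \<i>)) = 0)"

text \<open>A brane consists of a subset of \<open>X\<close>, its positive frames and its Spin structure.\<close>

type_synonym 'n brane =
  "'n pt set \<times> ('n pt \<times> ('n phase, 'n::finite) vec) set \<times> ('n pt, 'n phase, 'n) spin"

text \<open>A subset of \<open>X\<close> is an embedded submanifold if its inclusion, for the subspace topology,
  is an immersion.\<close>

definition branes :: "(real^'n) set \<Rightarrow> 'n brane set" where
  "branes \<Lambda> =
     {(L, Q, \<sigma>). L \<subseteq> topspace (X_top \<Lambda>) \<and> compactin (X_top \<Lambda>) L \<and>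
        (let T = subtopology (X_top \<Lambda>) L in
           immersed_manifold TYPE('n) (X_proj \<Lambda>) T id \<and> orientation (X_proj \<Lambda>) T id Q \<and>
           isotropic_frames omega Q \<and> spin_structure T Q \<sigma>) \<and>
        weakly_exact \<Lambda> L}"

definition brane_top :: "(real^'n) set \<Rightarrow> 'n brane \<Rightarrow> ('n pt \<times> ('n phase, 'n::finite) vec) topology" where
  "brane_top \<Lambda> B = (case B of (L, Q, \<sigma>) \<Rightarrow> frame_top (subtopology (X_top \<Lambda>) L) Q)"


section \<open>The cobordism group\<close>

text \<open>The frame \<open>(e, \<partial>\<^sub>x)\<close> of a product with a horizontal line.\<close>

definition stab_frame :: "('n::finite phase)^'n \<Rightarrow> ('n phase \<times> complex)^('n option)" where
  "stab_frame e = (\<chi> k. case k of Some i \<Rightarrow> (e $ i, 0) | None \<Rightarrow> (0, 1))"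

text \<open>Outside \<open>K\<close>, the orientation and Spin structure \<open>(Q, \<sigma>)\<close> of the immersed manifold \<open>(T, f)\<close>
  restrict along the end \<open>L \<times> (R + \<i> j)\<close> to those of the brane \<open>L\<close>, where \<open>f\<close> is injective
  outside \<open>K\<close>.\<close>

definition end_compatible ::
  "(real^'n) set \<Rightarrow> 'v topology \<Rightarrow> ('v \<Rightarrow> 'n pt \<times> complex) \<Rightarrow>
   ('v \<times> ('n phase \<times> complex, ('n::finite) option) vec) set \<Rightarrow>
   ('v, 'n phase \<times> complex, 'n option) spin \<Rightarrow>
   complex set \<Rightarrow> real set \<Rightarrow> nat \<Rightarrow> 'n brane \<Rightarrow> bool" where
  "end_compatible \<Lambda> T f Q \<sigma> K R j B \<longleftrightarrow>
     (case B of (L, QL, \<sigma>L) \<Rightarrow>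
        \<forall>t\<in>R. Complex t (real j) \<notin> K \<longrightarrow>
          (let g = inv_into {v \<in> topspace T. snd (f v) \<notin> K} f;
               h = (\<lambda>(x, e). (g (x, Complex t (real j)), stab_frame e))
           in h ` QL \<subseteq> Q \<and>
              spin_pullback (brane_top \<Lambda> B) (frame_top T Q) h \<sigma> = \<sigma>L))"

definition ends_set ::
  "'n brane list \<Rightarrow> real set \<Rightarrow> ('n::finite pt \<times> complex) set" where
  "ends_set Bs R = {(x, Complex t (real j)) | x t j. j < length Bs \<and> x \<in> fst (Bs ! j) \<and> t \<in> R}"

text \<open>The domain of a cobordism has at most the cardinality of the continuum, so taking its
  points in \<^typ>\<open>real\<close> (with an arbitrary topology \<open>T\<close> on a subset) is no restriction.\<close>

definition cobordant :: "(real^'n) set \<Rightarrow> 'n brane list \<Rightarrow> 'n brane list \<Rightarrow> bool" where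
  "cobordant \<Lambda> Bs Cs \<longleftrightarrow>
     (\<exists>(T :: real topology) f Q \<sigma> K.
        immersed_manifold TYPE('n option) (XC_proj \<Lambda>) T f \<and>
        proper_map T (XC_top \<Lambda>) f \<and>
        clean_self_intersections TYPE('n option) (XC_proj \<Lambda>) T f \<and>
        orientation (XC_proj \<Lambda>) T f Q \<and>
        isotropic_frames omegaC Q \<and>
        spin_structure T Q \<sigma> \<and>
        compact K \<and>
        inj_on f {v \<in> topspace T. snd (f v) \<notin> K} \<and>
        f ` {v \<in> topspace T. snd (f v) \<notin> K} =
          {w \<in> ends_set Bs {..0} \<union> ends_set Cs {0..}. snd w \<notin> K} \<and>
        (\<forall>j<length Bs. end_compatible \<Lambda> T f Q \<sigma> K {..0} j (Bs ! j)) \<and>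
        (\<forall>j<length Cs. end_compatible \<Lambda> T f Q \<sigma> K {0..} j (Cs ! j)))"

definition free_cob :: "(real^'n) set \<Rightarrow> ('n brane \<Rightarrow>\<^sub>0 int) monoid" where
  "free_cob \<Lambda> = free_Abelian_group (branes \<Lambda>)"

definition cob_relations :: "(real^'n) set \<Rightarrow> ('n brane \<Rightarrow>\<^sub>0 int) set" where
  "cob_relations \<Lambda> = generate (free_cob \<Lambda>)
     {sum_list (map frag_of Bs) - sum_list (map frag_of Cs) | Bs Cs.
        Bs \<in> lists (branes \<Lambda>) \<and> Cs \<in> lists (branes \<Lambda>) \<and> cobordant \<Lambda> Bs Cs}"

definition Cob :: "(real^'n) set \<Rightarrow> ('n brane \<Rightarrow>\<^sub>0 int) set monoid" where
  "Cob \<Lambda> = free_cob \<Lambda> Mod cob_relations \<Lambda>"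

definition cob_class :: "(real^'n) set \<Rightarrow> 'n brane \<Rightarrow> ('n brane \<Rightarrow>\<^sub>0 int) set" where
  "cob_class \<Lambda> B = cob_relations \<Lambda> #>\<^bsub>free_cob \<Lambda>\<^esub> frag_of B"


section \<open>Fibers and the parallelotope filtration\<close>

definition zero_fiber :: "(real^'n) set \<Rightarrow> 'n pt set" where
  "zero_fiber \<Lambda> = X_fiber \<Lambda> (quot_proj \<Lambda> 0)"

text \<open>The action of a point \<open>b\<close> of \<open>B\<close> (a coset of \<open>\<Lambda>\<close>) by translation.\<close>

definition translate_pt :: "(real^'n) set \<Rightarrow> 'n pt \<Rightarrow> 'n pt" where
  "translate_pt b x = {(q + a, p) | q p a. (q, p) \<in> x \<and> a \<in> b}"

definition translate_brane :: "(real^'n) set \<Rightarrow> (real^'n) set \<Rightarrow> 'n brane \<Rightarrow> 'n brane" where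
  "translate_brane \<Lambda> b B =
     (case B of (L, Q, \<sigma>) \<Rightarrow>
        let L' = translate_pt b ` L; Q' = map_prod (translate_pt b) id ` Q
        in (L', Q', spin_pullback (frame_top (subtopology (X_top \<Lambda>) L') Q') (brane_top \<Lambda> B)
                      (map_prod (translate_pt (uminus ` b)) id) \<sigma>))"

text \<open>From here on, \<open>B0\<close> is the fiber over \<open>0\<close> with a choice of orientation and Spin structure;
  all other fibers carry the translated structures.\<close>

definition fib_class ::
  "(real^'n) set \<Rightarrow> 'n brane \<Rightarrow> (real^'n) set \<Rightarrow> ('n brane \<Rightarrow>\<^sub>0 int) set" where
  "fib_class \<Lambda> B0 b = cob_class \<Lambda> (translate_brane \<Lambda> b B0)"

definition Cob_fib :: "(real^'n) set \<Rightarrow> 'n brane \<Rightarrow> ('n brane \<Rightarrow>\<^sub>0 int) set monoid" where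
  "Cob_fib \<Lambda> B0 = subgroup_generated (Cob \<Lambda>) (fib_class \<Lambda> B0 ` topspace (base_top \<Lambda>))"

text \<open>The Pontryagin product; its values on \<^const>\<open>Cob_fib\<close> are determined by these conditions.\<close>

definition is_pontryagin ::
  "(real^'n) set \<Rightarrow> 'n brane \<Rightarrow>
   (('n brane \<Rightarrow>\<^sub>0 int) set \<Rightarrow> ('n brane \<Rightarrow>\<^sub>0 int) set \<Rightarrow> ('n brane \<Rightarrow>\<^sub>0 int) set) \<Rightarrow> bool" where
  "is_pontryagin \<Lambda> B0 s \<longleftrightarrow>
     (let G = Cob_fib \<Lambda> B0 in
        (\<forall>x\<in>carrier G. s x \<in> hom G G) \<and>
        (\<forall>y\<in>carrier G. (\<lambda>x. s x y) \<in> hom G G) \<and>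
        (\<forall>b\<in>topspace (base_top \<Lambda>). \<forall>b'\<in>topspace (base_top \<Lambda>).
           s (fib_class \<Lambda> B0 b) (fib_class \<Lambda> B0 b') = fib_class \<Lambda> B0 (base_add b b')))"

definition pontryagin ::
  "(real^'n) set \<Rightarrow> 'n brane \<Rightarrow>
   ('n brane \<Rightarrow>\<^sub>0 int) set \<Rightarrow> ('n brane \<Rightarrow>\<^sub>0 int) set \<Rightarrow> ('n brane \<Rightarrow>\<^sub>0 int) set" where
  "pontryagin \<Lambda> B0 = (SOME s. is_pontryagin \<Lambda> B0 s)"

definition Cob_fib_hom :: "(real^'n) set \<Rightarrow> 'n brane \<Rightarrow> ('n brane \<Rightarrow>\<^sub>0 int) set set" where
  "Cob_fib_hom \<Lambda> B0 = generate (Cob_fib \<Lambda> B0)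
     {fib_class \<Lambda> B0 a \<otimes>\<^bsub>Cob_fib \<Lambda> B0\<^esub> inv\<^bsub>Cob_fib \<Lambda> B0\<^esub> (fib_class \<Lambda> B0 b) | a b.
        a \<in> topspace (base_top \<Lambda>) \<and> b \<in> topspace (base_top \<Lambda>)}"

primrec parallelotope_filtration ::
  "nat \<Rightarrow> (real^'n) set \<Rightarrow> 'n brane \<Rightarrow> ('n brane \<Rightarrow>\<^sub>0 int) set set" where
  "parallelotope_filtration 0 \<Lambda> B0 = carrier (Cob_fib \<Lambda> B0)"
| "parallelotope_filtration (Suc k) \<Lambda> B0 = generate (Cob_fib \<Lambda> B0)
     {foldl (pontryagin \<Lambda> B0) x xs | x xs.
        x \<in> Cob_fib_hom \<Lambda> B0 \<and> xs \<in> lists (Cob_fib_hom \<Lambda> B0) \<and> length xs = k}"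

definition filtration_group ::
  "nat \<Rightarrow> (real^'n) set \<Rightarrow> 'n brane \<Rightarrow> ('n brane \<Rightarrow>\<^sub>0 int) set monoid" where
  "filtration_group i \<Lambda> B0 = (Cob_fib \<Lambda> B0)\<lparr>carrier := parallelotope_filtration i \<Lambda> B0\<rparr>"

end

theory Submission
  imports Defs
begin

text \<open>The group \<open>F\<^sup>0\<close> is generated by the classes of the fibres, and
  \<open>F\<^sup>1\<close>, which consists of one-fold products, is the subgroup generated by
  the differences of such classes. Hence the quotient is cyclic, generated by the class of a
  single fibre, and the point is that this class has infinite order: an additive invariant of
  cobordism is needed which takes the same nonzero value on all fibres (lemma
  \<open>Mod_differences_iso_integer_group\<close>). As \<open>B\<close> is path connected,
  \<open>H\<^sub>0(B)\<close> is the group of integers as well.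

  The invariant is the degree of the projection of a Lagrangian \<open>L\<close> to the torus
  of the momenta \<open>p\<close>, that is, up to normalisation, the integral of
  \<open>dp\<^sub>1 \<and> \<dots> \<and> dp\<^sub>n\<close> over \<open>L\<close>. In order
  to compare it with integrals over a cobordism it is written as an integral over \<open>L
  \<times> \<real>\<close>, namely that of \<open>tent(t) dt \<and> dp\<^sub>1 \<and> \<dots>
  \<and> dp\<^sub>n\<close> with a fixed bump function \<open>tent\<close> (definition
  \<open>brane_degree\<close>). On a cobordism \<open>V\<close> one takes a function
  \<open>h(Re z)\<close> which is compactly supported on \<open>V\<close> because
  \<open>V\<close> is proper over the plane, and whose derivative consists of a copy of
  \<open>tent\<close> over the left ends and a copy of \<open>- tent\<close> over the right
  ends. Stokes' theorem for \<open>h dp\<^sub>1 \<and> \<dots> \<and> dp\<^sub>n\<close> then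
  says that the degrees of the left ends and of the right ends have the same sum (theorem
  \<open>cobordant_degree\<close>).

  Stokes' theorem for forms \<open>du \<and> dA\<^sub>2 \<and> \<dots> \<and>
  dA\<^sub>m\<close> with linear \<open>A\<^sub>i\<close> reduces, by a partition of unity, to
  the statement that the Jacobian determinant of a compactly supported Lipschitz map
  \<open>H\<close> has integral zero (lemma \<open>integral_det_compact_support\<close>). This
  holds because \<open>id + H\<close> maps a large ball bijectively to itself if
  \<open>H\<close> has a small Lipschitz constant, so that its Jacobian integrates to the
  volume of the ball; the same is true if some components of \<open>H\<close> are replaced by
  zero, and the determinant of the derivative of \<open>H\<close> is an alternating sum of
  such Jacobians.

  Two more facts about fibres are needed. All translates of the given fibre are Lagrangian
  branes: the only point which is not formal is weak exactness, and there the area of a disc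
  with boundary on a fibre vanishes by the same statement about Jacobian determinants, as the
  \<open>q\<close>-component of the disc is constant along the boundary (lemma
  \<open>weakly_exact_fibre\<close>). Moreover their common degree is nonzero, since in
  positive charts of a connected fibre the form \<open>dp\<^sub>1 \<and> \<dots> \<and>
  dp\<^sub>n\<close> has a constant sign (lemma \<open>fibre_degree_nonzero\<close>).\<close>

section \<open>Change of variables for arbitrary finite index types\<close>

text \<open>The theorem \<open>has_absolute_integral_change_of_variables\<close> is about well-ordered index
  types, so the coordinates of an arbitrary finite index type are renamed by an initial
  segment of the natural numbers.\<close>

typedef 'm enum_idx = "{..<CARD('m::finite)}"
  by (rule exI[of _ 0]) simp

setup_lifting type_definition_enum_idx

instantiation enum_idx :: (finite) wellorder
begin
definition less_eq_enum_idx :: "'a enum_idx \<Rightarrow> 'a enum_idx \<Rightarrow> bool" where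
  "less_eq_enum_idx x y \<longleftrightarrow> Rep_enum_idx x \<le> Rep_enum_idx y"
definition less_enum_idx :: "'a enum_idx \<Rightarrow> 'a enum_idx \<Rightarrow> bool" where
  "less_enum_idx x y \<longleftrightarrow> Rep_enum_idx x < Rep_enum_idx y"
instance
proof
  fix P :: "'a enum_idx \<Rightarrow> bool" and a
  assume step: "\<And>x. (\<And>y. y < x \<Longrightarrow> P y) \<Longrightarrow> P x"
  show "P a"
    by (induction a rule: measure_induct_rule[of Rep_enum_idx])
       (rule step, simp add: less_enum_idx_def)
qed (auto simp: less_eq_enum_idx_def less_enum_idx_def simp flip: Rep_enum_idx_inject)
end

instance enum_idx :: (finite) finite
proof
  have "(UNIV :: 'a enum_idx set) = Abs_enum_idx ` {..<CARD('a)}"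
    using type_definition.univ[OF type_definition_enum_idx] .
  then show "finite (UNIV :: 'a enum_idx set)"
    by (metis finite_imageI finite_lessThan)
qed

lemma enum_idx_bij: "\<exists>f :: 'm::finite \<Rightarrow> 'm enum_idx. bij f"
proof -
  have "card (UNIV :: 'm enum_idx set) = CARD('m)"
    using type_definition.card[OF type_definition_enum_idx] by simp
  then show ?thesis
    using finite_same_card_bij[of "UNIV::'m set" "UNIV :: 'm enum_idx set"] by auto
qed

text \<open>Linear maps which only rename coordinates preserve inner products, boxes, volumes and
  integrals. They are applied to the renaming of index types, and to the identification of
  \<open>\<complex>\<close> with the plane.\<close>

lemma lin_Basis_inner:
  fixes R :: "'a::euclidean_space \<Rightarrow> 'b::euclidean_space"
  assumes R: "linear R" and B: "bij_betw R Basis Basis"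
  shows "R x \<bullet> R y = x \<bullet> y"
proof -
  have *: "R a \<bullet> R y = a \<bullet> y" if "a \<in> Basis" for a
  proof -
    have "R a \<bullet> R y = (\<Sum>b\<in>Basis. (y \<bullet> b) * (R a \<bullet> R b))"
      by (subst euclidean_representation[of y, symmetric])
         (simp add: linear_sum[OF R] linear_scale[OF R] inner_sum_right del: euclidean_representation)
    also have "\<dots> = (\<Sum>b\<in>Basis. (y \<bullet> b) * (if b = a then 1 else 0))"
    proof (intro sum.cong refl)
      fix b :: 'a assume b: "b \<in> Basis"
      have "R a \<in> Basis" "R b \<in> Basis" "R a = R b \<longleftrightarrow> a = b"
        using B that b by (auto simp: bij_betw_def inj_on_def)
      then show "y \<bullet> b * (R a \<bullet> R b) = y \<bullet> b * (if b = a then 1 else 0)"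
        by (auto simp: inner_Basis)
    qed
    also have "\<dots> = a \<bullet> y"
      using that by (simp add: sum.delta' if_distrib inner_commute cong: if_cong)
    finally show ?thesis .
  qed
  have "R x \<bullet> R y = (\<Sum>b\<in>Basis. (x \<bullet> b) * (R b \<bullet> R y))"
    by (subst euclidean_representation[of x, symmetric])
       (simp add: linear_sum[OF R] linear_scale[OF R] inner_sum_left del: euclidean_representation)
  also have "\<dots> = (\<Sum>b\<in>Basis. (x \<bullet> b) * (b \<bullet> y))"
    by (simp add: *)
  also have "\<dots> = x \<bullet> y"
    by (simp add: euclidean_inner[of x y] inner_commute)
  finally show ?thesis .
qed

lemma lin_Basis_bij:
  fixes R :: "'a::euclidean_space \<Rightarrow> 'b::euclidean_space"
  assumes R: "linear R" and B: "bij_betw R Basis Basis"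
  shows "bij R"
proof -
  have "inj R"
  proof (rule injI)
    fix x y assume "R x = R y"
    then have "R (x - y) \<bullet> R (x - y) = 0" by (simp add: linear_diff[OF R])
    then show "x = y" by (simp add: lin_Basis_inner[OF R B])
  qed
  moreover have "y \<in> range R" for y
  proof -
    have "R (\<Sum>a\<in>Basis. (y \<bullet> R a) *\<^sub>R a) = (\<Sum>a\<in>Basis. (y \<bullet> R a) *\<^sub>R R a)"
      by (simp add: linear_sum[OF R] linear_scale[OF R])
    also have "\<dots> = (\<Sum>b\<in>Basis. (y \<bullet> b) *\<^sub>R b)"
      by (rule sum.reindex_bij_betw[OF B])
    also have "\<dots> = y" by (rule euclidean_representation)
    finally show ?thesis by (metis rangeI)
  qed
  ultimately show ?thesis by (auto simp: bij_def)
qed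

lemma lin_Basis_image_cbox:
  fixes R :: "'a::euclidean_space \<Rightarrow> 'b::euclidean_space"
  assumes R: "linear R" and B: "bij_betw R Basis Basis"
  shows "R ` cbox u v = cbox (R u) (R v)"
    and "measure lborel (cbox (R u) (R v)) = measure lborel (cbox u v)"
proof -
  have eq: "R x \<in> cbox (R u) (R v) \<longleftrightarrow> x \<in> cbox u v" for x u v
  proof -
    have "R x \<in> cbox (R u) (R v) \<longleftrightarrow> (\<forall>b\<in>R ` Basis. R u \<bullet> b \<le> R x \<bullet> b \<and> R x \<bullet> b \<le> R v \<bullet> b)"
      using B by (simp add: mem_box bij_betw_def)
    then show ?thesis by (simp add: mem_box lin_Basis_inner[OF R B])
  qed
  show im: "R ` cbox u v = cbox (R u) (R v)" for u v
  proof
    show "cbox (R u) (R v) \<subseteq> R ` cbox u v"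
    proof
      fix y assume y: "y \<in> cbox (R u) (R v)"
      obtain x where "y = R x" using lin_Basis_bij[OF R B] by (metis bij_pointE)
      then show "y \<in> R ` cbox u v" using eq[of x u v] y by blast
    qed
  qed (use eq in auto)
  show "measure lborel (cbox (R u) (R v)) = measure lborel (cbox u v)"
  proof (cases "cbox u v = {}")
    case True
    then show ?thesis using im[of u v] by simp
  next
    case False
    then have "cbox (R u) (R v) \<noteq> {}" using im[of u v] by blast
    then have "measure lborel (cbox (R u) (R v)) = (\<Prod>b\<in>Basis. (R v - R u) \<bullet> b)"
      by (simp add: content_cbox' inner_diff_left)
    also have "\<dots> = (\<Prod>a\<in>Basis. (R v - R u) \<bullet> R a)"
      by (rule prod.reindex_bij_betw[OF B, symmetric])
    also have "\<dots> = (\<Prod>a\<in>Basis. (v - u) \<bullet> a)"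
      by (simp add: inner_diff_left lin_Basis_inner[OF R B])
    also have "\<dots> = measure lborel (cbox u v)"
      using False by (simp add: content_cbox' inner_diff_left)
    finally show ?thesis .
  qed
qed

text \<open>The map \<open>R\<close> takes boxes to boxes of the same volume and balls about the origin to
  balls; the two cases are those in the definition of the integral.\<close>

lemma has_integral_lin_Basis:
  fixes R :: "'a::euclidean_space \<Rightarrow> 'b::euclidean_space" and f :: "'b \<Rightarrow> 'c::banach"
  assumes R: "linear R" and B: "bij_betw R Basis Basis"
    and f: "(f has_integral i) (R ` S)"
  shows "((\<lambda>x. f (R x)) has_integral i) S"
proof -
  have bij: "bij R" by (rule lin_Basis_bij[OF R B])
  have iR: "inv_into UNIV R (R x) = x" "R (inv_into UNIV R y) = y" for x y
    using bij by (simp_all add: bij_is_inj bij_is_surj surj_f_inv_f)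
  have nR: "norm (R x) = norm x" for x
    by (simp add: norm_eq_sqrt_inner lin_Basis_inner[OF R B])
  have box: "((\<lambda>x. g (R x)) has_integral z) (cbox a b)"
    if "(g has_integral z) (cbox (R a) (R b))" for g :: "'b \<Rightarrow> 'c" and z a b
  proof -
    have "((\<lambda>x. g (R x)) has_integral (1/1) *\<^sub>R z) (inv_into UNIV R ` cbox (R a) (R b))"
    proof (rule has_integral_twiddle)
      show "isCont R x" for x by (rule linear_continuous_at) (simp add: R linear_conv_bounded_linear[symmetric])
      show "\<exists>w z. R ` cbox u v = cbox w z" for u v using lin_Basis_image_cbox[OF R B] by blast
      show "\<exists>w z. inv_into UNIV R ` cbox u v = cbox w z" for u v
        using lin_Basis_image_cbox(1)[OF R B, of "inv_into UNIV R u" "inv_into UNIV R v"] iR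
        by (metis bij bij_is_inj image_inv_f_f)
      show "measure lborel (R ` cbox u v) = 1 * measure lborel (cbox u v)" for u v
        using lin_Basis_image_cbox[OF R B] by simp
    qed (use that iR in auto)
    then show ?thesis
      by (simp add: lin_Basis_image_cbox(1)[OF R B, symmetric] image_image iR)
  qed
  show ?thesis
  proof (cases "\<exists>a b. S = cbox a b")
    case True
    then show ?thesis using f box lin_Basis_image_cbox[OF R B] by metis
  next
    case False
    have nb: "\<nexists>a b. R ` S = cbox a b"
    proof
      assume "\<exists>a b. R ` S = cbox a b"
      then obtain a b where ab: "R ` S = cbox a b" by blast
      then have "R ` S = R ` cbox (inv_into UNIV R a) (inv_into UNIV R b)"
        by (simp add: lin_Basis_image_cbox(1)[OF R B] iR)
      then have "S = cbox (inv_into UNIV R a) (inv_into UNIV R b)"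
        using bij by (simp add: bij_is_inj inj_image_eq_iff)
      then show False using False by blast
    qed
    have "\<exists>B>0. \<forall>a b. ball 0 B \<subseteq> cbox a b \<longrightarrow>
        (\<exists>z. ((\<lambda>x. if x \<in> S then f (R x) else 0) has_integral z) (cbox a b) \<and> norm (z - i) < e)"
      if "e > 0" for e
    proof -
      obtain K where K: "K > 0" "\<And>a b. ball 0 K \<subseteq> cbox a b \<Longrightarrow>
         (\<exists>z. ((\<lambda>x. if x \<in> R ` S then f x else 0) has_integral z) (cbox a b) \<and> norm (z - i) < e)"
        using has_integral_altD[OF f nb \<open>e > 0\<close>] by metis
      have "\<exists>z. ((\<lambda>x. if x \<in> S then f (R x) else 0) has_integral z) (cbox a b) \<and> norm (z - i) < e"
        if ab: "ball 0 K \<subseteq> cbox a b" for a b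
      proof -
        have "ball 0 K \<subseteq> cbox (R a) (R b)"
        proof
          fix y :: 'b assume "y \<in> ball 0 K"
          then have "inv_into UNIV R y \<in> ball 0 K" using nR[of "inv_into UNIV R y"] iR by simp
          then have "R (inv_into UNIV R y) \<in> R ` cbox a b" using ab by blast
          then show "y \<in> cbox (R a) (R b)" by (simp add: lin_Basis_image_cbox(1)[OF R B] iR)
        qed
        then obtain z where z: "((\<lambda>x. if x \<in> R ` S then f x else 0) has_integral z) (cbox (R a) (R b))"
          "norm (z - i) < e" using K by blast
        have "((\<lambda>x. if R x \<in> R ` S then f (R x) else 0) has_integral z) (cbox a b)"
          by (rule box[OF z(1)])
        then show ?thesis using z(2) bij by (auto simp: bij_is_inj inj_image_mem_iff)
      qed
      with K(1) show ?thesis by blast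
    qed
    then show ?thesis
      by (subst has_integral_alt) (simp add: False)
  qed
qed

lemma absolutely_integrable_lin_Basis:
  fixes R :: "'a::euclidean_space \<Rightarrow> 'b::euclidean_space" and f :: "'b \<Rightarrow> real"
  assumes R: "linear R" and B: "bij_betw R Basis Basis"
    and f: "f absolutely_integrable_on (R ` S)"
  shows "(\<lambda>x. f (R x)) absolutely_integrable_on S"
    and "integral S (\<lambda>x. f (R x)) = integral (R ` S) f"
  using f has_integral_lin_Basis[OF R B, where f=f and S=S]
     has_integral_lin_Basis[OF R B, where f="\<lambda>x. norm (f x)" and S=S]
  unfolding absolutely_integrable_on_def integrable_on_def
  by (auto simp: has_integral_integral integrable_on_def intro!: integral_unique)

text \<open>The rows outside the block are rows of the identity, so only permutations supported on
  the block contribute to the Leibniz formula. For a bijection \<open>f\<close> this renames the indices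
  of a determinant; for \<open>f = Some\<close> it removes the direction of a line.\<close>

lemma det_inj_block:
  fixes A :: "real^'k^'k" and f :: "'m::finite \<Rightarrow> 'k::finite"
  assumes f: "inj f" and A: "\<And>i j. i \<notin> range f \<Longrightarrow> A $ i $ j = (if i = j then 1 else 0)"
  shows "det A = det (\<chi> i j. A $ f i $ f j)"
proof -
  let ?t = "\<lambda>p. of_int (sign p) * (\<Prod>i\<in>UNIV. A $ i $ p i)"
  let ?\<phi> = "\<lambda>p. map_permutation UNIV f p"
  have bij: "bij_betw ?\<phi> {p. p permutes UNIV} {p. p permutes range f}"
  proof -
    have "bij_betw (\<lambda>\<pi> x. if x \<in> range f then f (\<pi> (inv_into UNIV f x)) else x)
             {\<pi>. \<pi> permutes UNIV} {\<pi>. \<pi> permutes range f}"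
      by (rule bij_betw_permutations) (simp add: bij_betw_def f)
    moreover have "(\<lambda>\<pi> x. if x \<in> range f then f (\<pi> (inv_into UNIV f x)) else x) = ?\<phi>"
      by (auto simp: map_permutation_def restrict_id_def fun_eq_iff)
    ultimately show ?thesis by simp
  qed
  have "det A = sum ?t {p. p permutes UNIV}"
    by (simp add: det_def)
  also have "\<dots> = sum ?t {p. p permutes range f}"
  proof (rule sum.mono_neutral_right)
    show "{p. p permutes range f} \<subseteq> {p. p permutes UNIV}"
      using permutes_subset by blast
    show "\<forall>p\<in>{p. p permutes UNIV} - {p. p permutes range f}. ?t p = 0"
    proof
      fix p assume "p \<in> {p. p permutes UNIV} - {p. p permutes range f}"
      then have p: "p permutes UNIV" "\<not> p permutes range f" by auto
      then obtain i where "i \<notin> range f" "p i \<noteq> i"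
        unfolding permutes_def by blast
      then have "A $ i $ p i = 0" using A by simp
      then have "(\<Prod>i\<in>UNIV. A $ i $ p i) = 0" by (auto intro!: prod_zero)
      then show "?t p = 0" by simp
    qed
  qed (simp add: finite_permutations)
  also have "\<dots> = (\<Sum>p | p permutes (UNIV :: 'm set). ?t (?\<phi> p))"
    by (rule sum.reindex_bij_betw[OF bij, symmetric])
  also have "\<dots> = (\<Sum>p | p permutes (UNIV :: 'm set). of_int (sign p) * (\<Prod>i\<in>UNIV. A $ f i $ f (p i)))"
  proof (rule sum.cong[OF refl])
    fix p :: "'m \<Rightarrow> 'm" assume "p \<in> {p. p permutes UNIV}"
    then have p: "p permutes UNIV" by simp
    have q: "?\<phi> p permutes range f" using bij p by (auto simp: bij_betw_def)
    have "(\<Prod>i\<in>UNIV. A $ i $ (?\<phi> p i)) = (\<Prod>i\<in>range f. A $ i $ (?\<phi> p i))"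
      using q A by (intro prod.mono_neutral_right) (auto simp: permutes_def)
    also have "\<dots> = (\<Prod>i\<in>UNIV. A $ f i $ (?\<phi> p (f i)))"
      using f by (simp add: prod.reindex)
    also have "\<dots> = (\<Prod>i\<in>UNIV. A $ f i $ f (p i))"
      using f by (simp add: map_permutation_apply)
    finally show "?t (?\<phi> p) = of_int (sign p) * (\<Prod>i\<in>UNIV. A $ f i $ f (p i))"
      using p f by (simp add: sign_map_permutation)
  qed
  also have "\<dots> = det (\<chi> i j. A $ f i $ f j)"
    by (simp add: det_def)
  finally show ?thesis .
qed

text \<open>Conjugation of \<open>g\<close> by a renaming of the coordinates does not change the determinants.\<close>

lemma change_of_variables_finite:
  fixes g :: "real^'m::finite \<Rightarrow> real^'m" and f :: "real^'m \<Rightarrow> real"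
  assumes S: "S \<in> sets lebesgue"
    and der: "\<And>x. x \<in> S \<Longrightarrow> (g has_derivative g' x) (at x within S)"
    and inj: "inj_on g S"
    and f: "f absolutely_integrable_on (g ` S)"
  shows "(\<lambda>x. \<bar>det (matrix (g' x))\<bar> * f (g x)) absolutely_integrable_on S"
    and "integral S (\<lambda>x. \<bar>det (matrix (g' x))\<bar> * f (g x)) = integral (g ` S) f"
proof -
  obtain p :: "'m \<Rightarrow> 'm enum_idx" where p: "bij p" using enum_idx_bij by blast
  define R :: "real^'m enum_idx \<Rightarrow> real^'m" where "R = (\<lambda>x. \<chi> i. x $ p i)"
  define R' :: "real^'m \<Rightarrow> real^'m enum_idx" where "R' = (\<lambda>x. \<chi> k. x $ inv_into UNIV p k)"
  have pp: "inv_into UNIV p (p i) = i" "p (inv_into UNIV p k) = k" for i k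
    using p by (simp_all add: bij_is_inj bij_is_surj surj_f_inv_f)
  have RR [simp]: "R (R' x) = x" "R' (R y) = y" for x y
    by (simp_all add: R_def R'_def vec_eq_iff pp)
  have lin: "linear R" "linear R'"
    by (auto simp: R_def R'_def linear_iff vec_eq_iff)
  have ax: "R (axis k 1) = axis (inv_into UNIV p k) 1" "R' (axis i 1) = axis (p i) 1" for k i
    by (auto simp: R_def R'_def vec_eq_iff axis_def pp)
  have B': "R b \<in> Basis" if "b \<in> Basis" for b using that by (auto simp: Basis_vec_def ax)
  have B'': "R' b \<in> Basis" if "b \<in> Basis" for b using that by (auto simp: Basis_vec_def ax)
  have bb: "bij_betw R Basis Basis" "bij_betw R' Basis Basis"
    by (rule bij_betw_byWitness[where f'=R']; use B' B'' in auto)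
       (rule bij_betw_byWitness[where f'=R]; use B' B'' in auto)
  define g2 where "g2 = (\<lambda>x. R' (g (R x)))"
  define G2 where "G2 = (\<lambda>x v. R' (g' (R x) (R v)))"
  have im: "R ` (g2 ` (R' ` S)) = g ` S" by (auto simp: g2_def image_image)
  have lint: "linear (g' x)" if "x \<in> S" for x
    using der[OF that] by (simp add: has_derivative_linear)
  have detG: "det (matrix (G2 (R' x))) = det (matrix (g' x))" if "x \<in> S" for x
  proof -
    have "det (matrix (G2 (R' x))) = det (\<chi> i j. matrix (G2 (R' x)) $ p i $ p j)"
      using p by (intro det_inj_block) (auto simp: bij_is_inj bij_is_surj)
    also have "(\<chi> i j. matrix (G2 (R' x)) $ p i $ p j) = matrix (g' x)"
    proof -
      have "R' v $ p i = v $ i" for v i by (simp add: R'_def pp)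
      then show ?thesis by (simp add: vec_eq_iff matrix_def G2_def ax pp)
    qed
    finally show ?thesis .
  qed
  have derR: "(R has_derivative R) (at x within X)" "(R' has_derivative R') (at y within Y)" for x X y Y
    using lin by (simp_all add: linear_imp_has_derivative)
  have f2: "(\<lambda>x. f (R x)) absolutely_integrable_on (g2 ` (R' ` S))"
    and i2: "integral (g2 ` (R' ` S)) (\<lambda>x. f (R x)) = integral (g ` S) f"
    using absolutely_integrable_lin_Basis[OF lin(1) bb(1), where f=f and S="g2 ` (R' ` S)"] f im by auto
  have S2: "R' ` S \<in> sets lebesgue"
    by (rule differentiable_image_in_sets_lebesgue[OF S])
       (use lin in \<open>auto simp: linear_imp_differentiable_on bij_betw_same_card[OF p]\<close>)
  let ?v = "\<lambda>x. vec (f (R x)) :: real^1"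
  have "(\<lambda>x. \<bar>det (matrix (G2 x))\<bar> *\<^sub>R ?v (g2 x)) absolutely_integrable_on (R' ` S) \<and>
      integral (R' ` S) (\<lambda>x. \<bar>det (matrix (G2 x))\<bar> *\<^sub>R ?v (g2 x)) = integral (g2 ` R' ` S) ?v"
  proof (subst has_absolute_integral_change_of_variables[OF S2])
    show "(g2 has_derivative G2 x) (at x within R' ` S)" if x: "x \<in> R' ` S" for x
    proof -
      obtain y where y: "y \<in> S" "x = R' y" using x by auto
      have "R x \<in> S" and "R ` R' ` S = S" using y by (auto simp: image_image)
      then have "((\<lambda>x. g (R x)) has_derivative (\<lambda>v. g' (R x) (R v))) (at x within R' ` S)"
        using has_derivative_in_compose[OF derR(1), of g "g' (R x)" x "R' ` S"] der[of "R x"] by simp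
      then show ?thesis unfolding g2_def G2_def
        by (rule has_derivative_compose[OF _ derR(2)])
    qed
    show "inj_on g2 (R' ` S)"
      using inj unfolding inj_on_def g2_def by (metis RR image_iff)
  qed (use f2 in \<open>simp add: absolutely_integrable_on_1_iff\<close>)
  then have 3: "(\<lambda>x. \<bar>det (matrix (G2 x))\<bar> * f (R (g2 x))) absolutely_integrable_on (R' ` S)"
     "integral (R' ` S) (\<lambda>x. \<bar>det (matrix (G2 x))\<bar> * f (R (g2 x))) = integral (g ` S) f"
    using i2 by (simp_all add: absolutely_integrable_on_1_iff integral_on_1_eq)
  have eq: "\<bar>det (matrix (G2 (R' x)))\<bar> * f (R (g2 (R' x))) = \<bar>det (matrix (g' x))\<bar> * f (g x)" if "x \<in> S" for x
    using detG[OF that] by (simp add: g2_def)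
  note 4 = absolutely_integrable_lin_Basis[OF lin(2) bb(2) 3(1)]
  have "integral S (\<lambda>x. \<bar>det (matrix (g' x))\<bar> * f (g x))
      = integral S (\<lambda>x. \<bar>det (matrix (G2 (R' x)))\<bar> * f (R (g2 (R' x))))"
    by (rule Henstock_Kurzweil_Integration.integral_cong) (simp add: eq)
  then show "integral S (\<lambda>x. \<bar>det (matrix (g' x))\<bar> * f (g x)) = integral (g ` S) f"
    using 4(2) 3(2) by simp
  show "(\<lambda>x. \<bar>det (matrix (g' x))\<bar> * f (g x)) absolutely_integrable_on S"
    by (rule set_integrable_cong[OF refl refl, THEN iffD1, OF _ 4(1)]) (simp add: eq)
qed

section \<open>Integrals of Jacobian determinants\<close>

lemma derivative_norm_le_lipschitz:
  fixes H :: "'a::real_normed_vector \<Rightarrow> 'b::real_normed_vector"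
  assumes L: "L-lipschitz_on UNIV H" and H: "(H has_derivative H') (at x)"
  shows "norm (H' v) \<le> L * norm v"
proof (cases "v = 0")
  case True
  then show ?thesis using has_derivative_linear[OF H] by (simp add: linear_0)
next
  case False
  have lin: "linear H'" using has_derivative_linear[OF H] .
  show ?thesis
  proof (rule field_le_epsilon)
    fix e :: real assume "e > 0"
    define d where "d = e / norm v"
    have "d > 0" using \<open>e > 0\<close> False by (simp add: d_def)
    then obtain \<delta> where \<delta>: "\<delta> > 0"
      "\<And>y. norm (y - x) < \<delta> \<Longrightarrow> norm (H y - H x - H' (y - x)) \<le> d * norm (y - x)"
      using H unfolding has_derivative_at_alt by blast
    define t where "t = \<delta> / (2 * norm v)"
    have t: "t > 0" using \<delta>(1) False by (simp add: t_def)
    have "norm (t *\<^sub>R v) = \<delta> / 2" using False \<delta>(1) by (simp add: t_def)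
    then have "norm (H (x + t *\<^sub>R v) - H x - H' (t *\<^sub>R v)) \<le> d * norm (t *\<^sub>R v)"
      using \<delta>(2)[of "x + t *\<^sub>R v"] \<delta>(1) by simp
    moreover have "norm (H (x + t *\<^sub>R v) - H x) \<le> L * norm (t *\<^sub>R v)"
      using lipschitz_on_normD[OF L, of "x + t *\<^sub>R v" x] by simp
    ultimately have "norm (H' (t *\<^sub>R v)) \<le> (L + d) * norm (t *\<^sub>R v)"
      using norm_triangle_ineq2[of "H' (t *\<^sub>R v)" "H (x + t *\<^sub>R v) - H x"]
      by (simp add: norm_minus_commute algebra_simps)
    then have "t * norm (H' v) \<le> t * ((L + d) * norm v)"
      using t by (simp add: linear_scale[OF lin] mult.left_commute)
    then have "norm (H' v) \<le> (L + d) * norm v" using t by (simp add: mult_le_cancel_left_pos)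
    then show "norm (H' v) \<le> L * norm v + e"
      using False by (simp add: d_def distrib_right)
  qed
qed

text \<open>The determinant does not vanish along the path \<open>id + t A\<close> for \<open>t\<close> between 0 and 1,
  which starts at the identity.\<close>

lemma det_id_plus_pos:
  fixes A :: "real^'m::finite \<Rightarrow> real^'m"
  assumes lin: "linear A" and L: "L < 1" "\<And>v. norm (A v) \<le> L * norm v"
  shows "det (matrix (\<lambda>v. v + A v)) > 0"
proof -
  define h where "h = (\<lambda>t. det (matrix (\<lambda>v. v + t *\<^sub>R A v)))"
  have "continuous_on {0..1} h"
    unfolding h_def det_def matrix_def by (simp, intro continuous_intros)
  moreover have nz: "h t \<noteq> 0" if "t \<in> {0..1}" for t
  proof -
    let ?B = "\<lambda>v. v + t *\<^sub>R A v"
    have linB: "linear ?B" using lin by (auto simp: linear_iff algebra_simps)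
    have "inj ?B"
      unfolding linear_injective_0[OF linB]
    proof (intro allI impI)
      fix v assume "v + t *\<^sub>R A v = 0"
      then have "v = - (t *\<^sub>R A v)" by (simp add: eq_neg_iff_add_eq_0)
      then have "norm v = t * norm (A v)" using that by (metis abs_of_nonneg atLeastAtMost_iff norm_minus_cancel norm_scaleR)
      also have "\<dots> \<le> 1 * norm (A v)" using that by (intro mult_right_mono) auto
      also have "\<dots> \<le> L * norm v" using L(2) by simp
      finally have "(1 - L) * norm v \<le> 0" by (simp add: algebra_simps)
      then show "v = 0" using L(1) by (simp add: mult_le_0_iff)
    qed
    then show ?thesis unfolding h_def using det_nz_iff_inj[OF linB] by simp
  qed
  moreover have "h 0 = 1" by (simp add: h_def flip: id_def)
  ultimately have "h 1 > 0"
    using IVT2'[of h 1 0 0] by (smt (verit) atLeastAtMost_iff)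
  then show ?thesis by (simp add: h_def)
qed

text \<open>The map \<open>id + H\<close> is injective by the Lipschitz bound, and surjective to the ball by
  Banach's fixed point theorem, so the change of variables formula computes the volume of
  the ball. The null set \<open>N\<close> makes room for functions which are glued along a sphere.\<close>

lemma integral_det_perturbed_identity:
  fixes H :: "real^'m::finite \<Rightarrow> real^'m"
  assumes L: "L-lipschitz_on UNIV H" "L < 1" and N: "negligible N"
    and der: "\<And>x. x \<notin> N \<Longrightarrow> (H has_derivative H' x) (at x)"
    and supp: "\<And>x. x \<notin> cball a r \<Longrightarrow> H x = 0"
  shows "((\<lambda>x. det (matrix (\<lambda>v. v + H' x v))) has_integral measure lebesgue (cball a r)) (cball a r)"
proof -
  define \<Phi> where "\<Phi> = (\<lambda>x. x + H x)"
  have L0: "L \<ge> 0" using L(1) by (rule lipschitz_on_nonneg)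
  have inj: "inj \<Phi>"
  proof (rule injI)
    fix x y assume "\<Phi> x = \<Phi> y"
    then have "x - y = H y - H x" by (simp add: \<Phi>_def algebra_simps)
    then have "norm (x - y) \<le> L * norm (x - y)"
      using lipschitz_on_normD[OF L(1), of y x] by (simp add: norm_minus_commute)
    then have "(1 - L) * norm (x - y) \<le> 0" by (simp add: algebra_simps)
    then show "x = y" using L(2) by (simp add: mult_le_0_iff)
  qed
  have im: "\<Phi> ` cball a r = cball a r"
  proof (intro equalityI subsetI)
    fix z assume "z \<in> \<Phi> ` cball a r"
    then obtain x where x: "x \<in> cball a r" "z = \<Phi> x" by auto
    show "z \<in> cball a r"
    proof (rule ccontr)
      assume z: "z \<notin> cball a r"
      then have "\<Phi> z = \<Phi> x" using x supp by (simp add: \<Phi>_def)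
      then have "z = x" using inj by (simp add: inj_eq)
      then show False using x(1) z by simp
    qed
  next
    fix z assume z: "z \<in> cball a r"
    \<comment> \<open>A fixed point of this contraction is a preimage of \<open>z\<close>; it lies in the ball,
      since \<open>id + H\<close> is the identity outside.\<close>
    have "\<exists>!y. z - H y = y"
    proof (rule banach_fix_type[OF L0 L(2)], intro allI)
      fix x y
      have "(z - H x) - (z - H y) = H y - H x" by simp
      then have "dist (z - H x) (z - H y) = dist (H y) (H x)" by (simp add: dist_norm)
      also have "\<dots> \<le> L * dist y x" using lipschitz_onD[OF L(1)] by simp
      finally show "dist (z - H x) (z - H y) \<le> L * dist x y" by (simp add: dist_commute)
    qed
    then obtain y where y: "z - H y = y" by blast
    then have "\<Phi> y = z" by (simp add: \<Phi>_def algebra_simps)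
    moreover have "y \<in> cball a r" using y z supp by force
    ultimately show "z \<in> \<Phi> ` cball a r" by blast
  qed
  let ?S = "cball a r - N"
  have Sleb: "?S \<in> sets lebesgue"
    using N by (simp add: negligible_imp_sets sets.Diff)
  have negim: "negligible (\<Phi> ` N)"
  proof (rule negligible_locally_Lipschitz_image[OF _ N])
    fix x assume "x \<in> N"
    have "norm (\<Phi> y - \<Phi> x) \<le> (1 + L) * norm (y - x)" for y
      using lipschitz_on_normD[OF L(1), of y x] norm_triangle_ineq[of "y - x" "H y - H x"]
      by (simp add: \<Phi>_def algebra_simps)
    then show "\<exists>T B. open T \<and> x \<in> T \<and> (\<forall>y\<in>N \<inter> T. norm (\<Phi> y - \<Phi> x) \<le> B * norm (y - x))"
      by (intro exI[of _ UNIV] exI[of _ "1 + L"]) auto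
  qed simp
  have imS: "\<Phi> ` ?S = cball a r - \<Phi> ` N"
    using im inj by (simp add: image_set_diff)
  have one: "((\<lambda>x. 1 :: real) has_integral measure lebesgue (cball a r)) (cball a r)"
    using lmeasure_integral[of "cball a r"] by (simp add: has_integral_measure_lborel has_integral_integrable_integral integrable_on_const lmeasure_integral)
  then have one': "((\<lambda>x. 1 :: real) has_integral measure lebesgue (cball a r)) (\<Phi> ` ?S)"
    unfolding imS by (rule has_integral_spike_set_eq[THEN iffD1, rotated 2])
       (auto intro: negligible_subset[OF negim])
  have ai: "(\<lambda>x. 1 :: real) absolutely_integrable_on (\<Phi> ` ?S)"
    by (rule nonnegative_absolutely_integrable_1) (use one' in auto)
  have derS: "(\<Phi> has_derivative (\<lambda>v. v + H' x v)) (at x within ?S)" if "x \<in> ?S" for x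
    unfolding \<Phi>_def using that
    by (intro has_derivative_add has_derivative_ident has_derivative_at_withinI[OF der]) simp
  note cv = change_of_variables_finite[OF Sleb derS inj_on_subset[OF inj subset_UNIV] ai]
  have "((\<lambda>x. \<bar>det (matrix (\<lambda>v. v + H' x v))\<bar> * 1) has_integral measure lebesgue (cball a r)) ?S"
  proof -
    have 1: "(\<lambda>x. \<bar>det (matrix (\<lambda>v. v + H' x v))\<bar> * 1) absolutely_integrable_on ?S"
      by (rule cv(1))
    have 2: "integral ?S (\<lambda>x. \<bar>det (matrix (\<lambda>v. v + H' x v))\<bar> * 1) = integral (\<Phi> ` ?S) (\<lambda>x. 1)"
      by (rule cv(2))
    show ?thesis
      using integrable_integral[OF set_lebesgue_integral_eq_integral(1)[OF 1]]
      unfolding 2 integral_unique[OF one'] .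
  qed
  moreover have "\<bar>det (matrix (\<lambda>v. v + H' x v))\<bar> * 1 = det (matrix (\<lambda>v. v + H' x v))" if "x \<in> ?S" for x
  proof -
    have "det (matrix (\<lambda>v. v + H' x v)) > 0"
      using derivative_norm_le_lipschitz[OF L(1) der] der[THEN has_derivative_linear] that L(2)
      by (intro det_id_plus_pos) auto
    then show ?thesis by simp
  qed
  ultimately have "((\<lambda>x. det (matrix (\<lambda>v. v + H' x v))) has_integral measure lebesgue (cball a r)) ?S"
    by (rule has_integral_eq[rotated])
  then show ?thesis
    by (rule has_integral_spike_set_eq[THEN iffD1, rotated 2])
       (auto intro: negligible_subset[OF N])
qed

text \<open>The determinant \<open>D S R\<close> has the rows of the derivative of \<open>H\<close> for indices in \<open>S\<close>,
  those of the derivative of \<open>id + H\<close> for the other indices in \<open>R\<close>, and those of the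
  identity elsewhere. If \<open>S\<close> is empty, it is the Jacobian of a perturbation of the identity,
  and its integral is the volume of the ball for every \<open>R\<close>. Linearity in a row turns an
  element of \<open>S\<close> into a difference of two such integrals, which therefore cancel.\<close>

lemma integral_det_compact_support_small:
  fixes H :: "real^'m::finite \<Rightarrow> real^'m"
  assumes L: "L-lipschitz_on UNIV H" "L < 1" and N: "negligible N"
    and der: "\<And>x. x \<notin> N \<Longrightarrow> (H has_derivative H' x) (at x)"
    and supp: "\<And>x. x \<notin> cball a r \<Longrightarrow> H x = 0"
  shows "((\<lambda>x. det (matrix (H' x))) has_integral 0) (cball a r)"
proof -
  define D where "D = (\<lambda>S R x. det (\<chi> i. if i \<in> S then matrix (H' x) $ i else
     if i \<in> R then axis i 1 + matrix (H' x) $ i else axis i 1) :: real)"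
  define vol where "vol = measure lebesgue (cball a r)"
  have base: "(D {} R has_integral vol) (cball a r)" for R :: "'m set"
  proof -
    define P where "P = (\<lambda>v :: real^'m. \<chi> i. if i \<in> R then v $ i else 0)"
    have lin: "linear P" by (auto simp: P_def linear_iff vec_eq_iff)
    have nP: "norm (P v) \<le> norm v" for v
      by (rule norm_le_componentwise_cart) (simp add: P_def)
    have "((\<lambda>x. det (matrix (\<lambda>v. v + P (H' x v)))) has_integral vol) (cball a r)"
      unfolding vol_def
    proof (rule integral_det_perturbed_identity[OF _ L(2) N])
      show "L-lipschitz_on UNIV (\<lambda>x. P (H x))"
      proof (rule lipschitz_onI)
        fix x y
        have "norm (P (H x) - P (H y)) \<le> norm (H x - H y)"
          using nP[of "H x - H y"] by (simp add: linear_diff[OF lin])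
        also have "\<dots> \<le> L * norm (x - y)" using lipschitz_on_normD[OF L(1)] by simp
        finally show "dist (P (H x)) (P (H y)) \<le> L * dist x y" by (simp add: dist_norm)
      qed (rule lipschitz_on_nonneg[OF L(1)])
      show "((\<lambda>x. P (H x)) has_derivative (\<lambda>v. P (H' x v))) (at x)" if "x \<notin> N" for x
        using has_derivative_compose[OF der[OF that] linear_imp_has_derivative[OF lin]] .
    qed (use supp lin in \<open>auto simp: linear_0\<close>)
    moreover have "(\<lambda>x. det (matrix (\<lambda>v. v + P (H' x v)))) = D {} R"
      unfolding D_def by (rule ext, rule arg_cong[where f=det])
        (auto simp: vec_eq_iff matrix_def P_def axis_def)
    ultimately show ?thesis by simp
  qed
  have "(D S R has_integral (if S = {} then vol else 0)) (cball a r)" for S R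
  proof -
    have "finite S" by simp
    then show ?thesis
    proof (induction S arbitrary: R rule: finite_induct)
      case empty
      then show ?case using base by simp
    next
      case (insert k S)
      have "D (insert k S) R x = D S (insert k R) x - D S (R - {k}) x" for x
      proof -
        let ?c = "\<lambda>i. if i \<in> S then matrix (H' x) $ i else
           if i \<in> R then axis i 1 + matrix (H' x) $ i else axis i 1"
        have "D S (insert k R) x = det (\<chi> i. if i = k then axis i 1 + matrix (H' x) $ i else ?c i)"
          unfolding D_def using insert(2) by (intro arg_cong[where f=det]) (auto simp: vec_eq_iff)
        also have "\<dots> = det (\<chi> i. if i = k then axis i 1 else ?c i) + det (\<chi> i. if i = k then matrix (H' x) $ i else ?c i)"
          by (rule det_row_add)
        also have "det (\<chi> i. if i = k then axis i 1 else ?c i) = D S (R - {k}) x"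
          unfolding D_def using insert(2) by (intro arg_cong[where f=det]) (auto simp: vec_eq_iff)
        also have "det (\<chi> i. if i = k then matrix (H' x) $ i else ?c i) = D (insert k S) R x"
          unfolding D_def by (intro arg_cong[where f=det]) (auto simp: vec_eq_iff)
        finally show ?thesis by simp
      qed
      then have "D (insert k S) R = (\<lambda>x. D S (insert k R) x - D S (R - {k}) x)" by auto
      then show ?case
        using has_integral_diff[OF insert.IH[of "insert k R"] insert.IH[of "R - {k}"]] by simp
    qed
  qed
  from this[of UNIV UNIV] show ?thesis by (simp add: D_def)
qed

text \<open>The integral of a Jacobian determinant depends only on boundary values. This is the
  source of Stokes' theorem and of the weak exactness of fibres; small Lipschitz constants
  are reached by scaling \<open>H\<close>.\<close>

lemma integral_det_compact_support:
  fixes H :: "real^'m::finite \<Rightarrow> real^'m"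
  assumes L: "L-lipschitz_on UNIV H" and N: "negligible N"
    and der: "\<And>x. x \<notin> N \<Longrightarrow> (H has_derivative H' x) (at x)"
    and supp: "\<And>x. x \<notin> cball a r \<Longrightarrow> H x = 0"
  shows "((\<lambda>x. det (matrix (H' x))) has_integral 0) (cball a r)"
proof -
  have L0: "L \<ge> 0" using L by (rule lipschitz_on_nonneg)
  define c where "c = 1 / (L + 1)"
  have c: "c > 0" "c * L < 1" using L0 by (auto simp: c_def)
  have "((\<lambda>x. det (matrix (\<lambda>v. c *\<^sub>R H' x v))) has_integral 0) (cball a r)"
  proof (rule integral_det_compact_support_small[OF _ c(2) N])
    show "(c * L)-lipschitz_on UNIV (\<lambda>x. c *\<^sub>R H x)"
      using lipschitz_on_cmult[OF L, of c] c by simp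
    show "((\<lambda>x. c *\<^sub>R H x) has_derivative (\<lambda>v. c *\<^sub>R H' x v)) (at x)" if "x \<notin> N" for x
      by (rule has_derivative_scaleR_right[OF der[OF that]])
  qed (use supp in auto)
  moreover have "det (matrix (\<lambda>v. c *\<^sub>R H' x v)) = c ^ CARD('m) * det (matrix (H' x))" for x
  proof -
    have "matrix (\<lambda>v. c *\<^sub>R H' x v) = (\<chi> i. c *s (matrix (H' x)) $ i)"
      by (simp add: vec_eq_iff matrix_def)
    then show ?thesis by (simp add: det_rows_mul)
  qed
  ultimately have "((\<lambda>x. c ^ CARD('m) * det (matrix (H' x))) has_integral 0) (cball a r)" by simp
  then show ?thesis
    using has_integral_mult_right[of "\<lambda>x. c ^ CARD('m) * det (matrix (H' x))" 0 "cball a r" "1 / c ^ CARD('m)"] c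
    by simp
qed

section \<open>Continuously differentiable functions\<close>

text \<open>In finite dimensions, continuity of the derivative amounts to continuity of every
  directional derivative; the definition of \<open>Ck_on\<close> proceeds in the same way.\<close>

definition C1_on :: "'a::euclidean_space set \<Rightarrow> ('a \<Rightarrow> 'b::euclidean_space) \<Rightarrow> bool" where
  "C1_on S f \<longleftrightarrow> (\<forall>x\<in>S. f differentiable (at x)) \<and>
     (\<forall>v. continuous_on S (\<lambda>x. frechet_derivative f (at x) v))"

lemma smooth_on_imp_C1_on: "smooth_on S f \<Longrightarrow> C1_on S f"
  unfolding smooth_on_def C1_on_def by (drule spec[of _ "Suc 0"]) simp

lemma C1_onI:
  assumes "\<And>x. x \<in> S \<Longrightarrow> (f has_derivative f' x) (at x)"
    and "\<And>v. continuous_on S (\<lambda>x. f' x v)"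
  shows "C1_on S f"
  unfolding C1_on_def
proof (intro conjI ballI allI)
  show "f differentiable (at x)" if "x \<in> S" for x
    using assms(1)[OF that] unfolding differentiable_def by blast
  show "continuous_on S (\<lambda>x. frechet_derivative f (at x) v)" for v
    using assms(2)[of v] by (rule continuous_on_eq) (metis assms(1) frechet_derivative_at)
qed

lemma C1_onD: "C1_on S f \<Longrightarrow> x \<in> S \<Longrightarrow> (f has_derivative frechet_derivative f (at x)) (at x)"
  unfolding C1_on_def by (simp add: frechet_derivative_works[symmetric])

lemma C1_on_cont: "C1_on S f \<Longrightarrow> continuous_on S (\<lambda>x. frechet_derivative f (at x) v)"
  unfolding C1_on_def by blast

lemma C1_on_continuous_on: "C1_on S f \<Longrightarrow> continuous_on S f"
  by (meson C1_onD continuous_at_imp_continuous_on has_derivative_continuous)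

lemma C1_on_subset: "C1_on S f \<Longrightarrow> T \<subseteq> S \<Longrightarrow> C1_on T f"
  unfolding C1_on_def by (meson continuous_on_subset subset_iff)

lemma C1_on_cong:
  assumes "C1_on S f" "open S" "\<And>x. x \<in> S \<Longrightarrow> f x = g x"
  shows "C1_on S g"
proof (rule C1_onI)
  show "(g has_derivative frechet_derivative f (at x)) (at x)" if "x \<in> S" for x
    by (rule has_derivative_transform_within_open[OF C1_onD[OF assms(1) that] assms(2) that assms(3)])
qed (rule C1_on_cont[OF assms(1)])

lemma C1_on_open_cover:
  assumes "\<And>x. x \<in> S \<Longrightarrow> \<exists>U. open U \<and> x \<in> U \<and> C1_on U f"
  shows "C1_on S f"
  unfolding C1_on_def
proof (intro conjI ballI allI)
  show "f differentiable (at x)" if "x \<in> S" for x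
    using assms[OF that] unfolding C1_on_def by blast
  show "continuous_on S (\<lambda>x. frechet_derivative f (at x) v)" for v
    unfolding continuous_on_eq_continuous_within
    using assms C1_on_cont by (metis at_within_open continuous_at_imp_continuous_at_within continuous_on_eq_continuous_within)
qed

lemma C1_on_linear: "linear f \<Longrightarrow> C1_on S f" for f :: "'a::euclidean_space \<Rightarrow> 'b::euclidean_space"
  by (rule C1_onI[where f'="\<lambda>_. f"]) (simp_all add: linear_imp_has_derivative)

lemma C1_on_const: "C1_on S (\<lambda>x. c)"
  by (rule C1_onI[where f'="\<lambda>_ _. 0"]) simp_all

lemma C1_on_add: "C1_on S f \<Longrightarrow> C1_on S g \<Longrightarrow> C1_on S (\<lambda>x. f x + g x)"
  by (rule C1_onI[OF has_derivative_add[OF C1_onD C1_onD]]) (auto intro!: continuous_intros C1_on_cont)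

lemma C1_on_diff: "C1_on S f \<Longrightarrow> C1_on S g \<Longrightarrow> C1_on S (\<lambda>x. f x - g x)"
  by (rule C1_onI[OF has_derivative_diff[OF C1_onD C1_onD]]) (auto intro!: continuous_intros C1_on_cont)

lemma C1_on_mult: "C1_on S f \<Longrightarrow> C1_on S g \<Longrightarrow> C1_on S (\<lambda>x. f x * g x :: real)"
  by (rule C1_onI[OF has_derivative_mult[OF C1_onD C1_onD]])
     (simp_all add: continuous_on_add continuous_on_mult C1_on_cont C1_on_continuous_on)

lemma C1_on_compose:
  fixes g :: "'b::euclidean_space \<Rightarrow> 'c::euclidean_space"
  assumes f: "C1_on S f" and g: "C1_on U g" and im: "f ` S \<subseteq> U"
  shows "C1_on S (\<lambda>x. g (f x))"
proof (rule C1_onI[OF has_derivative_compose[OF C1_onD[OF f] C1_onD[OF g]]])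
  fix v
  let ?f' = "\<lambda>x. frechet_derivative f (at x) v" and ?g' = "\<lambda>y. frechet_derivative g (at y)"
  have "continuous_on S (\<lambda>x. \<Sum>b\<in>Basis. (?f' x \<bullet> b) *\<^sub>R ?g' (f x) b)"
    by (intro continuous_intros C1_on_cont[OF f]
        continuous_on_compose2[OF C1_on_cont[OF g] C1_on_continuous_on[OF f] im])
  then show "continuous_on S (\<lambda>x. ?g' (f x) (?f' x))"
  proof (rule continuous_on_eq)
    fix x assume "x \<in> S"
    then have lin: "linear (?g' (f x))"
      using C1_onD[OF g, of "f x"] im by (auto intro: has_derivative_linear)
    show "(\<Sum>b\<in>Basis. (?f' x \<bullet> b) *\<^sub>R ?g' (f x) b) = ?g' (f x) (?f' x)"
      by (subst (3) euclidean_representation[symmetric])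
         (simp add: linear_sum[OF lin] linear_scale[OF lin] del: euclidean_representation)
  qed
qed (use im in auto)

lemma C1_on_vec:
  fixes f :: "'a::euclidean_space \<Rightarrow> 'i::finite \<Rightarrow> real"
  assumes "\<And>i. C1_on S (\<lambda>x. f x i)"
  shows "C1_on S (\<lambda>x. \<chi> i. f x i)"
proof (rule C1_onI)
  show "((\<lambda>x. \<chi> i. f x i) has_derivative (\<lambda>v. \<chi> i. frechet_derivative (\<lambda>x. f x i) (at x) v)) (at x)"
    if "x \<in> S" for x
    using C1_onD[OF assms that] by (subst has_derivative_componentwise_within) (auto simp: Basis_vec_def inner_axis)
qed (auto intro!: continuous_intros C1_on_cont[OF assms])

text \<open>A continuously differentiable function which vanishes exactly for nonpositive
  arguments makes plateau functions explicit.\<close>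

definition sq_pos :: "real \<Rightarrow> real" where "sq_pos x = (max 0 x)\<^sup>2"

lemma sq_pos_has_derivative: "(sq_pos has_real_derivative 2 * max 0 x) (at x)"
proof -
  consider "x > 0" | "x < 0" | "x = 0" by linarith
  then show ?thesis
  proof cases
    case 1
    have "((\<lambda>x. x\<^sup>2) has_real_derivative 2 * max 0 x) (at x)"
      using 1 by (auto intro!: derivative_eq_intros)
    then show ?thesis
      by (rule has_field_derivative_transform_within_open[where S="{0<..}"]) (use 1 in \<open>auto simp: sq_pos_def\<close>)
  next
    case 2
    have "((\<lambda>x. 0) has_real_derivative 2 * max 0 x) (at x)"
      using 2 by (auto intro!: derivative_eq_intros)
    then show ?thesis
      by (rule has_field_derivative_transform_within_open[where S="{..<0}"]) (use 2 in \<open>auto simp: sq_pos_def\<close>)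
  next
    case 3
    have "((\<lambda>h. sq_pos h / h) \<longlongrightarrow> 0) (at 0)"
    proof (rule Lim_null_comparison[where g="\<lambda>h. \<bar>h\<bar>"])
      show "\<forall>\<^sub>F h in at 0. norm (sq_pos h / h) \<le> \<bar>h\<bar>"
        by (intro always_eventually allI) (auto simp: sq_pos_def max_def power2_eq_square)
      show "((\<lambda>h. \<bar>h\<bar>) \<longlongrightarrow> 0) (at (0::real))"
        by (rule tendsto_rabs_zero) simp
    qed
    then show ?thesis using 3 by (simp add: DERIV_def sq_pos_def[of 0])
  qed
qed

lemma C1_on_real:
  fixes f :: "real \<Rightarrow> real"
  assumes "\<And>x. (f has_real_derivative f' x) (at x)" "continuous_on UNIV f'"
  shows "C1_on UNIV f"
  by (rule C1_onI[where f'="\<lambda>x v. f' x * v"])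
     (use assms in \<open>auto simp: has_field_derivative_def intro!: continuous_intros\<close>)

lemma C1_on_sq_pos: "C1_on UNIV sq_pos"
  by (rule C1_on_real[OF sq_pos_has_derivative]) (intro continuous_intros)

lemma ex_C1_plateau:
  fixes a :: "'a::euclidean_space"
  assumes "0 < r" "r < R"
  obtains \<beta> :: "'a \<Rightarrow> real" where "C1_on UNIV \<beta>" "\<And>y. 0 \<le> \<beta> y" "\<And>y. \<beta> y \<le> 1"
    "\<And>y. y \<in> cball a r \<Longrightarrow> \<beta> y = 1" "\<And>y. y \<notin> ball a R \<Longrightarrow> \<beta> y = 0"
proof -
  define c where "c = 1 / (R\<^sup>2 - r\<^sup>2)\<^sup>2"
  have Rr: "R\<^sup>2 - r\<^sup>2 > 0" using assms by (simp add: power_strict_mono)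
  have c: "c > 0" using Rr by (simp add: c_def)
  define \<beta> where "\<beta> = (\<lambda>y. sq_pos (1 - c * sq_pos ((y - a) \<bullet> (y - a) - r\<^sup>2)))"
  have 1: "C1_on UNIV (\<lambda>y. (y - a) \<bullet> (y - a) - r\<^sup>2)"
    by (rule C1_onI[where f'="\<lambda>y v. 2 * ((y - a) \<bullet> v)"])
       (auto intro!: derivative_eq_intros continuous_intros simp: inner_commute)
  have "C1_on UNIV (\<lambda>y. 1 - c * sq_pos ((y - a) \<bullet> (y - a) - r\<^sup>2))"
    by (intro C1_on_diff C1_on_const C1_on_mult C1_on_compose[OF 1 C1_on_sq_pos]) simp
  then have "C1_on UNIV \<beta>"
    unfolding \<beta>_def by (rule C1_on_compose[OF _ C1_on_sq_pos]) simp
  moreover have "0 \<le> \<beta> y" "\<beta> y \<le> 1" for y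
    using c by (auto simp: \<beta>_def sq_pos_def intro!: power_le_one)
  moreover have "\<beta> y = 1" if "y \<in> cball a r" for y
  proof -
    have "(y - a) \<bullet> (y - a) \<le> r\<^sup>2"
      using that assms by (simp add: dot_square_norm dist_norm norm_minus_commute power_mono)
    then show ?thesis by (simp add: \<beta>_def sq_pos_def)
  qed
  moreover have "\<beta> y = 0" if "y \<notin> ball a R" for y
  proof -
    have "R\<^sup>2 \<le> (y - a) \<bullet> (y - a)"
      using that assms by (simp add: dot_square_norm dist_norm norm_minus_commute power_mono)
    then have "(R\<^sup>2 - r\<^sup>2)\<^sup>2 \<le> sq_pos ((y - a) \<bullet> (y - a) - r\<^sup>2)"
      using Rr unfolding sq_pos_def by (intro power_mono) auto
    then have "1 \<le> c * sq_pos ((y - a) \<bullet> (y - a) - r\<^sup>2)"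
      using Rr by (simp add: c_def)
    then show ?thesis by (simp add: \<beta>_def sq_pos_def[of "1 - _"])
  qed
  ultimately show ?thesis using that by blast
qed

section \<open>Charts and transition maps\<close>

abbreviation fd where "fd F y \<equiv> frechet_derivative F (at y)"

text \<open>One derivative suffices for the integration of top forms, and the class of these
  charts is easily seen to be closed under restriction, linear reparametrisation and
  products with a line.\<close>

definition C1_chart ::
  "('e::euclidean_space \<Rightarrow> 'x) \<Rightarrow> 'v topology \<Rightarrow> ('v \<Rightarrow> 'x) \<Rightarrow>
   (real^'m) set \<Rightarrow> (real^'m \<Rightarrow> 'v) \<Rightarrow> (real^'m::finite \<Rightarrow> 'e) \<Rightarrow> bool" where
  "C1_chart P T f W \<psi> F \<longleftrightarrow>
     open W \<and> embedding_map (top_of_set W) T \<psi> \<and> openin T (\<psi> ` W) \<and>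
     C1_on W F \<and> (\<forall>y\<in>W. inj (fd F y) \<and> P (F y) = f (\<psi> y))"

text \<open>The property of a quotient by a discrete group of translations which makes two
  continuous lifts of the same map differ by a locally constant vector.\<close>

definition separated_fibres :: "('e::real_normed_vector \<Rightarrow> 'x) \<Rightarrow> bool" where
  "separated_fibres P \<longleftrightarrow> (\<exists>e>0. \<forall>x y x' y'.
     P x = P y \<and> P x' = P y' \<and> norm ((x - y) - (x' - y')) < e \<longrightarrow> x - y = x' - y')"

lemma immersion_chart_imp_C1_chart:
  "immersion_chart P T f W \<psi> F \<Longrightarrow> C1_chart P T f W \<psi> F"
  unfolding immersion_chart_def C1_chart_def by (auto intro: smooth_on_imp_C1_on)

lemma C1_chart_inj: "C1_chart P T f W \<psi> F \<Longrightarrow> inj_on \<psi> W"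
  unfolding C1_chart_def embedding_map_def using homeomorphic_imp_injective_map by fastforce

lemma C1_chart_continuous_map: "C1_chart P T f W \<psi> F \<Longrightarrow> continuous_map (top_of_set W) T \<psi>"
  unfolding C1_chart_def
  by (metis embedding_map_def homeomorphic_imp_continuous_map continuous_map_in_subtopology)

lemma C1_chart_in_topspace: "C1_chart P T f W \<psi> F \<Longrightarrow> y \<in> W \<Longrightarrow> \<psi> y \<in> topspace T"
  using C1_chart_continuous_map by (fastforce simp: continuous_map_def)

lemma C1_chart_open_vimage:
  assumes "C1_chart P T f W \<psi> F" "openin T V"
  shows "open {y\<in>W. \<psi> y \<in> V}"
proof -
  have "openin (top_of_set W) {y \<in> topspace (top_of_set W). \<psi> y \<in> V}"
    using C1_chart_continuous_map[OF assms(1)] assms(2) by (rule openin_continuous_map_preimage)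
  then show ?thesis using assms(1) by (simp add: C1_chart_def openin_open_eq)
qed

lemma C1_chart_continuous_inv:
  assumes "C1_chart P T f W \<psi> F"
  shows "continuous_map (subtopology T (\<psi> ` W)) (top_of_set W) (inv_into W \<psi>)"
proof -
  have "homeomorphic_map (top_of_set W) (subtopology T (\<psi> ` W)) \<psi>"
    using assms by (simp add: C1_chart_def embedding_map_def)
  then obtain g where g: "homeomorphic_maps (top_of_set W) (subtopology T (\<psi> ` W)) \<psi> g"
    using homeomorphic_map_maps by blast
  then have "continuous_map (subtopology T (\<psi> ` W)) (top_of_set W) g"
    by (simp add: homeomorphic_maps_def)
  then show ?thesis
  proof (rule continuous_map_eq)
    fix x assume "x \<in> topspace (subtopology T (\<psi> ` W))"
    then obtain y where y: "y \<in> W" "x = \<psi> y" by auto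
    have "g (\<psi> y) = y" using g y by (simp add: homeomorphic_maps_def)
    then show "g x = inv_into W \<psi> x" using y C1_chart_inj[OF assms] by simp
  qed
qed

lemma C1_chart_compactin_image:
  assumes "C1_chart P T f W \<psi> F" "compact K" "K \<subseteq> W"
  shows "compactin T (\<psi> ` K)"
  using assms(2,3) C1_chart_continuous_map[OF assms(1)]
  by (metis compactin_euclidean_iff compactin_subtopology image_compactin)

text \<open>The differentiability part of the inverse function theorem, for an inverse which is
  known to be continuous: near \<open>\<kappa> y0\<close> the map \<open>f\<close> is a small perturbation of the
  identity, so that differences of \<open>\<kappa>\<close> are comparable with those of \<open>f \<circ>
  \<kappa>\<close>.\<close>

lemma has_derivative_right_factor:
  fixes \<kappa> :: "'a::real_normed_vector \<Rightarrow> 'b::real_normed_vector"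
  assumes f: "(f has_derivative (\<lambda>v. v)) (at (\<kappa> y0))" and c: "isCont \<kappa> y0"
    and D: "((\<lambda>y. f (\<kappa> y)) has_derivative D) (at y0)"
  shows "(\<kappa> has_derivative D) (at y0)"
  unfolding has_derivative_at_alt
proof (intro conjI allI impI)
  show bl: "bounded_linear D" using D by (rule has_derivative_bounded_linear)
  obtain B where B: "B > 0" "\<And>v. norm (D v) \<le> norm v * B" using bounded_linear.pos_bounded[OF bl] by blast
  fix e :: real assume e: "e > 0"
  \<comment> \<open>The bound \<open>\<eta> \<le> 1/2\<close> gives \<open>norm (\<kappa> y - \<kappa> y0) \<le> 2 (B
    + 1) norm (y - y0)\<close> below, and the second term makes \<open>\<eta>\<close> times this constant at
    most \<open>e/2\<close>.\<close>
  define \<eta> where "\<eta> = min (1/2) (e / (4 * (B + 1)))"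
  define \<eta>' where "\<eta>' = min 1 (e / 2)"
  have "\<eta> * (2 * (B + 1)) \<le> e / (4 * (B + 1)) * (2 * (B + 1))"
    unfolding \<eta>_def using B by (intro mult_right_mono) auto
  also have "\<dots> = e / 2" using B by (simp add: field_simps)
  finally have \<eta>3: "\<eta> * (2 * (B + 1)) \<le> e / 2" .
  have "\<eta> \<le> 1/2" unfolding \<eta>_def by (rule min.cobounded1)
  with \<eta>3 have \<eta>: "\<eta> > 0" "\<eta> \<le> 1/2" "\<eta> * (2 * (B + 1)) \<le> e / 2" and \<eta>': "\<eta>' > 0" "\<eta>' \<le> 1" "\<eta>' \<le> e / 2"
    using e B by (auto simp: \<eta>_def \<eta>'_def)
  obtain d1 where d1: "d1 > 0" "\<And>z. norm (z - \<kappa> y0) < d1 \<Longrightarrow>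
      norm (f z - f (\<kappa> y0) - (z - \<kappa> y0)) \<le> \<eta> * norm (z - \<kappa> y0)"
    using f \<eta>(1) unfolding has_derivative_at_alt by blast
  obtain d2 where d2: "d2 > 0" "\<And>y. norm (y - y0) < d2 \<Longrightarrow> norm (\<kappa> y - \<kappa> y0) < d1"
    using c d1(1) unfolding continuous_at_eps_delta by (auto simp: dist_norm)
  obtain d3 where d3: "d3 > 0" "\<And>y. norm (y - y0) < d3 \<Longrightarrow>
      norm (f (\<kappa> y) - f (\<kappa> y0) - D (y - y0)) \<le> \<eta>' * norm (y - y0)"
    using D \<eta>'(1) unfolding has_derivative_at_alt by blast
  show "\<exists>d>0. \<forall>y. norm (y - y0) < d \<longrightarrow> norm (\<kappa> y - \<kappa> y0 - D (y - y0)) \<le> e * norm (y - y0)"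
  proof (intro exI[of _ "min d2 d3"] conjI allI impI)
    fix y assume y: "norm (y - y0) < min d2 d3"
    let ?k = "\<kappa> y - \<kappa> y0" and ?f = "f (\<kappa> y) - f (\<kappa> y0)" and ?y = "y - y0"
    have 1: "norm (?f - ?k) \<le> \<eta> * norm ?k" using d1(2) d2(2) y by simp
    have 2: "norm (?f - D ?y) \<le> \<eta>' * norm ?y" using d3(2) y by simp
    have "norm ?f \<le> norm (D ?y) + norm (?f - D ?y)" by (metis add_diff_cancel_left' diff_add_cancel norm_triangle_ineq add.commute)
    also have "\<dots> \<le> norm ?y * B + 1 * norm ?y"
      using 2 B(2)[of ?y] mult_right_mono[OF \<eta>'(2), of "norm ?y"] by simp
    finally have 3: "norm ?f \<le> (B + 1) * norm ?y" by (simp add: algebra_simps)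
    have "norm ?k \<le> norm ?f + norm (?f - ?k)" by (metis norm_minus_commute norm_triangle_sub)
    moreover have "\<eta> * norm ?k \<le> 1/2 * norm ?k" by (rule mult_right_mono[OF \<eta>(2)]) simp
    ultimately have 4: "norm ?k \<le> 2 * (B + 1) * norm ?y" using 1 3 by linarith
    have "norm (?k - D ?y) \<le> norm (?f - ?k) + norm (?f - D ?y)"
      by (metis norm_minus_commute norm_diff_triangle_le order_refl add.commute)
    also have "\<dots> \<le> \<eta> * (2 * (B + 1) * norm ?y) + e / 2 * norm ?y"
    proof (rule add_mono)
      show "norm (?f - ?k) \<le> \<eta> * (2 * (B + 1) * norm ?y)"
        using 1 mult_left_mono[OF 4, of \<eta>] \<eta>(1) by linarith
      show "norm (?f - D ?y) \<le> e / 2 * norm ?y"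
        using 2 mult_right_mono[OF \<eta>'(3) norm_ge_zero, of ?y] by linarith
    qed
    also have "\<dots> \<le> e / 2 * norm ?y + e / 2 * norm ?y"
      using mult_right_mono[OF \<eta>(3), of "norm ?y"] by (simp add: algebra_simps)
    finally show "norm (?k - D ?y) \<le> e * norm ?y" by (simp add: algebra_simps)
  qed (use d2 d3 in auto)
qed

definition transition :: "('a \<Rightarrow> 'v) \<Rightarrow> 'b set \<Rightarrow> ('b \<Rightarrow> 'v) \<Rightarrow> 'a \<Rightarrow> 'b" where
  "transition \<psi> W' \<psi>' y = inv_into W' \<psi>' (\<psi> y)"

text \<open>The lifts \<open>F\<close> and \<open>F' \<circ> \<kappa>\<close> have the same projection, so their difference
  is locally constant. A left inverse \<open>Li\<close> of the derivative of \<open>F'\<close> at \<open>\<kappa> y0\<close> makes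
  \<open>Li \<circ> F'\<close> tangent to the identity there, which gives the differentiability of
  \<open>\<kappa>\<close>; for the continuity of its derivative, \<open>Li\<close> is still an approximate left
  inverse at nearby points.\<close>

lemma transition_map:
  fixes F :: "real^'m::finite \<Rightarrow> 'e::euclidean_space"
  assumes c1: "C1_chart P T f W \<psi> F" and c2: "C1_chart P T f W' \<psi>' F'"
    and sep: "separated_fibres P"
  defines "N \<equiv> {y\<in>W. \<psi> y \<in> \<psi>' ` W'}" and "\<kappa> \<equiv> transition \<psi> W' \<psi>'"
  shows "open N" "inj_on \<kappa> N" "\<kappa> ` N = {y\<in>W'. \<psi>' y \<in> \<psi> ` W}"
    "\<And>y. y \<in> N \<Longrightarrow> \<kappa> y \<in> W'" "\<And>y. y \<in> N \<Longrightarrow> \<psi>' (\<kappa> y) = \<psi> y"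
    "C1_on N \<kappa>"
    "\<And>y v. y \<in> N \<Longrightarrow> fd F y v = fd F' (\<kappa> y) (fd \<kappa> y v)"
proof -
  note inj1 = C1_chart_inj[OF c1] and inj2 = C1_chart_inj[OF c2]
  have op: "openin T (\<psi>' ` W')" "open W" "C1_on W F" "C1_on W' F'"
    using c1 c2 by (auto simp: C1_chart_def)
  show N: "open N" unfolding N_def by (rule C1_chart_open_vimage[OF c1 op(1)])
  show kW: "\<kappa> y \<in> W'" if "y \<in> N" for y
    using that unfolding N_def \<kappa>_def transition_def by (auto intro: inv_into_into)
  show kp: "\<psi>' (\<kappa> y) = \<psi> y" if "y \<in> N" for y
    using that unfolding N_def \<kappa>_def transition_def by (auto intro: f_inv_into_f)
  have NW: "N \<subseteq> W" by (auto simp: N_def)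
  show "inj_on \<kappa> N"
    by (rule inj_onI) (metis NW inj1 inj_onD kp subsetD)
  show "\<kappa> ` N = {y\<in>W'. \<psi>' y \<in> \<psi> ` W}"
  proof (intro equalityI subsetI)
    fix z assume "z \<in> \<kappa> ` N"
    then obtain y where y: "y \<in> N" "z = \<kappa> y" by blast
    then show "z \<in> {y\<in>W'. \<psi>' y \<in> \<psi> ` W}" using kW[OF y(1)] kp[OF y(1)] NW by auto
  next
    fix z assume "z \<in> {y\<in>W'. \<psi>' y \<in> \<psi> ` W}"
    then obtain y where y: "z \<in> W'" "y \<in> W" "\<psi>' z = \<psi> y" by auto
    then have "y \<in> N" unfolding N_def by (metis (mono_tags, lifting) imageI mem_Collect_eq)
    moreover have "\<kappa> y = z" using inj2 y unfolding \<kappa>_def transition_def by (metis inv_into_f_f)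
    ultimately show "z \<in> \<kappa> ` N" by blast
  qed
  have cont: "continuous_on N \<kappa>"
  proof -
    have "continuous_map (top_of_set N) (subtopology T (\<psi>' ` W')) \<psi>"
      using C1_chart_continuous_map[OF c1] NW
      by (auto simp: continuous_map_in_subtopology N_def intro: continuous_map_from_subtopology_mono)
    from continuous_map_compose[OF this C1_chart_continuous_inv[OF c2]]
    show ?thesis by (simp add: \<kappa>_def transition_def[abs_def] o_def)
  qed
  then have contk: "isCont \<kappa> y" if "y \<in> N" for y
    using that N by (simp add: continuous_on_eq_continuous_at)
  have contF: "continuous_on N F" and contF': "continuous_on N (\<lambda>y. F' (\<kappa> y))"
    using C1_on_continuous_on[OF op(3)] NW continuous_on_subset
      continuous_on_compose2[OF C1_on_continuous_on[OF op(4)] cont] kW by blast+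
  have PF: "P (F y) = P (F' (\<kappa> y))" if "y \<in> N" for y
    using c1 c2 that NW kW kp unfolding C1_chart_def by fastforce
  have loc: "\<exists>U. open U \<and> y0 \<in> U \<and> U \<subseteq> N \<and> (\<forall>y\<in>U. F y = F' (\<kappa> y) + (F y0 - F' (\<kappa> y0)))"
    if y0: "y0 \<in> N" for y0
  proof -
    obtain e where e: "e > 0" "\<And>x y x' y'. P x = P y \<Longrightarrow> P x' = P y' \<Longrightarrow>
        norm ((x - y) - (x' - y')) < e \<Longrightarrow> x - y = x' - y'"
      using sep unfolding separated_fibres_def by blast
    let ?h = "\<lambda>y. F y - F' (\<kappa> y)"
    have "continuous_on N ?h" by (intro continuous_intros contF contF')
    then have "open {y\<in>N. ?h y \<in> ball (?h y0) e}"
      using continuous_open_preimage[OF _ N open_ball] by (simp add: vimage_def Int_def conj_commute)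
    moreover have "F y = F' (\<kappa> y) + ?h y0" if "y \<in> N" "?h y \<in> ball (?h y0) e" for y
      using e(2)[OF PF[OF that(1)] PF[OF y0]] that(2)
      by (simp add: dist_norm norm_minus_commute algebra_simps)
    ultimately show ?thesis using y0 e(1)
      by (intro exI[of _ "{y\<in>N. ?h y \<in> ball (?h y0) e}"]) auto
  qed
  have derF': "(F' has_derivative fd F' (\<kappa> y)) (at (\<kappa> y))" if "y \<in> N" for y
    using C1_onD[OF op(4) kW[OF that]] .
  have derF: "(F has_derivative fd F y) (at y)" if "y \<in> N" for y
    using C1_onD[OF op(3)] NW that by blast
  have key: "(\<kappa> has_derivative (\<lambda>v. Li (fd F y0 v))) (at y0)"
    if y0: "y0 \<in> N" and Li: "linear Li" "\<And>v. Li (fd F' (\<kappa> y0) v) = v" for y0 Li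
  proof (rule has_derivative_right_factor[where f="\<lambda>z. Li (F' z)"])
    have dLi: "(Li has_derivative Li) (at x)" for x using Li(1) by (rule linear_imp_has_derivative)
    show "((\<lambda>z. Li (F' z)) has_derivative (\<lambda>v. v)) (at (\<kappa> y0))"
      using has_derivative_compose[OF derF'[OF y0] dLi] Li(2) by simp
    obtain U where U: "open U" "y0 \<in> U" "U \<subseteq> N" "\<And>y. y \<in> U \<Longrightarrow> F y = F' (\<kappa> y) + (F y0 - F' (\<kappa> y0))"
      using loc[OF y0] by blast
    have "((\<lambda>y. Li (F y - (F y0 - F' (\<kappa> y0)))) has_derivative (\<lambda>v. Li (fd F y0 v))) (at y0)"
      using has_derivative_compose[OF has_derivative_diff[OF derF[OF y0] has_derivative_const] dLi] by simp
    then show "((\<lambda>y. Li (F' (\<kappa> y))) has_derivative (\<lambda>v. Li (fd F y0 v))) (at y0)"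
      by (rule has_derivative_transform_within_open[OF _ U(1,2)]) (simp add: U(4))
  qed (rule contk[OF y0])
  have exLi: "\<exists>Li. linear Li \<and> (\<forall>v. Li (fd F' (\<kappa> y0) v) = v)" if y0: "y0 \<in> N" for y0
  proof -
    have "linear (fd F' (\<kappa> y0))" "inj (fd F' (\<kappa> y0))"
      using derF'[OF y0] c2 kW[OF y0] by (auto simp: C1_chart_def has_derivative_linear)
    then show ?thesis using linear_injective_left_inverse by (metis comp_apply id_apply)
  qed
  have derk: "(\<kappa> has_derivative fd \<kappa> y) (at y)" if "y \<in> N" for y
    using exLi[OF that] key[OF that] frechet_derivative_works unfolding differentiable_def by blast
  show fdF: "fd F y v = fd F' (\<kappa> y) (fd \<kappa> y v)" if y: "y \<in> N" for y v
  proof -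
    obtain U where U: "open U" "y \<in> U" "U \<subseteq> N" "\<And>z. z \<in> U \<Longrightarrow> F z = F' (\<kappa> z) + (F y - F' (\<kappa> y))"
      using loc[OF y] by blast
    have "((\<lambda>z. F' (\<kappa> z) + (F y - F' (\<kappa> y))) has_derivative (\<lambda>v. fd F' (\<kappa> y) (fd \<kappa> y v))) (at y)"
      using has_derivative_add[OF has_derivative_compose[OF derk[OF y] derF'[OF y]] has_derivative_const] by simp
    then have "(F has_derivative (\<lambda>v. fd F' (\<kappa> y) (fd \<kappa> y v))) (at y)"
      by (rule has_derivative_transform_within_open[OF _ U(1,2)]) (simp add: U(4))
    then show ?thesis using derF[OF y] has_derivative_unique by metis
  qed
  show "C1_on N \<kappa>"
  proof (rule C1_onI[OF derk])
    fix v
    show "continuous_on N (\<lambda>y. fd \<kappa> y v)"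
      unfolding continuous_on_eq_continuous_at[OF N]
    proof
      fix y0 assume y0: "y0 \<in> N"
      obtain Li where Li: "linear Li" "\<And>v. Li (fd F' (\<kappa> y0) v) = v" using exLi[OF y0] by blast
      define M where "M = (\<lambda>y w. Li (fd F' (\<kappa> y) w))"
      define n where "n = (\<lambda>y. Li (fd F y v))"
      define \<epsilon> where "\<epsilon> = (\<lambda>y. \<Sum>b\<in>Basis. norm (M y b - b))"
      have contLi: "continuous_on UNIV Li" using Li(1) by (simp add: linear_continuous_on linear_conv_bounded_linear)
      have cM: "continuous_on N (\<lambda>y. M y w)" for w
        unfolding M_def
        by (rule continuous_on_compose2[OF contLi continuous_on_compose2[OF C1_on_cont[OF op(4)] cont]])
           (use kW in auto)
      have cn: "continuous_on N n"
        unfolding n_def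
        by (rule continuous_on_compose2[OF contLi continuous_on_subset[OF C1_on_cont[OF op(3)] NW]]) auto
      have tn: "(n \<longlongrightarrow> n y0) (at y0)"
        using cn y0 N by (simp add: continuous_on_eq_continuous_at isCont_def)
      have "continuous_on N \<epsilon>" unfolding \<epsilon>_def by (intro continuous_intros cM)
      then have "(\<epsilon> \<longlongrightarrow> \<epsilon> y0) (at y0)"
        using y0 N by (simp add: continuous_on_eq_continuous_at isCont_def)
      then have te: "(\<epsilon> \<longlongrightarrow> 0) (at y0)" by (simp add: \<epsilon>_def M_def Li(2))
      have n_eq: "n y = M y (fd \<kappa> y v)" if "y \<in> N" for y
        unfolding n_def M_def using fdF[OF that] by simp
      have bnd: "norm (M y w - w) \<le> \<epsilon> y * norm w" if "y \<in> N" for y w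
      proof -
        have linM: "linear (M y)"
          unfolding M_def using linear_compose[OF has_derivative_linear[OF derF'[OF that]] Li(1)] by (simp add: o_def)
        have "M y w - w = (\<Sum>b\<in>Basis. (w \<bullet> b) *\<^sub>R (M y b - b))"
        proof -
          have "M y w = (\<Sum>b\<in>Basis. (w \<bullet> b) *\<^sub>R M y b)"
            by (subst euclidean_representation[of w, symmetric])
               (simp add: linear_sum[OF linM] linear_scale[OF linM] del: euclidean_representation)
          then show ?thesis
            by (simp add: scaleR_diff_right sum_subtractf euclidean_representation)
        qed
        also have "norm \<dots> \<le> (\<Sum>b\<in>Basis. norm w * norm (M y b - b))"
          by (rule sum_norm_le) (simp add: mult_right_mono Basis_le_norm)
        finally show ?thesis by (simp add: \<epsilon>_def sum_distrib_left sum_distrib_right mult.commute)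
      qed
      have ev: "\<forall>\<^sub>F y in at y0. y \<in> N" using N y0 by (simp add: eventually_at_topological) blast
      have "\<forall>\<^sub>F y in at y0. \<epsilon> y < 1/2" using te by (rule order_tendstoD) simp
      with ev have nle: "\<forall>\<^sub>F y in at y0. norm (fd \<kappa> y v - n y) \<le> \<epsilon> y * (2 * norm (n y))"
      proof eventually_elim
        case (elim y)
        let ?k = "fd \<kappa> y v"
        have 1: "norm (n y - ?k) \<le> \<epsilon> y * norm ?k" using bnd[OF elim(1), of ?k] n_eq[OF elim(1)] by simp
        have e0: "\<epsilon> y \<ge> 0" by (simp add: \<epsilon>_def sum_nonneg)
        have "\<epsilon> y * norm ?k \<le> 1/2 * norm ?k" using elim(2) by (intro mult_right_mono) auto
        then have "norm ?k \<le> 2 * norm (n y)"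
          using 1 norm_triangle_sub[of ?k "n y"] by (simp add: norm_minus_commute)
        then have "\<epsilon> y * norm ?k \<le> \<epsilon> y * (2 * norm (n y))" using e0 by (rule mult_left_mono)
        then show ?case using 1 by (simp add: norm_minus_commute)
      qed
      have "((\<lambda>y. \<epsilon> y * (2 * norm (n y))) \<longlongrightarrow> 0 * (2 * norm (n y0))) (at y0)"
        by (intro tendsto_intros te tn)
      then have lim0: "((\<lambda>y. \<epsilon> y * (2 * norm (n y))) \<longlongrightarrow> 0) (at y0)" by simp
      from nle lim0 have "((\<lambda>y. fd \<kappa> y v - n y) \<longlongrightarrow> 0) (at y0)"
        by (rule Lim_null_comparison)
      from tendsto_add[OF this tn] have "((\<lambda>y. fd \<kappa> y v) \<longlongrightarrow> n y0) (at y0)" by simp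
      moreover have "n y0 = fd \<kappa> y0 v" using n_eq[OF y0] by (simp add: M_def Li(2))
      ultimately show "isCont (\<lambda>y. fd \<kappa> y v) y0" by (simp add: isCont_def)
    qed
  qed
qed

section \<open>Integration of top forms\<close>

type_synonym ('m, 'v, 'e) lchart = "(real^'m) set \<times> (real^'m \<Rightarrow> 'v) \<times> (real^'m \<Rightarrow> 'e)"
text \<open>A top form is represented by its densities with respect to all charts.\<close>

type_synonym ('m, 'v, 'e) form = "('m, 'v, 'e) lchart \<Rightarrow> real^'m \<Rightarrow> real"

type_synonym ('m, 'v, 'e) bump = "('m, 'v, 'e) lchart \<times> (real^'m) \<times> real \<times> ('v \<Rightarrow> real)"

definition form_mult :: "('v \<Rightarrow> real) \<Rightarrow> ('m::finite, 'v, 'e) form \<Rightarrow> ('m, 'v, 'e) form" where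
  "form_mult u \<tau> = (\<lambda>(W, \<psi>, F) y. u (\<psi> y) * \<tau> (W, \<psi>, F) y)"

lemma absolutely_integrable_compact_support:
  fixes g :: "real^'m::finite \<Rightarrow> real"
  assumes "open W" "continuous_on W g" "compact K" "K \<subseteq> W" "\<And>y. y \<in> W \<Longrightarrow> y \<notin> K \<Longrightarrow> g y = 0"
  shows "g absolutely_integrable_on W"
proof -
  have "g absolutely_integrable_on K"
  proof -
    have "integrable lborel (\<lambda>x. indicator K x *\<^sub>R g x)"
      by (rule borel_integrable_compact[OF assms(3) continuous_on_subset[OF assms(2,4)]])
    then show ?thesis
      unfolding set_integrable_def
      by (subst integrable_completion) (auto dest: borel_measurable_integrable)
  qed
  then have "(\<lambda>y. if y \<in> K then g y else 0) absolutely_integrable_on UNIV"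
    by (simp add: absolutely_integrable_restrict_UNIV)
  moreover have "(\<lambda>y. if y \<in> K then g y else 0) = (\<lambda>y. if y \<in> W then g y else 0)"
    by (rule ext) (use assms(4,5) in auto)
  ultimately show ?thesis
    by (simp add: absolutely_integrable_restrict_UNIV)
qed

lemma integral_eq_subset:
  fixes g :: "'a::euclidean_space \<Rightarrow> real"
  assumes "S \<subseteq> W" "\<And>y. y \<in> W \<Longrightarrow> y \<notin> S \<Longrightarrow> g y = 0"
  shows "integral W g = integral S g"
proof -
  have "integral W g = integral W (\<lambda>y. if y \<in> S then g y else 0)"
    by (rule Henstock_Kurzweil_Integration.integral_cong) (use assms in auto)
  also have "\<dots> = integral (W \<inter> S) g"
    by (simp add: integral_restrict_Int Int_commute)
  finally show ?thesis using assms(1) by (simp add: Int_absorb1)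
qed

text \<open>Orientability is expressed on tangent vectors in \<open>'e\<close>: the matrix \<open>A\<close> is the
  derivative of the transition map, which exists for arbitrary charts by \<open>transition_map\<close>.\<close>

locale oriented_atlas =
  fixes P :: "'e::euclidean_space \<Rightarrow> 'x" and T :: "'v topology" and f :: "'v \<Rightarrow> 'x"
    and \<A> :: "('m::finite, 'v, 'e) lchart set"
  assumes haus: "Hausdorff_space T" and sep: "separated_fibres P"
    and chart: "(W, \<psi>, F) \<in> \<A> \<Longrightarrow> C1_chart P T f W \<psi> F"
    and cover: "x \<in> topspace T \<Longrightarrow> \<exists>W \<psi> F. (W, \<psi>, F) \<in> \<A> \<and> x \<in> \<psi> ` W"
    and positive: "\<lbrakk>(W, \<psi>, F) \<in> \<A>; (W', \<psi>', F') \<in> \<A>; y \<in> W; y' \<in> W'; \<psi> y = \<psi>' y'\<rbrakk>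
       \<Longrightarrow> \<exists>A :: real^'m^'m. det A > 0 \<and> (\<forall>v. fd F y v = fd F' y' (A *v v))"
begin

definition top_form :: "('m, 'v, 'e) form \<Rightarrow> bool" where
  "top_form \<tau> \<longleftrightarrow>
     (\<forall>W \<psi> F. (W, \<psi>, F) \<in> \<A> \<longrightarrow> continuous_on W (\<tau> (W, \<psi>, F))) \<and>
     (\<forall>W \<psi> F W' \<psi>' F' y y' A. (W, \<psi>, F) \<in> \<A> \<longrightarrow> (W', \<psi>', F') \<in> \<A> \<longrightarrow> y \<in> W \<longrightarrow> y' \<in> W' \<longrightarrow>
        \<psi> y = \<psi>' y' \<longrightarrow> (\<forall>v. fd F y v = fd F' y' (A *v v)) \<longrightarrow>
        \<tau> (W, \<psi>, F) y = det A * \<tau> (W', \<psi>', F') y')"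

definition supported :: "('m, 'v, 'e) form \<Rightarrow> 'v set \<Rightarrow> bool" where
  "supported \<tau> C \<longleftrightarrow> (\<forall>W \<psi> F y. (W, \<psi>, F) \<in> \<A> \<longrightarrow> y \<in> W \<longrightarrow> \<psi> y \<notin> C \<longrightarrow> \<tau> (W, \<psi>, F) y = 0)"

definition C1_fun :: "('v \<Rightarrow> real) \<Rightarrow> bool" where
  "C1_fun u \<longleftrightarrow> (\<forall>W \<psi> F. (W, \<psi>, F) \<in> \<A> \<longrightarrow> C1_on W (\<lambda>y. u (\<psi> y)))"

lemma chart_open: "(W, \<psi>, F) \<in> \<A> \<Longrightarrow> open W"
  using chart by (auto simp: C1_chart_def)

lemma top_formI:
  assumes "\<And>W \<psi> F. (W, \<psi>, F) \<in> \<A> \<Longrightarrow> continuous_on W (\<tau> (W, \<psi>, F))"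
    and "\<And>W \<psi> F W' \<psi>' F' y y' A. \<lbrakk>(W, \<psi>, F) \<in> \<A>; (W', \<psi>', F') \<in> \<A>; y \<in> W; y' \<in> W'; \<psi> y = \<psi>' y';
        \<And>v. fd F y v = fd F' y' (A *v v)\<rbrakk> \<Longrightarrow> \<tau> (W, \<psi>, F) y = det A * \<tau> (W', \<psi>', F') y'"
  shows "top_form \<tau>"
  unfolding top_form_def using assms by blast

lemma top_form_cont: "top_form \<tau> \<Longrightarrow> (W, \<psi>, F) \<in> \<A> \<Longrightarrow> continuous_on W (\<tau> (W, \<psi>, F))"
  unfolding top_form_def by blast

lemma top_formD:
  assumes "top_form \<tau>" "(W, \<psi>, F) \<in> \<A>" "(W', \<psi>', F') \<in> \<A>" "y \<in> W" "y' \<in> W'" "\<psi> y = \<psi>' y'"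
    "\<And>v. fd F y v = fd F' y' (A *v v)"
  shows "\<tau> (W, \<psi>, F) y = det A * \<tau> (W', \<psi>', F') y'"
  using assms unfolding top_form_def by blast

lemma C1_funD: "C1_fun u \<Longrightarrow> (W, \<psi>, F) \<in> \<A> \<Longrightarrow> C1_on W (\<lambda>y. u (\<psi> y))"
  unfolding C1_fun_def by blast

lemma top_form_mult:
  assumes \<tau>: "top_form \<tau>" and u: "C1_fun u"
  shows "top_form (form_mult u \<tau>)"
proof (rule top_formI)
  show "continuous_on W (form_mult u \<tau> (W, \<psi>, F))" if "(W, \<psi>, F) \<in> \<A>" for W \<psi> F
    using continuous_on_mult[OF C1_on_continuous_on[OF C1_funD[OF u that]] top_form_cont[OF \<tau> that]]
    by (simp add: form_mult_def)
  show "form_mult u \<tau> (W, \<psi>, F) y = det A * form_mult u \<tau> (W', \<psi>', F') y'"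
    if "(W, \<psi>, F) \<in> \<A>" "(W', \<psi>', F') \<in> \<A>" "y \<in> W" "y' \<in> W'" "\<psi> y = \<psi>' y'"
      "\<And>v. fd F y v = fd F' y' (A *v v)" for W \<psi> F W' \<psi>' F' y y' A
    using top_formD[OF \<tau> that] that(5) by (simp add: form_mult_def)
qed

lemma top_form_add:
  assumes \<tau>: "top_form \<tau>" and \<tau>': "top_form \<tau>'"
  shows "top_form (\<lambda>c y. \<tau> c y + \<tau>' c y)"
proof (rule top_formI)
  show "continuous_on W (\<lambda>y. \<tau> (W, \<psi>, F) y + \<tau>' (W, \<psi>, F) y)" if "(W, \<psi>, F) \<in> \<A>" for W \<psi> F
    by (rule continuous_on_add[OF top_form_cont[OF \<tau> that] top_form_cont[OF \<tau>' that]])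
  show "\<tau> (W, \<psi>, F) y + \<tau>' (W, \<psi>, F) y = det A * (\<tau> (W', \<psi>', F') y' + \<tau>' (W', \<psi>', F') y')"
    if "(W, \<psi>, F) \<in> \<A>" "(W', \<psi>', F') \<in> \<A>" "y \<in> W" "y' \<in> W'" "\<psi> y = \<psi>' y'"
      "\<And>v. fd F y v = fd F' y' (A *v v)" for W \<psi> F W' \<psi>' F' y y' A
    using top_formD[OF \<tau> that] top_formD[OF \<tau>' that] by (simp add: distrib_left)
qed

lemma top_form_0: "top_form (\<lambda>c y. 0)"
  unfolding top_form_def by auto

lemma supported_mult1: "supported \<tau> C \<Longrightarrow> supported (form_mult u \<tau>) C"
  and supported_mult2: "(\<And>x. x \<notin> C \<Longrightarrow> u x = 0) \<Longrightarrow> supported (form_mult u \<tau>) C"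
  unfolding supported_def form_mult_def by auto

text \<open>The change of variables formula along the transition map, where positivity of the
  atlas removes the absolute value of the determinant. The supports confine both integrals
  to the overlap of the charts.\<close>

lemma integral_transfer:
  assumes \<tau>: "top_form \<tau>" and c: "(W, \<psi>, F) \<in> \<A>" and c': "(W', \<psi>', F') \<in> \<A>"
    and K: "compact K" "K \<subseteq> W" "supported \<tau> (\<psi> ` K)"
    and K': "compact K'" "K' \<subseteq> W'" "supported \<tau> (\<psi>' ` K')"
  shows "integral W (\<tau> (W, \<psi>, F)) = integral W' (\<tau> (W', \<psi>', F'))"
proof -
  define N where "N = {y\<in>W. \<psi> y \<in> \<psi>' ` W'}"
  define \<kappa> where "\<kappa> = transition \<psi> W' \<psi>'"
  note tr = transition_map[OF chart[OF c] chart[OF c'] sep, folded \<kappa>_def, folded N_def]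
  have NW: "N \<subseteq> W" by (auto simp: N_def)
  let ?t = "\<tau> (W, \<psi>, F)" and ?t' = "\<tau> (W', \<psi>', F')"
  have cont': "continuous_on W' ?t'" using \<tau> c' by (auto simp: top_form_def)
  have inj': "inj_on \<psi>' W'" by (rule C1_chart_inj[OF chart[OF c']])
  have z': "?t' y = 0" if "y \<in> W'" "y \<notin> K'" for y
  proof -
    have "\<psi>' y \<notin> \<psi>' ` K'" using inj' K'(2) that by (auto dest: inj_onD)
    then show ?thesis using K'(3) c' that(1) unfolding supported_def by blast
  qed
  have ai: "?t' absolutely_integrable_on (\<kappa> ` N)"
  proof (rule set_integrable_subset[OF absolutely_integrable_compact_support[OF chart_open[OF c'] cont' K'(1,2) z']])
    have "open (\<kappa> ` N)"
      unfolding tr(3) using C1_chart_open_vimage[OF chart[OF c']] chart[OF c] by (auto simp: C1_chart_def)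
    then show "\<kappa> ` N \<in> sets lebesgue" by simp
    show "\<kappa> ` N \<subseteq> W'" using tr(4) by blast
  qed
  have eq: "\<bar>det (matrix (fd \<kappa> y))\<bar> * ?t' (\<kappa> y) = ?t y" if y: "y \<in> N" for y
  proof -
    have lin: "linear (fd \<kappa> y)" using C1_onD[OF tr(6) y] by (rule has_derivative_linear)
    have yW: "y \<in> W" "\<kappa> y \<in> W'" "\<psi> y = \<psi>' (\<kappa> y)" using NW y tr(4,5)[OF y] by auto
    obtain A :: "real^'m^'m" where A: "det A > 0" "\<And>v. fd F y v = fd F' (\<kappa> y) (A *v v)"
      using positive[OF c c' yW] by blast
    have "inj (fd F' (\<kappa> y))" using chart[OF c'] yW by (auto simp: C1_chart_def)
    then have "fd \<kappa> y v = A *v v" for v using A(2) tr(7)[OF y] by (metis injD)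
    then have "matrix (fd \<kappa> y) = A" by (metis ext matrix_of_matrix_vector_mul)
    moreover have "?t y = det A * ?t' (\<kappa> y)"
      using \<tau> c c' yW A(2) unfolding top_form_def by blast
    ultimately show ?thesis using A(1) by simp
  qed
  have "integral W ?t = integral N ?t"
  proof (rule integral_eq_subset[OF NW])
    fix y assume "y \<in> W" "y \<notin> N"
    then have "\<psi> y \<notin> \<psi>' ` K'" using K'(2) by (auto simp: N_def)
    then show "?t y = 0" using K'(3) c \<open>y \<in> W\<close> unfolding supported_def by blast
  qed
  also have "\<dots> = integral N (\<lambda>y. \<bar>det (matrix (fd \<kappa> y))\<bar> * ?t' (\<kappa> y))"
    by (rule Henstock_Kurzweil_Integration.integral_cong) (simp add: eq)
  also have "\<dots> = integral (\<kappa> ` N) ?t'"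
  proof (rule change_of_variables_finite(2)[OF _ _ tr(2) ai])
    show "N \<in> sets lebesgue" using tr(1) by simp
    show "(\<kappa> has_derivative fd \<kappa> y) (at y within N)" if "y \<in> N" for y
      using C1_onD[OF tr(6) that] by (rule has_derivative_at_withinI)
  qed
  also have "\<dots> = integral W' ?t'"
  proof (rule integral_eq_subset[symmetric])
    show "\<kappa> ` N \<subseteq> W'" using tr(4) by blast
    fix z assume z: "z \<in> W'" "z \<notin> \<kappa> ` N"
    then have "\<psi>' z \<notin> \<psi> ` K" using K(2) unfolding tr(3) by auto
    then show "?t' z = 0" using K(3) c' z(1) unfolding supported_def by blast
  qed
  finally show ?thesis .
qed

text \<open>In any other chart the extension is continuously differentiable near the chart
  \<open>\<psi>\<close>, because the transition map is, and it vanishes on the complement of \<open>\<psi> `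
  K\<close>, which is open since \<open>T\<close> is a Hausdorff space.\<close>

lemma C1_fun_extension:
  assumes c: "(W, \<psi>, F) \<in> \<A>" and K: "compact K" "K \<subseteq> W"
    and b: "C1_on W b" "\<And>y. y \<in> W \<Longrightarrow> y \<notin> K \<Longrightarrow> b y = 0"
  shows "C1_fun (\<lambda>x. if x \<in> \<psi> ` W then b (inv_into W \<psi> x) else 0)"
  unfolding C1_fun_def
proof (intro allI impI)
  fix W' \<psi>' F' assume c': "(W', \<psi>', F') \<in> \<A>"
  let ?u = "\<lambda>x. if x \<in> \<psi> ` W then b (inv_into W \<psi> x) else 0"
  define N where "N = {y\<in>W'. \<psi>' y \<in> \<psi> ` W}"
  define \<kappa> where "\<kappa> = transition \<psi>' W \<psi>"
  note tr = transition_map[OF chart[OF c'] chart[OF c] sep, folded \<kappa>_def, folded N_def]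
  have "C1_on N (\<lambda>y. b (\<kappa> y))" by (rule C1_on_compose[OF tr(6) b(1)]) (use tr(4) in blast)
  then have 1: "C1_on N (\<lambda>y. ?u (\<psi>' y))"
    by (rule C1_on_cong[OF _ tr(1)]) (simp add: N_def \<kappa>_def transition_def)
  define N' where "N' = {y\<in>W'. \<psi>' y \<in> topspace T - \<psi> ` K}"
  have cK: "compactin T (\<psi> ` K)" by (rule C1_chart_compactin_image[OF chart[OF c] K])
  then have "closedin T (\<psi> ` K)" by (rule compactin_imp_closedin[OF haus])
  then have "openin T (topspace T - \<psi> ` K)" by (rule openin_diff[OF openin_topspace])
  then have oN': "open N'" unfolding N'_def by (rule C1_chart_open_vimage[OF chart[OF c']])
  have 2: "C1_on N' (\<lambda>y. ?u (\<psi>' y))"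
  proof (rule C1_on_cong[OF C1_on_const[of _ 0] oN'])
    fix y assume y: "y \<in> N'"
    have "b (inv_into W \<psi> (\<psi>' y)) = 0" if "\<psi>' y \<in> \<psi> ` W"
    proof (rule b(2))
      show "inv_into W \<psi> (\<psi>' y) \<in> W" using that by (rule inv_into_into)
      show "inv_into W \<psi> (\<psi>' y) \<notin> K"
        using y f_inv_into_f[OF that] unfolding N'_def by (metis (no_types, lifting) DiffE image_eqI mem_Collect_eq)
    qed
    then show "0 = ?u (\<psi>' y)" by simp
  qed
  show "C1_on W' (\<lambda>y. ?u (\<psi>' y))"
  proof (rule C1_on_open_cover)
    fix y assume y: "y \<in> W'"
    have "\<psi>' y \<in> topspace T" by (rule C1_chart_in_topspace[OF chart[OF c'] y])
    then have "y \<in> N \<or> y \<in> N'" using y K(2) unfolding N_def N'_def by auto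
    then show "\<exists>U. open U \<and> y \<in> U \<and> C1_on U (\<lambda>y. ?u (\<psi>' y))"
      using 1 2 tr(1) oN' by blast
  qed
qed

text \<open>The margin between \<open>r\<close> and \<open>R\<close> leaves room for a cut-off function which is 1 near the
  support of \<open>u\<close>.\<close>

definition bump_on :: "('m, 'v, 'e) lchart \<Rightarrow> real^'m \<Rightarrow> real \<Rightarrow> ('v \<Rightarrow> real) \<Rightarrow> bool" where
  "bump_on c a r u \<longleftrightarrow> c \<in> \<A> \<and> 0 < r \<and> (\<exists>R>r. cball a R \<subseteq> fst c) \<and> C1_fun u \<and>
     (\<forall>x. 0 \<le> u x) \<and> (\<forall>x. x \<notin> fst (snd c) ` cball a r \<longrightarrow> u x = 0)"

text \<open>A finite partition of unity on \<open>C\<close>. It is a list, as repetitions are harmless and sums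
  over lists need no injectivity.\<close>

definition subordinate :: "('m, 'v, 'e) bump list \<Rightarrow> 'v set \<Rightarrow> bool" where
  "subordinate ps C \<longleftrightarrow> (\<forall>(c, a, r, u)\<in>set ps. bump_on c a r u) \<and>
     (\<forall>x\<in>C. (\<Sum>(c, a, r, u)\<leftarrow>ps. u x) = 1)"

lemma C1_fun_mult: "C1_fun u \<Longrightarrow> C1_fun w \<Longrightarrow> C1_fun (\<lambda>x. u x * w x)"
  unfolding C1_fun_def by (intro allI impI C1_on_mult) blast+

lemma C1_fun_one_minus: "C1_fun u \<Longrightarrow> C1_fun (\<lambda>x. 1 - u x)"
  unfolding C1_fun_def by (intro allI impI C1_on_diff C1_on_const) blast+

lemma ex_bump:
  assumes x: "x \<in> topspace T"
  shows "\<exists>c a r u V. bump_on c a r u \<and> openin T V \<and> x \<in> V \<and> (\<forall>x. u x \<le> 1) \<and> (\<forall>x\<in>V. u x = 1)"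
proof -
  obtain W \<psi> F a where c: "(W, \<psi>, F) \<in> \<A>" and a: "a \<in> W" "x = \<psi> a" using cover[OF x] by blast
  obtain e where e: "e > 0" "cball a e \<subseteq> W"
    using a chart_open[OF c] open_contains_cball by metis
  obtain \<beta> :: "real^'m \<Rightarrow> real" where \<beta>: "C1_on UNIV \<beta>" "\<And>y. 0 \<le> \<beta> y" "\<And>y. \<beta> y \<le> 1"
    "\<And>y. y \<in> cball a (e/4) \<Longrightarrow> \<beta> y = 1" "\<And>y. y \<notin> ball a (e/2) \<Longrightarrow> \<beta> y = 0"
    using ex_C1_plateau[of "e/4" "e/2" a] e(1) by auto
  define u where "u = (\<lambda>x. if x \<in> \<psi> ` W then \<beta> (inv_into W \<psi> x) else 0)"
  have "C1_fun u" unfolding u_def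
  proof (rule C1_fun_extension[OF c compact_cball])
    show "cball a (e/2) \<subseteq> W" using e by (auto simp: subset_iff)
    show "C1_on W \<beta>" by (rule C1_on_subset[OF \<beta>(1)]) simp
    show "\<beta> y = 0" if "y \<notin> cball a (e/2)" for y
      using \<beta>(5)[of y] that by (metis ball_subset_cball subsetD)
  qed
  moreover have "u x = 0" if "x \<notin> \<psi> ` cball a (e/2)" for x
  proof (cases "x \<in> \<psi> ` W")
    case True
    then have "inv_into W \<psi> x \<notin> ball a (e/2)" using that f_inv_into_f[OF True]
      by (metis ball_subset_cball image_eqI subsetD)
    then show ?thesis by (simp add: u_def \<beta>(5))
  qed (simp add: u_def)
  ultimately have "bump_on (W, \<psi>, F) a (e/2) u"
    unfolding bump_on_def using c e \<beta>(2) by (auto simp: u_def intro!: exI[of _ e])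
  moreover have "openin T (\<psi> ` ball a (e/4))"
  proof -
    have "homeomorphic_map (top_of_set W) (subtopology T (\<psi> ` W)) \<psi>"
      using chart[OF c] by (simp add: C1_chart_def embedding_map_def)
    then have "open_map (top_of_set W) (subtopology T (\<psi> ` W)) \<psi>"
      by (rule homeomorphic_imp_open_map)
    moreover have "openin (top_of_set W) (ball a (e/4))"
      using e by (auto simp: openin_open_eq chart_open[OF c] subset_iff)
    ultimately have "openin (subtopology T (\<psi> ` W)) (\<psi> ` ball a (e/4))"
      unfolding open_map_def by blast
    then show ?thesis
      using chart[OF c] by (metis C1_chart_def openin_trans_full)
  qed
  moreover have "u z = 1" if z: "z \<in> \<psi> ` ball a (e/4)" for z
  proof -
    obtain y where y: "y \<in> ball a (e/4)" "z = \<psi> y" using z by blast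
    then have "y \<in> W" using e by (auto simp: subset_iff)
    then have "u z = \<beta> y" using y(2) C1_chart_inj[OF chart[OF c]] by (simp add: u_def)
    then show ?thesis using y \<beta>(4) by simp
  qed
  moreover have "u x \<le> 1" for x by (simp add: u_def \<beta>(3))
  moreover have "x \<in> \<psi> ` ball a (e/4)" using a e(1) by auto
  ultimately show ?thesis by blast
qed

text \<open>From finitely many bumps \<open>u\<close>, each equal to 1 on its open set of a finite cover, the
  partition is built by the recursion \<open>s \<mapsto> u + s (1 - u)\<close>, which keeps the sum \<open>s\<close>
  at most 1.\<close>

lemma ex_subordinate:
  assumes C: "compactin T C"
  shows "\<exists>ps. subordinate ps C"
proof -
  define good where "good = (\<lambda>u V. openin T V \<and> (\<exists>c a r. bump_on c a r u) \<and> (\<forall>x. u x \<le> 1) \<and> (\<forall>x\<in>V. u x = 1))"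
  have CT: "C \<subseteq> topspace T" using C by (rule compactin_subset_topspace)
  have "\<forall>x\<in>topspace T. \<exists>V u. good u V \<and> x \<in> V" unfolding good_def using ex_bump by metis
  then have "C \<subseteq> \<Union>{V. \<exists>u. good u V}" using CT by blast
  moreover have "openin T V" if "V \<in> {V. \<exists>u. good u V}" for V using that unfolding good_def by blast
  ultimately obtain \<F> where \<F>: "finite \<F>" "\<F> \<subseteq> {V. \<exists>u. good u V}" "C \<subseteq> \<Union>\<F>"
    using compactinD[OF C, of "{V. \<exists>u. good u V}"] by blast
  have "\<exists>ps. (\<forall>(c, a, r, u)\<in>set ps. bump_on c a r u) \<and>
     (\<forall>x. (\<Sum>(c, a, r, u)\<leftarrow>ps. u x) \<le> 1) \<and> (\<forall>x\<in>\<Union>\<F>. (\<Sum>(c, a, r, u)\<leftarrow>ps. u x) = 1)"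
    using \<F>(1,2)
  proof (induction \<F> rule: finite_induct)
    case empty
    show ?case by (rule exI[of _ "[]"]) auto
  next
    case (insert V \<F>)
    obtain ps where ps': "\<forall>(c, a, r, u)\<in>set ps. bump_on c a r u"
      "\<forall>x. (\<Sum>(c, a, r, u)\<leftarrow>ps. u x) \<le> 1" "\<forall>x\<in>\<Union>\<F>. (\<Sum>(c, a, r, u)\<leftarrow>ps. u x) = 1"
      using insert.IH[OF subset_trans[OF subset_insertI insert.prems]] by (elim exE conjE)
    have ps: "bump_on c a r u" if "(c, a, r, u) \<in> set ps" for c a r u
      using bspec[OF ps'(1) that] by simp
    obtain u c a r where u: "bump_on c a r u" "\<And>x. u x \<le> 1" "\<And>x. x\<in>V \<Longrightarrow> u x = 1"
    proof -
      have "\<exists>u. good u V" using insert.prems by simp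
      then obtain u where gu: "good u V" by (rule exE)
      then obtain c a r where "bump_on c a r u" unfolding good_def by (elim conjE exE)
      then show ?thesis using gu that unfolding good_def by metis
    qed
    let ?h = "\<lambda>(c, a, r, w). (c, a, r, \<lambda>x. w x * (1 - u x))"
    have sum: "(\<Sum>(c, a, r, w)\<leftarrow>(c, a, r, u) # map ?h ps. w x) = u x + (\<Sum>(c, a, r, w)\<leftarrow>ps. w x) * (1 - u x)" for x
    proof -
      have "(\<Sum>(c, a, r, w)\<leftarrow>map ?h ps. w x) = (\<Sum>(c, a, r, w)\<leftarrow>ps. w x) * (1 - u x)"
        by (induction ps) (auto simp: algebra_simps)
      then show ?thesis by simp
    qed
    show ?case
    proof (intro exI[of _ "(c, a, r, u) # map ?h ps"] conjI)
      show "\<forall>(c, a, r, u)\<in>set ((c, a, r, u) # map ?h ps). bump_on c a r u"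
      proof -
        have "bump_on c' a' r' (\<lambda>x. w x * (1 - u x))" if "(c', a', r', w) \<in> set ps" for c' a' r' w
          using ps[OF that] u(1,2) unfolding bump_on_def
          by (auto intro!: C1_fun_mult C1_fun_one_minus)
        then show ?thesis using u(1) by auto
      qed
      show "\<forall>x. (\<Sum>(c, a, r, w)\<leftarrow>(c, a, r, u) # map ?h ps. w x) \<le> 1"
        unfolding sum
      proof
        fix x
        have "(\<Sum>(c, a, r, w)\<leftarrow>ps. w x) * (1 - u x) \<le> 1 * (1 - u x)"
          using ps'(2) u(2) by (intro mult_right_mono) auto
        then show "u x + (\<Sum>(c, a, r, w)\<leftarrow>ps. w x) * (1 - u x) \<le> 1" by simp
      qed
      show "\<forall>x\<in>\<Union>(insert V \<F>). (\<Sum>(c, a, r, w)\<leftarrow>(c, a, r, u) # map ?h ps. w x) = 1"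
        unfolding sum using ps'(3) u(3) by auto
    qed
  qed
  then show ?thesis using \<F>(3) unfolding subordinate_def by blast
qed

lemma subordinate_mono: "subordinate ps C \<Longrightarrow> D \<subseteq> C \<Longrightarrow> subordinate ps D"
  unfolding subordinate_def by auto

text \<open>The independence of the partition of unity is part of the definition, so that
  additivity only needs the union of two compact sets; it is established for compactly
  supported forms in \<open>has_form_integral_chart\<close> and \<open>has_form_integral_partition\<close>.\<close>

definition has_form_integral :: "('m, 'v, 'e) form \<Rightarrow> real \<Rightarrow> bool" where
  "has_form_integral \<tau> s \<longleftrightarrow> (\<exists>C. compactin T C \<and> (\<forall>ps. subordinate ps C \<longrightarrow>
     (\<Sum>(c, a, r, u)\<leftarrow>ps. integral (fst c) (form_mult u \<tau> c)) = s))"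

lemma has_form_integralE:
  assumes "has_form_integral \<tau> s"
  obtains C where "compactin T C"
    "\<And>ps. subordinate ps C \<Longrightarrow> (\<Sum>(c, a, r, u)\<leftarrow>ps. integral (fst c) (form_mult u \<tau> c)) = s"
  using assms unfolding has_form_integral_def by blast

lemma has_form_integral_unique:
  assumes "has_form_integral \<tau> s" "has_form_integral \<tau>' s'"
    and eq: "\<And>W \<psi> F y. (W, \<psi>, F) \<in> \<A> \<Longrightarrow> y \<in> W \<Longrightarrow> \<tau> (W, \<psi>, F) y = \<tau>' (W, \<psi>, F) y"
  shows "s = s'"
proof -
  obtain C where C: "compactin T C" "\<And>ps. subordinate ps C \<Longrightarrow> (\<Sum>(c, a, r, u)\<leftarrow>ps. integral (fst c) (form_mult u \<tau> c)) = s"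
    using has_form_integralE[OF assms(1)] by blast
  obtain C' where C': "compactin T C'" "\<And>ps. subordinate ps C' \<Longrightarrow> (\<Sum>(c, a, r, u)\<leftarrow>ps. integral (fst c) (form_mult u \<tau>' c)) = s'"
    using has_form_integralE[OF assms(2)] by blast
  obtain ps where ps: "subordinate ps (C \<union> C')" using ex_subordinate[OF compactin_Un[OF C(1) C'(1)]] by blast
  have "integral (fst c) (form_mult u \<tau> c) = integral (fst c) (form_mult u \<tau>' c)" if "(c, a, r, u) \<in> set ps" for c a r u
  proof (rule Henstock_Kurzweil_Integration.integral_cong)
    fix y assume y: "y \<in> fst c"
    obtain W \<psi> F where c: "c = (W, \<psi>, F)" by (cases c)
    have "c \<in> \<A>" using ps that unfolding subordinate_def bump_on_def by fastforce
    then show "form_mult u \<tau> c y = form_mult u \<tau>' c y"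
      using eq y unfolding c form_mult_def by simp
  qed
  then have "(\<Sum>(c, a, r, u)\<leftarrow>ps. integral (fst c) (form_mult u \<tau> c)) = (\<Sum>(c, a, r, u)\<leftarrow>ps. integral (fst c) (form_mult u \<tau>' c))"
    by (intro arg_cong[where f=sum_list] map_cong refl) auto
  then show ?thesis
    using C(2)[OF subordinate_mono[OF ps]] C'(2)[OF subordinate_mono[OF ps]] by simp
qed

lemma bump_integrable:
  assumes "bump_on c a r u" "top_form \<tau>"
  shows "form_mult u \<tau> c absolutely_integrable_on fst c"
proof -
  obtain W \<psi> F where c: "c = (W, \<psi>, F)" by (cases c)
  have cA: "(W, \<psi>, F) \<in> \<A>" and sub: "cball a r \<subseteq> W" and u: "C1_fun u" "\<And>x. x \<notin> \<psi> ` cball a r \<Longrightarrow> u x = 0"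
    using assms(1) unfolding bump_on_def c by fastforce+
  have inj: "inj_on \<psi> W" by (rule C1_chart_inj[OF chart[OF cA]])
  have "form_mult u \<tau> (W, \<psi>, F) absolutely_integrable_on W"
  proof (rule absolutely_integrable_compact_support[OF chart_open[OF cA] _ _ sub])
    show "continuous_on W (form_mult u \<tau> (W, \<psi>, F))"
      using top_form_mult[OF assms(2) u(1)] cA unfolding top_form_def by blast
    fix y assume "y \<in> W" "y \<notin> cball a r"
    then have "\<psi> y \<notin> \<psi> ` cball a r" using inj sub by (auto dest: inj_onD)
    then show "form_mult u \<tau> (W, \<psi>, F) y = 0" using u(2) by (simp add: form_mult_def)
  qed simp
  then show ?thesis by (simp add: c)
qed

lemma has_form_integral_add:
  assumes "has_form_integral \<tau> s" "has_form_integral \<tau>' s'" "top_form \<tau>" "top_form \<tau>'"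
  shows "has_form_integral (\<lambda>c y. \<tau> c y + \<tau>' c y) (s + s')"
proof -
  obtain C where C: "compactin T C" "\<And>ps. subordinate ps C \<Longrightarrow> (\<Sum>(c, a, r, u)\<leftarrow>ps. integral (fst c) (form_mult u \<tau> c)) = s"
    using has_form_integralE[OF assms(1)] by blast
  obtain C' where C': "compactin T C'" "\<And>ps. subordinate ps C' \<Longrightarrow> (\<Sum>(c, a, r, u)\<leftarrow>ps. integral (fst c) (form_mult u \<tau>' c)) = s'"
    using has_form_integralE[OF assms(2)] by blast
  have "(\<Sum>(c, a, r, u)\<leftarrow>ps. integral (fst c) (form_mult u (\<lambda>c y. \<tau> c y + \<tau>' c y) c)) = s + s'"
    if ps: "subordinate ps (C \<union> C')" for ps
  proof -
    have *: "(case p of (c, a, r, u) \<Rightarrow> integral (fst c) (form_mult u (\<lambda>c y. \<tau> c y + \<tau>' c y) c)) =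
        (case p of (c, a, r, u) \<Rightarrow> integral (fst c) (form_mult u \<tau> c)) + (case p of (c, a, r, u) \<Rightarrow> integral (fst c) (form_mult u \<tau>' c))"
      if "p \<in> set ps" for p
    proof -
      obtain c a r u where p: "p = (c, a, r, u)" by (cases p)
      have b: "bump_on c a r u" using ps that unfolding subordinate_def p by blast
      have "form_mult u (\<lambda>c y. \<tau> c y + \<tau>' c y) c = (\<lambda>y. form_mult u \<tau> c y + form_mult u \<tau>' c y)"
        by (cases c) (auto simp: form_mult_def distrib_left)
      then show ?thesis unfolding p
        using bump_integrable[OF b assms(3)] bump_integrable[OF b assms(4)]
        by (simp add: Henstock_Kurzweil_Integration.integral_add set_lebesgue_integral_eq_integral(1))
    qed
    have "(\<Sum>(c, a, r, u)\<leftarrow>ps. integral (fst c) (form_mult u (\<lambda>c y. \<tau> c y + \<tau>' c y) c)) =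
      (\<Sum>(c, a, r, u)\<leftarrow>ps. integral (fst c) (form_mult u \<tau> c)) + (\<Sum>(c, a, r, u)\<leftarrow>ps. integral (fst c) (form_mult u \<tau>' c))"
      unfolding sum_list_addf[symmetric] by (intro arg_cong[where f=sum_list] map_cong refl *)
    then show ?thesis
      using C(2)[OF subordinate_mono[OF ps]] C'(2)[OF subordinate_mono[OF ps]] by simp
  qed
  then show ?thesis unfolding has_form_integral_def using compactin_Un[OF C(1) C'(1)] by blast
qed

lemma has_form_integral_0: "has_form_integral (\<lambda>c y. 0) 0"
proof -
  have z: "form_mult u (\<lambda>c y. 0) = (\<lambda>c y. 0)" for u :: "'v \<Rightarrow> real"
    by (auto simp: form_mult_def fun_eq_iff)
  have "(\<Sum>(c, a, r, u)\<leftarrow>ps. integral (fst c) (form_mult u (\<lambda>c y. 0) c)) = 0" for ps :: "('m, 'v, 'e) bump list"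
    by (induction ps) (auto simp: z)
  then show ?thesis unfolding has_form_integral_def using compactin_empty by blast
qed

lemma has_form_integral_cong:
  assumes "has_form_integral \<tau> s"
    and eq: "\<And>W \<psi> F y. (W, \<psi>, F) \<in> \<A> \<Longrightarrow> y \<in> W \<Longrightarrow> \<tau> (W, \<psi>, F) y = \<tau>' (W, \<psi>, F) y"
  shows "has_form_integral \<tau>' s"
proof -
  obtain C where C: "compactin T C" "\<And>ps. subordinate ps C \<Longrightarrow> (\<Sum>(c, a, r, u)\<leftarrow>ps. integral (fst c) (form_mult u \<tau> c)) = s"
    using has_form_integralE[OF assms(1)] by blast
  have "(\<Sum>(c, a, r, u)\<leftarrow>ps. integral (fst c) (form_mult u \<tau>' c)) = s" if ps: "subordinate ps C" for ps
  proof -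
    have "integral (fst c) (form_mult u \<tau> c) = integral (fst c) (form_mult u \<tau>' c)" if "(c, a, r, u) \<in> set ps" for c a r u
    proof (rule Henstock_Kurzweil_Integration.integral_cong)
      fix y assume y: "y \<in> fst c"
      obtain W \<psi> F where c: "c = (W, \<psi>, F)" by (cases c)
      have "c \<in> \<A>" using ps that unfolding subordinate_def bump_on_def by fastforce
      then show "form_mult u \<tau> c y = form_mult u \<tau>' c y"
        using eq y unfolding c form_mult_def by simp
    qed
    then have "(\<Sum>(c, a, r, u)\<leftarrow>ps. integral (fst c) (form_mult u \<tau> c)) = (\<Sum>(c, a, r, u)\<leftarrow>ps. integral (fst c) (form_mult u \<tau>' c))"
      by (intro arg_cong[where f=sum_list] map_cong refl) auto
    then show ?thesis using C(2)[OF ps] by simp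
  qed
  then show ?thesis unfolding has_form_integral_def using C(1) by blast
qed

text \<open>Every summand can be computed in the given chart, and there the functions of the
  partition add up to 1 on the support.\<close>

lemma has_form_integral_chart:
  assumes \<tau>: "top_form \<tau>" and c: "(W, \<psi>, F) \<in> \<A>" and K: "compact K" "K \<subseteq> W" "supported \<tau> (\<psi> ` K)"
  shows "has_form_integral \<tau> (integral W (\<tau> (W, \<psi>, F)))"
proof -
  have cK: "compactin T (\<psi> ` K)" by (rule C1_chart_compactin_image[OF chart[OF c] K(1,2)])
  have inj: "inj_on \<psi> W" by (rule C1_chart_inj[OF chart[OF c]])
  have "(\<Sum>(c, a, r, u)\<leftarrow>ps. integral (fst c) (form_mult u \<tau> c)) = integral W (\<tau> (W, \<psi>, F))"
    if ps: "subordinate ps (\<psi> ` K)" for ps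
  proof -
    have step: "integral (fst c') (form_mult u \<tau> c') = integral W (form_mult u \<tau> (W, \<psi>, F))
        \<and> form_mult u \<tau> (W, \<psi>, F) integrable_on W"
      if "(c', a, r, u) \<in> set ps" for c' a r u
    proof -
      obtain W' \<psi>' F' where c': "c' = (W', \<psi>', F')" by (cases c')
      have b: "bump_on c' a r u" using ps that unfolding subordinate_def by blast
      then have cA: "(W', \<psi>', F') \<in> \<A>" and sub: "cball a r \<subseteq> W'" and u: "C1_fun u" "\<And>x. x \<notin> \<psi>' ` cball a r \<Longrightarrow> u x = 0"
        unfolding bump_on_def c' by fastforce+
      have tf: "top_form (form_mult u \<tau>)" by (rule top_form_mult[OF \<tau> u(1)])
      have sK: "supported (form_mult u \<tau>) (\<psi> ` K)" by (rule supported_mult1[OF K(3)])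
      have "integral W' (form_mult u \<tau> (W', \<psi>', F')) = integral W (form_mult u \<tau> (W, \<psi>, F))"
        by (rule integral_transfer[OF tf cA c _ sub supported_mult2[OF u(2)] K(1,2) sK]) auto
      moreover have "form_mult u \<tau> (W, \<psi>, F) absolutely_integrable_on W"
      proof (rule absolutely_integrable_compact_support[OF chart_open[OF c] _ K(1,2)])
        show "continuous_on W (form_mult u \<tau> (W, \<psi>, F))"
          using tf c unfolding top_form_def by blast
        fix y assume "y \<in> W" "y \<notin> K"
        moreover from this have "\<psi> y \<notin> \<psi> ` K" using inj K(2) by (auto dest: inj_onD)
        ultimately show "form_mult u \<tau> (W, \<psi>, F) y = 0" using sK c unfolding supported_def by blast
      qed
      ultimately show ?thesis by (simp add: c' set_lebesgue_integral_eq_integral(1))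
    qed
    have "(\<Sum>(c, a, r, u)\<leftarrow>qs. integral (fst c) (form_mult u \<tau> c)) =
        integral W (\<lambda>y. (\<Sum>(c, a, r, u)\<leftarrow>qs. u (\<psi> y)) * \<tau> (W, \<psi>, F) y)
        \<and> (\<lambda>y. (\<Sum>(c, a, r, u)\<leftarrow>qs. u (\<psi> y)) * \<tau> (W, \<psi>, F) y) integrable_on W"
      if "set qs \<subseteq> set ps" for qs
      using that
    proof (induction qs)
      case Nil
      then show ?case by (simp add: integrable_0)
    next
      case (Cons q qs)
      obtain c' a r u where q: "q = (c', a, r, u)" by (cases q)
      have "(c', a, r, u) \<in> set ps" using Cons.prems q by simp
      note st = step[OF this]
      have eq: "(\<lambda>y. (\<Sum>(c, a, r, u)\<leftarrow>q # qs. u (\<psi> y)) * \<tau> (W, \<psi>, F) y) =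
         (\<lambda>y. form_mult u \<tau> (W, \<psi>, F) y + (\<Sum>(c, a, r, u)\<leftarrow>qs. u (\<psi> y)) * \<tau> (W, \<psi>, F) y)"
        by (auto simp: q form_mult_def distrib_right)
      show ?case
        unfolding eq using st Cons
        by (simp add: q Henstock_Kurzweil_Integration.integral_add integrable_add)
    qed
    from this[OF subset_refl]
    have "(\<Sum>(c, a, r, u)\<leftarrow>ps. integral (fst c) (form_mult u \<tau> c)) =
        integral W (\<lambda>y. (\<Sum>(c, a, r, u)\<leftarrow>ps. u (\<psi> y)) * \<tau> (W, \<psi>, F) y)" by blast
    also have "\<dots> = integral W (\<tau> (W, \<psi>, F))"
    proof (rule Henstock_Kurzweil_Integration.integral_cong)
      fix y assume y: "y \<in> W"
      show "(\<Sum>(c, a, r, u)\<leftarrow>ps. u (\<psi> y)) * \<tau> (W, \<psi>, F) y = \<tau> (W, \<psi>, F) y"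
      proof (cases "\<psi> y \<in> \<psi> ` K")
        case True
        then have "(\<Sum>(c, a, r, u)\<leftarrow>ps. u (\<psi> y)) = 1" using ps unfolding subordinate_def by blast
        then show ?thesis by simp
      next
        case False
        then have "\<tau> (W, \<psi>, F) y = 0" using K(3) c y unfolding supported_def by blast
        then show ?thesis by simp
      qed
    qed
    finally show ?thesis .
  qed
  then show ?thesis unfolding has_form_integral_def using cK by blast
qed

lemma has_form_integral_sum_list:
  assumes "\<And>p. p \<in> set ps \<Longrightarrow> has_form_integral (\<rho> p) (s p)" "\<And>p. p \<in> set ps \<Longrightarrow> top_form (\<rho> p)"
  shows "has_form_integral (\<lambda>c y. \<Sum>p\<leftarrow>ps. \<rho> p c y) (\<Sum>p\<leftarrow>ps. s p) \<and> top_form (\<lambda>c y. \<Sum>p\<leftarrow>ps. \<rho> p c y)"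
  using assms
proof (induction ps)
  case Nil
  then show ?case using has_form_integral_0 top_form_0 by simp
next
  case (Cons p ps)
  then show ?case using has_form_integral_add[of "\<rho> p" "s p"] top_form_add by simp
qed

text \<open>A compactly supported form is a sum of forms supported in charts, so it has an
  integral, and the integral is computed by each single partition of unity.\<close>

lemma has_form_integral_partition:
  assumes \<tau>: "top_form \<tau>" "supported \<tau> C" and ps: "subordinate ps C"
  shows "has_form_integral \<tau> (\<Sum>(c, a, r, u)\<leftarrow>ps. integral (fst c) (form_mult u \<tau> c))"
proof -
  have "has_form_integral (\<lambda>c y. \<Sum>p\<leftarrow>ps. (case p of (c', a, r, u) \<Rightarrow> form_mult u \<tau>) c y)
      (\<Sum>p\<leftarrow>ps. case p of (c, a, r, u) \<Rightarrow> integral (fst c) (form_mult u \<tau> c))"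
  proof (rule has_form_integral_sum_list[THEN conjunct1])
    fix p assume p: "p \<in> set ps"
    obtain W \<psi> F a r u where pe: "p = ((W, \<psi>, F), a, r, u)" by (cases p) auto
    have "bump_on (W, \<psi>, F) a r u" using ps p unfolding subordinate_def pe by blast
    then have cA: "(W, \<psi>, F) \<in> \<A>" and sub: "cball a r \<subseteq> W" and u: "C1_fun u" "\<And>x. x \<notin> \<psi> ` cball a r \<Longrightarrow> u x = 0"
      unfolding bump_on_def by fastforce+
    show tf: "top_form (case p of (c', a, r, u) \<Rightarrow> form_mult u \<tau>)"
      using top_form_mult[OF \<tau>(1) u(1)] by (simp add: pe)
    show "has_form_integral (case p of (c', a, r, u) \<Rightarrow> form_mult u \<tau>)
       (case p of (c, a, r, u) \<Rightarrow> integral (fst c) (form_mult u \<tau> c))"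
      using has_form_integral_chart[OF top_form_mult[OF \<tau>(1) u(1)] cA compact_cball sub supported_mult2[OF u(2)]]
      by (simp add: pe)
  qed
  then show ?thesis
  proof (rule has_form_integral_cong)
    fix W \<psi> F y assume c: "(W, \<psi>, F) \<in> \<A>" "y \<in> W"
    have "(\<Sum>p\<leftarrow>qs. (case p of (c', a, r, u) \<Rightarrow> form_mult u \<tau>) (W, \<psi>, F) y) = (\<Sum>(c, a, r, u)\<leftarrow>qs. u (\<psi> y)) * \<tau> (W, \<psi>, F) y"
      for qs :: "('m, 'v, 'e) bump list" by (induction qs) (auto simp: form_mult_def algebra_simps)
    moreover have "(\<Sum>(c, a, r, u)\<leftarrow>ps. u (\<psi> y)) * \<tau> (W, \<psi>, F) y = \<tau> (W, \<psi>, F) y"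
      using ps \<tau>(2) c unfolding subordinate_def supported_def by (cases "\<psi> y \<in> C") auto
    ultimately show "(\<Sum>p\<leftarrow>ps. (case p of (c', a, r, u) \<Rightarrow> form_mult u \<tau>) (W, \<psi>, F) y) = \<tau> (W, \<psi>, F) y" by simp
  qed
qed

end

section \<open>Stokes' theorem\<close>

lemma fdI: "(f has_derivative f') (at x) \<Longrightarrow> fd f x = f'"
  by (rule frechet_derivative_at[symmetric])

lemma continuous_on_det_matrix:
  fixes L :: "'a::topological_space \<Rightarrow> real^'m::finite \<Rightarrow> real^'m"
  assumes "\<And>i v. continuous_on S (\<lambda>y. L y v $ i)"
  shows "continuous_on S (\<lambda>y. det (matrix (L y)))"
  unfolding det_def matrix_def by (simp, intro continuous_intros assms)

text \<open>A segment from a point of the ball to a point outside meets the sphere, where \<open>g\<close>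
  vanishes.\<close>

lemma lipschitz_extend_by_zero:
  fixes g :: "'a::euclidean_space \<Rightarrow> 'b::real_normed_vector"
  assumes L: "L-lipschitz_on (cball a r) g" and z: "\<And>x. x \<in> sphere a r \<Longrightarrow> g x = 0"
  shows "L-lipschitz_on UNIV (\<lambda>x. if x \<in> cball a r then g x else 0)"
proof (rule lipschitz_onI)
  let ?g = "\<lambda>x. if x \<in> cball a r then g x else 0"
  show L0: "0 \<le> L" by (rule lipschitz_on_nonneg[OF L])
  have mixed: "dist (g x) 0 \<le> L * dist x y" if x: "x \<in> cball a r" and y: "y \<notin> cball a r" for x y
  proof -
    have "closed_segment x y \<inter> frontier (cball a r) \<noteq> {}"
      by (rule connected_Int_frontier) (use x y in auto)
    then obtain w where w: "w \<in> closed_segment x y" "w \<in> sphere a r"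
      unfolding frontier_cball by blast
    have "dist (g x) (g w) \<le> L * dist x w" by (rule lipschitz_onD[OF L x]) (use w(2) in auto)
    then have "dist (g x) 0 \<le> L * dist x w" using z[OF w(2)] by simp
    also have "\<dots> \<le> L * dist x y"
      using L0 w(1) by (intro mult_left_mono) (metis dist_commute dist_in_closed_segment(1), simp)
    finally show ?thesis .
  qed
  fix x y :: 'a
  show "dist (?g x) (?g y) \<le> L * dist x y"
    using mixed[of x y] mixed[of y x] lipschitz_onD[OF L, of x y] L0
    by (auto simp: dist_commute)
qed

lemma C1_on_lipschitz_cball:
  fixes g :: "'a::euclidean_space \<Rightarrow> 'b::euclidean_space"
  assumes g: "C1_on S g" and S: "cball a r \<subseteq> S"
  shows "\<exists>L. L-lipschitz_on (cball a r) g"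
proof -
  let ?n = "\<lambda>x. \<Sum>b\<in>Basis. norm (fd g x b)"
  have "continuous_on (cball a r) ?n"
    by (intro continuous_intros continuous_on_subset[OF C1_on_cont[OF g] S])
  then have "bounded (?n ` cball a r)" by (intro compact_imp_bounded compact_continuous_image) auto
  then obtain B where B: "\<And>x. x \<in> cball a r \<Longrightarrow> ?n x \<le> B"
    unfolding bounded_iff by (metis abs_le_D1 imageI real_norm_def)
  have "(max B 0)-lipschitz_on (cball a r) g"
  proof (rule bounded_derivative_imp_lipschitz[where f'="fd g"])
    fix x assume x: "x \<in> cball a r"
    have d: "(g has_derivative fd g x) (at x)" using C1_onD[OF g] x S by blast
    then show "(g has_derivative fd g x) (at x within cball a r)" by (rule has_derivative_at_withinI)
    show "onorm (fd g x) \<le> max B 0"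
    proof (rule onorm_le)
      fix v
      have lin: "linear (fd g x)" using d by (rule has_derivative_linear)
      have "fd g x v = (\<Sum>b\<in>Basis. (v \<bullet> b) *\<^sub>R fd g x b)"
        by (subst euclidean_representation[of v, symmetric])
           (simp add: linear_sum[OF lin] linear_scale[OF lin] del: euclidean_representation)
      also have "norm \<dots> \<le> (\<Sum>b\<in>Basis. norm v * norm (fd g x b))"
        by (rule sum_norm_le) (simp add: mult_right_mono Basis_le_norm)
      also have "\<dots> = ?n x * norm v" by (simp add: sum_distrib_left mult.commute)
      also have "\<dots> \<le> max B 0 * norm v"
        using B[OF x] by (intro mult_right_mono) (auto simp: le_max_iff_disj)
      finally show "norm (fd g x v) \<le> max B 0 * norm v" .
    qed
  qed auto
  then show ?thesis by blast
qed

text \<open>On the sphere of radius \<open>r + 1\<close> the function vanishes, so the bound on that ball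
  extends to the whole space.\<close>

lemma C1_on_compact_support_lipschitz:
  fixes H :: "'a::euclidean_space \<Rightarrow> 'b::euclidean_space"
  assumes H: "C1_on UNIV H" and supp: "\<And>x. x \<notin> cball a r \<Longrightarrow> H x = 0"
  shows "\<exists>L. L-lipschitz_on UNIV H"
proof -
  obtain L where "L-lipschitz_on (cball a (r + 1)) H"
    using C1_on_lipschitz_cball[OF H subset_UNIV] by blast
  then have l: "L-lipschitz_on UNIV (\<lambda>x. if x \<in> cball a (r + 1) then H x else 0)"
    by (rule lipschitz_extend_by_zero) (use supp in auto)
  have e: "(\<lambda>x. if x \<in> cball a (r + 1) then H x else 0) = H"
    using supp by (auto simp: fun_eq_iff)
  show ?thesis using l unfolding e by blast
qed

text \<open>The wedge product of the differentials of the components of \<open>A\<close>, with the \<open>k\<close>-th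
  factor replaced by \<open>du\<close>.\<close>

definition det_form :: "'m \<Rightarrow> ('e \<Rightarrow> real^'m) \<Rightarrow> ('v \<Rightarrow> real) \<Rightarrow> ('m::finite, 'v, 'e::euclidean_space) form" where
  "det_form k A u = (\<lambda>(W, \<psi>, F) y. det (matrix (\<lambda>v. \<chi> i.
     if i = k then fd (\<lambda>y. u (\<psi> y)) y v else A (fd F y v) $ i)))"

context oriented_atlas
begin

lemma transition_law:
  assumes c: "(W, \<psi>, F) \<in> \<A>" "(W', \<psi>', F') \<in> \<A>" and y: "y \<in> W" "y' \<in> W'" "\<psi> y = \<psi>' y'"
    and A: "\<And>v. fd F y v = fd F' y' (A *v v)" and u: "C1_fun u"
  shows "fd (\<lambda>y. u (\<psi> y)) y v = fd (\<lambda>y. u (\<psi>' y)) y' (A *v v)"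
proof -
  define N where "N = {y\<in>W. \<psi> y \<in> \<psi>' ` W'}"
  define \<kappa> where "\<kappa> = transition \<psi> W' \<psi>'"
  note tr = transition_map[OF chart[OF c(1)] chart[OF c(2)] sep, folded \<kappa>_def, folded N_def]
  have yN: "y \<in> N" using y by (auto simp: N_def)
  have ky: "\<kappa> y = y'"
    using C1_chart_inj[OF chart[OF c(2)]] y tr(4,5)[OF yN] by (metis inj_onD)
  have "inj (fd F' y')" using chart[OF c(2)] y by (auto simp: C1_chart_def)
  then have kv: "fd \<kappa> y v = A *v v" for v using A tr(7)[OF yN] ky by (metis injD)
  have "((\<lambda>y. u (\<psi>' (\<kappa> y))) has_derivative (\<lambda>v. fd (\<lambda>y. u (\<psi>' y)) y' (fd \<kappa> y v))) (at y)"
    using has_derivative_compose[OF C1_onD[OF tr(6) yN] C1_onD[OF C1_funD[OF u c(2)], of "\<kappa> y"]] ky y by simp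
  then have "((\<lambda>y. u (\<psi> y)) has_derivative (\<lambda>v. fd (\<lambda>y. u (\<psi>' y)) y' (fd \<kappa> y v))) (at y)"
    by (rule has_derivative_transform_within_open[OF _ tr(1) yN]) (simp add: tr(5))
  from fdI[OF this] show ?thesis using kv by simp
qed

lemma top_form_det_form:
  assumes A: "linear A" and u: "C1_fun u"
  shows "top_form (det_form k A u)"
proof (rule top_formI)
  fix W \<psi> F assume c: "(W, \<psi>, F) \<in> \<A>"
  have F: "C1_on W F" using chart[OF c] by (simp add: C1_chart_def)
  have cA: "continuous_on UNIV A" using A by (simp add: linear_continuous_on linear_conv_bounded_linear)
  have "continuous_on W (\<lambda>y. A (fd F y v) $ i)" for v i
    by (intro continuous_intros continuous_on_compose2[OF cA C1_on_cont[OF F]]) simp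
  then have "continuous_on W (\<lambda>y. if i = k then fd (\<lambda>y. u (\<psi> y)) y v else A (fd F y v) $ i)" for v i
    using C1_on_cont[OF C1_funD[OF u c]] by (cases "i = k") simp_all
  then show "continuous_on W (det_form k A u (W, \<psi>, F))"
    unfolding det_form_def split by (intro continuous_on_det_matrix) simp
next
  fix W \<psi> F W' \<psi>' F' y y' B
  assume c: "(W, \<psi>, F) \<in> \<A>" "(W', \<psi>', F') \<in> \<A>" and y: "y \<in> W" "y' \<in> W'" "\<psi> y = \<psi>' y'"
    and B: "\<And>v. fd F y v = fd F' y' (B *v v)"
  let ?L = "\<lambda>v. \<chi> i. if i = k then fd (\<lambda>y. u (\<psi>' y)) y' v else A (fd F' y' v) $ i"
  have l1: "linear (fd (\<lambda>y. u (\<psi>' y)) y')" using C1_onD[OF C1_funD[OF u c(2)] y(2)] by (rule has_derivative_linear)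
  have "C1_on W' F'" using chart[OF c(2)] by (simp add: C1_chart_def)
  then have l2: "linear (fd F' y')" using C1_onD y(2) has_derivative_linear by blast
  have linL: "linear ?L"
    by (rule linearI) (auto simp: vec_eq_iff linear_add[OF l1] linear_add[OF l2] linear_add[OF A]
        linear_scale[OF l1] linear_scale[OF l2] linear_scale[OF A])
  have "(\<lambda>v. \<chi> i. if i = k then fd (\<lambda>y. u (\<psi> y)) y v else A (fd F y v) $ i) = ?L \<circ> (\<lambda>v. B *v v)"
    by (auto simp: fun_eq_iff vec_eq_iff B transition_law[OF c y B u])
  then have "det_form k A u (W, \<psi>, F) y = det (matrix ?L ** matrix (\<lambda>v. B *v v))"
    unfolding det_form_def split by (simp add: matrix_compose linL matrix_vector_mul_linear)
  then show "det_form k A u (W, \<psi>, F) y = det B * det_form k A u (W', \<psi>', F') y'"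
    by (simp add: det_form_def det_mul mult.commute)
qed

text \<open>Outside the support of \<open>u\<close> the row of \<open>du\<close> vanishes, so multiplying the other
  components by a function \<open>\<beta>\<close> which is 1 near that support does not change the form;
  the result is the Jacobian determinant of a compactly supported map.\<close>

lemma chart_stokes:
  assumes A: "linear A" and u: "C1_fun u" and c: "(W, \<psi>, F) \<in> \<A>"
    and r: "0 < r" "r < R" "cball a R \<subseteq> W" and supp: "\<And>y. y \<in> W \<Longrightarrow> y \<notin> cball a r \<Longrightarrow> u (\<psi> y) = 0"
  shows "integral W (det_form k A u (W, \<psi>, F)) = 0"
    and "\<And>y. y \<in> W \<Longrightarrow> y \<notin> cball a r \<Longrightarrow> det_form k A u (W, \<psi>, F) y = 0"
proof -
  define r1 where "r1 = r + (R - r) / 3"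
  define R1 where "R1 = r + 2 * (R - r) / 3"
  have rr: "0 < r1" "r < r1" "r1 < R1" "R1 < R" using r by (auto simp: r1_def R1_def field_simps)
  obtain \<beta> :: "real^'m \<Rightarrow> real" where \<beta>: "C1_on UNIV \<beta>" "\<And>y. y \<in> cball a r1 \<Longrightarrow> \<beta> y = 1"
      "\<And>y. y \<notin> ball a R1 \<Longrightarrow> \<beta> y = 0"
    using ex_C1_plateau[OF rr(1,3), of a] by metis
  have oW: "open W" by (rule chart_open[OF c])
  have F: "C1_on W F" using chart[OF c] by (simp add: C1_chart_def)
  let ?w = "\<lambda>y. u (\<psi> y)"
  have w: "C1_on W ?w" by (rule C1_funD[OF u c])
  have fw: "fd ?w y = (\<lambda>v. 0)" if y: "y \<in> W" "y \<notin> cball a r" for y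
  proof -
    have "((\<lambda>y. 0) has_derivative (\<lambda>v. 0)) (at y)" by simp
    then have "(?w has_derivative (\<lambda>v. 0)) (at y)"
      by (rule has_derivative_transform_within_open[where s="W - cball a r"])
         (use y supp oW in \<open>auto intro: open_Diff\<close>)
    then show ?thesis by (rule fdI)
  qed
  show z: "det_form k A u (W, \<psi>, F) y = 0" if y: "y \<in> W" "y \<notin> cball a r" for y
    unfolding det_form_def split using fw[OF y]
    by (intro det_zero_row(1)[of k]) (auto simp: matrix_def row_def vec_eq_iff)
  define H where "H = (\<lambda>y. if y \<in> W then (\<chi> i. if i = k then ?w y else \<beta> y * A (F y) $ i) else 0)"
  have C1H: "C1_on UNIV H"
  proof (rule C1_on_open_cover)
    have 1: "C1_on W H"
    proof (rule C1_on_cong[OF C1_on_vec oW])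
      have "C1_on W (\<lambda>y. A (F y) $ i)" for i
        by (rule C1_on_compose[OF F C1_on_linear[of "\<lambda>x. A x $ i"]])
           (use A in \<open>auto simp: linear_iff\<close>)
      then show "C1_on W (\<lambda>y. if i = k then ?w y else \<beta> y * A (F y) $ i)" for i
        using w C1_on_mult[OF C1_on_subset[OF \<beta>(1) subset_UNIV]] by (cases "i = k") auto
    qed (simp add: H_def)
    have 2: "C1_on (- cball a R1) H"
    proof (rule C1_on_cong[OF C1_on_const[of _ 0]])
      fix y assume y: "y \<in> - cball a R1"
      then have "y \<notin> cball a r" "y \<notin> ball a R1" using rr by auto
      then show "0 = H y" unfolding H_def using supp \<beta>(3) by (auto simp: vec_eq_iff)
    qed auto
    fix y :: "real^'m"
    show "\<exists>U. open U \<and> y \<in> U \<and> C1_on U H"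
    proof (cases "y \<in> W")
      case True then show ?thesis using 1 oW by blast
    next
      case False
      then have "y \<notin> cball a R" using r(3) by blast
      then have "y \<in> - cball a R1" using rr by auto
      then show ?thesis using 2 by blast
    qed
  qed
  have suppH: "H y = 0" if "y \<notin> cball a R1" for y
  proof -
    have "y \<notin> cball a r" "y \<notin> ball a R1" using that rr by auto
    then show ?thesis unfolding H_def using supp \<beta>(3) by (auto simp: vec_eq_iff)
  qed
  obtain L where L: "L-lipschitz_on UNIV H" using C1_on_compact_support_lipschitz[OF C1H suppH] by blast
  have hi: "((\<lambda>x. det (matrix (fd H x))) has_integral 0) (cball a R1)"
    by (rule integral_det_compact_support[OF L negligible_empty _ suppH]) (use C1_onD[OF C1H] in auto)
  have eq: "det (matrix (fd H y)) = det_form k A u (W, \<psi>, F) y" if y: "y \<in> cball a R1" for y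
  proof (cases "y \<in> cball a r")
    case True
    then have yW: "y \<in> W" and yb: "y \<in> ball a r1" using r rr by auto
    have "((\<lambda>y. \<chi> i. if i = k then ?w y else A (F y) $ i) has_derivative
        (\<lambda>v. \<chi> i. if i = k then fd ?w y v else A (fd F y v) $ i)) (at y)"
      unfolding has_derivative_componentwise_within[of "\<lambda>y. \<chi> i. _ y i"]
    proof
      fix b :: "real^'m" assume "b \<in> Basis"
      then obtain i where b: "b = axis i 1" by (auto simp: Basis_vec_def)
      have "((\<lambda>y. A (F y) $ i) has_derivative (\<lambda>v. A (fd F y v) $ i)) (at y)"
        using bounded_linear.has_derivative[OF bounded_linear_vec_nth has_derivative_compose[OF C1_onD[OF F yW] linear_imp_has_derivative[OF A]]] .
      then show "((\<lambda>x. (\<chi> i. if i = k then ?w x else A (F x) $ i) \<bullet> b) has_derivative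
          (\<lambda>x. (\<chi> i. if i = k then fd ?w y x else A (fd F y x) $ i) \<bullet> b)) (at y)"
        using C1_onD[OF w yW] by (cases "i = k") (simp_all add: b inner_axis)
    qed
    then have "(H has_derivative (\<lambda>v. \<chi> i. if i = k then fd ?w y v else A (fd F y v) $ i)) (at y)"
    proof (rule has_derivative_transform_within_open[where s="ball a r1"])
      fix z assume "z \<in> ball a r1"
      then have "z \<in> W" "\<beta> z = 1" using r rr \<beta>(2)[of z] by auto
      then show "(\<chi> i. if i = k then ?w z else A (F z) $ i) = H z" by (simp add: H_def vec_eq_iff)
    qed (use yb in auto)
    then have "fd H y = (\<lambda>v. \<chi> i. if i = k then fd ?w y v else A (fd F y v) $ i)"
      by (rule fdI)
    then show ?thesis by (simp add: det_form_def)
  next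
    case False
    have yW: "y \<in> W" using r rr y by auto
    have lin: "linear (fd H y)" using C1_onD[OF C1H] has_derivative_linear by blast
    have "((\<lambda>z. H z $ k) has_derivative (\<lambda>v. fd H y v $ k)) (at y)"
      using bounded_linear.has_derivative[OF bounded_linear_vec_nth] C1_onD[OF C1H] by blast
    moreover have "((\<lambda>z. H z $ k) has_derivative (\<lambda>v. 0)) (at y)"
    proof (rule has_derivative_transform_within_open[where s="- cball a r" and f="\<lambda>z. 0"])
      show "((\<lambda>z. 0) has_derivative (\<lambda>v. 0)) (at y)" by simp
      show "0 = H z $ k" if "z \<in> - cball a r" for z
        unfolding H_def using supp[of z] that by auto
    qed (use False in auto)
    ultimately have "(\<lambda>v. fd H y v $ k) = (\<lambda>v. 0)" by (rule has_derivative_unique)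
    then have "det (matrix (fd H y)) = 0"
      by (intro det_zero_row(1)[of k]) (auto simp: matrix_def row_def vec_eq_iff fun_eq_iff)
    then show ?thesis using z[OF yW False] by simp
  qed
  have "integral W (det_form k A u (W, \<psi>, F)) = integral (cball a R1) (det_form k A u (W, \<psi>, F))"
    by (rule integral_eq_subset) (use r rr z in auto)
  also have "\<dots> = integral (cball a R1) (\<lambda>x. det (matrix (fd H x)))"
    by (rule Henstock_Kurzweil_Integration.integral_cong) (simp add: eq)
  also have "\<dots> = 0" using hi by (rule integral_unique)
  finally show "integral W (det_form k A u (W, \<psi>, F)) = 0" .
qed

text \<open>With a partition of unity, \<open>u\<close> becomes a sum of functions supported in charts, and
  \<open>det_form\<close> is additive in \<open>u\<close>.\<close>

theorem stokes:
  assumes A: "linear A" and u: "C1_fun u" and C: "compactin T C" "\<And>x. x \<in> topspace T \<Longrightarrow> x \<notin> C \<Longrightarrow> u x = 0"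
  shows "has_form_integral (det_form k A u) 0"
proof -
  obtain ps where ps: "subordinate ps C" using ex_subordinate[OF C(1)] by blast
  let ?\<rho> = "\<lambda>p. case p of (c, a, r, w) \<Rightarrow> det_form k A (\<lambda>x. w x * u x)"
  have b: "bump_on c a r w" if "(c, a, r, w) \<in> set ps" for c a r w
    using ps that unfolding subordinate_def by blast
  have "has_form_integral (\<lambda>c y. \<Sum>p\<leftarrow>ps. ?\<rho> p c y) (\<Sum>p\<leftarrow>ps. 0)"
  proof (rule has_form_integral_sum_list[THEN conjunct1])
    fix p assume p: "p \<in> set ps"
    obtain W \<psi> F a r w where pe: "p = ((W, \<psi>, F), a, r, w)" by (cases p) auto
    have bp: "bump_on (W, \<psi>, F) a r w" using b p pe by simp
    then have cA: "(W, \<psi>, F) \<in> \<A>" and r: "0 < r" and w: "C1_fun w" "\<And>x. x \<notin> \<psi> ` cball a r \<Longrightarrow> w x = 0"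
      unfolding bump_on_def by auto
    from bp obtain R where R: "r < R" "cball a R \<subseteq> W" unfolding bump_on_def by auto
    have inj: "inj_on \<psi> W" by (rule C1_chart_inj[OF chart[OF cA]])
    have sub: "cball a r \<subseteq> W" using R by auto
    have wu: "C1_fun (\<lambda>x. w x * u x)" by (rule C1_fun_mult[OF w(1) u])
    have z: "w (\<psi> y) * u (\<psi> y) = 0" if "y \<in> W" "y \<notin> cball a r" for y
    proof -
      have "\<psi> y \<notin> \<psi> ` cball a r" using inj sub that by (auto dest: inj_onD)
      then show ?thesis using w(2) by simp
    qed
    have tf: "top_form (det_form k A (\<lambda>x. w x * u x))" by (rule top_form_det_form[OF A wu])
    then show "top_form (?\<rho> p)" by (simp add: pe)
    have "supported (det_form k A (\<lambda>x. w x * u x)) (\<psi> ` cball a r)"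
      unfolding supported_def
    proof (intro allI impI)
      fix W' \<psi>' F' y assume c': "(W', \<psi>', F') \<in> \<A>" "y \<in> W'" "\<psi>' y \<notin> \<psi> ` cball a r"
      have cK: "compactin T (\<psi> ` cball a r)" by (rule C1_chart_compactin_image[OF chart[OF cA] _ sub]) simp
      then have "closedin T (\<psi> ` cball a r)" by (rule compactin_imp_closedin[OF haus])
      then have "openin T (topspace T - \<psi> ` cball a r)" by (rule openin_diff[OF openin_topspace])
      then have oN: "open {y\<in>W'. \<psi>' y \<in> topspace T - \<psi> ` cball a r}" by (rule C1_chart_open_vimage[OF chart[OF c'(1)]])
      have "((\<lambda>y. 0) has_derivative (\<lambda>v. 0)) (at y)" by simp
      then have "((\<lambda>y. w (\<psi>' y) * u (\<psi>' y)) has_derivative (\<lambda>v. 0)) (at y)"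
        by (rule has_derivative_transform_within_open[OF _ oN])
           (use c' w(2) C1_chart_in_topspace[OF chart[OF c'(1)]] in auto)
      then have "fd (\<lambda>y. w (\<psi>' y) * u (\<psi>' y)) y = (\<lambda>v. 0)" by (rule fdI)
      then show "det_form k A (\<lambda>x. w x * u x) (W', \<psi>', F') y = 0"
        unfolding det_form_def split
        by (intro det_zero_row(1)[of k]) (auto simp: matrix_def row_def vec_eq_iff)
    qed
    from has_form_integral_chart[OF tf cA compact_cball sub this]
    show "has_form_integral (?\<rho> p) 0"
      using chart_stokes(1)[OF A wu cA r R z] by (simp add: pe)
  qed
  then have "has_form_integral (\<lambda>c y. \<Sum>p\<leftarrow>ps. ?\<rho> p c y) 0" by (simp add: sum_list_0)
  then show ?thesis
  proof (rule has_form_integral_cong)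
    fix W \<psi> F y assume c: "(W, \<psi>, F) \<in> \<A>" and y: "y \<in> W"
    let ?D = "\<lambda>d. det (matrix (\<lambda>v. \<chi> i. if i = k then d v else A (fd F y v) $ i))"
    have add: "?D (\<lambda>v. d v + d' v) = ?D d + ?D d'" for d d'
    proof -
      have m: "matrix (\<lambda>v. \<chi> i. if i = k then d v else A (fd F y v) $ i) =
         (\<chi> i. if i = k then (\<chi> j. d (axis j 1)) else (\<chi> j. A (fd F y (axis j 1)) $ i))" for d
        by (auto simp: matrix_def vec_eq_iff)
      have eq: "(\<chi> j. d (axis j 1) + d' (axis j 1)) = (\<chi> j. d (axis j 1)) + (\<chi> j. d' (axis j 1))" by (simp add: vec_eq_iff)
      show ?thesis unfolding m eq by (rule det_row_add)
    qed
    have zero: "?D (\<lambda>v. 0) = 0"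
      by (intro det_zero_row(1)[of k]) (auto simp: matrix_def row_def vec_eq_iff)
    have sumD: "(\<Sum>p\<leftarrow>qs. ?\<rho> p (W, \<psi>, F) y) = ?D (\<lambda>v. \<Sum>(c, a, r, w)\<leftarrow>qs. fd (\<lambda>y. w (\<psi> y) * u (\<psi> y)) y v)"
      for qs :: "('m, 'v, 'e) bump list"
    proof (induction qs)
      case Nil
      show ?case using zero by (simp only: list.map sum_list.Nil)
    next
      case (Cons q qs)
      obtain c a r w where q: "q = (c, a, r, w)" by (cases q)
      let ?S = "\<lambda>qs v. \<Sum>(c, a, r, w)\<leftarrow>qs. fd (\<lambda>y. w (\<psi> y) * u (\<psi> y)) y v"
      let ?d = "fd (\<lambda>y. w (\<psi> y) * u (\<psi> y)) y"
      have "?S (q # qs) = (\<lambda>v. ?d v + ?S qs v)" by (simp add: q)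
      then have "?D (?S (q # qs)) = ?D (\<lambda>v. ?d v + ?S qs v)" by (rule arg_cong)
      also have "\<dots> = ?D ?d + ?D (?S qs)" by (rule add)
      finally have "?D (?S (q # qs)) = ?D ?d + ?D (?S qs)" .
      moreover have "?\<rho> q (W, \<psi>, F) y = ?D (fd (\<lambda>y. w (\<psi> y) * u (\<psi> y)) y)"
        by (simp add: q det_form_def)
      ultimately show ?case using Cons by simp
    qed
    have "((\<lambda>y. \<Sum>(c, a, r, w)\<leftarrow>qs. w (\<psi> y) * u (\<psi> y)) has_derivative
        (\<lambda>v. \<Sum>(c, a, r, w)\<leftarrow>qs. fd (\<lambda>y. w (\<psi> y) * u (\<psi> y)) y v)) (at y)" if "set qs \<subseteq> set ps" for qs
      using that
    proof (induction qs)
      case Nil then show ?case by simp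
    next
      case (Cons q qs)
      obtain c' a r w where q: "q = (c', a, r, w)" by (cases q)
      have "C1_fun w" using b[of c' a r w] Cons.prems q unfolding bump_on_def by auto
      then have "((\<lambda>y. w (\<psi> y) * u (\<psi> y)) has_derivative fd (\<lambda>y. w (\<psi> y) * u (\<psi> y)) y) (at y)"
        using C1_onD[OF C1_funD[OF C1_fun_mult[OF _ u] c] y] by blast
      from has_derivative_add[OF this] show ?case using Cons by (simp add: q)
    qed
    from this[OF subset_refl]
    have "((\<lambda>y. u (\<psi> y)) has_derivative (\<lambda>v. \<Sum>(c, a, r, w)\<leftarrow>ps. fd (\<lambda>y. w (\<psi> y) * u (\<psi> y)) y v)) (at y)"
    proof (rule has_derivative_transform_within_open[OF _ chart_open[OF c] y])
      fix z assume z: "z \<in> W"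
      have "(\<Sum>(c, a, r, w)\<leftarrow>qs. w (\<psi> z) * u (\<psi> z)) = (\<Sum>(c, a, r, w)\<leftarrow>qs. w (\<psi> z)) * u (\<psi> z)"
        for qs :: "('m, 'v, 'e) bump list" by (induction qs) (auto simp: algebra_simps)
      moreover have "(\<Sum>(c, a, r, w)\<leftarrow>ps. w (\<psi> z)) * u (\<psi> z) = u (\<psi> z)"
        using ps C(2)[OF C1_chart_in_topspace[OF chart[OF c] z]] unfolding subordinate_def
        by (cases "\<psi> z \<in> C") auto
      ultimately show "(\<Sum>(c, a, r, w)\<leftarrow>ps. w (\<psi> z) * u (\<psi> z)) = u (\<psi> z)" by simp
    qed
    then have fdu: "fd (\<lambda>y. u (\<psi> y)) y = (\<lambda>v. \<Sum>(c, a, r, w)\<leftarrow>ps. fd (\<lambda>y. w (\<psi> y) * u (\<psi> y)) y v)"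
      by (rule fdI)
    show "(\<Sum>p\<leftarrow>ps. ?\<rho> p (W, \<psi>, F) y) = det_form k A u (W, \<psi>, F) y"
      unfolding sumD unfolding det_form_def case_prod_conv fdu ..
  qed
qed

end

text \<open>An injective map \<open>\<iota>\<close> which takes charts to charts and \<open>\<tau>\<close> to \<open>\<tau>'\<close> does
  not change integrals: the bumps of a partition of unity are extended by zero, and
  \<open>\<tau>'\<close> is supported in the image of \<open>C\<close>.\<close>

lemma has_form_integral_pushforward:
  fixes \<A> :: "('m::finite, 'v, 'e::euclidean_space) lchart set" and \<A>' :: "('m, 'w, 'e) lchart set"
    and \<iota> :: "'v \<Rightarrow> 'w"
  assumes o1: "oriented_atlas P T f \<A>" and o2: "oriented_atlas P' T' f' \<A>'"
    and \<tau>: "oriented_atlas.top_form \<A> \<tau>" "oriented_atlas.supported \<A> \<tau> C" "compactin T C"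
    and hi: "oriented_atlas.has_form_integral T \<A> \<tau> s"
    and \<tau>': "oriented_atlas.top_form \<A>' \<tau>'" "oriented_atlas.supported \<A>' \<tau>' (\<iota> ` C)"
    and \<iota>: "inj_on \<iota> (topspace T)"
    and ch: "\<And>W \<psi> F. (W, \<psi>, F) \<in> \<A> \<Longrightarrow> (W, \<lambda>y. \<iota> (\<psi> y), S F) \<in> \<A>'"
    and eq: "\<And>W \<psi> F y. (W, \<psi>, F) \<in> \<A> \<Longrightarrow> y \<in> W \<Longrightarrow> \<tau>' (W, \<lambda>y. \<iota> (\<psi> y), S F) y = \<tau> (W, \<psi>, F) y"
  shows "oriented_atlas.has_form_integral T' \<A>' \<tau>' s"
proof -
  interpret a1: oriented_atlas P T f \<A> by (rule o1)
  interpret a2: oriented_atlas P' T' f' \<A>' by (rule o2)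
  obtain ps where ps: "a1.subordinate ps C" using a1.ex_subordinate[OF \<tau>(3)] by blast
  have s: "s = (\<Sum>(c, a, r, u)\<leftarrow>ps. integral (fst c) (form_mult u \<tau> c))"
    using a1.has_form_integral_unique[OF hi a1.has_form_integral_partition[OF \<tau>(1,2) ps]] by simp
  define ext :: "(real^'m) set \<Rightarrow> (real^'m \<Rightarrow> 'v) \<Rightarrow> ('v \<Rightarrow> real) \<Rightarrow> 'w \<Rightarrow> real"
    where "ext = (\<lambda>W \<psi> u x. if x \<in> (\<lambda>y. \<iota> (\<psi> y)) ` W then u (\<psi> (inv_into W (\<lambda>y. \<iota> (\<psi> y)) x)) else (0::real))"
  define \<rho> :: "('m, 'v, 'e) bump \<Rightarrow> ('m, 'w, 'e) form"
    where "\<rho> = (\<lambda>p. case p of ((W, \<psi>, F), a, r, u) \<Rightarrow> form_mult (ext W \<psi> u) \<tau>')"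
  have CT: "C \<subseteq> topspace T" using \<tau>(3) by (rule compactin_subset_topspace)
  have bp: "a1.bump_on c a r u" if "(c, a, r, u) \<in> set ps" for c a r u
    using ps that unfolding a1.subordinate_def by blast
  have inv: "inv_into W (\<lambda>y. \<iota> (\<psi> y)) (\<iota> (\<psi> y)) = y" if "(W, \<psi>, F) \<in> \<A>" "y \<in> W" for W \<psi> F y
    using C1_chart_inj[OF a2.chart[OF ch[OF that(1)]]] that(2) by (rule inv_into_f_f)
  have "a2.has_form_integral (\<lambda>c y. \<Sum>p\<leftarrow>ps. \<rho> p c y) (\<Sum>(c, a, r, u)\<leftarrow>ps. integral (fst c) (form_mult u \<tau> c))"
  proof (rule a2.has_form_integral_sum_list[THEN conjunct1])
    fix p assume p: "p \<in> set ps"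
    obtain W \<psi> F a r u where pe: "p = ((W, \<psi>, F), a, r, u)" by (cases p) auto
    have "a1.bump_on (W, \<psi>, F) a r u" using bp p pe by simp
    then have cA: "(W, \<psi>, F) \<in> \<A>" and sub: "cball a r \<subseteq> W" and u: "a1.C1_fun u" "\<And>x. x \<notin> \<psi> ` cball a r \<Longrightarrow> u x = 0"
      unfolding a1.bump_on_def by fastforce+
    have inj: "inj_on \<psi> W" by (rule C1_chart_inj[OF a1.chart[OF cA]])
    have u0: "u (\<psi> y) = 0" if "y \<in> W" "y \<notin> cball a r" for y
    proof -
      have "\<psi> y \<notin> \<psi> ` cball a r" using inj sub that by (auto dest: inj_onD)
      then show ?thesis using u(2) by simp
    qed
    have ext: "a2.C1_fun (ext W \<psi> u)"
      unfolding ext_def by (rule a2.C1_fun_extension[OF ch[OF cA] compact_cball sub a1.C1_funD[OF u(1) cA] u0])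
    have tf: "a2.top_form (form_mult (ext W \<psi> u) \<tau>')" by (rule a2.top_form_mult[OF \<tau>'(1) ext])
    then show "a2.top_form (\<rho> p)" by (simp add: \<rho>_def pe)
    have "a2.supported (form_mult (ext W \<psi> u) \<tau>') ((\<lambda>y. \<iota> (\<psi> y)) ` cball a r)"
    proof (rule a2.supported_mult2)
      fix x assume x: "x \<notin> (\<lambda>y. \<iota> (\<psi> y)) ` cball a r"
      show "ext W \<psi> u x = 0"
      proof (cases "x \<in> (\<lambda>y. \<iota> (\<psi> y)) ` W")
        case True
        then obtain y where y: "y \<in> W" "x = \<iota> (\<psi> y)" by blast
        then have "y \<notin> cball a r" using x by blast
        then show ?thesis using y u0 inv[OF cA y(1)] by (simp add: ext_def)
      qed (simp add: ext_def)
    qed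
    from a2.has_form_integral_chart[OF tf ch[OF cA] compact_cball sub this]
    have "a2.has_form_integral (form_mult (ext W \<psi> u) \<tau>') (integral W (form_mult (ext W \<psi> u) \<tau>' (W, \<lambda>y. \<iota> (\<psi> y), S F)))" .
    moreover have "integral W (form_mult (ext W \<psi> u) \<tau>' (W, \<lambda>y. \<iota> (\<psi> y), S F)) = integral W (form_mult u \<tau> (W, \<psi>, F))"
    proof (rule Henstock_Kurzweil_Integration.integral_cong)
      fix y assume y: "y \<in> W"
      show "form_mult (ext W \<psi> u) \<tau>' (W, \<lambda>y. \<iota> (\<psi> y), S F) y = form_mult u \<tau> (W, \<psi>, F) y"
        using y inv[OF cA y] eq[OF cA y] by (simp add: form_mult_def ext_def)
    qed
    ultimately show "a2.has_form_integral (\<rho> p) (case p of (c, a, r, u) \<Rightarrow> integral (fst c) (form_mult u \<tau> c))"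
      by (simp add: \<rho>_def pe)
  qed
  then show ?thesis unfolding s
  proof (rule a2.has_form_integral_cong)
    fix W' \<psi>' F' y assume c': "(W', \<psi>', F') \<in> \<A>'" and y: "y \<in> W'"
    have sum: "(\<Sum>p\<leftarrow>qs. \<rho> p (W', \<psi>', F') y) = (\<Sum>((W, \<psi>, F), a, r, u)\<leftarrow>qs. ext W \<psi> u (\<psi>' y)) * \<tau>' (W', \<psi>', F') y"
      for qs by (induction qs) (auto simp: \<rho>_def form_mult_def algebra_simps)
    show "(\<Sum>p\<leftarrow>ps. \<rho> p (W', \<psi>', F') y) = \<tau>' (W', \<psi>', F') y"
    proof (cases "\<psi>' y \<in> \<iota> ` C")
      case False
      then show ?thesis unfolding sum using \<tau>'(2) c' y unfolding a2.supported_def by simp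
    next
      case True
      then obtain x where x: "x \<in> C" "\<psi>' y = \<iota> x" by blast
      have pt: "ext W \<psi> u (\<iota> x) = u x" if p: "((W, \<psi>, F), a, r, u) \<in> set ps" for W \<psi> F a r u
      proof -
        have "a1.bump_on (W, \<psi>, F) a r u" by (rule bp[OF p])
        then have cA: "(W, \<psi>, F) \<in> \<A>" and sub: "cball a r \<subseteq> W" and u: "\<And>x. x \<notin> \<psi> ` cball a r \<Longrightarrow> u x = 0"
          unfolding a1.bump_on_def by fastforce+
        show "ext W \<psi> u (\<iota> x) = u x"
        proof (cases "x \<in> \<psi> ` W")
          case True
          then obtain z where "z \<in> W" "x = \<psi> z" by blast
          then show ?thesis using inv[OF cA] by (auto simp: ext_def)
        next
          case False
          then have "u x = 0" using u sub by blast
          moreover have "\<iota> x \<notin> (\<lambda>y. \<iota> (\<psi> y)) ` W"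
          proof
            assume "\<iota> x \<in> (\<lambda>y. \<iota> (\<psi> y)) ` W"
            then obtain z where z: "z \<in> W" "\<iota> x = \<iota> (\<psi> z)" by blast
            then have "x = \<psi> z" using \<iota> CT x(1) C1_chart_in_topspace[OF a1.chart[OF cA]] by (metis inj_onD subsetD)
            then show False using False z(1) by blast
          qed
          ultimately show ?thesis by (simp add: ext_def)
        qed
      qed
      have "(\<Sum>((W, \<psi>, F), a, r, u)\<leftarrow>ps. ext W \<psi> u (\<psi>' y)) = (\<Sum>(c, a, r, u)\<leftarrow>ps. u x)"
        by (intro arg_cong[where f=sum_list] map_cong refl) (auto simp: pt x(2))
      also have "\<dots> = 1" using ps x(1) unfolding a1.subordinate_def by blast
      finally show ?thesis unfolding sum by simp
    qed
  qed
qed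

section \<open>Positive charts of an oriented immersed manifold\<close>

lemma C1_chart_reparam:
  fixes R :: "real^'m::finite \<Rightarrow> real^'m"
  assumes c: "C1_chart P T f W \<psi> F" and R: "linear R" "inj R"
  shows "C1_chart P T f (R -` W) (\<lambda>y. \<psi> (R y)) (\<lambda>y. F (R y))"
    and "\<And>y v. R y \<in> W \<Longrightarrow> fd (\<lambda>y. F (R y)) y v = fd F (R y) (R v)"
proof -
  have contR: "continuous_on UNIV R" using R(1) by (simp add: linear_continuous_on linear_conv_bounded_linear)
  have surj: "surj R" using R linear_injective_imp_surjective by blast
  have F: "C1_on W F" and oW: "open W" using c by (auto simp: C1_chart_def)
  show fdR: "fd (\<lambda>y. F (R y)) y v = fd F (R y) (R v)" if "R y \<in> W" for y v
    using fdI[OF has_derivative_compose[OF linear_imp_has_derivative[OF R(1)] C1_onD[OF F that]]] by simp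
  have "embedding_map (top_of_set (R -` W)) (top_of_set W) R"
  proof (rule injective_open_imp_embedding_map)
    show "continuous_map (top_of_set (R -` W)) (top_of_set W) R"
      using contR by (auto intro: continuous_on_subset)
    show "open_map (top_of_set (R -` W)) (top_of_set W) R"
      unfolding open_map_def
    proof (intro allI impI)
      fix U assume "openin (top_of_set (R -` W)) U"
      moreover have "open (R -` W)" using oW contR by (simp add: open_vimage)
      ultimately have "open U" "U \<subseteq> R -` W" by (auto simp: openin_open_eq)
      then show "openin (top_of_set W) (R ` U)"
        using open_surjective_linear_image[OF _ R(1) surj] oW by (auto simp: openin_open_eq)
    qed
    show "inj_on R (topspace (top_of_set (R -` W)))" using R(2) by (auto intro: inj_on_subset)
  qed
  from embedding_map_compose[OF this] c
  have "embedding_map (top_of_set (R -` W)) T (\<lambda>y. \<psi> (R y))" by (auto simp: C1_chart_def o_def)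
  moreover have "(\<lambda>y. \<psi> (R y)) ` (R -` W) = \<psi> ` W"
    unfolding image_image[symmetric, of \<psi> R] surj_image_vimage_eq[OF surj] ..
  moreover have "C1_on (R -` W) (\<lambda>y. F (R y))" by (rule C1_on_compose[OF C1_on_linear[OF R(1)] F]) auto
  moreover have "open (R -` W)" using oW contR by (simp add: open_vimage)
  moreover have "inj (fd (\<lambda>y. F (R y)) y)" if "R y \<in> W" for y
  proof -
    have "inj (fd F (R y))" using c that by (auto simp: C1_chart_def)
    then show ?thesis using R(2) fdR[OF that] by (auto simp: inj_def)
  qed
  ultimately show "C1_chart P T f (R -` W) (\<lambda>y. \<psi> (R y)) (\<lambda>y. F (R y))"
    using c by (simp add: C1_chart_def)
qed

lemma C1_chart_subset:
  assumes c: "C1_chart P T f W \<psi> F" and N: "open N" "N \<subseteq> W"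
  shows "C1_chart P T f N \<psi> F"
proof -
  have "homeomorphic_map (top_of_set W) (subtopology T (\<psi> ` W)) \<psi>"
    using c by (simp add: C1_chart_def embedding_map_def)
  then have om: "open_map (top_of_set W) (subtopology T (\<psi> ` W)) \<psi>" by (rule homeomorphic_imp_open_map)
  have oW: "open W" and oT: "openin T (\<psi> ` W)" using c by (auto simp: C1_chart_def)
  have open_im: "openin T (\<psi> ` U)" if "open U" "U \<subseteq> W" for U
  proof -
    have "openin (top_of_set W) U" using that oW by (simp add: openin_open_eq)
    then have "openin (subtopology T (\<psi> ` W)) (\<psi> ` U)" using om unfolding open_map_def by blast
    then show ?thesis using oT by (rule openin_trans_full)
  qed
  have "embedding_map (top_of_set N) T \<psi>"
  proof (rule injective_open_imp_embedding_map)
    show "continuous_map (top_of_set N) T \<psi>"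
      using C1_chart_continuous_map[OF c] N(2) by (rule continuous_map_from_subtopology_mono)
    show "open_map (top_of_set N) T \<psi>"
      unfolding open_map_def using N open_im by (auto simp: openin_open_eq)
    show "inj_on \<psi> (topspace (top_of_set N))" using C1_chart_inj[OF c] N(2) by (auto intro: inj_on_subset)
  qed
  then show ?thesis using c N open_im[OF N] C1_on_subset unfolding C1_chart_def by blast
qed

definition chart_frame :: "(real^'m \<Rightarrow> 'e::euclidean_space) \<Rightarrow> real^'m::finite \<Rightarrow> 'e^'m" where
  "chart_frame F y = (\<chi> i. fd F y (axis i 1))"

definition positive_charts ::
  "('e::euclidean_space \<Rightarrow> 'x) \<Rightarrow> 'v topology \<Rightarrow> ('v \<Rightarrow> 'x) \<Rightarrow> ('v \<times> ('e, 'm::finite) vec) set \<Rightarrow> ('m, 'v, 'e) lchart set" where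
  "positive_charts P T f Q = {(W, \<psi>, F). C1_chart P T f W \<psi> F \<and> (\<forall>y\<in>W. (\<psi> y, chart_frame F y) \<in> Q)}"

lemma linear_axis_sum:
  fixes L :: "real^'m::finite \<Rightarrow> 'e::real_vector"
  assumes "linear L"
  shows "L v = (\<Sum>i\<in>UNIV. v $ i *\<^sub>R L (axis i 1))"
proof -
  have "v = (\<Sum>i\<in>UNIV. v $ i *\<^sub>R axis i 1)" by (simp add: vec_eq_iff axis_def sum_component if_distrib cong: if_cong)
  then have "L v = L (\<Sum>i\<in>UNIV. v $ i *\<^sub>R axis i 1)" by simp
  then show ?thesis by (simp add: linear_sum[OF assms] linear_scale[OF assms])
qed

lemma independent_frame_sum_0:
  fixes e :: "'e::real_vector^'m::finite"
  assumes "inj (\<lambda>i. e $ i)" "independent (range (\<lambda>i. e $ i))" "(\<Sum>i\<in>UNIV. c i *\<^sub>R e $ i) = 0"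
  shows "c i = 0"
proof -
  let ?c = "\<lambda>v. c (inv_into UNIV (\<lambda>i. e $ i) v)"
  have "(\<Sum>v\<in>range (\<lambda>i. e $ i). ?c v *\<^sub>R v) = (\<Sum>i\<in>UNIV. c i *\<^sub>R e $ i)"
    using assms(1) by (simp add: sum.reindex)
  then have "?c (e $ i) = 0"
    using assms(2,3) independentD[OF assms(2) _ subset_refl, of ?c "e $ i"] by auto
  then show ?thesis using assms(1) by simp
qed

lemma same_tangent_space:
  fixes F :: "real^'m::finite \<Rightarrow> 'e::euclidean_space"
  assumes "C1_chart P T f W \<psi> F" "C1_chart P T f W' \<psi>' F'" "separated_fibres P" "y \<in> W" "y' \<in> W'" "\<psi> y = \<psi>' y'"
  shows "range (fd F y) \<subseteq> range (fd F' y')"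
proof -
  note tr = transition_map[OF assms(1-3)]
  have yN: "y \<in> {y\<in>W. \<psi> y \<in> \<psi>' ` W'}" using assms by auto
  have "transition \<psi> W' \<psi>' y = y'"
    using C1_chart_inj[OF assms(2)] assms(5,6) by (simp add: transition_def)
  then show ?thesis using tr(7)[OF yN] by auto
qed

lemma frames_in_chart:
  fixes F :: "real^'m::finite \<Rightarrow> 'e::euclidean_space" and R :: "real^'m \<Rightarrow> real^'m"
  assumes c: "immersion_chart P T f W \<psi> F" and y: "y \<in> W" and R: "linear R" "inj R"
  shows "(\<psi> y, \<chi> i. fd F y (R (axis i 1))) \<in> frames P T f"
proof -
  have c1: "C1_chart P T f W \<psi> F" using c by (rule immersion_chart_imp_C1_chart)
  have lin: "linear (fd F y)" using c1 y C1_onD has_derivative_linear unfolding C1_chart_def by blast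
  have inj: "inj (fd F y)" using c1 y by (auto simp: C1_chart_def)
  let ?L = "\<lambda>v. fd F y (R v)"
  have L: "linear ?L" "inj ?L"
    using linear_compose[OF R(1) lin] inj R(2) by (auto simp: o_def inj_def)
  have "inj (\<lambda>i. ?L (axis i 1))"
  proof (rule injI)
    fix i j assume "?L (axis i 1) = ?L (axis j 1)"
    then have "axis i (1::real) = axis j 1" using L(2) unfolding inj_def by blast
    then show "i = j" by (simp add: axis_eq_axis)
  qed
  moreover have "independent (range (\<lambda>i. ?L (axis i 1)))"
  proof -
    have ax: "range (\<lambda>i::'m. axis i (1::real)) = Basis" by (auto simp: Basis_vec_def)
    have "independent (?L ` Basis)"
      by (rule linear_independent_injective_image[OF L(1) independent_Basis])
         (use L(2) in \<open>auto intro: inj_on_subset\<close>)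
    then show ?thesis by (simp flip: ax add: image_image)
  qed
  moreover have "($) (\<chi> i. g i) = g" for g :: "'m \<Rightarrow> 'e" by (rule ext) simp
  ultimately show ?thesis
    unfolding frames_def mem_Collect_eq case_prod_conv
    by (intro exI[of _ W] exI[of _ \<psi>] exI[of _ F] exI[of _ y] conjI allI) (simp_all add: c y)
qed

text \<open>Near a point with a positive frame \<open>e0\<close>, a smooth chart is reparametrised by a linear
  map \<open>R\<close> which makes its coordinate frame at the point equal to \<open>e0\<close>; the frame stays
  positive nearby since the set of positive frames is open. The matrix relating two positive
  frames has positive determinant, and its transpose is the derivative of the transition
  map.\<close>

lemma oriented_atlas_positive_charts:
  fixes Q :: "('v \<times> ('e::euclidean_space, 'm::finite) vec) set"
  assumes im: "immersed_manifold TYPE('m) P T f" and or: "orientation P T f Q" and sep: "separated_fibres P"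
  shows "oriented_atlas P T f (positive_charts P T f Q)"
proof
  show "Hausdorff_space T" using im by (simp add: immersed_manifold_def)
  show "separated_fibres P" by (rule sep)
  show "C1_chart P T f W \<psi> F" if "(W, \<psi>, F) \<in> positive_charts P T f Q" for W \<psi> F
    using that by (simp add: positive_charts_def)
  have Qf: "Q \<subseteq> frames P T f" and Qo: "openin (frame_top T (frames P T f)) Q"
    using or openin_subset by (fastforce simp: orientation_def frame_top_def)+
  have orb: "\<exists>A :: real^'m^'m. det A > 0 \<and> (\<forall>i. e' $ i = (\<Sum>j\<in>UNIV. A $ i $ j *\<^sub>R e $ j))"
    if "(x, e) \<in> Q" "(x, e') \<in> Q" for x e e'
  proof -
    have "{e'. (x, e') \<in> Q} = {e'. \<exists>A :: real^'m^'m. det A > 0 \<and> (\<forall>i. e' $ i = (\<Sum>j\<in>UNIV. A $ i $ j *\<^sub>R e $ j))}"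
      using or that(1) unfolding orientation_def by blast
    then show ?thesis using that(2) by blast
  qed
  show "\<exists>W \<psi> F. (W, \<psi>, F) \<in> positive_charts P T f Q \<and> x \<in> \<psi> ` W" if x: "x \<in> topspace T" for x
  proof -
    obtain W :: "(real^'m) set" and \<psi> F where ic: "immersion_chart P T f W \<psi> F" "x \<in> \<psi> ` W"
      using im x unfolding immersed_manifold_def by blast
    have c: "C1_chart P T f W \<psi> F" using ic(1) by (rule immersion_chart_imp_C1_chart)
    obtain y0 where y0: "y0 \<in> W" "x = \<psi> y0" using ic(2) by blast
    obtain e0 where e0: "(x, e0) \<in> Q" using or x unfolding orientation_def by blast
    then have "(x, e0) \<in> frames P T f" using Qf by blast
    then obtain W2 :: "(real^'m) set" and \<psi>2 F2 y2 where c2: "immersion_chart P T f W2 \<psi>2 F2" "y2 \<in> W2" "x = \<psi>2 y2"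
        "\<And>i. e0 $ i \<in> range (fd F2 y2)" and ind: "inj (\<lambda>i. e0 $ i)" "independent (range (\<lambda>i. e0 $ i))"
      unfolding frames_def by auto
    have "range (fd F2 y2) \<subseteq> range (fd F y0)"
      using same_tangent_space[OF immersion_chart_imp_C1_chart[OF c2(1)] c sep c2(2) y0(1)] y0(2) c2(3) by simp
    then have "\<forall>i. \<exists>b. e0 $ i = fd F y0 b" using c2(4) by blast
    then obtain b where b: "\<And>i. e0 $ i = fd F y0 (b i)" by metis
    have lin: "linear (fd F y0)" using c y0(1) C1_onD has_derivative_linear unfolding C1_chart_def by blast
    define R where "R = (\<lambda>v :: real^'m. \<Sum>i\<in>UNIV. v $ i *\<^sub>R b i)"
    have linR: "linear R"
      by (rule linearI) (simp_all add: R_def scaleR_add_left sum.distrib scaleR_sum_right)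
    have Rax: "R (axis i 1) = b i" for i
      by (simp add: R_def axis_def if_distrib[of "\<lambda>x. x *\<^sub>R _"] cong: if_cong)
    have injR: "inj R"
      unfolding linear_injective_0[OF linR]
    proof (intro allI impI)
      fix v assume "R v = 0"
      then have "fd F y0 (R v) = 0" by (simp add: linear_0[OF lin])
      then have "(\<Sum>i\<in>UNIV. v $ i *\<^sub>R e0 $ i) = 0"
        by (simp add: R_def linear_sum[OF lin] linear_scale[OF lin] b)
      then show "v = 0" using independent_frame_sum_0[OF ind] by (simp add: vec_eq_iff)
    qed
    have surjR: "surj R" using linR injR linear_injective_imp_surjective by blast
    obtain z0 where z0: "R z0 = y0" using surjR by (metis surjD)
    note rp = C1_chart_reparam[OF c linR injR]
    let ?\<psi> = "\<lambda>y. \<psi> (R y)" and ?F = "\<lambda>y. F (R y)"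
    let ?h = "\<lambda>y. (?\<psi> y, chart_frame ?F y)"
    have cf: "chart_frame ?F y = (\<chi> i. fd F (R y) (R (axis i 1)))" if "y \<in> R -` W" for y
      using rp(2) that by (simp add: chart_frame_def)
    have "continuous_map (top_of_set (R -` W)) (prod_topology T euclidean) ?h"
    proof (rule continuous_map_pairedI)
      show "continuous_map (top_of_set (R -` W)) T ?\<psi>" by (rule C1_chart_continuous_map[OF rp(1)])
      have "continuous_on (R -` W) (chart_frame ?F)"
        unfolding chart_frame_def using C1_on_cont rp(1) by (auto simp: C1_chart_def intro!: continuous_intros)
      then show "continuous_map (top_of_set (R -` W)) euclidean (chart_frame ?F)" by simp
    qed
    moreover have "?h ` (R -` W) \<subseteq> frames P T f"
      using cf frames_in_chart[OF ic(1) _ linR injR] by auto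
    ultimately have "continuous_map (top_of_set (R -` W)) (frame_top T (frames P T f)) ?h"
      by (auto simp: frame_top_def continuous_map_in_subtopology)
    from openin_continuous_map_preimage[OF this Qo]
    have "openin (top_of_set (R -` W)) {y \<in> R -` W. ?h y \<in> Q}" by simp
    moreover have "open (R -` W)" using rp(1) by (simp add: C1_chart_def)
    ultimately have oN: "open {y \<in> R -` W. ?h y \<in> Q}" by (simp add: openin_open_eq)
    have "({y \<in> R -` W. ?h y \<in> Q}, ?\<psi>, ?F) \<in> positive_charts P T f Q"
      using C1_chart_subset[OF rp(1) oN] by (auto simp: positive_charts_def)
    moreover have "z0 \<in> {y \<in> R -` W. ?h y \<in> Q}"
    proof -
      have "chart_frame ?F z0 = e0" using cf[of z0] z0 y0 by (simp add: vec_eq_iff b Rax)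
      then show ?thesis using z0 y0 e0 by simp
    qed
    ultimately show ?thesis using z0 y0(2) by (metis (no_types, lifting) imageI)
  qed
  show "\<exists>A :: real^'m^'m. det A > 0 \<and> (\<forall>v. fd F y v = fd F' y' (A *v v))"
    if c: "(W, \<psi>, F) \<in> positive_charts P T f Q" and c': "(W', \<psi>', F') \<in> positive_charts P T f Q"
      and y: "y \<in> W" "y' \<in> W'" "\<psi> y = \<psi>' y'" for W \<psi> F W' \<psi>' F' y y'
  proof -
    have c1: "C1_chart P T f W \<psi> F" "C1_chart P T f W' \<psi>' F'" using c c' by (auto simp: positive_charts_def)
    have lin: "linear (fd F y)" "linear (fd F' y')"
      using c1 y C1_onD has_derivative_linear unfolding C1_chart_def by blast+
    have "(\<psi> y, chart_frame F y) \<in> Q" "(\<psi> y, chart_frame F' y') \<in> Q"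
      using c c' y by (auto simp: positive_charts_def)
    from orb[OF this(2,1)] obtain A :: "real^'m^'m" where
      A: "det A > 0" "\<And>i. chart_frame F y $ i = (\<Sum>j\<in>UNIV. A $ i $ j *\<^sub>R chart_frame F' y' $ j)" by blast
    have "fd F y v = fd F' y' (transpose A *v v)" for v
    proof -
      have "fd F' y' (transpose A *v v) = (\<Sum>j\<in>UNIV. (transpose A *v v) $ j *\<^sub>R fd F' y' (axis j 1))"
        by (rule linear_axis_sum[OF lin(2)])
      also have "\<dots> = (\<Sum>j\<in>UNIV. \<Sum>i\<in>UNIV. (v $ i * A $ i $ j) *\<^sub>R fd F' y' (axis j 1))"
        by (simp add: matrix_vector_mult_def transpose_def scaleR_sum_left mult.commute)
      also have "\<dots> = (\<Sum>i\<in>UNIV. \<Sum>j\<in>UNIV. (v $ i * A $ i $ j) *\<^sub>R fd F' y' (axis j 1))"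
        by (rule sum.swap)
      also have "\<dots> = (\<Sum>i\<in>UNIV. v $ i *\<^sub>R fd F y (axis i 1))"
        using A(2) by (simp add: chart_frame_def scaleR_sum_right)
      also have "\<dots> = fd F y v" by (rule linear_axis_sum[OF lin(1), symmetric])
      finally show ?thesis by simp
    qed
    moreover have "det (transpose A) > 0" using A(1) by simp
    ultimately show ?thesis by blast
  qed
qed

section \<open>Quotients by discrete groups of translations\<close>

definition discrete_subgroup :: "'e::real_normed_vector set \<Rightarrow> bool" where
  "discrete_subgroup G \<longleftrightarrow> 0 \<in> G \<and> (\<forall>x\<in>G. \<forall>y\<in>G. x - y \<in> G) \<and> (\<exists>e>0. \<forall>x\<in>G. norm x < e \<longrightarrow> x = 0)"

lemma discrete_subgroup_minus: "discrete_subgroup G \<Longrightarrow> x \<in> G \<Longrightarrow> - x \<in> G"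
  and discrete_subgroup_add: "discrete_subgroup G \<Longrightarrow> x \<in> G \<Longrightarrow> y \<in> G \<Longrightarrow> x + y \<in> G"
proof -
  show m: "- x \<in> G" if "discrete_subgroup G" "x \<in> G" for x
    using that unfolding discrete_subgroup_def by (metis diff_0)
  show "x + y \<in> G" if "discrete_subgroup G" "x \<in> G" "y \<in> G"
    using m[OF that(1,3)] that unfolding discrete_subgroup_def by (metis diff_minus_eq_add)
qed

lemma quot_proj_eq_iff:
  assumes "discrete_subgroup G"
  shows "quot_proj G x = quot_proj G y \<longleftrightarrow> x - y \<in> G"
proof
  assume "quot_proj G x = quot_proj G y"
  then have "x + 0 \<in> (+) y ` G" using assms unfolding quot_proj_def discrete_subgroup_def by blast
  then show "x - y \<in> G" by auto
next
  assume xy: "x - y \<in> G"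
  show "quot_proj G x = quot_proj G y"
    unfolding quot_proj_def
  proof (intro equalityI subsetI)
    fix z assume "z \<in> (+) x ` G"
    then obtain g where "g \<in> G" "z = x + g" by blast
    then have "z = y + ((x - y) + g)" "(x - y) + g \<in> G" using discrete_subgroup_add[OF assms xy] by auto
    then show "z \<in> (+) y ` G" by blast
  next
    fix z assume "z \<in> (+) y ` G"
    then obtain g where "g \<in> G" "z = y + g" by blast
    then have "z = x + (- (x - y) + g)" "- (x - y) + g \<in> G"
      using discrete_subgroup_add[OF assms discrete_subgroup_minus[OF assms xy]] by auto
    then show "z \<in> (+) x ` G" by blast
  qed
qed

lemma topspace_quot_top: "topspace (quot_top G) = range (quot_proj G)"
proof (rule subset_antisym)
  show "topspace (quot_top G) \<subseteq> range (quot_proj G)"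
    using openin_topspace[of "quot_top G"] unfolding openin_quot_top by (rule conjunct1)
  have "quot_proj G -` range (quot_proj G) = UNIV" by blast
  then have "openin (quot_top G) (range (quot_proj G))" unfolding openin_quot_top by simp
  then show "range (quot_proj G) \<subseteq> topspace (quot_top G)" by (rule openin_subset)
qed

lemma continuous_map_quot_proj: "continuous_map euclidean (quot_top G) (quot_proj G)"
  unfolding continuous_map_def topspace_quot_top openin_quot_top by (auto simp: vimage_def)

lemma open_map_quot_proj:
  fixes G :: "'e::euclidean_space set"
  assumes "discrete_subgroup G"
  shows "open_map euclidean (quot_top G) (quot_proj G)"
  unfolding open_map_def openin_quot_top
proof (intro allI impI conjI)
  fix U :: "'e set" assume "openin euclidean U"
  then have "open U" by simp
  have "quot_proj G -` (quot_proj G ` U) = (\<Union>g\<in>G. (+) g ` U)"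
  proof (intro equalityI subsetI)
    fix x assume "x \<in> quot_proj G -` (quot_proj G ` U)"
    then obtain u where "u \<in> U" "x - u \<in> G" using quot_proj_eq_iff[OF assms] by auto
    then show "x \<in> (\<Union>g\<in>G. (+) g ` U)" by (intro UN_I[of "x - u"] image_eqI[of _ _ u]) auto
  next
    fix x assume "x \<in> (\<Union>g\<in>G. (+) g ` U)"
    then obtain g u where "g \<in> G" "u \<in> U" "x = g + u" by auto
    then show "x \<in> quot_proj G -` (quot_proj G ` U)" using quot_proj_eq_iff[OF assms, of x u] by auto
  qed
  then show "open (quot_proj G -` (quot_proj G ` U))"
    using \<open>open U\<close> by (simp add: open_UN open_translation)
qed blast

lemma separated_fibres_quot_proj:
  assumes "discrete_subgroup G"
  shows "separated_fibres (quot_proj G)"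
proof -
  obtain e where e: "e > 0" "\<And>x. x \<in> G \<Longrightarrow> norm x < e \<Longrightarrow> x = 0"
    using assms unfolding discrete_subgroup_def by blast
  show ?thesis
    unfolding separated_fibres_def quot_proj_eq_iff[OF assms]
  proof (intro exI[of _ e] conjI allI impI e(1))
    fix x y x' y' assume h: "x - y \<in> G \<and> x' - y' \<in> G \<and> norm ((x - y) - (x' - y')) < e"
    then have "(x - y) - (x' - y') \<in> G" using assms unfolding discrete_subgroup_def by blast
    then show "x - y = x' - y'" using e(2) h by fastforce
  qed
qed

lemma Hausdorff_quot_top:
  fixes G :: "'e::euclidean_space set"
  assumes "discrete_subgroup G"
  shows "Hausdorff_space (quot_top G)"
  unfolding Hausdorff_space_def topspace_quot_top
proof (intro allI impI)
  fix X Y assume h: "X \<in> range (quot_proj G) \<and> Y \<in> range (quot_proj G) \<and> X \<noteq> Y"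
  then obtain x y where xy': "X = quot_proj G x" "Y = quot_proj G y" by blast
  then have xy: "X = quot_proj G x" "Y = quot_proj G y" "x - y \<notin> G"
    using h quot_proj_eq_iff[OF assms, of x y] by auto
  obtain e where e: "e > 0" "\<And>x. x \<in> G \<Longrightarrow> norm x < e \<Longrightarrow> x = 0"
    using assms unfolding discrete_subgroup_def by blast
  \<comment> \<open>Two elements of \<open>G\<close> within \<open>e/2\<close> of \<open>x - y\<close> coincide, so a positive distance is attained.\<close>
  have "\<exists>d>0. \<forall>g\<in>G. norm ((x - y) - g) \<ge> d"
  proof (cases "\<exists>g\<in>G. norm ((x - y) - g) < e / 2")
    case False
    then show ?thesis using e(1) by (intro exI[of _ "e/2"]) force
  next
    case True
    then obtain g where g: "g \<in> G" "norm ((x - y) - g) < e / 2" by blast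
    have "norm ((x - y) - h) \<ge> min (e/2) (norm ((x - y) - g))" if "h \<in> G" for h
    proof (cases "norm ((x - y) - h) < e / 2")
      case True
      have "norm (g - h) \<le> norm ((x - y) - h) + norm ((x - y) - g)"
        by (metis add.commute dist_norm dist_triangle dist_commute)
      then have "norm (g - h) < e" using True g(2) by simp
      moreover have "g - h \<in> G" using assms g(1) that unfolding discrete_subgroup_def by blast
      ultimately have "g = h" using e(2) by fastforce
      then show ?thesis by simp
    qed auto
    moreover have "min (e/2) (norm ((x - y) - g)) > 0" using e(1) xy(3) g(1) by auto
    ultimately show ?thesis by blast
  qed
  then obtain d where d: "d > 0" "\<And>g. g \<in> G \<Longrightarrow> norm ((x - y) - g) \<ge> d" by blast
  have "disjnt (quot_proj G ` ball x (d/2)) (quot_proj G ` ball y (d/2))"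
    unfolding disjnt_iff
  proof (intro allI notI)
    fix z assume z: "z \<in> quot_proj G ` ball x (d/2) \<and> z \<in> quot_proj G ` ball y (d/2)"
    then obtain a b where ab: "dist x a < d/2" "dist y b < d/2" "quot_proj G a = quot_proj G b" by auto
    then have "a - b \<in> G" using quot_proj_eq_iff[OF assms] by blast
    then have "norm ((x - y) - (a - b)) \<ge> d" by (rule d(2))
    moreover have "norm ((x - y) - (a - b)) \<le> norm (x - a) + norm (y - b)"
      using norm_triangle_ineq4[of "x - a" "y - b"] by (simp add: algebra_simps)
    ultimately show False using ab by (simp add: dist_norm)
  qed
  moreover have "openin (quot_top G) (quot_proj G ` ball z (d/2))" for z
    using open_map_quot_proj[OF assms] unfolding open_map_def by simp
  ultimately show "\<exists>U V. openin (quot_top G) U \<and> openin (quot_top G) V \<and> X \<in> U \<and> Y \<in> V \<and> disjnt U V"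
    using xy d(1) by (intro exI[of _ "quot_proj G ` ball x (d/2)"] exI[of _ "quot_proj G ` ball y (d/2)"]) auto
qed

lemma second_countable_euclidean_space: "second_countable (euclidean :: 'e::euclidean_space topology)"
proof -
  obtain B :: "'e set set" where B: "countable B" "topological_basis B" using ex_countable_basis by blast
  show ?thesis
    unfolding second_countable_def
  proof (intro exI[of _ B] conjI allI impI ballI)
    show "countable B" by (rule B(1))
    show "openin euclidean V" if "V \<in> B" for V using topological_basis_open[OF B(2) that] by simp
    fix U :: "'e set" and x assume "openin euclidean U \<and> x \<in> U"
    then show "\<exists>V\<in>B. x \<in> V \<and> V \<subseteq> U" using topological_basisE[OF B(2)] by (metis open_openin)
  qed
qed

lemma second_countable_quot_top:
  fixes G :: "'e::euclidean_space set"
  assumes "discrete_subgroup G"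
  shows "second_countable (quot_top G)"
proof (rule second_countable_open_map_image[OF continuous_map_quot_proj open_map_quot_proj[OF assms]])
  show "quot_proj G ` topspace euclidean = topspace (quot_top G)" by (simp add: topspace_quot_top)
  show "second_countable (euclidean :: 'e topology)"
    by (rule second_countable_euclidean_space)
qed

section \<open>Full lattices and the phase torus\<close>

lemma full_lattice_image:
  assumes "full_lattice (\<Lambda> :: (real^'n::finite) set)"
  obtains A :: "real^'n \<Rightarrow> real^'n" where "linear A" "inj A" "\<Lambda> = A ` int_lattice"
proof -
  obtain v :: "'n \<Rightarrow> real^'n" where v: "inj v" "independent (range v)"
      "\<Lambda> = {(\<Sum>i\<in>UNIV. of_int (c i) *\<^sub>R v i) | c. True}"
    using assms unfolding full_lattice_def by blast
  define A where "A = (\<lambda>x :: real^'n. \<Sum>i\<in>UNIV. x $ i *\<^sub>R v i)"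
  have lin: "linear A"
    by (rule linearI) (simp_all add: A_def scaleR_add_left sum.distrib scaleR_sum_right)
  have "inj A"
    unfolding linear_injective_0[OF lin]
  proof (intro allI impI)
    fix x assume "A x = 0"
    have n: "($) (\<chi> i. v i) = v" by (rule ext) simp
    have "x $ i = 0" for i
    proof (rule independent_frame_sum_0[of "\<chi> i. v i" "\<lambda>i. x $ i"])
      show "(\<Sum>i\<in>UNIV. x $ i *\<^sub>R (\<chi> i. v i) $ i) = 0" using \<open>A x = 0\<close> by (simp add: A_def)
    qed (simp_all add: n v(1,2))
    then show "x = 0" by (simp add: vec_eq_iff)
  qed
  moreover have "\<Lambda> = A ` int_lattice"
  proof (intro equalityI subsetI)
    fix x assume "x \<in> \<Lambda>"
    then obtain c :: "'n \<Rightarrow> int" where "x = (\<Sum>i\<in>UNIV. of_int (c i) *\<^sub>R v i)" unfolding v(3) by blast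
    then have "x = A (\<chi> i. of_int (c i))" by (simp add: A_def)
    then show "x \<in> A ` int_lattice" by (auto simp: int_lattice_def)
  next
    fix x assume "x \<in> A ` int_lattice"
    then obtain y where y: "\<forall>i. y $ i \<in> \<int>" "x = A y" by (auto simp: int_lattice_def)
    have "y $ i = of_int \<lfloor>y $ i\<rfloor>" for i using y(1) by (metis floor_of_int Ints_cases)
    then have "x = (\<Sum>i\<in>UNIV. of_int \<lfloor>y $ i\<rfloor> *\<^sub>R v i)" unfolding y(2) A_def by metis
    then show "x \<in> \<Lambda>" unfolding v(3) by (intro CollectI exI[of _ "\<lambda>i. \<lfloor>y $ i\<rfloor>"]) simp
  qed
  ultimately show ?thesis using that lin by blast
qed

lemma discrete_subgroup_image_int_lattice:
  fixes A :: "real^'n::finite \<Rightarrow> real^'n"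
  assumes A: "linear A" "inj A"
  shows "discrete_subgroup (A ` int_lattice)"
  unfolding discrete_subgroup_def
proof (intro conjI ballI)
  show "0 \<in> A ` int_lattice"
    by (rule image_eqI[of _ _ 0]) (simp_all add: linear_0[OF A(1)] int_lattice_def)
  show "x - y \<in> A ` int_lattice" if "x \<in> A ` int_lattice" "y \<in> A ` int_lattice" for x y
  proof -
    obtain a b where "a \<in> int_lattice" "b \<in> int_lattice" "x = A a" "y = A b" using \<open>x \<in> _\<close> \<open>y \<in> _\<close> by blast
    then show ?thesis
      by (intro image_eqI[of _ _ "a - b"]) (simp_all add: linear_diff[OF A(1)] int_lattice_def)
  qed
  obtain B where B: "B > 0" "\<And>x. B * norm x \<le> norm (A x)"
    using linear_inj_bounded_below_pos[OF A] by blast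
  have "x = 0" if "x \<in> A ` int_lattice" "norm x < B" for x
  proof -
    obtain a where a: "a \<in> int_lattice" "x = A a" using \<open>x \<in> _\<close> by blast
    have "a $ i = 0" for i
    proof (rule ccontr)
      assume "a $ i \<noteq> 0"
      then have "1 \<le> \<bar>a $ i\<bar>" using a(1) by (simp add: int_lattice_def Ints_nonzero_abs_ge1)
      also have "\<dots> \<le> norm a" by (rule component_le_norm_cart)
      finally have "B * 1 \<le> B * norm a" using B(1) by (intro mult_left_mono) auto
      then show False using B(2)[of a] a(2) that(2) by simp
    qed
    then have "a = 0" by (simp add: vec_eq_iff)
    then show ?thesis using a(2) linear_0[OF A(1)] by simp
  qed
  then show "\<exists>e>0. \<forall>x\<in>A ` int_lattice. norm x < e \<longrightarrow> x = 0" using B(1) by blast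
qed

lemma dual_int_lattice: "dual_lattice int_lattice = int_lattice"
proof (intro equalityI subsetI)
  fix p :: "real^'n" assume "p \<in> dual_lattice int_lattice"
  then have "p \<bullet> axis i 1 \<in> \<int>" for i
    by (auto simp: dual_lattice_def int_lattice_def axis_def)
  then show "p \<in> int_lattice" by (simp add: int_lattice_def inner_axis)
next
  fix p :: "real^'n" assume "p \<in> int_lattice"
  then show "p \<in> dual_lattice int_lattice"
    by (auto simp: dual_lattice_def int_lattice_def inner_vec_def intro!: Ints_sum)
qed

lemma discrete_subgroup_Times:
  assumes "discrete_subgroup G" "discrete_subgroup H"
  shows "discrete_subgroup (G \<times> H)"
proof -
  obtain e where e: "e > 0" "\<And>x. x \<in> G \<Longrightarrow> norm x < e \<Longrightarrow> x = 0"
    using assms(1) unfolding discrete_subgroup_def by blast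
  obtain d where d: "d > 0" "\<And>x. x \<in> H \<Longrightarrow> norm x < d \<Longrightarrow> x = 0"
    using assms(2) unfolding discrete_subgroup_def by blast
  have "z = 0" if "z \<in> G \<times> H" "norm z < min e d" for z
  proof -
    have "norm (fst z) \<le> norm z" "norm (snd z) \<le> norm z"
      by (metis norm_fst_le prod.collapse, metis norm_snd_le prod.collapse)
    then show ?thesis using e(2)[of "fst z"] d(2)[of "snd z"] that by (auto simp: prod_eq_iff)
  qed
  then show ?thesis
    using assms e(1) d(1) unfolding discrete_subgroup_def
    by (auto simp: zero_prod_def intro!: exI[of _ "min e d"])
qed

lemma discrete_subgroup_full_lattice: "full_lattice \<Lambda> \<Longrightarrow> discrete_subgroup \<Lambda>"
  by (metis full_lattice_image discrete_subgroup_image_int_lattice)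

lemma discrete_subgroup_phase_lattice:
  assumes "full_lattice (\<Lambda> :: (real^'n::finite) set)"
  shows "discrete_subgroup (phase_lattice \<Lambda>)"
proof -
  have "discrete_subgroup ((\<lambda>x :: real^'n. x) ` int_lattice)"
    by (rule discrete_subgroup_image_int_lattice) (simp_all add: linear_ident)
  then show ?thesis
    unfolding phase_lattice_def dual_int_lattice
    using discrete_subgroup_Times[OF discrete_subgroup_full_lattice[OF assms]] by simp
qed

lemma X_proj_eq_iff:
  assumes "full_lattice (\<Lambda> :: (real^'n::finite) set)"
  shows "X_proj \<Lambda> (q, p) = X_proj \<Lambda> (q', p') \<longleftrightarrow> q - q' \<in> \<Lambda> \<and> p - p' \<in> int_lattice"
  unfolding X_proj_def quot_proj_eq_iff[OF discrete_subgroup_phase_lattice[OF assms]]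
  by (simp add: phase_lattice_def dual_int_lattice)

lemma separated_fibres_X_proj:
  "full_lattice (\<Lambda> :: (real^'n::finite) set) \<Longrightarrow> separated_fibres (X_proj \<Lambda>)"
  unfolding X_proj_def by (intro separated_fibres_quot_proj discrete_subgroup_phase_lattice)

lemma separated_fibres_map_prod:
  assumes "separated_fibres P"
  shows "separated_fibres (map_prod P id)"
proof -
  obtain e where e: "e > 0" "\<And>x y x' y'. P x = P y \<Longrightarrow> P x' = P y' \<Longrightarrow>
        norm ((x - y) - (x' - y')) < e \<Longrightarrow> x - y = x' - y'"
    using assms unfolding separated_fibres_def by blast
  show ?thesis
    unfolding separated_fibres_def
  proof (intro exI[of _ e] conjI allI impI e(1))
    fix x y x' y' :: "'a \<times> 'c"
    assume h: "map_prod P id x = map_prod P id y \<and> map_prod P id x' = map_prod P id y' \<and>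
       norm ((x - y) - (x' - y')) < e"
    have "norm ((fst x - fst y) - (fst x' - fst y')) \<le> norm ((x - y) - (x' - y'))"
      by (metis norm_fst_le prod.collapse fst_diff)
    then have "fst x - fst y = fst x' - fst y'"
      using h by (intro e(2)) (auto simp: prod_eq_iff)
    then show "x - y = x' - y'" using h by (auto simp: prod_eq_iff)
  qed
qed

lemma separated_fibres_XC_proj:
  "full_lattice (\<Lambda> :: (real^'n::finite) set) \<Longrightarrow> separated_fibres (XC_proj \<Lambda>)"
  unfolding XC_proj_def by (intro separated_fibres_map_prod separated_fibres_X_proj)

lemma Hausdorff_X_top: "full_lattice (\<Lambda> :: (real^'n::finite) set) \<Longrightarrow> Hausdorff_space (X_top \<Lambda>)"
  unfolding X_top_def by (intro Hausdorff_quot_top discrete_subgroup_phase_lattice)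

lemma continuous_map_X_proj: "continuous_map euclidean (X_top \<Lambda>) (X_proj \<Lambda>)"
  unfolding X_top_def X_proj_def by (rule continuous_map_quot_proj)

lemma topspace_X_top: "topspace (X_top \<Lambda>) = range (X_proj \<Lambda>)"
  by (simp add: X_top_def X_proj_def topspace_quot_top)

text \<open>The unit cube, in coordinates given by a basis of the lattice, meets every coset.\<close>

lemma compact_space_X_top:
  assumes "full_lattice (\<Lambda> :: (real^'n::finite) set)"
  shows "compact_space (X_top \<Lambda>)"
proof -
  obtain A :: "real^'n \<Rightarrow> real^'n" where A: "linear A" "inj A" "\<Lambda> = A ` int_lattice"
    using full_lattice_image[OF assms] .
  have surj: "surj A" using A linear_injective_imp_surjective by blast
  let ?K = "A ` cbox 0 1 \<times> cbox 0 (1 :: real^'n)"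
  have "continuous_on UNIV A" using A(1) by (simp add: linear_continuous_on linear_conv_bounded_linear)
  then have "compact (A ` cbox 0 1)" by (rule compact_continuous_image[OF continuous_on_subset[OF _ subset_UNIV] compact_cbox])
  then have "compact ?K" by (intro compact_Times) auto
  then have "compactin (X_top \<Lambda>) (X_proj \<Lambda> ` ?K)"
    using image_compactin[OF _ continuous_map_X_proj] by simp
  moreover have "X_proj \<Lambda> ` ?K = topspace (X_top \<Lambda>)"
    unfolding topspace_X_top
  proof (intro equalityI subsetI)
    fix x assume "x \<in> range (X_proj \<Lambda>)"
    then obtain q p where x: "x = X_proj \<Lambda> (q, p)" by auto
    obtain u where u: "q = A u" using surj by (metis surjD)
    let ?fr = "\<lambda>w :: real^'n. \<chi> i. frac (w $ i)"
    have fr: "?fr w \<in> cbox 0 1" "w - ?fr w \<in> int_lattice" for w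
      by (auto simp: mem_box_cart frac_def int_lattice_def one_vec_def intro: less_imp_le) linarith+
    have "q - A (?fr u) \<in> \<Lambda>"
      unfolding A(3) u linear_diff[OF A(1), symmetric] using fr(2) by (rule imageI)
    then have "x = X_proj \<Lambda> (A (?fr u), ?fr p)"
      unfolding x X_proj_eq_iff[OF assms] using fr(2) by blast
    then show "x \<in> X_proj \<Lambda> ` ?K" using fr(1) by blast
  qed auto
  ultimately show ?thesis by (simp add: compact_space_def)
qed

section \<open>The product with a line\<close>

lemma C1_on_Pair:
  assumes "C1_on S f" "C1_on S g"
  shows "C1_on S (\<lambda>x. (f x, g x))"
  by (rule C1_onI[OF has_derivative_Pair[OF C1_onD[OF assms(1)] C1_onD[OF assms(2)]]])
     (auto intro!: continuous_on_Pair C1_on_cont assms)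

text \<open>The index \<open>None\<close> is reserved for the coordinate along the line.\<close>

definition rest :: "real^('n::finite option) \<Rightarrow> real^'n" where
  "rest w = (\<chi> i. w $ Some i)"

lemma linear_rest: "linear rest"
  by (rule linearI) (simp_all add: rest_def vec_eq_iff)

lemma sum_option: "(\<Sum>k\<in>UNIV. g k) = g None + (\<Sum>i\<in>UNIV. g (Some i))"
  for g :: "'n::finite option \<Rightarrow> real"
  by (simp add: UNIV_option_conv sum.reindex)

text \<open>The interval is wider than the support of \<open>tent\<close>, and bounded in order to fit into an
  end of a cobordism.\<close>

definition line_top :: "'v topology \<Rightarrow> ('v \<times> real) topology" where
  "line_top T = prod_topology T (top_of_set {-2<..<2})"

definition line_chart :: "('n::finite, 'v, 'e) lchart \<Rightarrow> ('n option, 'v \<times> real, 'e \<times> complex) lchart" where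
  "line_chart = (\<lambda>(W, \<psi>, F). ({w. rest w \<in> W \<and> w $ None \<in> {-2<..<2}},
      \<lambda>w. (\<psi> (rest w), w $ None), \<lambda>w. (F (rest w), Complex (w $ None) 0)))"

definition line_map :: "('v \<Rightarrow> 'x) \<Rightarrow> 'v \<times> real \<Rightarrow> 'x \<times> complex" where
  "line_map f = (\<lambda>(x, t). (f x, Complex t 0))"

lemma linear_line_coord: "linear (\<lambda>w :: real^('n::finite option). Complex (w $ None) 0)"
  by (rule linearI) (simp_all add: complex_eq_iff)

lemma C1_chart_line:
  fixes F :: "real^'n::finite \<Rightarrow> 'e::euclidean_space"
  assumes c: "C1_chart P T f W \<psi> F"
  defines "W' \<equiv> {w. rest w \<in> W \<and> w $ None \<in> {-2<..<2}}"
  shows "C1_chart (map_prod P id) (line_top T) (line_map f) W' (\<lambda>w. (\<psi> (rest w), w $ None))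
           (\<lambda>w. (F (rest w), Complex (w $ None) 0))"
    and "\<And>w v. rest w \<in> W \<Longrightarrow>
       fd (\<lambda>w. (F (rest w), Complex (w $ None) 0)) w v = (fd F (rest w) (rest v), Complex (v $ None) 0)"
proof -
  let ?\<psi> = "\<lambda>w. (\<psi> (rest w), w $ None)" and ?F = "\<lambda>w. (F (rest w), Complex (w $ None) 0)"
  have oW: "open W" and F: "C1_on W F" using c by (auto simp: C1_chart_def)
  have crest: "continuous_on S (rest :: real^('n option) \<Rightarrow> real^'n)" for S
    by (rule linear_continuous_on[OF linear_conv_bounded_linear[THEN iffD1, OF linear_rest]])
  have "open (rest -` W)" using oW crest by (simp add: open_vimage)
  moreover have "open {w :: real^('n option). w $ None \<in> {-2<..<2}}"
    by (rule open_vimage[of "{-2<..<2}" "\<lambda>w. w $ None", unfolded vimage_def]) (auto intro!: continuous_intros)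
  ultimately have oW': "open W'" unfolding W'_def by (simp add: vimage_def Collect_conj_eq open_Int)
  have der: "(?F has_derivative (\<lambda>v. (fd F (rest w) (rest v), Complex (v $ None) 0))) (at w)" if "rest w \<in> W" for w
    by (intro has_derivative_Pair has_derivative_compose[OF linear_imp_has_derivative[OF linear_rest] C1_onD[OF F that]]
        linear_imp_has_derivative[OF linear_line_coord])
  then show fdF: "fd ?F w v = (fd F (rest w) (rest v), Complex (v $ None) 0)" if "rest w \<in> W" for w v
    using fdI[OF der[OF that]] by simp
  have "C1_on W' ?F"
    by (intro C1_on_Pair C1_on_linear[OF linear_line_coord] C1_on_compose[OF C1_on_linear[OF linear_rest] F])
       (auto simp: W'_def)
  moreover have "inj (fd ?F w)" if "w \<in> W'" for w
  proof (rule injI)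
    fix u v assume h: "fd ?F w u = fd ?F w v"
    have rw: "rest w \<in> W" using that by (simp add: W'_def)
    have "inj (fd F (rest w))" using c rw by (simp add: C1_chart_def)
    then have "rest u = rest v" "u $ None = v $ None" using h unfolding fdF[OF rw] by (auto dest: injD)
    then show "u = v" unfolding rest_def vec_eq_iff by (metis not_None_eq vec_lambda_beta)
  qed
  moreover have "embedding_map (top_of_set W') (line_top T) ?\<psi> \<and> openin (line_top T) (?\<psi> ` W')"
  proof -
    have cm: "continuous_map (top_of_set W') (line_top T) ?\<psi>"
      unfolding line_top_def
    proof (rule continuous_map_pairedI)
      have "continuous_map (top_of_set W') (top_of_set W) rest" using crest by (auto simp: W'_def)
      from continuous_map_compose[OF this C1_chart_continuous_map[OF c]]
      show "continuous_map (top_of_set W') T (\<lambda>w. \<psi> (rest w))" by (simp add: o_def)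
      show "continuous_map (top_of_set W') (top_of_set {-2<..<2}) (\<lambda>w. w $ None)"
        by (auto simp: W'_def intro!: continuous_intros)
    qed
    have opn: "openin (line_top T) (?\<psi> ` U)" if U: "open U" "U \<subseteq> W'" for U
      unfolding line_top_def openin_prod_topology_alt
    proof (intro allI impI)
      fix x t assume "(x, t) \<in> ?\<psi> ` U"
      then obtain w where w: "w \<in> U" "x = \<psi> (rest w)" "t = w $ None" by auto
      define J where "J = (\<lambda>(y :: real^'n, s). \<chi> k. case k of None \<Rightarrow> s | Some i \<Rightarrow> y $ i)"
      have J: "rest (J (y, s)) = y" "J (y, s) $ None = s" for y s by (simp_all add: J_def rest_def vec_eq_iff)
      have Jw: "J (rest w, w $ None) = w"
        by (simp add: J_def rest_def vec_eq_iff split: option.split)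
      have cJ: "continuous_on UNIV J"
      proof -
        have "continuous_on UNIV (\<lambda>z :: (real^'n) \<times> real. case k of None \<Rightarrow> snd z | Some i \<Rightarrow> fst z $ i)" for k
          by (cases k) (auto intro!: continuous_intros)
        moreover have "J = (\<lambda>z. \<chi> k. case k of None \<Rightarrow> snd z | Some i \<Rightarrow> fst z $ i)" by (auto simp: J_def)
        ultimately show ?thesis by (simp add: continuous_on_vec_lambda)
      qed
      have "open (J -` U)" using cJ U(1) by (simp add: open_vimage)
      moreover have "(rest w, w $ None) \<in> J -` U" using w(1) Jw by simp
      ultimately obtain V I where VI: "open V" "open I" "rest w \<in> V" "w $ None \<in> I" "V \<times> I \<subseteq> J -` U"
        by (rule open_prod_elim) (auto simp: mem_Times_iff)
      have sub: "y \<in> W \<and> s \<in> {-2<..<2}" if "y \<in> V" "s \<in> I" for y s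
      proof -
        have "J (y, s) \<in> W'" using VI(5) U(2) that by blast
        then show ?thesis using J unfolding W'_def by auto
      qed
      have VW: "V \<subseteq> W" using sub VI(4) by blast
      have "openin T (\<psi> ` V)" using C1_chart_subset[OF c VI(1) VW] by (simp add: C1_chart_def)
      moreover have "openin (top_of_set {-2<..<2}) I" using VI(2,3) sub by (auto simp: openin_open_eq)
      moreover have "\<psi> ` V \<times> I \<subseteq> ?\<psi> ` U"
      proof
        fix z assume "z \<in> \<psi> ` V \<times> I"
        then obtain y s where "z = (\<psi> y, s)" "y \<in> V" "s \<in> I" by auto
        then show "z \<in> ?\<psi> ` U" using J VI(5) by (intro image_eqI[of _ _ "J (y, s)"]) auto
      qed
      ultimately show "\<exists>U' V'. openin T U' \<and> openin (top_of_set {-2<..<2}) V' \<and> x \<in> U' \<and> t \<in> V' \<and> U' \<times> V' \<subseteq> ?\<psi> ` U"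
        using w VI(3,4) by blast
    qed
    have "inj_on ?\<psi> W'"
    proof (rule inj_onI)
      fix u v assume h: "u \<in> W'" "v \<in> W'" "?\<psi> u = ?\<psi> v"
      then have "rest u = rest v" "u $ None = v $ None"
        using C1_chart_inj[OF c] by (auto simp: W'_def dest: inj_onD)
      then show "u = v" unfolding rest_def vec_eq_iff by (metis not_None_eq vec_lambda_beta)
    qed
    moreover have "open_map (top_of_set W') (line_top T) ?\<psi>"
      unfolding open_map_def using opn oW' by (auto simp: openin_open_eq)
    ultimately show ?thesis using injective_open_imp_embedding_map[OF cm] opn[OF oW'] by simp
  qed
  ultimately show "C1_chart (map_prod P id) (line_top T) (line_map f) W' ?\<psi> ?F"
    using oW' c unfolding C1_chart_def by (auto simp: line_map_def W'_def)
qed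

lemma oriented_atlas_line:
  fixes \<A> :: "('n::finite, 'v, 'e::euclidean_space) lchart set"
  assumes "oriented_atlas P T f \<A>"
  shows "oriented_atlas (map_prod P id) (line_top T) (line_map f) (line_chart ` \<A>)"
proof -
  interpret oriented_atlas P T f \<A> by (rule assms)
  show ?thesis
  proof
    show "Hausdorff_space (line_top T)"
      unfolding line_top_def by (simp add: Hausdorff_space_prod_topology haus Hausdorff_space_subtopology)
    show "separated_fibres (map_prod P (id :: complex \<Rightarrow> complex))" by (rule separated_fibres_map_prod[OF sep])
    show "C1_chart (map_prod P id) (line_top T) (line_map f) W \<psi> F" if "(W, \<psi>, F) \<in> line_chart ` \<A>" for W \<psi> F
      using that C1_chart_line(1)[OF chart] by (auto simp: line_chart_def)
    show "\<exists>W \<psi> F. (W, \<psi>, F) \<in> line_chart ` \<A> \<and> z \<in> \<psi> ` W" if z: "z \<in> topspace (line_top T)" for z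
    proof -
      obtain x t where xt: "z = (x, t)" "x \<in> topspace T" "t \<in> {-2<..<2}" using z by (auto simp: line_top_def)
      obtain W \<psi> F y where c: "(W, \<psi>, F) \<in> \<A>" "y \<in> W" "x = \<psi> y" using cover[OF xt(2)] by blast
      let ?w = "\<chi> k. case k of None \<Rightarrow> t | Some i \<Rightarrow> y $ i"
      have "rest ?w = y" "?w $ None = t" by (simp_all add: rest_def vec_eq_iff)
      then have "z \<in> (\<lambda>w. (\<psi> (rest w), w $ None)) ` {w. rest w \<in> W \<and> w $ None \<in> {-2<..<2}}"
        using c xt by (intro image_eqI[of _ _ ?w]) auto
      moreover have "line_chart (W, \<psi>, F) \<in> line_chart ` \<A>" using c by blast
      ultimately show ?thesis unfolding line_chart_def split by blast
    qed
    show "\<exists>A :: real^('n option)^('n option). det A > 0 \<and> (\<forall>v. fd F y v = fd F' y' (A *v v))"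
      if c: "(W, \<psi>, F) \<in> line_chart ` \<A>" and c': "(W', \<psi>', F') \<in> line_chart ` \<A>"
        and y: "y \<in> W" "y' \<in> W'" "\<psi> y = \<psi>' y'" for W \<psi> F W' \<psi>' F' y y'
    proof -
      obtain U \<phi> G where c1: "(U, \<phi>, G) \<in> \<A>" "(W, \<psi>, F) = line_chart (U, \<phi>, G)" using c by auto
      obtain U' \<phi>' G' where c2: "(U', \<phi>', G') \<in> \<A>" "(W', \<psi>', F') = line_chart (U', \<phi>', G')" using c' by auto
      have yy: "rest y \<in> U" "rest y' \<in> U'" "\<phi> (rest y) = \<phi>' (rest y')"
        using y c1(2) c2(2) by (auto simp: line_chart_def)
      obtain A :: "real^'n^'n" where A: "det A > 0" "\<And>v. fd G (rest y) v = fd G' (rest y') (A *v v)"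
        using positive[OF c1(1) c2(1) yy] by blast
      \<comment> \<open>The block sum of \<open>A\<close> and the identity on the line.\<close>
      define B :: "real^('n option)^('n option)" where
        "B = (\<chi> k l. case k of None \<Rightarrow> (if l = None then 1 else 0) | Some i \<Rightarrow> (case l of None \<Rightarrow> 0 | Some j \<Rightarrow> A $ i $ j))"
      have "det B = det (\<chi> i j. B $ Some i $ Some j)"
        by (rule det_inj_block) (auto simp: B_def notin_range_Some)
      also have "(\<chi> i j. B $ Some i $ Some j) = A" by (simp add: B_def vec_eq_iff)
      finally have "det B > 0" using A(1) by simp
      moreover have "rest (B *v v) = A *v rest v" "(B *v v) $ None = v $ None" for v
        by (simp_all add: vec_eq_iff rest_def matrix_vector_mult_def sum_option B_def)
      then have "fd F y v = fd F' y' (B *v v)" for v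
        using c1(2) c2(2) C1_chart_line(2)[OF chart[OF c1(1)] yy(1)] C1_chart_line(2)[OF chart[OF c2(1)] yy(2)] A(2)
        by (simp add: line_chart_def)
      ultimately show ?thesis by blast
    qed
  qed
qed

section \<open>Weighted volume forms\<close>

text \<open>The weight \<open>w\<close> times the wedge product of the differentials of the components of \<open>A\<close>.\<close>

definition vol_form :: "('e \<Rightarrow> real^'m) \<Rightarrow> ('v \<Rightarrow> real) \<Rightarrow> ('m::finite, 'v, 'e::euclidean_space) form" where
  "vol_form A w = (\<lambda>(W, \<psi>, F) y. w (\<psi> y) * det (matrix (\<lambda>v. A (fd F y v))))"

lemma (in oriented_atlas) top_form_vol_form:
  assumes A: "linear A" and w: "\<And>W \<psi> F. (W, \<psi>, F) \<in> \<A> \<Longrightarrow> continuous_on W (\<lambda>y. w (\<psi> y))"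
  shows "top_form (vol_form A w)"
proof (rule top_formI)
  fix W \<psi> F assume c: "(W, \<psi>, F) \<in> \<A>"
  have F: "C1_on W F" using chart[OF c] by (simp add: C1_chart_def)
  have cA: "continuous_on UNIV A" using A by (simp add: linear_continuous_on linear_conv_bounded_linear)
  have "continuous_on W (\<lambda>y. A (fd F y v) $ i)" for v i
    by (intro continuous_intros continuous_on_compose2[OF cA C1_on_cont[OF F]]) simp
  then have "continuous_on W (\<lambda>y. det (matrix (\<lambda>v. A (fd F y v))))"
    by (intro continuous_on_det_matrix)
  then show "continuous_on W (vol_form A w (W, \<psi>, F))"
    unfolding vol_form_def split by (rule continuous_on_mult[OF w[OF c]])
next
  fix W \<psi> F W' \<psi>' F' y y' B
  assume c: "(W, \<psi>, F) \<in> \<A>" "(W', \<psi>', F') \<in> \<A>" and y: "y \<in> W" "y' \<in> W'" "\<psi> y = \<psi>' y'"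
    and B: "\<And>v. fd F y v = fd F' y' (B *v v)"
  have "C1_on W' F'" using chart[OF c(2)] by (simp add: C1_chart_def)
  then have "linear (fd F' y')" using C1_onD y(2) has_derivative_linear by blast
  then have lin: "linear (\<lambda>v. A (fd F' y' v))" using linear_compose[OF _ A] by (simp add: o_def)
  have "(\<lambda>v. A (fd F y v)) = (\<lambda>v. A (fd F' y' v)) \<circ> (\<lambda>v. B *v v)" by (auto simp: B)
  then have "matrix (\<lambda>v. A (fd F y v)) = matrix (\<lambda>v. A (fd F' y' v)) ** B"
    by (simp add: matrix_compose lin matrix_vector_mul_linear)
  then show "vol_form A w (W, \<psi>, F) y = det B * vol_form A w (W', \<psi>', F') y'"
    by (simp add: vol_form_def det_mul y(3))
qed

text \<open>The derivative of \<open>ramp\<close>, a continuously differentiable step from 0 to 2.\<close>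

definition tent :: "real \<Rightarrow> real" where
  "tent t = 2 * (max 0 (t + 1) - 2 * max 0 t + max 0 (t - 1))"

definition ramp :: "real \<Rightarrow> real" where
  "ramp t = sq_pos (t + 1) - 2 * sq_pos t + sq_pos (t - 1)"

lemma tent: "0 \<le> tent t" "1 \<le> \<bar>t\<bar> \<Longrightarrow> tent t = 0" "\<bar>t\<bar> < 1 \<Longrightarrow> 0 < tent t"
  by (auto simp: tent_def max_def)

lemma continuous_on_tent: "continuous_on S tent"
  unfolding tent_def[abs_def] by (intro continuous_intros)

lemma ramp: "t \<le> -1 \<Longrightarrow> ramp t = 0" "1 \<le> t \<Longrightarrow> ramp t = 2"
  by (auto simp: ramp_def sq_pos_def max_def power2_eq_square algebra_simps)

lemma ramp_has_derivative: "(ramp has_real_derivative tent t) (at t)"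
proof -
  have s: "((\<lambda>t. sq_pos (t + c)) has_real_derivative 2 * max 0 (t + c)) (at t)" for c
    using DERIV_shift[of sq_pos "2 * max 0 (t + c)" t c] sq_pos_has_derivative[of "t + c"] by simp
  show ?thesis
    unfolding ramp_def[abs_def] tent_def using s[of 1] s[of 0] s[of "-1"]
    by (auto intro!: derivative_eq_intros simp: algebra_simps)
qed

section \<open>The degree of a brane\<close>

text \<open>The linear functions \<open>(Re z, p\<^sub>1, \<dots>, p\<^sub>n)\<close> on the universal cover of
  \<open>X \<times> \<complex>\<close>; all of them are invariant under translations in \<open>q\<close>, and their
  differentials descend to the quotient.\<close>

definition fibre_coords :: "'n::finite phase \<times> complex \<Rightarrow> real^('n option)" where
  "fibre_coords z = (\<chi> k. case k of None \<Rightarrow> Re (snd z) | Some i \<Rightarrow> snd (fst z) $ i)"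

lemma linear_fibre_coords: "linear fibre_coords"
  by (rule linearI) (auto simp: fibre_coords_def vec_eq_iff split: option.split)

abbreviation brane_charts :: "(real^'n) set \<Rightarrow> 'n brane \<Rightarrow> ('n::finite, 'n pt, 'n phase) lchart set" where
  "brane_charts \<Lambda> B \<equiv> positive_charts (X_proj \<Lambda>) (subtopology (X_top \<Lambda>) (fst B)) id (fst (snd B))"

text \<open>Up to the factor 2, the integral of \<open>tent\<close>, this is the integral of \<open>dp\<^sub>1 \<and>
  \<dots> \<and> dp\<^sub>n\<close> over the brane.\<close>

definition has_degree :: "(real^'n) set \<Rightarrow> 'n::finite brane \<Rightarrow> real \<Rightarrow> bool" where
  "has_degree \<Lambda> B d \<longleftrightarrow>
     oriented_atlas.has_form_integral (line_top (subtopology (X_top \<Lambda>) (fst B))) (line_chart ` brane_charts \<Lambda> B)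
       (vol_form fibre_coords (\<lambda>z. tent (snd z))) d"

definition brane_degree :: "(real^'n) set \<Rightarrow> 'n::finite brane \<Rightarrow> real" where
  "brane_degree \<Lambda> B = (THE d. has_degree \<Lambda> B d)"

lemma brane_atlas:
  fixes B :: "'n::finite brane"
  assumes "full_lattice \<Lambda>" "B \<in> branes \<Lambda>"
  shows "oriented_atlas (X_proj \<Lambda>) (subtopology (X_top \<Lambda>) (fst B)) id (brane_charts \<Lambda> B)"
  using assms(2)
  by (intro oriented_atlas_positive_charts[OF _ _ separated_fibres_X_proj[OF assms(1)]])
     (auto simp: branes_def Let_def)

lemma brane_line_atlas:
  fixes B :: "'n::finite brane"
  assumes "full_lattice \<Lambda>" "B \<in> branes \<Lambda>"
  shows "oriented_atlas (XC_proj \<Lambda>) (line_top (subtopology (X_top \<Lambda>) (fst B))) (line_map id) (line_chart ` brane_charts \<Lambda> B)"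
  using oriented_atlas_line[OF brane_atlas[OF assms]] by (simp add: XC_proj_def)

lemma line_tent_form:
  fixes B :: "'n::finite brane"
  assumes "full_lattice \<Lambda>" "B \<in> branes \<Lambda>"
  defines "T \<equiv> line_top (subtopology (X_top \<Lambda>) (fst B))" and "\<A> \<equiv> line_chart ` brane_charts \<Lambda> B"
    and "\<tau> \<equiv> vol_form fibre_coords (\<lambda>z. tent (snd z))"
  shows "oriented_atlas.top_form \<A> \<tau>" "oriented_atlas.supported \<A> \<tau> (fst B \<times> {-1..1})" "compactin T (fst B \<times> {-1..1})"
proof -
  interpret oriented_atlas "XC_proj \<Lambda>" T "line_map id" \<A>
    unfolding T_def \<A>_def by (rule brane_line_atlas[OF assms(1,2)])
  show "top_form \<tau>"
    unfolding \<tau>_def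
  proof (rule top_form_vol_form[OF linear_fibre_coords])
    fix W \<psi> F assume "(W, \<psi>, F) \<in> \<A>"
    then obtain \<phi> where "\<psi> = (\<lambda>w. (\<phi> (rest w), w $ None))" by (auto simp: \<A>_def line_chart_def)
    then show "continuous_on W (\<lambda>y. tent (snd (\<psi> y)))"
      by (auto intro!: continuous_on_compose2[OF continuous_on_tent[of UNIV]] continuous_intros)
  qed
  show "supported \<tau> (fst B \<times> {-1..1})"
    unfolding supported_def
  proof (intro allI impI)
    fix W \<psi> F y assume c: "(W, \<psi>, F) \<in> \<A>" "y \<in> W" "\<psi> y \<notin> fst B \<times> {-1..1}"
    have "\<psi> y \<in> topspace T" by (rule C1_chart_in_topspace[OF chart[OF c(1)] c(2)])
    then have "fst (\<psi> y) \<in> fst B" by (auto simp: T_def line_top_def)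
    then have "1 \<le> \<bar>snd (\<psi> y)\<bar>" using c(3) by (cases "\<psi> y") auto
    then show "\<tau> (W, \<psi>, F) y = 0" by (simp add: \<tau>_def vol_form_def tent(2))
  qed
  have "compactin (X_top \<Lambda>) (fst B)" using assms(2) by (auto simp: branes_def)
  then have "compactin (subtopology (X_top \<Lambda>) (fst B)) (fst B)" by (simp add: compactin_subtopology)
  moreover have "compactin (top_of_set {-2<..<2::real}) {-1..1}" by (auto simp: compactin_subtopology)
  ultimately show "compactin T (fst B \<times> {-1..1})"
    by (simp add: T_def line_top_def compactin_Times)
qed

lemma has_degree_brane_degree:
  fixes B :: "'n::finite brane"
  assumes "full_lattice \<Lambda>" "B \<in> branes \<Lambda>"
  shows "has_degree \<Lambda> B (brane_degree \<Lambda> B)" and "has_degree \<Lambda> B d \<Longrightarrow> brane_degree \<Lambda> B = d"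
proof -
  interpret oriented_atlas "XC_proj \<Lambda>" "line_top (subtopology (X_top \<Lambda>) (fst B))" "line_map id" "line_chart ` brane_charts \<Lambda> B"
    by (rule brane_line_atlas[OF assms])
  note tf = line_tent_form[OF assms]
  obtain ps where "subordinate ps (fst B \<times> {-1..1})" using ex_subordinate[OF tf(3)] by blast
  from has_form_integral_partition[OF tf(1,2) this] obtain d0 where d0: "has_degree \<Lambda> B d0"
    unfolding has_degree_def by blast
  have uniq: "d' = d''" if "has_degree \<Lambda> B d'" "has_degree \<Lambda> B d''" for d' d''
    using has_form_integral_unique that unfolding has_degree_def by blast
  have "brane_degree \<Lambda> B = d" if "has_degree \<Lambda> B d" for d
    unfolding brane_degree_def by (rule the_equality) (use that uniq in auto)
  then show "has_degree \<Lambda> B (brane_degree \<Lambda> B)" and "has_degree \<Lambda> B d \<Longrightarrow> brane_degree \<Lambda> B = d"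
    using d0 by auto
qed

text \<open>For an open embedding \<open>\<iota>\<close> of domains which covers a translation by \<open>v\<close> of the
  targets, the lift of a chart is translated by \<open>v\<close>. This is used for the ends of a
  cobordism and for the translations of fibres.\<close>

lemma C1_chart_push:
  assumes c: "C1_chart P T f W \<psi> F"
    and \<iota>: "embedding_map T T' \<iota>" "open_map T T' \<iota>"
    and f: "\<And>x. x \<in> topspace T \<Longrightarrow> f' (\<iota> x) = s (f x)" and P: "\<And>z. P' (z + v) = s (P z)"
  shows "C1_chart P' T' f' W (\<lambda>y. \<iota> (\<psi> y)) (\<lambda>y. F y + v)"
    and "\<And>y u. y \<in> W \<Longrightarrow> fd (\<lambda>y. F y + v) y u = fd F y u"
proof -
  have F: "C1_on W F" using c by (simp add: C1_chart_def)
  show fdF: "fd (\<lambda>y. F y + v) y u = fd F y u" if "y \<in> W" for y u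
    using fdI[OF has_derivative_add[OF C1_onD[OF F that] has_derivative_const]] by simp
  have "embedding_map (top_of_set W) T' (\<lambda>y. \<iota> (\<psi> y))"
    using embedding_map_compose[of "top_of_set W" T \<psi> T' \<iota>] c \<iota>(1) by (simp add: C1_chart_def o_def)
  moreover have "openin T' ((\<lambda>y. \<iota> (\<psi> y)) ` W)"
    using \<iota>(2) c by (simp add: C1_chart_def open_map_def image_image[symmetric, of \<iota> \<psi>])
  moreover have "C1_on W (\<lambda>y. F y + v)" by (rule C1_on_add[OF F C1_on_const])
  moreover have "inj (fd (\<lambda>y. F y + v) y)" if "y \<in> W" for y
    using c that fdF[OF that] by (simp add: C1_chart_def inj_def)
  moreover have "P' (F y + v) = f' (\<iota> (\<psi> y))" if "y \<in> W" for y
    using c that P f[OF C1_chart_in_topspace[OF c that]] by (simp add: C1_chart_def)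
  ultimately show "C1_chart P' T' f' W (\<lambda>y. \<iota> (\<psi> y)) (\<lambda>y. F y + v)"
    using c by (simp add: C1_chart_def)
qed

lemma chart_frame_push:
  assumes "C1_chart P T f W \<psi> F" "y \<in> W"
  shows "chart_frame (\<lambda>y. F y + v) y = chart_frame F y"
proof -
  have "C1_on W F" using assms(1) by (simp add: C1_chart_def)
  from fdI[OF has_derivative_add[OF C1_onD[OF this assms(2)] has_derivative_const]]
  show ?thesis by (simp add: chart_frame_def)
qed

lemma chart_frame_line:
  fixes F :: "real^'n::finite \<Rightarrow> 'n phase"
  assumes "C1_chart P T f W \<psi> F" "rest w \<in> W"
  shows "chart_frame (\<lambda>w. (F (rest w), Complex (w $ None) 0)) w = stab_frame (chart_frame F (rest w))"
proof -
  have lin: "linear (fd F (rest w))"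
    using assms C1_onD has_derivative_linear unfolding C1_chart_def by blast
  have r: "rest (axis None 1) = 0" "rest (axis (Some i) 1) = axis i 1" for i :: 'n
    by (simp_all add: rest_def axis_def vec_eq_iff)
  have a: "axis None (1::real) $ None = 1" "axis (Some i) (1::real) $ None = 0" for i :: 'n
    by (simp_all add: axis_def)
  have "chart_frame (\<lambda>w. (F (rest w), Complex (w $ None) 0)) w $ k = stab_frame (chart_frame F (rest w)) $ k" for k
    unfolding chart_frame_def vec_lambda_beta C1_chart_line(2)[OF assms] stab_frame_def
    by (cases k) (simp_all add: r a linear_0[OF lin] complex_eq_iff)
  then show ?thesis by (simp add: vec_eq_iff)
qed

section \<open>Cobordism invariance of the degree\<close>

locale cobordism =
  fixes \<Lambda> :: "(real^'n::finite) set" and Bs Cs :: "'n brane list"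
    and T :: "real topology" and f :: "real \<Rightarrow> 'n pt \<times> complex"
    and Q :: "(real \<times> ('n phase \<times> complex, 'n option) vec) set" and \<sigma> :: "(real, 'n phase \<times> complex, 'n option) spin"
    and K :: "complex set"
  assumes lat: "full_lattice \<Lambda>" and Bs: "set Bs \<subseteq> branes \<Lambda>" and Cs: "set Cs \<subseteq> branes \<Lambda>"
    and im: "immersed_manifold TYPE('n option) (XC_proj \<Lambda>) T f"
    and proper: "proper_map T (XC_top \<Lambda>) f"
    and orient: "orientation (XC_proj \<Lambda>) T f Q"
    and K: "compact K" "inj_on f {v \<in> topspace T. snd (f v) \<notin> K}"
    and ends: "f ` {v \<in> topspace T. snd (f v) \<notin> K} = {w \<in> ends_set Bs {..0} \<union> ends_set Cs {0..}. snd w \<notin> K}"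
    and left: "\<And>j. j < length Bs \<Longrightarrow> end_compatible \<Lambda> T f Q \<sigma> K {..0} j (Bs ! j)"
    and right: "\<And>j. j < length Cs \<Longrightarrow> end_compatible \<Lambda> T f Q \<sigma> K {0..} j (Cs ! j)"
begin

sublocale oriented_atlas "XC_proj \<Lambda>" T f "positive_charts (XC_proj \<Lambda>) T f Q"
  by (rule oriented_atlas_positive_charts[OF im orient separated_fibres_XC_proj[OF lat]])

abbreviation "\<A> \<equiv> positive_charts (XC_proj \<Lambda>) T f Q"

text \<open>On this part of the domain, \<open>f\<close> is injective, with inverse \<open>lift_pt\<close>.\<close>

definition out where "out = {v \<in> topspace T. snd (f v) \<notin> K}"

definition lift_pt where "lift_pt = inv_into out f"

lemma f_chart: "(W, \<psi>, F) \<in> \<A> \<Longrightarrow> y \<in> W \<Longrightarrow> f (\<psi> y) = XC_proj \<Lambda> (F y)"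
  using chart by (auto simp: C1_chart_def)

lemma snd_f_chart: "(W, \<psi>, F) \<in> \<A> \<Longrightarrow> y \<in> W \<Longrightarrow> snd (f (\<psi> y)) = snd (F y)"
  by (simp add: f_chart XC_proj_def)

lemma cont_XC_proj: "continuous_map euclidean (XC_top \<Lambda>) (XC_proj \<Lambda>)"
proof -
  have "continuous_map euclidean (X_top \<Lambda>) (\<lambda>z :: 'n phase \<times> complex. X_proj \<Lambda> (fst z))"
    using continuous_map_compose[OF _ continuous_map_X_proj, of euclidean fst \<Lambda>]
    by (simp add: o_def continuous_on_fst)
  then show ?thesis
    unfolding XC_top_def XC_proj_def map_prod_def
    by (auto simp: case_prod_beta' continuous_on_snd intro!: continuous_map_pairedI)
qed

lemma continuous_f: "continuous_map T (XC_top \<Lambda>) f"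
  unfolding continuous_map_def
proof (intro conjI allI impI)
  have "f v \<in> topspace (XC_top \<Lambda>)" if v: "v \<in> topspace T" for v
  proof -
    obtain W \<psi> F y where "(W, \<psi>, F) \<in> \<A>" "y \<in> W" "v = \<psi> y" using cover[OF v] by blast
    then show ?thesis using f_chart continuous_map_image_subset_topspace[OF cont_XC_proj] by auto
  qed
  then show "f \<in> topspace T \<rightarrow> topspace (XC_top \<Lambda>)" by blast
  fix U assume U: "openin (XC_top \<Lambda>) U"
  show "openin T {v \<in> topspace T. f v \<in> U}"
  proof (subst openin_subopen, intro ballI)
    fix v assume v: "v \<in> {v \<in> topspace T. f v \<in> U}"
    obtain W \<psi> F y where c: "(W, \<psi>, F) \<in> \<A>" "y \<in> W" "v = \<psi> y" using cover v by blast
    have "C1_on W F" using chart[OF c(1)] by (simp add: C1_chart_def)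
    then have "continuous_map (top_of_set W) euclidean F" using C1_on_continuous_on by simp
    from continuous_map_compose[OF this cont_XC_proj]
    have "openin (top_of_set W) {y \<in> W. XC_proj \<Lambda> (F y) \<in> U}"
      using openin_continuous_map_preimage[OF _ U] by (fastforce simp: o_def)
    then have "open {y \<in> W. XC_proj \<Lambda> (F y) \<in> U}" using chart_open[OF c(1)] by (simp add: openin_open_eq)
    then have "C1_chart (XC_proj \<Lambda>) T f {y \<in> W. XC_proj \<Lambda> (F y) \<in> U} \<psi> F"
      by (rule C1_chart_subset[OF chart[OF c(1)]]) auto
    then have "openin T (\<psi> ` {y \<in> W. XC_proj \<Lambda> (F y) \<in> U})" by (simp add: C1_chart_def)
    moreover have "v \<in> \<psi> ` {y \<in> W. XC_proj \<Lambda> (F y) \<in> U}" using c v f_chart by auto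
    moreover have "\<psi> ` {y \<in> W. XC_proj \<Lambda> (F y) \<in> U} \<subseteq> {v \<in> topspace T. f v \<in> U}"
      using f_chart[OF c(1)] C1_chart_in_topspace[OF chart[OF c(1)]] by auto
    ultimately show "\<exists>V. openin T V \<and> v \<in> V \<and> V \<subseteq> {v \<in> topspace T. f v \<in> U}" by blast
  qed
qed

lemma continuous_snd_f: "continuous_map T euclidean (\<lambda>v. snd (f v))"
  using continuous_map_compose[OF continuous_f, of euclidean snd] continuous_map_snd
  unfolding XC_top_def o_def by blast

lemma continuous_fst_f: "continuous_map T (X_top \<Lambda>) (\<lambda>v. fst (f v))"
  using continuous_map_compose[OF continuous_f, of "X_top \<Lambda>" fst] continuous_map_fst
  unfolding XC_top_def o_def by blast

lemma openin_snd_f: "open U \<Longrightarrow> openin T {v \<in> topspace T. snd (f v) \<in> U}"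
  using openin_continuous_map_preimage[OF continuous_snd_f, of U] by simp

lemma f_lift_pt: "w \<in> f ` out \<Longrightarrow> f (lift_pt w) = w \<and> lift_pt w \<in> out"
  unfolding lift_pt_def by (simp add: f_inv_into_f inv_into_into)

lemma lift_pt_f: "v \<in> out \<Longrightarrow> lift_pt (f v) = v"
  unfolding lift_pt_def using K(2) by (simp add: out_def)

text \<open>A proper map is closed, so the restriction of \<open>f\<close> to \<open>out\<close> is a closed embedding into
  the part of \<open>X \<times> \<complex>\<close> over the complement of \<open>K\<close>.\<close>

lemma continuous_lift_pt: "continuous_map (subtopology (XC_top \<Lambda>) (f ` out)) T lift_pt"
proof -
  have "closed_map (subtopology T out) (subtopology (XC_top \<Lambda>) {w. snd w \<notin> K}) f"
    by (rule closed_map_restriction[OF proper_imp_closed_map[OF proper]]) (auto simp: out_def)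
  moreover have "continuous_map (subtopology T out) (subtopology (XC_top \<Lambda>) {w. snd w \<notin> K}) f"
    using continuous_map_from_subtopology[OF continuous_f]
    by (auto simp: continuous_map_in_subtopology out_def)
  ultimately have "embedding_map (subtopology T out) (subtopology (XC_top \<Lambda>) {w. snd w \<notin> K}) f"
    using K(2) by (intro injective_closed_imp_embedding_map) (auto simp: out_def inj_on_def)
  moreover have "subtopology (subtopology (XC_top \<Lambda>) {w. snd w \<notin> K}) (f ` topspace (subtopology T out)) = subtopology (XC_top \<Lambda>) (f ` out)"
  proof -
    have "topspace T \<inter> out = out" by (auto simp: out_def)
    moreover have "{w. snd w \<notin> K} \<inter> f ` out = f ` out" by (auto simp: out_def)
    ultimately show ?thesis by (simp add: subtopology_subtopology)
  qed
  ultimately have "homeomorphic_map (subtopology T out) (subtopology (XC_top \<Lambda>) (f ` out)) f"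
    by (simp add: embedding_map_def)
  then obtain g where g: "homeomorphic_maps (subtopology T out) (subtopology (XC_top \<Lambda>) (f ` out)) f g"
    using homeomorphic_map_maps by blast
  then have "continuous_map (subtopology (XC_top \<Lambda>) (f ` out)) T g"
    by (auto simp: homeomorphic_maps_def continuous_map_in_subtopology)
  then show ?thesis
  proof (rule continuous_map_eq)
    fix w assume "w \<in> topspace (subtopology (XC_top \<Lambda>) (f ` out))"
    then obtain v where v: "v \<in> out" "w = f v" by auto
    have "g (f v) = v" using g v(1) by (auto simp: homeomorphic_maps_def out_def)
    then show "g w = lift_pt w" using v lift_pt_f by simp
  qed
qed

lemma ends_out: "f ` out = {w \<in> ends_set Bs {..0} \<union> ends_set Cs {0..}. snd w \<notin> K}"
  unfolding out_def by (rule ends)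

text \<open>The strips of width 4 about the lines with real part \<open>far\<close> and \<open>- far\<close> avoid \<open>K\<close> and
  the imaginary axis.\<close>

definition far :: real where "far = (SOME s. 2 < s \<and> (\<forall>z\<in>K. norm z < s - 2))"

lemma far: "2 < far" "z \<in> K \<Longrightarrow> norm z < far - 2"
proof -
  obtain b where b: "\<And>z. z \<in> K \<Longrightarrow> norm z \<le> b"
    using compact_imp_bounded[OF K(1)] unfolding bounded_iff by blast
  have "\<exists>s. 2 < s \<and> (\<forall>z\<in>K. norm z < s - 2)"
    by (rule exI[of _ "max 0 b + 3"]) (use b in \<open>force intro: le_less_trans\<close>)
  then have "2 < far \<and> (\<forall>z\<in>K. norm z < far - 2)" unfolding far_def by (rule someI_ex)
  then show "2 < far" "z \<in> K \<Longrightarrow> norm z < far - 2" by auto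
qed

definition side :: "real \<Rightarrow> 'n brane list" where "side s = (if 0 < s then Cs else Bs)"

text \<open>For \<open>s = \<plusminus> far\<close>, the part of the \<open>j\<close>-th end over the interval of length 4
  about \<open>s\<close>; it is parametrised by \<open>end_map s j\<close>.\<close>

definition zone :: "real \<Rightarrow> nat \<Rightarrow> real set" where
  "zone s j = {v \<in> topspace T. \<bar>Re (snd (f v)) - s\<bar> < 2 \<and> \<bar>Im (snd (f v)) - real j\<bar> < 1}"

definition end_map :: "real \<Rightarrow> nat \<Rightarrow> 'n pt \<times> real \<Rightarrow> real" where
  "end_map s j = (\<lambda>(x, t). lift_pt (x, Complex (t + s) (real j)))"

text \<open>The function which is a copy of \<open>tent\<close> on one end and zero on the rest of the
  cobordism.\<close>

definition end_weight :: "real \<Rightarrow> nat \<Rightarrow> real \<Rightarrow> real" where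
  "end_weight s j v = (if v \<in> zone s j then tent (Re (snd (f v)) - s) else 0)"

lemma far_not_K:
  assumes s: "s = far \<or> s = - far" and z: "\<bar>Re z - s\<bar> < 2"
  shows "z \<notin> K" and "0 < s \<longleftrightarrow> 0 < Re z" and "Re z \<noteq> 0"
proof -
  have "far - 2 < \<bar>Re z\<bar>" using s z far(1) by auto
  also have "\<dots> \<le> norm z" by (rule abs_Re_le_cmod)
  finally show "z \<notin> K" using far(2) by force
  show "0 < s \<longleftrightarrow> 0 < Re z" "Re z \<noteq> 0" using s z far(1) by auto
qed

lemma far_end:
  assumes s: "s = far \<or> s = - far" and v: "v \<in> topspace T" "\<bar>Re (snd (f v)) - s\<bar> < 2"
  shows "\<exists>j x. j < length (side s) \<and> x \<in> fst (side s ! j) \<and> f v = (x, Complex (Re (snd (f v))) (real j)) \<and> v \<in> out"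
proof -
  note nk = far_not_K[OF s v(2)]
  have vo: "v \<in> out" using v(1) nk(1) by (simp add: out_def)
  then have "f v \<in> ends_set Bs {..0} \<union> ends_set Cs {0..}" using ends_out by blast
  then show ?thesis using nk(2,3) vo unfolding ends_set_def side_def by (cases "0 < s") force+
qed

lemma far_mem:
  assumes s: "s = far \<or> s = - far" and j: "j < length (side s)" and x: "x \<in> fst (side s ! j)" and t: "\<bar>t\<bar> < 2"
  shows "(x, Complex (t + s) (real j)) \<in> f ` out"
proof -
  have z: "\<bar>Re (Complex (t + s) (real j)) - s\<bar> < 2" using t by simp
  note nk = far_not_K[OF s z]
  show ?thesis
  proof (cases "0 < s")
    case True
    then have "(x, Complex (t + s) (real j)) \<in> ends_set Cs {0..}"
      using j x nk(2) unfolding ends_set_def side_def by auto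
    then show ?thesis unfolding ends_out using nk(1) by auto
  next
    case False
    then have "(x, Complex (t + s) (real j)) \<in> ends_set Bs {..0}"
      using j x nk(2) unfolding ends_set_def side_def by auto
    then show ?thesis unfolding ends_out using nk(1) by auto
  qed
qed

lemma side_brane: "j < length (side s) \<Longrightarrow> side s ! j \<in> branes \<Lambda>"
proof -
  assume "j < length (side s)"
  then have "side s ! j \<in> set (side s)" by (rule nth_mem)
  then show "side s ! j \<in> branes \<Lambda>" using Bs Cs by (auto simp only: side_def split: if_splits)
qed

lemma openin_zone: "openin T (zone s j)"
proof -
  have "open {z. \<bar>Re z - s\<bar> < 2 \<and> \<bar>Im z - real j\<bar> < 1}"
    by (intro open_Collect_conj open_Collect_less continuous_intros)
  from openin_snd_f[OF this] show ?thesis by (simp add: zone_def)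
qed

context
  fixes s :: real and j :: nat
  assumes s: "s = far \<or> s = - far" and j: "j < length (side s)"
begin

definition "end_brane = fst (side s ! j)"
definition "end_line = line_top (subtopology (X_top \<Lambda>) end_brane)"

lemma end_brane_sub: "end_brane \<subseteq> topspace (X_top \<Lambda>)"
  using side_brane[OF j] by (auto simp: end_brane_def branes_def)

lemma topspace_end_line: "topspace end_line = end_brane \<times> {-2<..<2}"
  using end_brane_sub by (auto simp: end_line_def line_top_def)

lemma zone_point:
  assumes "v \<in> zone s j"
  shows "fst (f v) \<in> end_brane" "f v = (fst (f v), Complex (Re (snd (f v))) (real j))" "v \<in> out"
proof -
  have v: "v \<in> topspace T" "\<bar>Re (snd (f v)) - s\<bar> < 2" "\<bar>Im (snd (f v)) - real j\<bar> < 1"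
    using assms by (auto simp: zone_def)
  obtain i x where i: "i < length (side s)" "x \<in> fst (side s ! i)" "f v = (x, Complex (Re (snd (f v))) (real i))" "v \<in> out"
    using far_end[OF s v(1,2)] by blast
  have "Im (snd (f v)) = real i" using i(3) by (metis complex.sel(2) snd_conv)
  then have "i = j" using v(3) by linarith
  then show "fst (f v) \<in> end_brane" "f v = (fst (f v), Complex (Re (snd (f v))) (real j))" "v \<in> out"
    using i by (auto simp: end_brane_def) (metis fst_conv, metis fst_conv)
qed

lemma end_map_point:
  assumes "z \<in> topspace end_line"
  shows "f (end_map s j z) = (fst z, Complex (snd z + s) (real j))" "end_map s j z \<in> zone s j"
proof -
  obtain x t where z: "z = (x, t)" "x \<in> end_brane" "\<bar>t\<bar> < 2" using assms by (cases z) (auto simp: topspace_end_line)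
  have "(x, Complex (t + s) (real j)) \<in> f ` out"
    using far_mem[OF s j _ z(3)] z(2) by (simp add: end_brane_def)
  from f_lift_pt[OF this]
  show "f (end_map s j z) = (fst z, Complex (snd z + s) (real j))" "end_map s j z \<in> zone s j"
    using z(3) by (auto simp: end_map_def z(1) zone_def out_def)
qed

lemma homeomorphic_maps_end:
  "homeomorphic_maps end_line (subtopology T (zone s j)) (end_map s j) (\<lambda>v. (fst (f v), Re (snd (f v)) - s))"
  unfolding homeomorphic_maps_def
proof (intro conjI ballI)
  have "continuous_map end_line (XC_top \<Lambda>) (\<lambda>z. (fst z, Complex (snd z + s) (real j)))"
    unfolding XC_top_def
  proof (rule continuous_map_pairedI)
    have "continuous_map end_line (subtopology (X_top \<Lambda>) end_brane) fst" unfolding end_line_def line_top_def by (rule continuous_map_fst)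
    then show "continuous_map end_line (X_top \<Lambda>) fst" by (simp add: continuous_map_in_subtopology)
    have "continuous_map end_line (top_of_set {-2<..<2}) snd" unfolding end_line_def line_top_def by (rule continuous_map_snd)
    then have 1: "continuous_map end_line euclidean snd" by (simp add: continuous_map_in_subtopology)
    have "continuous_map euclidean euclidean (\<lambda>t. Complex (t + s) (real j))"
      by (simp, intro continuous_intros)
    from continuous_map_compose[OF 1 this] show "continuous_map end_line euclidean (\<lambda>z. Complex (snd z + s) (real j))"
      by (simp add: o_def)
  qed
  moreover have "(fst z, Complex (snd z + s) (real j)) \<in> f ` out" if "z \<in> topspace end_line" for z
    using end_map_point[OF that] zone_point(3) by (metis imageI)
  ultimately have "continuous_map end_line (subtopology (XC_top \<Lambda>) (f ` out)) (\<lambda>z. (fst z, Complex (snd z + s) (real j)))"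
    by (auto simp: continuous_map_in_subtopology)
  from continuous_map_compose[OF this continuous_lift_pt]
  have "continuous_map end_line T (end_map s j)" by (simp add: o_def end_map_def case_prod_beta')
  then show "continuous_map end_line (subtopology T (zone s j)) (end_map s j)"
    using end_map_point(2) by (auto simp: continuous_map_in_subtopology)
  show "continuous_map (subtopology T (zone s j)) end_line (\<lambda>v. (fst (f v), Re (snd (f v)) - s))"
    unfolding end_line_def line_top_def
  proof (rule continuous_map_pairedI)
    show "continuous_map (subtopology T (zone s j)) (subtopology (X_top \<Lambda>) end_brane) (\<lambda>v. fst (f v))"
      using continuous_map_from_subtopology[OF continuous_fst_f] zone_point(1)
      by (auto simp: continuous_map_in_subtopology)
    have "continuous_map euclidean euclidean (\<lambda>z. Re z - s)" by (simp, intro continuous_intros)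
    from continuous_map_compose[OF continuous_snd_f this]
    have "continuous_map T euclidean (\<lambda>v. Re (snd (f v)) - s)" by (simp add: o_def)
    from continuous_map_from_subtopology[OF this]
    show "continuous_map (subtopology T (zone s j)) (top_of_set {-2<..<2}) (\<lambda>v. Re (snd (f v)) - s)"
      by (auto simp: continuous_map_in_subtopology zone_def)
  qed
  show "(fst (f (end_map s j z)), Re (snd (f (end_map s j z))) - s) = z" if "z \<in> topspace end_line" for z
    using end_map_point(1)[OF that] by simp
  show "end_map s j (fst (f v), Re (snd (f v)) - s) = v" if "v \<in> topspace (subtopology T (zone s j))" for v
  proof -
    have v: "v \<in> zone s j" using that by simp
    then have "end_map s j (fst (f v), Re (snd (f v)) - s) = lift_pt (f v)"
      using zone_point(2)[OF v] by (simp add: end_map_def)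
    then show ?thesis using lift_pt_f zone_point(3)[OF v] by simp
  qed
qed

lemma end_map_embedding: "embedding_map end_line T (end_map s j)" "open_map end_line T (end_map s j)" "inj_on (end_map s j) (topspace end_line)"
proof -
  have h: "homeomorphic_map end_line (subtopology T (zone s j)) (end_map s j)"
    using homeomorphic_maps_end homeomorphic_map_maps by blast
  then have "open_map end_line (subtopology T (zone s j)) (end_map s j)" by (rule homeomorphic_imp_open_map)
  then show op: "open_map end_line T (end_map s j)" by (rule open_map_from_open_subtopology[OF openin_zone])
  show inj: "inj_on (end_map s j) (topspace end_line)" using h by (rule homeomorphic_imp_injective_map)
  have "continuous_map end_line T (end_map s j)"
    using homeomorphic_maps_end by (simp add: homeomorphic_maps_def continuous_map_in_subtopology)
  then show "embedding_map end_line T (end_map s j)" using op inj by (rule injective_open_imp_embedding_map)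
qed

text \<open>By \<open>end_compatible\<close>, the positive frames of a brane, stabilised by the direction of
  the line, are positive frames of the cobordism.\<close>

lemma end_chart:
  assumes "(W, \<psi>, F) \<in> line_chart ` brane_charts \<Lambda> (side s ! j)"
  shows "(W, \<lambda>y. end_map s j (\<psi> y), \<lambda>y. F y + (0, Complex s (real j))) \<in> \<A>"
proof -
  interpret l: oriented_atlas "XC_proj \<Lambda>" end_line "line_map id" "line_chart ` brane_charts \<Lambda> (side s ! j)"
    unfolding end_line_def end_brane_def by (rule brane_line_atlas[OF lat side_brane[OF j]])
  obtain QL \<sigma>end_brane where B: "side s ! j = (end_brane, QL, \<sigma>end_brane)" by (cases "side s ! j") (simp add: end_brane_def)
  note c = l.chart[OF assms]
  obtain U \<phi> G where c0: "(U, \<phi>, G) \<in> brane_charts \<Lambda> (side s ! j)" "(W, \<psi>, F) = line_chart (U, \<phi>, G)"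
    using assms by auto
  have WF: "W = {w. rest w \<in> U \<and> w $ None \<in> {-2<..<2}}" "\<psi> = (\<lambda>w. (\<phi> (rest w), w $ None))"
      "F = (\<lambda>w. (G (rest w), Complex (w $ None) 0))"
    using c0(2) by (auto simp: line_chart_def)
  have c1: "C1_chart (XC_proj \<Lambda>) T f W (\<lambda>y. end_map s j (\<psi> y)) (\<lambda>y. F y + (0, Complex s (real j)))"
  proof (rule C1_chart_push(1)[OF c end_map_embedding(1,2), where s="\<lambda>w. (fst w, snd w + Complex s (real j))"])
    show "f (end_map s j z) = (fst (line_map id z), snd (line_map id z) + Complex s (real j))" if "z \<in> topspace end_line" for z
      using end_map_point(1)[OF that] by (simp add: line_map_def case_prod_beta' complex_eq_iff)
    show "XC_proj \<Lambda> (z + (0, Complex s (real j))) = (fst (XC_proj \<Lambda> z), snd (XC_proj \<Lambda> z) + Complex s (real j))" for z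
      by (cases z) (simp add: XC_proj_def)
  qed
  have "(end_map s j (\<psi> w), chart_frame (\<lambda>y. F y + (0, Complex s (real j))) w) \<in> Q" if w: "w \<in> W" for w
  proof -
    have rw: "rest w \<in> U" and t: "\<bar>w $ None\<bar> < 2" using w by (auto simp: WF(1))
    have g: "C1_chart (X_proj \<Lambda>) (subtopology (X_top \<Lambda>) end_brane) id U \<phi> G" and q: "(\<phi> (rest w), chart_frame G (rest w)) \<in> QL"
      using c0(1) rw by (auto simp: positive_charts_def B)
    have fr: "chart_frame (\<lambda>y. F y + (0, Complex s (real j))) w = stab_frame (chart_frame G (rest w))"
      unfolding chart_frame_push[OF c w] unfolding WF(3) by (rule chart_frame_line[OF g rw])
    let ?t = "w $ None + s"
    have nk: "Complex ?t (real j) \<notin> K" "0 < s \<longleftrightarrow> 0 < ?t"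
      using far_not_K[OF s, of "Complex ?t (real j)"] t by auto
    have ec: "end_compatible \<Lambda> T f Q \<sigma> K (if 0 < s then {0..} else {..0}) j (end_brane, QL, \<sigma>end_brane)"
      using left[of j] right[of j] j B unfolding side_def by (cases "0 < s") auto
    have "(\<lambda>(x, e). (inv_into {v \<in> topspace T. snd (f v) \<notin> K} f (x, Complex ?t (real j)), stab_frame e)) ` QL \<subseteq> Q"
      using ec nk unfolding end_compatible_def Let_def by (cases "0 < s") auto
    then have "(lift_pt (\<phi> (rest w), Complex ?t (real j)), stab_frame (chart_frame G (rest w))) \<in> Q"
      using q unfolding lift_pt_def out_def by force
    then show ?thesis unfolding fr by (simp add: end_map_def WF(2))
  qed
  then show ?thesis using c1 by (simp add: positive_charts_def)
qed

lemma end_image: "compactin T (end_map s j ` (end_brane \<times> {-1..1}))"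
  "v \<in> topspace T \<Longrightarrow> v \<notin> end_map s j ` (end_brane \<times> {-1..1}) \<Longrightarrow> end_weight s j v = 0"
proof -
  have "compactin end_line (end_brane \<times> {-1..1})" unfolding end_line_def end_brane_def by (rule line_tent_form(3)[OF lat side_brane[OF j]])
  moreover have "continuous_map end_line T (end_map s j)"
    using homeomorphic_maps_end by (simp add: homeomorphic_maps_def continuous_map_in_subtopology)
  ultimately show "compactin T (end_map s j ` (end_brane \<times> {-1..1}))" by (rule image_compactin)
  assume v: "v \<in> topspace T" "v \<notin> end_map s j ` (end_brane \<times> {-1..1})"
  show "end_weight s j v = 0"
  proof (cases "v \<in> zone s j")
    case True
    have eq: "end_map s j (fst (f v), Re (snd (f v)) - s) = v"
      using homeomorphic_maps_end True v(1) by (auto simp: homeomorphic_maps_def)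
    have "Re (snd (f v)) - s \<notin> {-1..1}"
    proof
      assume "Re (snd (f v)) - s \<in> {-1..1}"
      then have "(fst (f v), Re (snd (f v)) - s) \<in> end_brane \<times> {-1..1}" using zone_point(1)[OF True] by simp
      from imageI[OF this, of "end_map s j"] show False using v(2) unfolding eq by simp
    qed
    then show ?thesis by (auto simp: end_weight_def tent(2))
  qed (simp add: end_weight_def)
qed

text \<open>Continuity has to be checked only on the zone, where the weight is a function of \<open>Re
  z\<close>, and off the compact image of the support, where it is zero.\<close>

lemma top_form_end: "top_form (vol_form fibre_coords (end_weight s j))"
proof (rule top_form_vol_form[OF linear_fibre_coords])
  fix W \<psi> F assume c: "(W, \<psi>, F) \<in> \<A>"
  let ?C = "end_map s j ` (end_brane \<times> {-1..1})"
  have o1: "open {y \<in> W. \<psi> y \<in> zone s j}" by (rule C1_chart_open_vimage[OF chart[OF c] openin_zone])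
  have "closedin T ?C" by (rule compactin_imp_closedin[OF haus end_image(1)])
  then have "openin T (topspace T - ?C)" by (rule openin_diff[OF openin_topspace])
  then have o2: "open {y \<in> W. \<psi> y \<in> topspace T - ?C}" by (rule C1_chart_open_vimage[OF chart[OF c]])
  have "C1_on W F" using chart[OF c] by (simp add: C1_chart_def)
  then have cF: "continuous_on W F" by (rule C1_on_continuous_on)
  have "continuous_on W (\<lambda>y. tent (Re (snd (F y)) - s))"
    by (intro continuous_on_compose2[OF continuous_on_tent[of UNIV]] continuous_intros cF) simp
  then have "continuous_on {y \<in> W. \<psi> y \<in> zone s j} (\<lambda>y. tent (Re (snd (F y)) - s))"
    by (rule continuous_on_subset) auto
  then have 1: "continuous_on {y \<in> W. \<psi> y \<in> zone s j} (\<lambda>y. end_weight s j (\<psi> y))"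
    by (rule continuous_on_eq) (auto simp: end_weight_def snd_f_chart[OF c])
  have 2: "continuous_on {y \<in> W. \<psi> y \<in> topspace T - ?C} (\<lambda>y. end_weight s j (\<psi> y))"
    by (rule continuous_on_eq[OF continuous_on_const[of _ 0]]) (auto simp: end_image(2))
  have "W = {y \<in> W. \<psi> y \<in> zone s j} \<union> {y \<in> W. \<psi> y \<in> topspace T - ?C}"
  proof -
    have "?C \<subseteq> zone s j" using end_map_point(2) by (auto simp: topspace_end_line)
    then show ?thesis using C1_chart_in_topspace[OF chart[OF c]] by auto
  qed
  then show "continuous_on W (\<lambda>y. end_weight s j (\<psi> y))"
    using continuous_on_open_Un[OF o1 o2 1 2] by simp
qed

lemma end_integral: "has_form_integral (vol_form fibre_coords (end_weight s j)) (brane_degree \<Lambda> (side s ! j))"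
proof (rule has_form_integral_pushforward[where \<iota>="end_map s j" and C="end_brane \<times> {-1..1}"
      and S="\<lambda>F y. F y + (0, Complex s (real j))"])
  note lt = line_tent_form[OF lat side_brane[OF j], folded end_brane_def, folded end_line_def]
  show "oriented_atlas (XC_proj \<Lambda>) end_line (line_map id) (line_chart ` brane_charts \<Lambda> (side s ! j))"
    unfolding end_line_def end_brane_def by (rule brane_line_atlas[OF lat side_brane[OF j]])
  then interpret l: oriented_atlas "XC_proj \<Lambda>" end_line "line_map id" "line_chart ` brane_charts \<Lambda> (side s ! j)" .
  show "oriented_atlas (XC_proj \<Lambda>) T f \<A>" by (rule oriented_atlas_axioms)
  show "l.top_form (vol_form fibre_coords (\<lambda>z. tent (snd z)))"
    "l.supported (vol_form fibre_coords (\<lambda>z. tent (snd z))) (end_brane \<times> {-1..1})" "compactin end_line (end_brane \<times> {-1..1})"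
    using lt by (simp_all add: end_brane_def)
  show "l.has_form_integral (vol_form fibre_coords (\<lambda>z. tent (snd z))) (brane_degree \<Lambda> (side s ! j))"
    using has_degree_brane_degree(1)[OF lat side_brane[OF j]] by (simp add: has_degree_def end_line_def end_brane_def)
  show "top_form (vol_form fibre_coords (end_weight s j))" by (rule top_form_end)
  show "supported (vol_form fibre_coords (end_weight s j)) (end_map s j ` (end_brane \<times> {-1..1}))"
    unfolding supported_def vol_form_def using end_image(2) C1_chart_in_topspace[OF chart] by auto
  show "inj_on (end_map s j) (topspace end_line)" by (rule end_map_embedding(3))
  fix W \<psi> F assume c: "(W, \<psi>, F) \<in> line_chart ` brane_charts \<Lambda> (side s ! j)"
  show "(W, \<lambda>y. end_map s j (\<psi> y), \<lambda>y. F y + (0, Complex s (real j))) \<in> \<A>" by (rule end_chart[OF c])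
  fix y assume y: "y \<in> W"
  have z: "\<psi> y \<in> topspace end_line" by (rule C1_chart_in_topspace[OF l.chart[OF c] y])
  have "C1_on W F" using l.chart[OF c] by (simp add: C1_chart_def)
  then have "fd (\<lambda>y. F y + (0, Complex s (real j))) y = fd F y"
    using fdI[OF has_derivative_add[OF C1_onD[OF _ y] has_derivative_const]] by simp
  then show "vol_form fibre_coords (end_weight s j) (W, \<lambda>y. end_map s j (\<psi> y), \<lambda>y. F y + (0, Complex s (real j))) y =
      vol_form fibre_coords (\<lambda>z. tent (snd z)) (W, \<psi>, F) y"
    using end_map_point[OF z] by (simp add: vol_form_def end_weight_def)
qed

end

lemma far_weight_sum:
  assumes s: "s = far \<or> s = - far" and v: "v \<in> topspace T"
  shows "(\<Sum>j\<leftarrow>[0..<length (side s)]. end_weight s j v) = tent (Re (snd (f v)) - s)"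
proof (cases "\<bar>Re (snd (f v)) - s\<bar> < 2")
  case False
  then have "end_weight s j v = 0" for j by (simp add: end_weight_def zone_def)
  then show ?thesis using False by (simp add: tent(2) sum_list_0)
next
  case True
  obtain i x where i: "i < length (side s)" "x \<in> fst (side s ! i)" "f v = (x, Complex (Re (snd (f v))) (real i))"
    using far_end[OF s v True] by blast
  have im: "Im (snd (f v)) = real i" using i(3) by (metis complex.sel(2) snd_conv)
  have "v \<in> zone s j \<longleftrightarrow> j = i" for j
    using v True im by (auto simp: zone_def)
  then have "(\<Sum>j\<leftarrow>[0..<length (side s)]. end_weight s j v) = (\<Sum>j<length (side s). if j = i then tent (Re (snd (f v)) - s) else 0)"
    by (simp add: end_weight_def sum_list_sum_nth atLeast0LessThan)
  then show ?thesis using i(1) by simp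
qed

text \<open>Near the line \<open>Re z = s\<close> the cobordism is the disjoint union of its ends.\<close>

lemma side_integral:
  assumes s: "s = far \<or> s = - far"
  shows "has_form_integral (vol_form fibre_coords (\<lambda>v. tent (Re (snd (f v)) - s))) (\<Sum>B\<leftarrow>side s. brane_degree \<Lambda> B)"
    and "top_form (vol_form fibre_coords (\<lambda>v. tent (Re (snd (f v)) - s)))"
proof -
  let ?js = "[0..<length (side s)]"
  have "has_form_integral (\<lambda>c y. \<Sum>j\<leftarrow>?js. vol_form fibre_coords (end_weight s j) c y) (\<Sum>j\<leftarrow>?js. brane_degree \<Lambda> (side s ! j))"
    by (rule has_form_integral_sum_list[THEN conjunct1]) (auto intro: end_integral[OF s] top_form_end[OF s])
  moreover have "(\<Sum>j\<leftarrow>?js. brane_degree \<Lambda> (side s ! j)) = (\<Sum>B\<leftarrow>side s. brane_degree \<Lambda> B)"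
  proof -
    have "map (\<lambda>j. brane_degree \<Lambda> (side s ! j)) ?js = map (brane_degree \<Lambda>) (map ((!) (side s)) ?js)" by simp
    then show ?thesis unfolding map_nth by (rule arg_cong[where f=sum_list])
  qed
  ultimately have "has_form_integral (\<lambda>c y. \<Sum>j\<leftarrow>?js. vol_form fibre_coords (end_weight s j) c y) (\<Sum>B\<leftarrow>side s. brane_degree \<Lambda> B)"
    by simp
  then show "has_form_integral (vol_form fibre_coords (\<lambda>v. tent (Re (snd (f v)) - s))) (\<Sum>B\<leftarrow>side s. brane_degree \<Lambda> B)"
  proof (rule has_form_integral_cong)
    fix W \<psi> F y assume c: "(W, \<psi>, F) \<in> \<A>" "y \<in> W"
    show "(\<Sum>j\<leftarrow>?js. vol_form fibre_coords (end_weight s j) (W, \<psi>, F) y) =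
       vol_form fibre_coords (\<lambda>v. tent (Re (snd (f v)) - s)) (W, \<psi>, F) y"
      unfolding vol_form_def split sum_list_mult_const
      by (simp only: far_weight_sum[OF s C1_chart_in_topspace[OF chart[OF c(1)] c(2)]])
  qed
  show "top_form (vol_form fibre_coords (\<lambda>v. tent (Re (snd (f v)) - s)))"
  proof (rule top_form_vol_form[OF linear_fibre_coords])
    fix W \<psi> F assume c: "(W, \<psi>, F) \<in> \<A>"
    have "C1_on W F" using chart[OF c] by (simp add: C1_chart_def)
    then have cF: "continuous_on W F" by (rule C1_on_continuous_on)
    have "continuous_on W (\<lambda>y. tent (Re (snd (F y)) - s))"
      by (intro continuous_on_compose2[OF continuous_on_tent[of UNIV]] continuous_intros cF) simp
    then show "continuous_on W (\<lambda>y. tent (Re (snd (f (\<psi> y))) - s))"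
      by (rule continuous_on_eq) (simp add: snd_f_chart[OF c])
  qed
qed

text \<open>Properness: outside \<open>K\<close> the imaginary part is one of the finitely many heights of the
  ends, so it is bounded.\<close>

lemma compactin_slab: "compactin T {v \<in> topspace T. \<bar>Re (snd (f v))\<bar> \<le> r}"
proof -
  obtain b where b: "\<And>z. z \<in> K \<Longrightarrow> norm z \<le> b"
    using compact_imp_bounded[OF K(1)] unfolding bounded_iff by blast
  define M where "M = max b (real (length Bs + length Cs))"
  let ?R = "cbox (Complex (-r) (-M)) (Complex r M)"
  have Im: "\<bar>Im (snd (f v))\<bar> \<le> M" if "v \<in> topspace T" for v
  proof (cases "snd (f v) \<in> K")
    case True
    then show ?thesis using b[OF True] abs_Im_le_cmod[of "snd (f v)"] by (simp add: M_def)
  next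
    case False
    then have "f v \<in> ends_set Bs {..0} \<union> ends_set Cs {0..}" using ends_out that unfolding out_def by blast
    then show ?thesis unfolding ends_set_def M_def by auto
  qed
  have "compactin (X_top \<Lambda>) (topspace (X_top \<Lambda>))" using compact_space_X_top[OF lat] by (simp add: compact_space_def)
  then have "compactin (XC_top \<Lambda>) (topspace (X_top \<Lambda>) \<times> ?R)"
    by (simp add: XC_top_def compactin_Times)
  from compactin_proper_map_preimage[OF proper this]
  have "compactin T {v. v \<in> topspace T \<and> f v \<in> topspace (X_top \<Lambda>) \<times> ?R}" .
  moreover have "{v. v \<in> topspace T \<and> f v \<in> topspace (X_top \<Lambda>) \<times> ?R} = {v \<in> topspace T. \<bar>Re (snd (f v))\<bar> \<le> r}"
  proof -
    have "fst (f v) \<in> topspace (X_top \<Lambda>)" if "v \<in> topspace T" for v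
      using continuous_fst_f that by (auto simp: continuous_map_def)
    then show ?thesis using Im by (fastforce simp: in_cbox_complex_iff mem_Times_iff)
  qed
  ultimately show ?thesis by simp
qed

text \<open>The function \<open>h(Re z)\<close> has derivative \<open>tent(x + far) - tent(x - far)\<close> and is supported
  in a slab, so by Stokes' theorem the integrals near the two lines \<open>Re z = \<plusminus>
  far\<close> agree.\<close>

theorem degree_sum_eq: "(\<Sum>B\<leftarrow>Bs. brane_degree \<Lambda> B) = (\<Sum>B\<leftarrow>Cs. brane_degree \<Lambda> B)"
proof -
  define h where "h = (\<lambda>t. ramp (t + far) - ramp (t - far))"
  define h' where "h' = (\<lambda>t. tent (t + far) - tent (t - far))"
  let ?u = "\<lambda>v. h (Re (snd (f v)))"
  have dh: "(h has_real_derivative h' t) (at t)" for t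
    unfolding h_def h'_def
    using DERIV_shift[of ramp "tent (t + far)" t far] DERIV_shift[of ramp "tent (t - far)" t "- far"]
      ramp_has_derivative[of "t + far"] ramp_has_derivative[of "t - far"]
    by (auto intro!: derivative_eq_intros)
  have C1h: "C1_on UNIV h"
    by (rule C1_on_real[OF dh]) (auto simp: h'_def intro!: continuous_intros continuous_on_compose2[OF continuous_on_tent[of UNIV]])
  have linRe: "linear (\<lambda>z :: 'n phase \<times> complex. Re (snd z))" by (rule linearI) simp_all
  have F: "C1_on W F" if "(W, \<psi>, F) \<in> \<A>" for W \<psi> F using chart[OF that] by (simp add: C1_chart_def)
  have uF: "C1_on W (\<lambda>y. h (Re (snd (F y))))" if "(W, \<psi>, F) \<in> \<A>" for W \<psi> F
    by (rule C1_on_compose[OF C1_on_compose[OF F[OF that] C1_on_linear[OF linRe]] C1h]) auto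
  have u: "C1_fun ?u"
    unfolding C1_fun_def
  proof (intro allI impI)
    fix W \<psi> F assume c: "(W, \<psi>, F) \<in> \<A>"
    show "C1_on W (\<lambda>y. h (Re (snd (f (\<psi> y)))))"
      by (rule C1_on_cong[OF uF[OF c] chart_open[OF c]]) (simp add: snd_f_chart[OF c])
  qed
  have "has_form_integral (det_form None fibre_coords ?u) 0"
  proof (rule stokes[OF linear_fibre_coords u compactin_slab[of "far + 1"]])
    fix v assume "v \<in> topspace T" "v \<notin> {v \<in> topspace T. \<bar>Re (snd (f v))\<bar> \<le> far + 1}"
    then have "Re (snd (f v)) < - far - 1 \<or> Re (snd (f v)) > far + 1" by auto
    then show "?u v = 0" using far(1) by (auto simp: h_def ramp)
  qed
  from has_form_integral_add[OF this side_integral(1) top_form_det_form[OF linear_fibre_coords u] side_integral(2), of far]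
  have 1: "has_form_integral (\<lambda>c y. det_form None fibre_coords ?u c y + vol_form fibre_coords (\<lambda>v. tent (Re (snd (f v)) - far)) c y)
      (\<Sum>B\<leftarrow>Cs. brane_degree \<Lambda> B)"
    using far(1) by (simp add: side_def)
  have 2: "has_form_integral (vol_form fibre_coords (\<lambda>v. tent (Re (snd (f v)) + far))) (\<Sum>B\<leftarrow>Bs. brane_degree \<Lambda> B)"
    using side_integral(1)[of "- far"] far(1) by (simp add: side_def)
  show ?thesis
  proof (rule has_form_integral_unique[OF 2 1])
    fix W \<psi> F y assume c: "(W, \<psi>, F) \<in> \<A>" and y: "y \<in> W"
    let ?t = "Re (snd (F y))"
    have "((\<lambda>y. h (Re (snd (F y)))) has_derivative (\<lambda>v. h' ?t * Re (snd (fd F y v)))) (at y)"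
      using has_derivative_compose[OF has_derivative_compose[OF C1_onD[OF F[OF c] y] linear_imp_has_derivative[OF linRe]]
          dh[unfolded has_field_derivative_def]] .
    then have "((\<lambda>y. ?u (\<psi> y)) has_derivative (\<lambda>v. h' ?t * Re (snd (fd F y v)))) (at y)"
      by (rule has_derivative_transform_within_open[OF _ chart_open[OF c] y]) (simp add: snd_f_chart[OF c])
    then have fdu: "fd (\<lambda>y. ?u (\<psi> y)) y = (\<lambda>v. h' ?t * Re (snd (fd F y v)))" by (rule fdI)
    let ?M = "matrix (\<lambda>v. fibre_coords (fd F y v))"
    have "det_form None fibre_coords ?u (W, \<psi>, F) y = det (\<chi> i. if i = None then h' ?t *s (?M $ i) else ?M $ i)"
      unfolding det_form_def case_prod_conv fdu
      by (rule arg_cong[where f=det]) (auto simp: vec_eq_iff matrix_def fibre_coords_def)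
    also have "\<dots> = h' ?t * det (\<chi> i. if i = None then ?M $ i else ?M $ i)" by (rule det_row_mul)
    also have "(\<chi> i. if i = None then ?M $ i else ?M $ i) = ?M" by (simp add: vec_eq_iff)
    finally have "det_form None fibre_coords ?u (W, \<psi>, F) y = h' ?t * det ?M" .
    then show "vol_form fibre_coords (\<lambda>v. tent (Re (snd (f v)) + far)) (W, \<psi>, F) y =
        det_form None fibre_coords ?u (W, \<psi>, F) y + vol_form fibre_coords (\<lambda>v. tent (Re (snd (f v)) - far)) (W, \<psi>, F) y"
      using snd_f_chart[OF c y] by (simp add: vol_form_def h'_def algebra_simps)
  qed
qed

end

theorem cobordant_degree:
  assumes "full_lattice \<Lambda>" "Bs \<in> lists (branes \<Lambda>)" "Cs \<in> lists (branes \<Lambda>)" "cobordant \<Lambda> Bs Cs"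
  shows "(\<Sum>B\<leftarrow>Bs. brane_degree \<Lambda> B) = (\<Sum>B\<leftarrow>Cs. brane_degree \<Lambda> B)"
proof -
  obtain T f Q \<sigma> K where "cobordism \<Lambda> Bs Cs T f Q \<sigma> K"
    using assms unfolding cobordant_def cobordism_def by (auto simp: in_lists_conv_set subset_iff)
  then show ?thesis by (rule cobordism.degree_sum_eq)
qed

section \<open>Discs with boundary on a level set\<close>

lemma has_derivative_2I:
  fixes f1 f2 :: "'a::real_normed_vector \<Rightarrow> real"
  assumes "(f1 has_derivative d1) F" "(f2 has_derivative d2) F"
  shows "((\<lambda>x. (\<chi> i. if i = 1 then f1 x else f2 x) :: real^2) has_derivative
     (\<lambda>v. \<chi> i. if i = 1 then d1 v else d2 v)) F"
proof -
  have e: "(\<lambda>x. (\<chi> i. if i = 1 then g1 x else g2 x) :: real^2) = (\<lambda>x. g1 x *\<^sub>R axis 1 1 + g2 x *\<^sub>R axis 2 1)"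
    for g1 g2 :: "'a \<Rightarrow> real"
    by (rule ext) (auto simp: vec_eq_iff axis_def forall_2)
  show ?thesis unfolding e
    by (intro has_derivative_add has_derivative_scaleR_left assms)
qed

text \<open>The function \<open>a\<close>, which vanishes on the circle, is extended by zero to a Lipschitz
  function that is differentiable off the circle; the function \<open>b\<close> is multiplied by a
  cut-off function which is 1 on the disc. The Jacobian determinant of the resulting
  compactly supported map is that of \<open>(a, b)\<close> in the disc and zero outside.\<close>

lemma disc_area_zero_real2:
  fixes a b :: "real^2 \<Rightarrow> real"
  assumes S: "open S" "cball 0 1 \<subseteq> S" and a: "C1_on S a" and b: "C1_on S b"
    and z: "\<And>x. x \<in> sphere 0 1 \<Longrightarrow> a x = 0"
  shows "((\<lambda>x. fd a x (axis 1 1) * fd b x (axis 2 1) - fd a x (axis 2 1) * fd b x (axis 1 1)) has_integral 0) (cball 0 1)"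
proof -
  obtain e where e: "e > 0" "(\<Union>x\<in>cball 0 1. ball x e) \<subseteq> S"
    using compact_subset_open_imp_ball_epsilon_subset[OF compact_cball S] .
  define r where "r = 1 + e / 2"
  have r: "1 < r" using e by (simp add: r_def)
  have rS: "cball 0 r \<subseteq> S"
  proof
    fix x :: "real^2" assume x: "x \<in> cball 0 r"
    show "x \<in> S"
    proof (cases "norm x \<le> 1")
      case False
      have "dist ((1 / norm x) *\<^sub>R x) x = \<bar>1 / norm x - 1\<bar> * norm x"
        by (metis dist_norm norm_scaleR real_norm_def scaleR_left_diff_distrib scaleR_one)
      also have "\<dots> = norm x - 1"
      proof -
        have "x \<noteq> 0" using False by auto
        then show ?thesis using False by (simp add: abs_if field_simps)
      qed
      finally have "x \<in> ball ((1 / norm x) *\<^sub>R x) e" using x e(1) by (simp add: r_def)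
      moreover have "(1 / norm x) *\<^sub>R x \<in> cball 0 1" using False by simp
      ultimately show ?thesis using e(2) by blast
    qed (use S in auto)
  qed
  define r' where "r' = (1 + r) / 2"
  have r': "1 < r'" "r' < r" using r by (auto simp: r'_def)
  obtain \<beta> :: "real^2 \<Rightarrow> real" where \<beta>: "C1_on UNIV \<beta>" "\<And>y. y \<in> cball 0 1 \<Longrightarrow> \<beta> y = 1"
      "\<And>y. y \<notin> ball 0 r' \<Longrightarrow> \<beta> y = 0"
    using ex_C1_plateau[OF zero_less_one r'(1), of "0 :: real^2"] by metis
  define h1 where "h1 = (\<lambda>x. if x \<in> cball 0 1 then a x else 0)"
  define h2 where "h2 = (\<lambda>x. if x \<in> S then \<beta> x * b x else 0)"
  have C1h2: "C1_on UNIV h2"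
  proof (rule C1_on_open_cover)
    fix x :: "real^2"
    have 1: "C1_on S h2"
      by (rule C1_on_cong[OF C1_on_mult[OF C1_on_subset[OF \<beta>(1) subset_UNIV] b] S(1)]) (simp add: h2_def)
    have 2: "C1_on (- cball 0 r') h2"
      by (rule C1_on_cong[OF C1_on_const[of _ 0]]) (use \<beta>(3) in \<open>auto simp: h2_def\<close>)
    show "\<exists>U. open U \<and> x \<in> U \<and> C1_on U h2"
    proof (cases "x \<in> S")
      case True then show ?thesis using 1 S(1) by blast
    next
      case False
      then have "x \<notin> cball 0 r" using rS by blast
      then have "x \<in> - cball 0 r'" using r' by auto
      then show ?thesis using 2 by blast
    qed
  qed
  have supp2: "h2 x = 0" if "x \<notin> cball 0 r'" for x using that \<beta>(3)[of x] by (auto simp: h2_def)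
  obtain L2 where L2: "L2-lipschitz_on UNIV h2" using C1_on_compact_support_lipschitz[OF C1h2 supp2] by blast
  obtain L1' where "L1'-lipschitz_on (cball 0 1) a" using C1_on_lipschitz_cball[OF a S(2)] by blast
  then have L1: "L1'-lipschitz_on UNIV h1" unfolding h1_def by (rule lipschitz_extend_by_zero) (rule z)
  define H :: "real^2 \<Rightarrow> real^2" where "H = (\<lambda>x. \<chi> i. if i = 1 then h1 x else h2 x)"
  have LH: "(L1' + L2)-lipschitz_on UNIV H"
  proof (rule lipschitz_onI)
    fix x y :: "real^2"
    have "norm (H x - H y) \<le> (\<Sum>i\<in>UNIV. \<bar>(H x - H y) $ i\<bar>)" by (rule norm_le_l1_cart)
    also have "\<dots> = \<bar>h1 x - h1 y\<bar> + \<bar>h2 x - h2 y\<bar>" by (simp add: sum_2 H_def)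
    also have "\<dots> \<le> L1' * norm (x - y) + L2 * norm (x - y)"
      using lipschitz_on_normD[OF L1, of x y] lipschitz_on_normD[OF L2, of x y] by simp
    finally show "dist (H x) (H y) \<le> (L1' + L2) * dist x y" by (simp add: dist_norm algebra_simps)
  qed (use lipschitz_on_nonneg[OF L1] lipschitz_on_nonneg[OF L2] in auto)
  define D1 where "D1 = (\<lambda>x. if x \<in> ball 0 1 then fd a x else (\<lambda>v. 0))"
  define H' where "H' = (\<lambda>x v. (\<chi> i. if i = 1 then D1 x v else fd h2 x v) :: real^2)"
  have der: "(H has_derivative H' x) (at x)" if x: "x \<notin> sphere 0 1" for x
    unfolding H_def H'_def
  proof (rule has_derivative_2I)
    show "(h2 has_derivative fd h2 x) (at x)" using C1_onD[OF C1h2] by simp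
    show "(h1 has_derivative D1 x) (at x)"
    proof (cases "x \<in> ball 0 1")
      case True
      then have "x \<in> S" using S(2) by (meson ball_subset_cball subsetD)
      then have "(a has_derivative D1 x) (at x)" using C1_onD[OF a] True by (simp add: D1_def)
      then show ?thesis
        by (rule has_derivative_transform_within_open[where s="ball 0 1"]) (use True in \<open>auto simp: h1_def\<close>)
    next
      case False
      have "((\<lambda>x. 0) has_derivative D1 x) (at x)" using False by (simp add: D1_def)
      then show ?thesis
        by (rule has_derivative_transform_within_open[where s="- cball 0 1"]) (use False x in \<open>auto simp: h1_def\<close>)
    qed
  qed
  have supp: "H x = 0" if "x \<notin> cball 0 r" for x
  proof -
    have "x \<notin> cball 0 1" "x \<notin> cball 0 r'" using that r r' by auto
    then show ?thesis using supp2 by (simp add: H_def h1_def vec_eq_iff)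
  qed
  have hi: "((\<lambda>x. det (matrix (H' x))) has_integral 0) (cball 0 r)"
    by (rule integral_det_compact_support[OF LH negligible_sphere der supp])
  let ?J = "\<lambda>x. fd a x (axis 1 1) * fd b x (axis 2 1) - fd a x (axis 2 1) * fd b x (axis 1 1)"
  have fdh2: "fd h2 x = fd b x" if x: "x \<in> ball 0 1" for x
  proof (rule fdI)
    have "x \<in> S" using x S(2) by (meson ball_subset_cball subsetD)
    then have "(b has_derivative fd b x) (at x)" by (rule C1_onD[OF b])
    then show "(h2 has_derivative fd b x) (at x)"
      by (rule has_derivative_transform_within_open[where s="ball 0 1"])
         (use x \<beta>(2) S(2) in \<open>auto simp: h2_def subset_iff\<close>)
  qed
  have "((\<lambda>x. if x \<in> cball 0 1 then ?J x else 0) has_integral 0) (cball 0 r)"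
  proof (rule has_integral_spike[OF negligible_sphere _ hi])
    fix x :: "real^2" assume x: "x \<in> cball 0 r - sphere 0 1"
    show "(if x \<in> cball 0 1 then ?J x else 0) = det (matrix (H' x))"
    proof (cases "x \<in> ball 0 1")
      case True
      then show ?thesis by (simp add: det_2 matrix_def H'_def D1_def fdh2)
    next
      case False
      then have "x \<notin> cball 0 1" using x by auto
      then show ?thesis using False by (simp add: det_2 matrix_def H'_def D1_def)
    qed
  qed
  then show ?thesis using r by (subst (asm) has_integral_restrict) (auto simp: subset_iff)
qed

lemma disc_area_zero:
  fixes a b :: "complex \<Rightarrow> real"
  assumes S: "open S" "cball 0 1 \<subseteq> S" and a: "C1_on S a" and b: "C1_on S b"
    and z: "\<And>x. x \<in> sphere 0 1 \<Longrightarrow> a x = 0"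
  shows "((\<lambda>x. fd a x 1 * fd b x \<i> - fd a x \<i> * fd b x 1) has_integral 0) (cball 0 1)"
proof -
  define R :: "real^2 \<Rightarrow> complex" where "R = (\<lambda>x. Complex (x $ 1) (x $ 2))"
  define R' :: "complex \<Rightarrow> real^2" where "R' = (\<lambda>z. \<chi> i. if i = 1 then Re z else Im z)"
  have RR: "R (R' z) = z" "R' (R x) = x" for x z
    by (simp_all add: R_def R'_def vec_eq_iff forall_2)
  have lin: "linear R" "linear R'"
    by (auto intro!: linearI simp: R_def R'_def complex_eq_iff vec_eq_iff)
  have R1: "R (axis 1 1) = 1" "R (axis 2 1) = \<i>" "R' 1 = axis 1 1" "R' \<i> = axis 2 1"
    by (auto simp: R_def R'_def axis_def complex_eq_iff vec_eq_iff forall_2)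
  have B2: "(Basis :: (real^2) set) = {axis 1 1, axis 2 1}"
    by (auto simp: Basis_vec_def UNIV_2)
  have BB: "bij_betw R' Basis Basis"
    by (rule bij_betw_byWitness[where f'=R]) (auto simp: RR R1 B2 Basis_complex_def)
  have nR': "norm (R' z) = norm z" for z
    by (simp add: norm_eq_sqrt_inner lin_Basis_inner[OF lin(2) BB])
  then have nR: "norm (R x) = norm x" for x by (metis RR(2))
  have C: "C1_on (R -` S) (\<lambda>x. g (R x))" and fdR: "\<And>x v. R x \<in> S \<Longrightarrow> fd (\<lambda>x. g (R x)) x v = fd g (R x) (R v)"
    if g: "C1_on S g" for g :: "complex \<Rightarrow> real"
  proof -
    show "C1_on (R -` S) (\<lambda>x. g (R x))" by (rule C1_on_compose[OF C1_on_linear[OF lin(1)] g]) auto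
    show "fd (\<lambda>x. g (R x)) x v = fd g (R x) (R v)" if "R x \<in> S" for x v
      using fdI[OF has_derivative_compose[OF linear_imp_has_derivative[OF lin(1)] C1_onD[OF g that]]] by simp
  qed
  have "continuous_on UNIV R" by (rule linear_continuous_on[OF linear_conv_bounded_linear[THEN iffD1, OF lin(1)]])
  then have oS: "open (R -` S)" using S(1) by (simp add: open_vimage)
  have cS: "cball 0 1 \<subseteq> R -` S" using S(2) nR by (auto simp: subset_iff)
  note hi = disc_area_zero_real2[OF oS cS C[OF a] C[OF b]]
  let ?J = "\<lambda>x. fd (\<lambda>x. a (R x)) x (axis 1 1) * fd (\<lambda>x. b (R x)) x (axis 2 1)
       - fd (\<lambda>x. a (R x)) x (axis 2 1) * fd (\<lambda>x. b (R x)) x (axis 1 1)"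
  have "(?J has_integral 0) (cball 0 1)" by (rule hi) (use z nR in auto)
  moreover have "R' ` cball 0 1 = cball 0 1"
  proof (intro equalityI subsetI)
    fix x :: "real^2" assume "x \<in> cball 0 1"
    then show "x \<in> R' ` cball 0 1" using nR RR by (intro image_eqI[of _ _ "R x"]) auto
  qed (use nR' in auto)
  ultimately have "((\<lambda>z. ?J (R' z)) has_integral 0) (cball 0 1)"
    by (intro has_integral_lin_Basis[OF lin(2) BB]) simp
  then show ?thesis
  proof (rule has_integral_eq[rotated])
    fix z :: complex assume "z \<in> cball 0 1"
    then have "R (R' z) \<in> S" using S(2) RR by auto
    then show "?J (R' z) = fd a z 1 * fd b z \<i> - fd a z \<i> * fd b z 1"
      using fdR[OF a] fdR[OF b] RR R1 by simp
  qed
qed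

section \<open>The fibres as Lagrangian submanifolds\<close>

locale lattice_torus =
  fixes \<Lambda> :: "(real^'n::finite) set"
  assumes lat: "full_lattice \<Lambda>"
begin

lemmas discrete_Lambda = discrete_subgroup_full_lattice[OF lat]

abbreviation "pt q p \<equiv> X_proj \<Lambda> (q, p)"
abbreviation "fibre q \<equiv> X_fiber \<Lambda> (quot_proj \<Lambda> q)"
abbreviation "fibre_top q \<equiv> subtopology (X_top \<Lambda>) (fibre q)"
abbreviation "shift q \<equiv> translate_pt (quot_proj \<Lambda> q)"

lemma X_proj_set: "pt q p = {(q + a, p + c) | a c. a \<in> \<Lambda> \<and> c \<in> int_lattice}"
  by (auto simp: X_proj_def quot_proj_def phase_lattice_def dual_int_lattice image_iff)

lemma zero_mem: "0 \<in> \<Lambda>" "(0 :: real^'n) \<in> int_lattice"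
  using discrete_Lambda by (auto simp: discrete_subgroup_def int_lattice_def)

lemma fst_X_proj: "fst ` pt q p = quot_proj \<Lambda> q"
  unfolding X_proj_set quot_proj_def using zero_mem(2) by (force simp: image_iff)

lemma fibre_eq: "fibre q = range (pt q)"
proof (intro equalityI subsetI)
  fix x assume "x \<in> fibre q"
  then obtain q' p where x: "x = pt q' p" "fst ` x = quot_proj \<Lambda> q"
    by (auto simp: X_fiber_def topspace_X_top)
  then have "q' - q \<in> \<Lambda>" using quot_proj_eq_iff[OF discrete_Lambda] by (simp add: fst_X_proj)
  then have "pt q' p = pt q p" unfolding X_proj_eq_iff[OF lat] using zero_mem(2) by simp
  then show "x \<in> range (pt q)" using x by simp
next
  fix x assume "x \<in> range (pt q)"
  then obtain p where "x = pt q p" by blast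
  then show "x \<in> fibre q" by (simp add: X_fiber_def topspace_X_top fst_X_proj)
qed

lemma topspace_fibre: "topspace (fibre_top q) = fibre q"
  by (auto simp: X_fiber_def)

lemma shift_pt: "shift a (pt q p) = pt (q + a) p"
proof (intro equalityI subsetI)
  fix z assume "z \<in> shift a (pt q p)"
  then obtain l c l' where "l \<in> \<Lambda>" "c \<in> int_lattice" "l' \<in> \<Lambda>" "z = ((q + l) + (a + l'), p + c)"
    unfolding translate_pt_def X_proj_set quot_proj_def by blast
  then have "z = ((q + a) + (l + l'), p + c)" "l + l' \<in> \<Lambda>" "c \<in> int_lattice"
    using discrete_subgroup_add[OF discrete_Lambda] by auto
  then show "z \<in> pt (q + a) p" unfolding X_proj_set by blast
next
  fix z assume "z \<in> pt (q + a) p"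
  then obtain l c where "l \<in> \<Lambda>" "c \<in> int_lattice" "z = ((q + l) + (a + 0), p + c)"
    unfolding X_proj_set by (auto simp: algebra_simps)
  then show "z \<in> shift a (pt q p)"
    unfolding translate_pt_def X_proj_set quot_proj_def using zero_mem(1) by blast
qed

lemma uminus_quot_proj: "uminus ` quot_proj \<Lambda> a = quot_proj \<Lambda> (- a)"
proof (intro equalityI subsetI)
  fix x assume "x \<in> uminus ` quot_proj \<Lambda> a"
  then obtain l where "l \<in> \<Lambda>" "x = - a + - l" unfolding quot_proj_def by auto
  then show "x \<in> quot_proj \<Lambda> (- a)" unfolding quot_proj_def using discrete_subgroup_minus[OF discrete_Lambda] by blast
next
  fix x assume "x \<in> quot_proj \<Lambda> (- a)"
  then obtain l where "l \<in> \<Lambda>" "x = - (a + - l)" unfolding quot_proj_def by auto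
  then show "x \<in> uminus ` quot_proj \<Lambda> a" unfolding quot_proj_def using discrete_subgroup_minus[OF discrete_Lambda] by blast
qed

lemma shift_shift: "x \<in> topspace (X_top \<Lambda>) \<Longrightarrow> shift (- a) (shift a x) = x"
  by (auto simp: topspace_X_top shift_pt)

lemma shift_fibre: "shift a ` fibre q = fibre (q + a)"
  unfolding fibre_eq by (auto simp: shift_pt image_image)

lemma continuous_map_shift: "continuous_map (X_top \<Lambda>) (X_top \<Lambda>) (shift a)"
  unfolding continuous_map_def
proof (intro conjI allI impI)
  show "shift a \<in> topspace (X_top \<Lambda>) \<rightarrow> topspace (X_top \<Lambda>)"
    by (auto simp: topspace_X_top shift_pt)
  fix U assume "openin (X_top \<Lambda>) U"
  then have U: "open (X_proj \<Lambda> -` U)" unfolding X_top_def openin_quot_top X_proj_def by simp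
  have "X_proj \<Lambda> -` {x \<in> topspace (X_top \<Lambda>). shift a x \<in> U} = (\<lambda>z. z + (a, 0)) -` (X_proj \<Lambda> -` U)"
    by (auto simp: topspace_X_top shift_pt)
  moreover have "open ((\<lambda>z. z + (a, 0)) -` (X_proj \<Lambda> -` U))"
    by (intro open_vimage U continuous_intros)
  ultimately show "openin (X_top \<Lambda>) {x \<in> topspace (X_top \<Lambda>). shift a x \<in> U}"
    unfolding X_top_def openin_quot_top by (auto simp: X_proj_def topspace_quot_top)
qed

lemma continuous_map_shift_fibre: "continuous_map (fibre_top q) (fibre_top (q + a)) (shift a)"
  using continuous_map_from_subtopology[OF continuous_map_shift]
  by (auto simp: continuous_map_in_subtopology simp flip: shift_fibre)

lemma compactin_fibre: "compactin (X_top \<Lambda>) (fibre q)"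
proof -
  have "compact ({q} \<times> cbox 0 (1::real^'n))" by (intro compact_Times) auto
  then have "compactin (X_top \<Lambda>) (X_proj \<Lambda> ` ({q} \<times> cbox 0 1))"
    using image_compactin[OF _ continuous_map_X_proj] by simp
  moreover have "X_proj \<Lambda> ` ({q} \<times> cbox 0 1) = fibre q"
    unfolding fibre_eq
  proof (intro equalityI subsetI)
    fix x assume "x \<in> range (pt q)"
    then obtain p where x: "x = pt q p" by blast
    let ?fr = "(\<chi> i. frac (p $ i)) :: real^'n"
    have "?fr \<in> cbox 0 1" "p - ?fr \<in> int_lattice"
      by (auto simp: mem_box_cart frac_def int_lattice_def one_vec_def intro: less_imp_le) linarith+
    moreover from this have "x = pt q ?fr" unfolding x X_proj_eq_iff[OF lat] using zero_mem by simp
    ultimately show "x \<in> X_proj \<Lambda> ` ({q} \<times> cbox 0 1)" by blast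
  qed auto
  ultimately show ?thesis by simp
qed

lemma continuous_map_pt: "continuous_map euclidean (fibre_top q) (pt q)"
proof -
  have "continuous_map euclidean euclidean (\<lambda>p :: real^'n. (q, p))" by (simp, intro continuous_intros)
  from continuous_map_compose[OF this continuous_map_X_proj]
  show ?thesis by (auto simp: continuous_map_in_subtopology o_def fibre_eq)
qed

lemma Ck_on_const: "Ck_on k S (\<lambda>x :: 'a::euclidean_space. c :: 'b::euclidean_space)"
  by (induction k arbitrary: c) (simp_all add: frechet_derivative_const)

lemma smooth_on_fibre_lift: "smooth_on S (\<lambda>p :: real^'n. (q, p))"
  unfolding smooth_on_def
proof
  fix k
  have d: "((\<lambda>p. (q, p)) has_derivative (\<lambda>v. (0, v))) (at p)" for p :: "real^'n"
    by (intro has_derivative_Pair has_derivative_const has_derivative_ident)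
  show "Ck_on k S (\<lambda>p :: real^'n. (q, p))"
  proof (cases k)
    case 0
    then show ?thesis by (simp add: continuous_on_Pair)
  next
    case (Suc k')
    have "(\<lambda>p :: real^'n. (q, p)) differentiable (at p)" for p
      unfolding differentiable_def using d by blast
    then show ?thesis by (simp add: Suc fdI[OF d] Ck_on_const)
  qed
qed

lemma fd_fibre_lift: "fd (\<lambda>p :: real^'n. (q, p)) p = (\<lambda>v. (0, v))"
  by (rule fdI) (intro has_derivative_Pair has_derivative_const has_derivative_ident)

text \<open>Two points of a ball of radius 1/2 which differ by an integral vector are equal.\<close>

lemma fibre_immersion_chart:
  "immersion_chart (X_proj \<Lambda>) (fibre_top q) id (ball p0 (1/2)) (pt q) (\<lambda>p. (q, p))"
  unfolding immersion_chart_def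
proof (intro conjI ballI)
  have inj: "inj_on (pt q) (ball p0 (1/2))"
  proof (rule inj_onI)
    fix x y assume h: "x \<in> ball p0 (1/2)" "y \<in> ball p0 (1/2)" "pt q x = pt q y"
    then have xy: "x - y \<in> int_lattice" unfolding X_proj_eq_iff[OF lat] by simp
    have "norm (x - y) < 1" using h(1,2) dist_triangle_half_r[of p0 x 1 y] by (simp add: dist_norm norm_minus_commute)
    have "x $ i - y $ i = 0" for i
    proof (rule ccontr)
      assume "x $ i - y $ i \<noteq> 0"
      moreover have "x $ i - y $ i \<in> \<int>" using xy by (simp add: int_lattice_def)
      ultimately have "1 \<le> \<bar>x $ i - y $ i\<bar>" by (simp add: Ints_nonzero_abs_ge1)
      then show False using component_le_norm_cart[of "x - y" i] \<open>norm (x - y) < 1\<close> by simp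
    qed
    then show "x = y" by (simp add: vec_eq_iff)
  qed
  have opn: "openin (fibre_top q) (pt q ` U)" if U: "open U" for U :: "(real^'n) set"
  proof -
    have "openin (X_top \<Lambda>) (X_proj \<Lambda> ` (UNIV \<times> U))"
      using open_map_quot_proj[OF discrete_subgroup_phase_lattice[OF lat]] U
      by (simp add: open_map_def X_top_def X_proj_def open_Times)
    then have "openin (fibre_top q) (X_proj \<Lambda> ` (UNIV \<times> U) \<inter> fibre q)" by (rule openin_subtopology_Int)
    moreover have "X_proj \<Lambda> ` (UNIV \<times> U) \<inter> fibre q = pt q ` U"
    proof (intro equalityI subsetI)
      fix x assume x: "x \<in> X_proj \<Lambda> ` (UNIV \<times> U) \<inter> fibre q"
      then obtain q' u where u: "x = pt q' u" "u \<in> U" by auto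
      obtain p where "x = pt q p" using x unfolding fibre_eq by blast
      then have "q' - q \<in> \<Lambda>" using u(1) X_proj_eq_iff[OF lat] by metis
      then have "pt q' u = pt q u" unfolding X_proj_eq_iff[OF lat] using zero_mem by simp
      then show "x \<in> pt q ` U" using u by blast
    qed (auto simp: fibre_eq)
    ultimately show ?thesis by simp
  qed
  show "embedding_map (top_of_set (ball p0 (1/2))) (fibre_top q) (pt q)"
  proof (rule injective_open_imp_embedding_map)
    show "continuous_map (top_of_set (ball p0 (1/2))) (fibre_top q) (pt q)"
      by (rule continuous_map_from_subtopology[OF continuous_map_pt])
    show "open_map (top_of_set (ball p0 (1/2))) (fibre_top q) (pt q)"
      unfolding open_map_def by (auto simp: openin_open_eq opn)
  qed (use inj in simp)
  show "openin (fibre_top q) (pt q ` ball p0 (1/2))" by (rule opn) simp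
qed (auto simp: smooth_on_fibre_lift fd_fibre_lift inj_def)

lemma immersed_manifold_fibre: "immersed_manifold TYPE('n) (X_proj \<Lambda>) (fibre_top q) id"
  unfolding immersed_manifold_def
proof (intro conjI ballI)
  show "Hausdorff_space (fibre_top q)" by (rule Hausdorff_space_subtopology[OF Hausdorff_X_top[OF lat]])
  show "second_countable (fibre_top q)"
    unfolding X_top_def
    by (rule second_countable_subtopology[OF second_countable_quot_top[OF discrete_subgroup_phase_lattice[OF lat]]])
  fix x assume "x \<in> topspace (fibre_top q)"
  then have "x \<in> fibre q" unfolding topspace_fibre .
  then obtain p where "x = pt q p" unfolding fibre_eq by blast
  then show "\<exists>(W :: (real^'n) set) \<psi> F. immersion_chart (X_proj \<Lambda>) (fibre_top q) id W \<psi> F \<and> x \<in> \<psi> ` W"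
    by (intro exI[of _ "ball p (1/2)"] exI[of _ "pt q"] exI[of _ "\<lambda>p. (q, p)"] conjI fibre_immersion_chart) simp
qed

text \<open>Lifts of points of a fibre have their \<open>q\<close>-component in one coset of the lattice, which
  is discrete.\<close>

lemma fst_locally_constant:
  fixes g :: "'a::metric_space \<Rightarrow> 'n phase"
  assumes g: "continuous_on S g" and S: "\<And>z. z \<in> S \<Longrightarrow> X_proj \<Lambda> (g z) \<in> fibre q" and z: "z \<in> S"
  shows "\<exists>d>0. \<forall>w\<in>S. dist w z < d \<longrightarrow> fst (g w) = fst (g z)"
proof -
  obtain e where e: "e > 0" "\<And>x. x \<in> \<Lambda> \<Longrightarrow> norm x < e \<Longrightarrow> x = 0"
    using discrete_Lambda unfolding discrete_subgroup_def by blast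
  have m: "fst (g w) - fst (g z) \<in> \<Lambda>" if "w \<in> S" for w
  proof -
    have "quot_proj \<Lambda> (fst (g v)) = quot_proj \<Lambda> q" if "v \<in> S" for v
      using S[OF that] fst_X_proj[of "fst (g v)" "snd (g v)"] by (simp add: X_fiber_def)
    then show ?thesis using quot_proj_eq_iff[OF discrete_Lambda] that z by metis
  qed
  have "continuous_on S (\<lambda>w. fst (g w))" by (intro continuous_intros g)
  then obtain d where "d > 0" "\<And>w. w \<in> S \<Longrightarrow> dist w z < d \<Longrightarrow> dist (fst (g w)) (fst (g z)) < e"
    using z e(1) unfolding continuous_on_iff by metis
  then show ?thesis using e(2) m by (metis dist_norm eq_iff_diff_eq_0)
qed

lemma fst_tangent_fibre:
  assumes c: "C1_chart (X_proj \<Lambda>) (fibre_top q) id W \<psi> F" and y: "y \<in> W"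
  shows "fst (fd F y v) = 0"
proof -
  have F: "C1_on W F" and oW: "open W" using c by (auto simp: C1_chart_def)
  have "X_proj \<Lambda> (F z) \<in> fibre q" if "z \<in> W" for z
    using c that C1_chart_in_topspace[OF c that] by (simp add: C1_chart_def topspace_fibre)
  from fst_locally_constant[OF C1_on_continuous_on[OF F] this y]
  obtain d where d: "d > 0" "\<And>w. w \<in> W \<Longrightarrow> dist w y < d \<Longrightarrow> fst (F w) = fst (F y)" by blast
  have "((\<lambda>w. fst (F y)) has_derivative (\<lambda>v. 0)) (at y)" by simp
  then have "((\<lambda>w. fst (F w)) has_derivative (\<lambda>v. 0)) (at y)"
  proof (rule has_derivative_transform_within_open[where s="W \<inter> ball y d"])
    show "open (W \<inter> ball y d)" using oW by (simp add: open_Int)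
    show "y \<in> W \<inter> ball y d" using y d(1) by simp
    show "fst (F y) = fst (F w)" if "w \<in> W \<inter> ball y d" for w
      using d(2)[of w] that by (simp add: dist_commute)
  qed
  moreover have "((\<lambda>w. fst (F w)) has_derivative (\<lambda>v. fst (fd F y v))) (at y)"
    using has_derivative_fst[OF C1_onD[OF F y]] .
  ultimately have "(\<lambda>v. fst (fd F y v)) = (\<lambda>v. 0)" using has_derivative_unique by blast
  then show ?thesis by (rule fun_cong)
qed

text \<open>Along the boundary circle \<open>q\<close> is constant. Subtracting this constant does not change
  the form \<open>\<Sum>i. dq\<^sub>i \<and> dp\<^sub>i\<close>, and makes \<open>disc_area_zero\<close> applicable to
  every summand.\<close>

lemma weakly_exact_fibre: "weakly_exact \<Lambda> (fibre q)"
  unfolding weakly_exact_def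
proof (intro allI impI)
  fix u :: "complex \<Rightarrow> 'n phase" and S
  assume h: "open S \<and> cball 0 1 \<subseteq> S \<and> smooth_on S u \<and> (\<forall>z\<in>sphere 0 1. X_proj \<Lambda> (u z) \<in> fibre q)"
  then have S: "open S" "cball 0 1 \<subseteq> S" and u: "C1_on S u" by (auto intro: smooth_on_imp_C1_on)
  have sub: "sphere 0 1 \<subseteq> S" using S(2) by auto
  have cu: "continuous_on (sphere 0 1) u" by (rule continuous_on_subset[OF C1_on_continuous_on[OF u] sub])
  have const: "fst (u z) = fst (u 1)" if z: "z \<in> sphere 0 1" for z
  proof (rule connected_local_const[of "sphere (0::complex) 1" _ _ "\<lambda>z. fst (u z)"])
    show "connected (sphere (0::complex) 1)" by (rule connected_sphere) simp
    show "\<forall>a\<in>sphere 0 1. \<forall>\<^sub>F b in at a within sphere 0 1. fst (u a) = fst (u b)"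
      unfolding eventually_at
      using fst_locally_constant[OF cu, of q] h by (metis (no_types, lifting))
  qed (use z in auto)
  define a where "a = (\<lambda>i z. fst (u z) $ i - fst (u 1) $ i)"
  define b where "b = (\<lambda>i z. snd (u z) $ i)"
  have lin: "linear (\<lambda>z :: 'n phase. fst z $ i)" "linear (\<lambda>z :: 'n phase. snd z $ i)" for i
    by (auto intro!: linearI)
  have a: "C1_on S (a i)" for i
    unfolding a_def by (rule C1_on_diff[OF C1_on_compose[OF u C1_on_linear[OF lin(1)] subset_UNIV] C1_on_const])
  have b: "C1_on S (b i)" for i
    unfolding b_def by (rule C1_on_compose[OF u C1_on_linear[OF lin(2)] subset_UNIV])
  have az: "a i z = 0" if "z \<in> sphere 0 1" for i z using const[OF that] by (simp add: a_def)
  have fdab: "fd (a i) z v = fst (fd u z v) $ i" "fd (b i) z v = snd (fd u z v) $ i" if "z \<in> S" for i z v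
    using fdI[OF has_derivative_diff[OF has_derivative_compose[OF C1_onD[OF u that] linear_imp_has_derivative[OF lin(1)]] has_derivative_const]]
      fdI[OF has_derivative_compose[OF C1_onD[OF u that] linear_imp_has_derivative[OF lin(2)]]]
    by (simp_all add: a_def b_def)
  have "((\<lambda>z. \<Sum>i\<in>UNIV. fd (a i) z 1 * fd (b i) z \<i> - fd (a i) z \<i> * fd (b i) z 1) has_integral (\<Sum>i\<in>(UNIV::'n set). 0)) (cball 0 1)"
    by (intro has_integral_sum disc_area_zero[OF S a b] az) auto
  then have "((\<lambda>z. omega (fd u z 1) (fd u z \<i>)) has_integral 0) (cball 0 1)"
  proof (rule has_integral_eq[rotated, THEN has_integral_eq_rhs])
    fix z :: complex assume "z \<in> cball 0 1"
    then have z: "z \<in> S" using S(2) by blast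
    show "(\<Sum>i\<in>UNIV. fd (a i) z 1 * fd (b i) z \<i> - fd (a i) z \<i> * fd (b i) z 1) = omega (fd u z 1) (fd u z \<i>)"
      by (simp add: fdab[OF z] omega_def inner_vec_def sum_subtractf mult.commute)
  qed simp
  then show "integral (cball 0 1) (\<lambda>z. omega (fd u z 1) (fd u z \<i>)) = 0" by (rule integral_unique)
qed

end

section \<open>Translations of fibres\<close>

lemma Ck_on_cong:
  assumes "open S" "\<And>x. x \<in> S \<Longrightarrow> f x = g x" "Ck_on k S f"
  shows "Ck_on k S g"
  using assms(2,3)
proof (induction k arbitrary: f g)
  case 0
  then show ?case by (simp cong: continuous_on_cong)
next
  case (Suc k)
  have d: "(g has_derivative fd f x) (at x)" if "x \<in> S" for x
    using Suc.prems that assms(1) frechet_derivative_works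
    by (intro has_derivative_transform_within_open[of f "fd f x" x UNIV S g]) auto
  have "Ck_on k S (\<lambda>x. fd g x v)" for v
    by (rule Suc.IH[of "\<lambda>x. fd f x v"]) (use Suc.prems fdI[OF d] in auto)
  then show ?case using d by (auto simp: differentiable_def)
qed

lemma smooth_on_add_const:
  assumes "open S" "smooth_on S f"
  shows "smooth_on S (\<lambda>x. f x + c)"
  unfolding smooth_on_def
proof
  fix k
  show "Ck_on k S (\<lambda>x. f x + c)"
  proof (cases k)
    case 0
    then show ?thesis using assms(2)[unfolded smooth_on_def, rule_format, of 0]
      by (auto intro: continuous_on_add continuous_on_const)
  next
    case (Suc k')
    have f: "Ck_on (Suc k') S f" using assms(2) by (simp only: smooth_on_def)
    have d: "((\<lambda>x. f x + c) has_derivative fd f x) (at x)" if "x \<in> S" for x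
    proof -
      have "(f has_derivative fd f x) (at x)" using f that by (simp add: frechet_derivative_works[symmetric])
      from has_derivative_add[OF this has_derivative_const] show ?thesis by simp
    qed
    have "Ck_on k' S (\<lambda>x. fd (\<lambda>x. f x + c) x v)" for v
      by (rule Ck_on_cong[OF assms(1), of "\<lambda>x. fd f x v"]) (use f fdI[OF d] in auto)
    then show ?thesis using d unfolding Suc by (auto simp: differentiable_def)
  qed
qed

lemma continuous_map_frame_top:
  assumes "continuous_map T T' h" "\<And>x e. (x, e) \<in> Q \<Longrightarrow> (h x, e) \<in> Q'"
  shows "continuous_map (frame_top T Q) (frame_top T' Q') (map_prod h id)"
proof -
  have "continuous_map (prod_topology T euclidean) (prod_topology T' euclidean) (map_prod h id)"
    using continuous_map_prod_top[of T euclidean T' euclidean h id] assms(1)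
    by (simp add: map_prod_def)
  then show ?thesis
    unfolding frame_top_def using assms(2)
    by (auto simp: continuous_map_in_subtopology intro: continuous_map_from_subtopology)
qed

lemma integral_pos:
  fixes g :: "'a::euclidean_space \<Rightarrow> real"
  assumes W: "open W" "continuous_on W g" "g integrable_on W" and g: "\<And>y. y \<in> W \<Longrightarrow> 0 \<le> g y"
    and y: "y0 \<in> W" "0 < g y0"
  shows "0 < integral W g"
proof -
  let ?N = "{y \<in> W. g y0 / 2 < g y}"
  have oN: "open ?N"
    using continuous_open_preimage[OF W(2,1), of "{g y0 / 2<..}"] by (simp add: vimage_def Int_def conj_commute)
  have yN: "y0 \<in> ?N" using y by simp
  obtain a b where ab: "cbox a b \<subseteq> ?N" "y0 \<in> box a b"
    by (rule open_contains_cbox[OF oN yN])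
  have i1: "g integrable_on cbox a b" by (rule integrable_on_subcbox[OF W(3)]) (use ab in auto)
  have pos: "0 < measure lborel (cbox a b)"
    using ab(2) unfolding content_pos_lt_eq mem_box by fastforce
  have "g y0 / 2 * measure lborel (cbox a b) = integral (cbox a b) (\<lambda>y. g y0 / 2)" by simp
  also have "\<dots> \<le> integral (cbox a b) g"
    by (rule integral_le) (use i1 ab in auto)
  also have "\<dots> \<le> integral W g"
    by (rule integral_subset_le[OF _ i1 W(3)]) (use ab g in auto)
  finally show ?thesis using mult_pos_pos[OF _ pos, of "g y0 / 2"] y(2) by linarith
qed

context lattice_torus
begin

lemma homeomorphic_map_shift: "homeomorphic_map (fibre_top q) (fibre_top (q + a)) (shift a)"
proof -
  have "homeomorphic_maps (fibre_top q) (fibre_top (q + a)) (shift a) (shift (- a))"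
    unfolding homeomorphic_maps_def
  proof (intro conjI ballI)
    show "continuous_map (fibre_top q) (fibre_top (q + a)) (shift a)" by (rule continuous_map_shift_fibre)
    show "continuous_map (fibre_top (q + a)) (fibre_top q) (shift (- a))"
      using continuous_map_shift_fibre[of "q + a" "- a"] by simp
    show "shift (- a) (shift a x) = x" if "x \<in> topspace (fibre_top q)" for x
      using that by (intro shift_shift) simp
    show "shift a (shift (- a) x) = x" if "x \<in> topspace (fibre_top (q + a))" for x
      using shift_shift[of x "- a"] that by simp
  qed
  then show ?thesis using homeomorphic_map_maps by blast
qed

lemma shift_embedding:
  "embedding_map (fibre_top q) (fibre_top (q + a)) (shift a)" "open_map (fibre_top q) (fibre_top (q + a)) (shift a)"
proof -
  note h = homeomorphic_map_shift[of q a]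
  show op: "open_map (fibre_top q) (fibre_top (q + a)) (shift a)" using h by (rule homeomorphic_imp_open_map)
  show "embedding_map (fibre_top q) (fibre_top (q + a)) (shift a)"
    using homeomorphic_imp_continuous_map[OF h] op homeomorphic_imp_injective_map[OF h]
    by (rule injective_open_imp_embedding_map)
qed

lemma X_proj_shift: "X_proj \<Lambda> (z + (a, 0)) = shift a (X_proj \<Lambda> z)"
  by (cases z) (simp add: shift_pt)

lemma immersion_chart_shift:
  assumes c: "immersion_chart (X_proj \<Lambda>) (fibre_top q) id W \<psi> F"
  shows "immersion_chart (X_proj \<Lambda>) (fibre_top (q + a)) id W (\<lambda>y. shift a (\<psi> y)) (\<lambda>y. F y + (a, 0))"
    and "\<And>y. y \<in> W \<Longrightarrow> fd (\<lambda>y. F y + (a, 0)) y = fd F y"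
proof -
  have c1: "C1_chart (X_proj \<Lambda>) (fibre_top q) id W \<psi> F" using c by (rule immersion_chart_imp_C1_chart)
  have p: "C1_chart (X_proj \<Lambda>) (fibre_top (q + a)) id W (\<lambda>y. shift a (\<psi> y)) (\<lambda>y. F y + (a, 0))"
    by (rule C1_chart_push(1)[OF c1 shift_embedding, where s="shift a"]) (simp_all add: X_proj_shift)
  have "smooth_on W (\<lambda>y. F y + (a, 0))"
    using c by (intro smooth_on_add_const) (auto simp: immersion_chart_def)
  then show "immersion_chart (X_proj \<Lambda>) (fibre_top (q + a)) id W (\<lambda>y. shift a (\<psi> y)) (\<lambda>y. F y + (a, 0))"
    using p by (auto simp: immersion_chart_def C1_chart_def)
  show "fd (\<lambda>y. F y + (a, 0)) y = fd F y" if "y \<in> W" for y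
  proof -
    have "C1_on W F" using c1 by (simp add: C1_chart_def)
    from fdI[OF has_derivative_add[OF C1_onD[OF this that] has_derivative_const]] show ?thesis by simp
  qed
qed

lemma frames_shift:
  fixes e :: "('n phase, 'n) vec"
  assumes "(x, e) \<in> frames (X_proj \<Lambda>) (fibre_top q) id"
  shows "(shift a x, e) \<in> frames (X_proj \<Lambda>) (fibre_top (q + a)) id"
proof -
  obtain W :: "(real^'n) set" and \<psi> F y where c: "immersion_chart (X_proj \<Lambda>) (fibre_top q) id W \<psi> F" "y \<in> W" "x = \<psi> y"
      "\<forall>i. e $ i \<in> range (fd F y)" "inj (\<lambda>i. e $ i)" "independent (range (\<lambda>i. e $ i))"
    using assms by (fastforce simp: frames_def)
  note s = immersion_chart_shift[where a=a, OF c(1)]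
  show ?thesis
    unfolding frames_def mem_Collect_eq case_prod_conv
    using s(1) c s(2)[OF c(2)] by metis
qed

definition shift_frames :: "real^'n \<Rightarrow> ('n pt \<times> ('n phase, 'n) vec) set \<Rightarrow> ('n pt \<times> ('n phase, 'n) vec) set" where
  "shift_frames a Q = map_prod (shift a) id ` Q"

lemma frames_fibre:
  fixes e :: "('n phase, 'n) vec"
  assumes "(x, e) \<in> frames (X_proj \<Lambda>) (fibre_top q) id"
  shows "x \<in> fibre q"
proof -
  obtain W :: "(real^'n) set" and \<psi> F y where c: "immersion_chart (X_proj \<Lambda>) (fibre_top q) id W \<psi> F" "y \<in> W" "x = \<psi> y"
    using assms by (fastforce simp: frames_def)
  show ?thesis
    using C1_chart_in_topspace[OF immersion_chart_imp_C1_chart[OF c(1)] c(2)] unfolding c(3) topspace_fibre .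
qed

lemma orientation_frames: "orientation (X_proj \<Lambda>) (fibre_top q) id Q \<Longrightarrow> Q \<subseteq> frames (X_proj \<Lambda>) (fibre_top q) id"
  unfolding orientation_def frame_top_def using openin_subset by fastforce

lemma mem_shift_frames:
  assumes Q: "orientation (X_proj \<Lambda>) (fibre_top q) id Q"
  shows "(x, e) \<in> shift_frames a Q \<longleftrightarrow> x \<in> fibre (q + a) \<and> (shift (- a) x, e) \<in> Q"
proof -
  have Qt: "y \<in> fibre q" if "(y, e) \<in> Q" for y e
    using frames_fibre orientation_frames[OF Q] that by blast
  have top: "fibre q' \<subseteq> topspace (X_top \<Lambda>)" for q' by (auto simp: X_fiber_def)
  show ?thesis
  proof
    assume "(x, e) \<in> shift_frames a Q"
    then obtain y where y: "(y, e) \<in> Q" "x = shift a y" by (auto simp: shift_frames_def)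
    have "x \<in> fibre (q + a)" unfolding y(2) shift_fibre[symmetric] using Qt[OF y(1)] by (rule imageI)
    moreover have "shift (- a) x = y" unfolding y(2) by (rule shift_shift[OF subsetD[OF top Qt[OF y(1)]]])
    ultimately show "x \<in> fibre (q + a) \<and> (shift (- a) x, e) \<in> Q" using y(1) by simp
  next
    assume h: "x \<in> fibre (q + a) \<and> (shift (- a) x, e) \<in> Q"
    then have "shift a (shift (- a) x) = x" using shift_shift[of x "- a"] top by auto
    then show "(x, e) \<in> shift_frames a Q"
      using h unfolding shift_frames_def by (intro image_eqI[of _ _ "(shift (- a) x, e)"]) auto
  qed
qed

lemma orientation_shift:
  fixes Q :: "('n pt \<times> ('n phase, 'n) vec) set"
  assumes Q: "orientation (X_proj \<Lambda>) (fibre_top q) id Q"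
  shows "orientation (X_proj \<Lambda>) (fibre_top (q + a)) id (shift_frames a Q)"
  unfolding orientation_def
proof (intro conjI ballI allI impI)
  let ?Fr = "frames (X_proj \<Lambda>) (fibre_top q) id :: ('n pt \<times> ('n phase, 'n) vec) set"
  let ?Fr' = "frames (X_proj \<Lambda>) (fibre_top (q + a)) id :: ('n pt \<times> ('n phase, 'n) vec) set"
  have c: "continuous_map (frame_top (fibre_top (q + a)) ?Fr') (frame_top (fibre_top q) ?Fr) (map_prod (shift (- a)) id)"
  proof (rule continuous_map_frame_top)
    show "continuous_map (fibre_top (q + a)) (fibre_top q) (shift (- a))"
      using continuous_map_shift_fibre[of "q + a" "- a"] by simp
    show "(shift (- a) x, e) \<in> ?Fr" if "(x, e) \<in> ?Fr'" for x e
      using frames_shift[OF that, of "- a"] by simp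
  qed
  have "openin (frame_top (fibre_top q) ?Fr) Q" using Q by (simp add: orientation_def)
  from openin_continuous_map_preimage[OF c this]
  have "openin (frame_top (fibre_top (q + a)) ?Fr')
      {z \<in> topspace (frame_top (fibre_top (q + a)) ?Fr'). map_prod (shift (- a)) id z \<in> Q}" .
  moreover have "{z \<in> topspace (frame_top (fibre_top (q + a)) ?Fr'). map_prod (shift (- a)) id z \<in> Q} = shift_frames a Q"
  proof -
    have "?Fr' \<subseteq> (topspace (X_top \<Lambda>) \<inter> fibre (q + a)) \<times> UNIV"
    proof
      fix z assume z: "z \<in> ?Fr'"
      obtain x e where xe: "z = (x, e)" by (cases z)
      have "x \<in> fibre (q + a)" using z unfolding xe by (rule frames_fibre)
      then show "z \<in> (topspace (X_top \<Lambda>) \<inter> fibre (q + a)) \<times> UNIV" by (simp add: xe X_fiber_def)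
    qed
    then have tF: "topspace (frame_top (fibre_top (q + a)) ?Fr') = ?Fr'"
      by (simp add: frame_top_def Int_absorb1)
    have sF: "(x, e) \<in> ?Fr'" if "x \<in> fibre (q + a)" "(shift (- a) x, e) \<in> Q" for x e
    proof -
      have "(shift a (shift (- a) x), e) \<in> ?Fr'" using frames_shift orientation_frames[OF Q] that(2) by blast
      then show ?thesis using shift_shift[of x "- a"] that(1) by (simp add: X_fiber_def)
    qed
    show ?thesis
    proof (intro equalityI subsetI)
      fix z assume z: "z \<in> {z \<in> topspace (frame_top (fibre_top (q + a)) ?Fr'). map_prod (shift (- a)) id z \<in> Q}"
      obtain x e where xe: "z = (x, e)" by (cases z)
      have "(x, e) \<in> ?Fr'" "(shift (- a) x, e) \<in> Q"
        using z unfolding xe tF by auto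
      then show "z \<in> shift_frames a Q" unfolding xe mem_shift_frames[OF Q] using frames_fibre by blast
    next
      fix z assume z: "z \<in> shift_frames a Q"
      obtain x e where xe: "z = (x, e)" by (cases z)
      have m: "x \<in> fibre (q + a)" "(shift (- a) x, e) \<in> Q" using z unfolding xe mem_shift_frames[OF Q] by auto
      then have "(x, e) \<in> ?Fr'" by (rule sF)
      then show "z \<in> {z \<in> topspace (frame_top (fibre_top (q + a)) ?Fr'). map_prod (shift (- a)) id z \<in> Q}"
        unfolding tF using m(2) by (simp add: xe)
    qed
  qed
  ultimately show "openin (frame_top (fibre_top (q + a)) ?Fr') (shift_frames a Q)" by simp
  fix x
  show "\<exists>e. (x, e) \<in> shift_frames a Q" if "x \<in> topspace (fibre_top (q + a))"
  proof -
    have x: "x \<in> fibre (q + a)" using that unfolding topspace_fibre .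
    then have "shift (- a) x \<in> fibre q" using shift_fibre[of "- a" "q + a"] by auto
    then have "\<exists>e. (shift (- a) x, e) \<in> Q" using Q unfolding orientation_def topspace_fibre by blast
    then show ?thesis using mem_shift_frames[OF Q] x by blast
  qed
  show "{e'. (x, e') \<in> shift_frames a Q} =
      {e'. \<exists>A :: real^'n^'n. 0 < det A \<and> (\<forall>i. e' $ i = (\<Sum>j\<in>UNIV. A $ i $ j *\<^sub>R e $ j))}"
    if "(x, e) \<in> shift_frames a Q" for e
  proof -
    have m: "x \<in> fibre (q + a)" "(shift (- a) x, e) \<in> Q" using that mem_shift_frames[OF Q] by auto
    have "{e'. (x, e') \<in> shift_frames a Q} = {e'. (shift (- a) x, e') \<in> Q}"
      using mem_shift_frames[OF Q] m(1) by blast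
    also have "\<dots> = {e'. \<exists>A :: real^'n^'n. 0 < det A \<and> (\<forall>i. e' $ i = (\<Sum>j\<in>UNIV. A $ i $ j *\<^sub>R e $ j))}"
      using Q m(2) unfolding orientation_def by blast
    finally show ?thesis .
  qed
qed

lemma isotropic_fibre:
  fixes Q :: "('n pt \<times> ('n phase, 'n) vec) set"
  assumes "orientation (X_proj \<Lambda>) (fibre_top q) id Q"
  shows "isotropic_frames omega Q"
  unfolding isotropic_frames_def
proof (clarify)
  fix x and e :: "('n phase, 'n) vec" and i j assume "(x, e) \<in> Q"
  then have "(x, e) \<in> frames (X_proj \<Lambda>) (fibre_top q) id" using orientation_frames[OF assms] by blast
  then obtain W :: "(real^'n) set" and \<psi> F y where c: "immersion_chart (X_proj \<Lambda>) (fibre_top q) id W \<psi> F" "y \<in> W"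
      "\<forall>i. e $ i \<in> range (fd F y)"
    unfolding frames_def by auto
  have "fst (e $ k) = 0" for k
    using c(3) fst_tangent_fibre[OF immersion_chart_imp_C1_chart[OF c(1)] c(2)] by (metis rangeE)
  then show "omega (e $ i) (e $ j) = 0" by (simp add: omega_def)
qed

text \<open>The translation back to the original fibre induces a homomorphism on first homology;
  on the frames over a point it has the forward translation as an inverse, which carries the
  nontrivial class to the translated fibre.\<close>

lemma spin_structure_shift:
  fixes \<sigma> :: "('n pt, 'n phase, 'n) spin"
  assumes Q: "orientation (X_proj \<Lambda>) (fibre_top q) id Q" and \<sigma>: "spin_structure (fibre_top q) Q \<sigma>"
  shows "spin_structure (fibre_top (q + a)) (shift_frames a Q)
    (spin_pullback (frame_top (fibre_top (q + a)) (shift_frames a Q)) (frame_top (fibre_top q) Q) (map_prod (shift (- a)) id) \<sigma>)"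
proof -
  let ?Z = "frame_top (fibre_top q) Q" and ?Y = "frame_top (fibre_top (q + a)) (shift_frames a Q)"
  let ?g = "map_prod (shift (- a)) id :: 'n pt \<times> ('n phase, 'n) vec \<Rightarrow> _"
  let ?\<sigma>' = "spin_pullback ?Y ?Z ?g \<sigma>"
  note ms = mem_shift_frames[OF Q]
  have cont_back: "continuous_map (fibre_top (q + a)) (fibre_top q) (shift (- a))"
    using continuous_map_shift_fibre[of "q + a" "- a"] by simp
  have cg: "continuous_map ?Y ?Z ?g"
    by (rule continuous_map_frame_top[OF cont_back]) (simp add: ms)
  have h\<sigma>: "\<sigma> \<in> hom (homology_group 1 ?Z) (integer_mod_group 2)"
    using \<sigma> by (simp add: spin_structure_def)
  have hom: "?\<sigma>' \<in> hom (homology_group 1 ?Y) (integer_mod_group 2)"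
  proof -
    have "\<sigma> \<circ> hom_induced 1 ?Y {} ?Z {} ?g \<in> hom (homology_group 1 ?Y) (integer_mod_group 2)"
      by (rule hom_compose[OF hom_induced_hom h\<sigma>])
    then have "restrict (\<sigma> \<circ> hom_induced 1 ?Y {} ?Z {} ?g) (carrier (homology_group 1 ?Y)) \<in> hom (homology_group 1 ?Y) (integer_mod_group 2)"
      by (rule group.hom_restrict[rotated]) simp_all
    then show ?thesis by (simp add: spin_pullback_def o_def)
  qed
  have ext: "?\<sigma>' \<in> extensional (carrier (homology_group 1 ?Y))" by (simp add: spin_pullback_def)
  have nt: "\<exists>c\<in>carrier (homology_group 1 (frame_top (fibre_top (q + a)) {z \<in> shift_frames a Q. fst z = x})).
       ?\<sigma>' (hom_induced 1 (frame_top (fibre_top (q + a)) {z \<in> shift_frames a Q. fst z = x}) {} ?Y {} id c) \<noteq> 0"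
    if n: "2 \<le> CARD('n)" and x: "x \<in> fibre (q + a)" for x
  proof -
    let ?x = "shift (- a) x"
    let ?Qx = "{z \<in> Q. fst z = ?x}" and ?Qx' = "{z \<in> shift_frames a Q. fst z = x}"
    let ?Zx = "frame_top (fibre_top q) ?Qx" and ?Yx = "frame_top (fibre_top (q + a)) ?Qx'"
    let ?G = "map_prod (shift a) id :: 'n pt \<times> ('n phase, 'n) vec \<Rightarrow> _"
    have sx: "?x \<in> fibre q" using shift_fibre[of "- a" "q + a"] x by auto
    have sxx: "shift a ?x = x" using shift_shift[of x "- a"] x by (simp add: X_fiber_def)
    obtain c where c: "c \<in> carrier (homology_group 1 ?Zx)" "\<sigma> (hom_induced 1 ?Zx {} ?Z {} id c) \<noteq> 0"
      using \<sigma> n sx unfolding spin_structure_def Let_def topspace_fibre by blast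
    have cG: "continuous_map ?Zx ?Yx ?G"
    proof (rule continuous_map_frame_top[OF continuous_map_shift_fibre])
      fix y e assume "(y, e) \<in> ?Qx"
      then have "(y, e) \<in> Q" "y = ?x" by auto
      then show "(shift a y, e) \<in> ?Qx'" using ms sxx x by auto
    qed
    have ci: "continuous_map ?Yx ?Y id"
      unfolding frame_top_def by (auto simp: continuous_map_in_subtopology intro: continuous_map_from_subtopology)
    let ?c' = "hom_induced 1 ?Zx {} ?Yx {} ?G c"
    have c': "?c' \<in> carrier (homology_group 1 ?Yx)" by (rule hom_induced_carrier)
    have "hom_induced 1 ?Y {} ?Z {} ?g (hom_induced 1 ?Yx {} ?Y {} id ?c') = hom_induced 1 ?Zx {} ?Z {} (?g \<circ> (id \<circ> ?G)) c"
      using hom_induced_compose[OF cG _ ci, of "{}" "{}" "{}" 1] hom_induced_compose[OF continuous_map_compose[OF cG ci] _ cg, of "{}" "{}" "{}" 1]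
      by simp
    also have "\<dots> = hom_induced 1 ?Zx {} ?Z {} id c"
    proof (rule fun_cong[where x=c], rule hom_induced_eq)
      fix z assume "z \<in> topspace ?Zx"
      then have "fst z \<in> fibre q" using sx by (auto simp: frame_top_def)
      then show "(?g \<circ> (id \<circ> ?G)) z = id z"
        using shift_shift[of "fst z" a] by (cases z) (simp add: X_fiber_def)
    qed
    finally have "?\<sigma>' (hom_induced 1 ?Yx {} ?Y {} id ?c') = \<sigma> (hom_induced 1 ?Zx {} ?Z {} id c)"
      unfolding spin_pullback_def restrict_apply'[OF hom_induced_carrier] by (rule arg_cong)
    then have "?\<sigma>' (hom_induced 1 ?Yx {} ?Y {} id ?c') \<noteq> 0" using c(2) by (rule ssubst)
    then show ?thesis by (rule bexI[OF _ c'])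
  qed
  show ?thesis
    unfolding spin_structure_def Let_def topspace_fibre by (intro conjI hom ext impI ballI nt)
qed

lemma fibre_brane:
  assumes "orientation (X_proj \<Lambda>) (fibre_top q) id Q" "spin_structure (fibre_top q) Q \<sigma>"
  shows "(fibre q, Q, \<sigma>) \<in> branes \<Lambda>"
  using assms compactin_fibre immersed_manifold_fibre isotropic_fibre weakly_exact_fibre
  by (auto simp: branes_def Let_def X_fiber_def)

lemma translate_brane_eq:
  "translate_brane \<Lambda> (quot_proj \<Lambda> a) (fibre q, Q, \<sigma>) = (fibre (q + a), shift_frames a Q,
     spin_pullback (frame_top (fibre_top (q + a)) (shift_frames a Q)) (frame_top (fibre_top q) Q) (map_prod (shift (- a)) id) \<sigma>)"
  unfolding translate_brane_def Let_def split brane_top_def shift_fibre shift_frames_def uminus_quot_proj ..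

lemma translate_brane_mem:
  assumes "orientation (X_proj \<Lambda>) (fibre_top q) id Q" "spin_structure (fibre_top q) Q \<sigma>"
  shows "translate_brane \<Lambda> (quot_proj \<Lambda> a) (fibre q, Q, \<sigma>) \<in> branes \<Lambda>"
  unfolding translate_brane_eq by (rule fibre_brane[OF orientation_shift spin_structure_shift]; rule assms)

section \<open>The degree of the fibres\<close>

lemma brane_charts_shift:
  assumes Q: "orientation (X_proj \<Lambda>) (fibre_top q) id Q"
    and c: "(W, \<psi>, F) \<in> positive_charts (X_proj \<Lambda>) (fibre_top q) id Q"
  shows "(W, \<lambda>y. shift a (\<psi> y), \<lambda>y. F y + (a, 0)) \<in> positive_charts (X_proj \<Lambda>) (fibre_top (q + a)) id (shift_frames a Q)"
proof -
  have c1: "C1_chart (X_proj \<Lambda>) (fibre_top q) id W \<psi> F" and p: "\<And>y. y \<in> W \<Longrightarrow> (\<psi> y, chart_frame F y) \<in> Q"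
    using c by (auto simp: positive_charts_def)
  have "C1_chart (X_proj \<Lambda>) (fibre_top (q + a)) id W (\<lambda>y. shift a (\<psi> y)) (\<lambda>y. F y + (a, 0))"
    by (rule C1_chart_push(1)[OF c1 shift_embedding, where s="shift a"]) (simp_all add: X_proj_shift)
  moreover have "(shift a (\<psi> y), chart_frame (\<lambda>y. F y + (a, 0)) y) \<in> shift_frames a Q" if "y \<in> W" for y
    unfolding chart_frame_push[OF c1 that] shift_frames_def
    by (rule image_eqI[OF _ p[OF that]]) simp
  ultimately show ?thesis by (simp add: positive_charts_def)
qed

text \<open>The forms in question do not involve \<open>q\<close>.\<close>

lemma degree_translate:
  assumes Q: "orientation (X_proj \<Lambda>) (fibre_top q) id Q" and \<sigma>: "spin_structure (fibre_top q) Q \<sigma>"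
  shows "brane_degree \<Lambda> (translate_brane \<Lambda> (quot_proj \<Lambda> a) (fibre q, Q, \<sigma>)) = brane_degree \<Lambda> (fibre q, Q, \<sigma>)"
proof -
  let ?B = "(fibre q, Q, \<sigma>)" and ?B' = "translate_brane \<Lambda> (quot_proj \<Lambda> a) (fibre q, Q, \<sigma>)"
  have B: "?B \<in> branes \<Lambda>" by (rule fibre_brane[OF Q \<sigma>])
  have B': "?B' \<in> branes \<Lambda>" by (rule translate_brane_mem[OF Q \<sigma>])
  let ?T = "line_top (fibre_top q)" and ?T' = "line_top (fibre_top (q + a))"
  let ?\<A>0 = "positive_charts (X_proj \<Lambda>) (fibre_top q) id Q"
  let ?\<A>0' = "positive_charts (X_proj \<Lambda>) (fibre_top (q + a)) id (shift_frames a Q)"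
  let ?\<tau> = "vol_form fibre_coords (\<lambda>z. tent (snd z))"
  note lt = line_tent_form[OF lat B, unfolded fst_conv snd_conv]
  note lt' = line_tent_form[OF lat B', unfolded translate_brane_eq fst_conv snd_conv]
  have o1: "oriented_atlas (XC_proj \<Lambda>) ?T (line_map id) (line_chart ` ?\<A>0)"
    using brane_line_atlas[OF lat B] by simp
  have o2: "oriented_atlas (XC_proj \<Lambda>) ?T' (line_map id) (line_chart ` ?\<A>0')"
    using brane_line_atlas[OF lat B'] by (simp add: translate_brane_eq)
  have hi: "oriented_atlas.has_form_integral ?T (line_chart ` ?\<A>0) ?\<tau> (brane_degree \<Lambda> ?B)"
    using has_degree_brane_degree(1)[OF lat B] by (simp add: has_degree_def)
  have "oriented_atlas.has_form_integral ?T' (line_chart ` ?\<A>0') ?\<tau> (brane_degree \<Lambda> ?B)"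
  proof (rule has_form_integral_pushforward[OF o1 o2 lt(1-3) hi lt'(1), where \<iota>="map_prod (shift a) id"
        and S="\<lambda>F y. F y + ((a, 0), 0)"])
    have "map_prod (shift a) id ` (fibre q \<times> {-1..1::real}) = fibre (q + a) \<times> {-1..1}"
      by (simp add: map_prod_surj_on shift_fibre)
    then show "oriented_atlas.supported (line_chart ` ?\<A>0') ?\<tau> (map_prod (shift a) id ` (fibre q \<times> {-1..1}))"
      using lt'(2) by simp
    have "inj_on (shift a) (fibre q)"
      using homeomorphic_imp_injective_map[OF homeomorphic_map_shift[of q a]] unfolding topspace_fibre .
    then show "inj_on (map_prod (shift a) id) (topspace ?T)"
      by (auto simp: line_top_def inj_on_def)
    fix W \<psi> F assume "(W, \<psi>, F) \<in> line_chart ` ?\<A>0"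
    then obtain U \<phi> G where g: "(U, \<phi>, G) \<in> ?\<A>0" "(W, \<psi>, F) = line_chart (U, \<phi>, G)" by auto
    have "(W, \<lambda>y. map_prod (shift a) id (\<psi> y), \<lambda>y. F y + ((a, 0), 0)) = line_chart (U, \<lambda>y. shift a (\<phi> y), \<lambda>y. G y + (a, 0))"
      using g(2) by (auto simp: line_chart_def)
    then show "(W, \<lambda>y. map_prod (shift a) id (\<psi> y), \<lambda>y. F y + ((a, 0), 0)) \<in> line_chart ` ?\<A>0'"
      by (rule image_eqI[OF _ brane_charts_shift[OF Q g(1)]])
    fix y assume y: "y \<in> W"
    have "C1_on W F" using oriented_atlas.chart[OF o1 \<open>(W, \<psi>, F) \<in> _\<close>] by (simp add: C1_chart_def)
    from fdI[OF has_derivative_add[OF C1_onD[OF this y] has_derivative_const]]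
    show "?\<tau> (W, \<lambda>y. map_prod (shift a) id (\<psi> y), \<lambda>y. F y + ((a, 0), 0)) y = ?\<tau> (W, \<psi>, F) y"
      by (simp add: vol_form_def)
  qed
  then have "has_degree \<Lambda> ?B' (brane_degree \<Lambda> ?B)" by (simp add: has_degree_def translate_brane_eq)
  then show ?thesis by (rule has_degree_brane_degree(2)[OF lat B'])
qed

abbreviation "fibre_jac F y \<equiv> det (matrix (\<lambda>v. snd (fd F y v)))"

text \<open>Tangent vectors of a fibre have no \<open>q\<close>-component, so on them \<open>p\<close> determines the
  vector.\<close>

lemma fibre_jac_nonzero:
  assumes c: "C1_chart (X_proj \<Lambda>) (fibre_top q) id W \<psi> F" and y: "y \<in> W"
  shows "fibre_jac F y \<noteq> 0"
proof -
  have F: "C1_on W F" and inj: "inj (fd F y)" using c y by (auto simp: C1_chart_def)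
  have lin: "linear (fd F y)" using C1_onD[OF F y] by (rule has_derivative_linear)
  have "linear (\<lambda>v. snd (fd F y v))" using linear_compose[OF lin linear_snd] by (simp add: o_def)
  moreover have "inj (\<lambda>v. snd (fd F y v))"
    using inj fst_tangent_fibre[OF c y] by (auto simp: inj_def prod_eq_iff)
  ultimately show ?thesis using det_nz_iff_inj by blast
qed

text \<open>The sign of the Jacobian depends only on the point of the fibre, because derivatives
  of transition maps of positive charts have positive determinant, and it is locally
  constant. Lifted to the connected space of all \<open>p\<close>, it is constant.\<close>

lemma fibre_orientation_sign:
  assumes Q: "orientation (X_proj \<Lambda>) (fibre_top q) id Q"
  shows "\<exists>s :: real. \<forall>W \<psi> F y. (W, \<psi>, F) \<in> positive_charts (X_proj \<Lambda>) (fibre_top q) id Q \<longrightarrow> y \<in> W \<longrightarrow> 0 < s * fibre_jac F y"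
proof -
  let ?\<A> = "positive_charts (X_proj \<Lambda>) (fibre_top q) id Q"
  interpret oriented_atlas "X_proj \<Lambda>" "fibre_top q" id ?\<A>
    by (rule oriented_atlas_positive_charts[OF immersed_manifold_fibre Q separated_fibres_X_proj[OF lat]])
  have law: "\<exists>d>0. fibre_jac F y = d * fibre_jac F' y'"
    if c: "(W, \<psi>, F) \<in> ?\<A>" "(W', \<psi>', F') \<in> ?\<A>" "y \<in> W" "y' \<in> W'" "\<psi> y = \<psi>' y'" for W \<psi> F W' \<psi>' F' y y'
  proof -
    obtain A :: "real^'n^'n" where A: "det A > 0" "\<And>v. fd F y v = fd F' y' (A *v v)" using positive[OF c] by blast
    have "C1_on W' F'" using chart[OF c(2)] by (simp add: C1_chart_def)
    then have "linear (fd F' y')" using C1_onD c(4) has_derivative_linear by blast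
    then have lin: "linear (\<lambda>v. snd (fd F' y' v))" using linear_compose[OF _ linear_snd] by (simp add: o_def)
    have "(\<lambda>v. snd (fd F y v)) = (\<lambda>v. snd (fd F' y' v)) \<circ> (\<lambda>v. A *v v)" by (auto simp: A(2))
    then have "matrix (\<lambda>v. snd (fd F y v)) = matrix (\<lambda>v. snd (fd F' y' v)) ** A"
      by (simp add: matrix_compose lin matrix_vector_mul_linear)
    then show ?thesis using A(1) by (auto simp: det_mul mult.commute)
  qed
  \<comment> \<open>The points \<open>p\<close> at which the Jacobian has the sign \<open>s\<close> in some positive chart.\<close>
  define Sg where "Sg = (\<lambda>s :: real. {p. \<exists>W \<psi> F y. (W, \<psi>, F) \<in> ?\<A> \<and> y \<in> W \<and> \<psi> y = pt q p \<and> 0 < s * fibre_jac F y})"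
  have opn: "open (Sg s)" for s
  proof (subst open_subopen, intro ballI)
    fix p assume "p \<in> Sg s"
    then obtain W \<psi> F y where c: "(W, \<psi>, F) \<in> ?\<A>" "y \<in> W" "\<psi> y = pt q p" "0 < s * fibre_jac F y"
      by (auto simp: Sg_def)
    have F: "C1_on W F" using chart[OF c(1)] by (simp add: C1_chart_def)
    have "continuous_on W (\<lambda>y. s * fibre_jac F y)"
      by (intro continuous_intros continuous_on_det_matrix C1_on_cont[OF F])
    from continuous_open_preimage[OF this chart_open[OF c(1)], of "{0<..}"]
    have "open {y \<in> W. 0 < s * fibre_jac F y}" by (simp add: vimage_def Int_def conj_commute)
    then have "C1_chart (X_proj \<Lambda>) (fibre_top q) id {y \<in> W. 0 < s * fibre_jac F y} \<psi> F"
      by (rule C1_chart_subset[OF chart[OF c(1)]]) auto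
    then have "openin (fibre_top q) (\<psi> ` {y \<in> W. 0 < s * fibre_jac F y})" by (simp add: C1_chart_def)
    from openin_continuous_map_preimage[OF continuous_map_pt this]
    have "open {p. pt q p \<in> \<psi> ` {y \<in> W. 0 < s * fibre_jac F y}}" by simp
    moreover have "p \<in> {p. pt q p \<in> \<psi> ` {y \<in> W. 0 < s * fibre_jac F y}}"
      using c(2-4) by (auto intro!: image_eqI[of _ _ y])
    moreover have "{p. pt q p \<in> \<psi> ` {y \<in> W. 0 < s * fibre_jac F y}} \<subseteq> Sg s"
    proof
      fix p' assume "p' \<in> {p. pt q p \<in> \<psi> ` {y \<in> W. 0 < s * fibre_jac F y}}"
      then obtain y' where "y' \<in> W" "0 < s * fibre_jac F y'" "\<psi> y' = pt q p'" by auto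
      then show "p' \<in> Sg s" unfolding Sg_def using c(1) by blast
    qed
    ultimately show "\<exists>T. open T \<and> p \<in> T \<and> T \<subseteq> Sg s" by blast
  qed
  have cov: "Sg 1 \<union> Sg (-1) = UNIV"
  proof (intro equalityI subsetI)
    fix p :: "real^'n"
    have "pt q p \<in> fibre q" unfolding fibre_eq by blast
    then have "pt q p \<in> topspace (fibre_top q)" unfolding topspace_fibre .
    then obtain W \<psi> F y where c: "(W, \<psi>, F) \<in> ?\<A>" "y \<in> W" "pt q p = \<psi> y" using cover by blast
    have "fibre_jac F y \<noteq> 0" by (rule fibre_jac_nonzero[OF chart[OF c(1)] c(2)])
    then have "0 < 1 * fibre_jac F y \<or> 0 < -1 * fibre_jac F y" by linarith
    then show "p \<in> Sg 1 \<union> Sg (-1)" unfolding Sg_def using c by (metis (mono_tags, lifting) UnCI mem_Collect_eq)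
  qed simp
  have dis: "Sg 1 \<inter> Sg (-1) = {}"
  proof (rule ccontr)
    assume "Sg 1 \<inter> Sg (-1) \<noteq> {}"
    then obtain p where "p \<in> Sg 1" "p \<in> Sg (-1)" by blast
    then obtain W \<psi> F y W' \<psi>' F' y' where c: "(W, \<psi>, F) \<in> ?\<A>" "(W', \<psi>', F') \<in> ?\<A>" "y \<in> W" "y' \<in> W'" "\<psi> y = \<psi>' y'"
        "0 < fibre_jac F y" "fibre_jac F' y' < 0"
      unfolding Sg_def by force
    obtain d where "d > 0" "fibre_jac F y = d * fibre_jac F' y'" using law[OF c(1-5)] by blast
    then show False using c(6,7) by (simp add: zero_less_mult_iff)
  qed
  have "connected (UNIV :: (real^'n) set)" by (rule connected_UNIV)
  then have "Sg 1 = {} \<or> Sg (-1) = {}"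
    unfolding connected_def using opn cov dis by (metis Int_UNIV_right Int_commute subset_refl inf_top_left)
  then obtain s where s: "Sg s = UNIV" using cov by (metis Un_empty_left Un_empty_right)
  have "0 < s * fibre_jac F y" if c: "(W, \<psi>, F) \<in> ?\<A>" "y \<in> W" for W \<psi> F y
  proof -
    have "\<psi> y \<in> fibre q" using C1_chart_in_topspace[OF chart[OF c(1)] c(2)] unfolding topspace_fibre .
    then obtain p where p: "\<psi> y = pt q p" unfolding fibre_eq by blast
    have "p \<in> Sg s" using s by simp
    then obtain W' \<psi>' F' y' where c': "(W', \<psi>', F') \<in> ?\<A>" "y' \<in> W'" "\<psi>' y' = pt q p" "0 < s * fibre_jac F' y'"
      unfolding Sg_def by blast
    obtain d where "d > 0" "fibre_jac F y = d * fibre_jac F' y'"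
      using law[OF c(1) c'(1) c(2) c'(2)] p c'(3) by auto
    then show ?thesis using c'(4) by (simp add: zero_less_mult_iff mult.left_commute[of s d])
  qed
  then show ?thesis by blast
qed

lemma line_jac:
  fixes F :: "real^'n \<Rightarrow> 'n phase"
  assumes c: "C1_chart P T f W \<psi> F" "rest w \<in> W"
  shows "det (matrix (\<lambda>v. fibre_coords (fd (\<lambda>w. (F (rest w), Complex (w $ None) 0)) w v))) = fibre_jac F (rest w)"
proof -
  let ?A = "matrix (\<lambda>v. fibre_coords (fd (\<lambda>w. (F (rest w), Complex (w $ None) 0)) w v))"
  have r: "rest (axis (Some j) 1) = axis j 1" for j :: 'n
    by (simp add: rest_def axis_def vec_eq_iff)
  have "det ?A = det (\<chi> i j. ?A $ Some i $ Some j)"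
  proof (rule det_inj_block)
    fix i j :: "'n option" assume "i \<notin> range Some"
    then have "i = None" by (cases i) auto
    then show "?A $ i $ j = (if i = j then 1 else 0)"
      unfolding C1_chart_line(2)[OF c] by (simp add: matrix_def fibre_coords_def axis_def)
  qed simp
  also have "(\<chi> i j. ?A $ Some i $ Some j) = matrix (\<lambda>v. snd (fd F (rest w) v))"
    unfolding C1_chart_line(2)[OF c] by (simp add: vec_eq_iff matrix_def fibre_coords_def r)
  finally show ?thesis .
qed

text \<open>Multiplied by the sign of the fibre, all summands for a partition of unity are
  nonnegative, and a bump which is nonzero at the point \<open>(q, 0)\<close>, \<open>t = 0\<close> contributes a
  positive one.\<close>

lemma fibre_degree_nonzero:
  assumes Q: "orientation (X_proj \<Lambda>) (fibre_top q) id Q" and \<sigma>: "spin_structure (fibre_top q) Q \<sigma>"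
  shows "brane_degree \<Lambda> (fibre q, Q, \<sigma>) \<noteq> 0"
proof -
  let ?B = "(fibre q, Q, \<sigma>)"
  have B: "?B \<in> branes \<Lambda>" by (rule fibre_brane[OF Q \<sigma>])
  let ?T = "line_top (fibre_top q)"
  let ?\<A>0 = "positive_charts (X_proj \<Lambda>) (fibre_top q) id Q"
  let ?\<tau> = "vol_form fibre_coords (\<lambda>z. tent (snd z)) :: ('n option, 'n pt \<times> real, 'n phase \<times> complex) form"
  let ?C = "fibre q \<times> {-1..1::real}"
  interpret oriented_atlas "XC_proj \<Lambda>" ?T "line_map id" "line_chart ` ?\<A>0"
    using brane_line_atlas[OF lat B] by simp
  note lt = line_tent_form[OF lat B, unfolded fst_conv snd_conv]
  obtain s where s: "\<And>W \<psi> F y. (W, \<psi>, F) \<in> ?\<A>0 \<Longrightarrow> y \<in> W \<Longrightarrow> 0 < s * fibre_jac F y"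
    using fibre_orientation_sign[OF Q] by blast
  have pos: "\<exists>k>0. s * ?\<tau> (W, \<psi>, F) y = tent (snd (\<psi> y)) * k" if c: "(W, \<psi>, F) \<in> line_chart ` ?\<A>0" "y \<in> W" for W \<psi> F y
  proof -
    obtain U \<phi> G where g: "(U, \<phi>, G) \<in> ?\<A>0" "(W, \<psi>, F) = line_chart (U, \<phi>, G)" using c(1) by auto
    have U: "rest y \<in> U" and Fe: "F = (\<lambda>w. (G (rest w), Complex (w $ None) 0))"
      using g(2) c(2) by (auto simp: line_chart_def)
    have g1: "C1_chart (X_proj \<Lambda>) (fibre_top q) id U \<phi> G" using g(1) by (simp add: positive_charts_def)
    have "?\<tau> (W, \<psi>, F) y = tent (snd (\<psi> y)) * fibre_jac G (rest y)"
      unfolding vol_form_def split Fe line_jac[OF g1 U] ..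
    then show ?thesis using s[OF g(1) U] by (intro exI[of _ "s * fibre_jac G (rest y)"]) simp
  qed
  obtain ps where ps: "subordinate ps ?C" using ex_subordinate[OF lt(3)] by blast
  have d: "brane_degree \<Lambda> ?B = (\<Sum>(c, a, r, u)\<leftarrow>ps. integral (fst c) (form_mult u ?\<tau> c))"
  proof (rule has_degree_brane_degree(2)[OF lat B])
    show "has_degree \<Lambda> ?B (\<Sum>(c, a, r, u)\<leftarrow>ps. integral (fst c) (form_mult u ?\<tau> c))"
      using has_form_integral_partition[OF lt(1,2) ps] by (simp add: has_degree_def)
  qed
  let ?I = "\<lambda>p. case p of (c, a, r, u) \<Rightarrow> integral (fst c) (\<lambda>y. s * form_mult u ?\<tau> c y)"
  have sI: "s * brane_degree \<Lambda> ?B = (\<Sum>p\<leftarrow>ps. ?I p)"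
    unfolding d sum_list_const_mult[symmetric]
    by (intro arg_cong[where f=sum_list] map_cong refl) (auto simp: split_beta)
  let ?x = "(pt q 0, 0 :: real)"
  have x: "?x \<in> ?C" by (auto simp: fibre_eq)
  have bump: "bump_on c a r u" if "(c, a, r, u) \<in> set ps" for c a r u
    using ps that unfolding subordinate_def by blast
  have nonneg: "0 \<le> s * form_mult u ?\<tau> (W, \<psi>, F) y" if p: "((W, \<psi>, F), a, r, u) \<in> set ps" and y: "y \<in> W" for W \<psi> F a r u y
  proof -
    have b: "(W, \<psi>, F) \<in> line_chart ` ?\<A>0" "0 \<le> u (\<psi> y)" using bump[OF p] unfolding bump_on_def by blast+
    obtain k where k: "k > 0" "s * ?\<tau> (W, \<psi>, F) y = tent (snd (\<psi> y)) * k" using pos[OF b(1) y] by blast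
    have "s * form_mult u ?\<tau> (W, \<psi>, F) y = u (\<psi> y) * (s * ?\<tau> (W, \<psi>, F) y)" by (simp add: form_mult_def)
    also have "0 \<le> \<dots>" unfolding k(2) using b(2) k(1) tent(1) by (intro mult_nonneg_nonneg) auto
    finally show ?thesis .
  qed
  have integ: "(\<lambda>y. s * form_mult u ?\<tau> c y) integrable_on fst c" if "(c, a, r, u) \<in> set ps" for c a r u
    by (intro integrable_on_mult_right set_lebesgue_integral_eq_integral(1) bump_integrable[OF bump[OF that] lt(1)])
  have I0: "0 \<le> ?I p" if "p \<in> set ps" for p
  proof -
    obtain W \<psi> F a r u where p: "p = ((W, \<psi>, F), a, r, u)" by (cases p) auto
    show ?thesis unfolding p split fst_conv
      by (rule Henstock_Kurzweil_Integration.integral_nonneg)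
         (use integ nonneg that p in auto)
  qed
  have "\<exists>p\<in>set ps. 0 < ?I p"
  proof -
    have "(\<Sum>(c, a, r, u)\<leftarrow>ps. u ?x) = 1" using ps x unfolding subordinate_def by blast
    then have one: "(\<Sum>p\<leftarrow>ps. case p of (c, a, r, u) \<Rightarrow> u ?x) = 1" .
    have "\<exists>p\<in>set ps. (case p of (c, a, r, u) \<Rightarrow> u ?x) \<noteq> 0"
    proof (rule ccontr)
      assume "\<not> ?thesis"
      then have z: "map (\<lambda>p. case p of (c, a, r, u) \<Rightarrow> u ?x) ps = map (\<lambda>p. 0) ps"
        by (intro map_cong refl) (simp only: bex_simps not_not ball_simps)
      show False using one unfolding z by simp
    qed
    then obtain W \<psi> F a r u where p: "((W, \<psi>, F), a, r, u) \<in> set ps" "u ?x \<noteq> 0" by auto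
    note b = bump[OF p(1)]
    note b' = b[unfolded bump_on_def fst_conv snd_conv]
    have cA: "(W, \<psi>, F) \<in> line_chart ` ?\<A>0" and u: "C1_fun u" "0 \<le> u ?x" using b' by simp_all
    obtain R where R: "r < R" "cball a R \<subseteq> W" using b' by (elim conjE exE)
    have aW: "cball a r \<subseteq> W" by (rule order_trans[OF subset_cball[OF less_imp_le[OF R(1)]] R(2)])
    have z: "\<forall>x. x \<notin> \<psi> ` cball a r \<longrightarrow> u x = 0" using b' by (elim conjE)
    have xi: "?x \<in> \<psi> ` cball a r"
      by (rule ccontr) (use p(2) z[rule_format, of ?x] in contradiction)
    from xi obtain y where y: "y \<in> W" "\<psi> y = ?x"
    proof (rule imageE)
      fix y assume h: "?x = \<psi> y" "y \<in> cball a r"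
      show thesis by (rule that[OF subsetD[OF aW h(2)] h(1)[symmetric]])
    qed
    obtain k where k: "k > 0" "s * ?\<tau> (W, \<psi>, F) y = tent (snd (\<psi> y)) * k" using pos[OF cA y(1)] by blast
    have "s * form_mult u ?\<tau> (W, \<psi>, F) y = u ?x * (s * ?\<tau> (W, \<psi>, F) y)" by (simp add: form_mult_def y(2))
    also have "\<dots> > 0" unfolding k(2) using u(2) p(2) k(1) tent(3)[of 0] y(2) by simp
    finally have gt: "0 < s * form_mult u ?\<tau> (W, \<psi>, F) y" .
    have "continuous_on W (form_mult u ?\<tau> (W, \<psi>, F))"
      by (rule top_form_cont[OF top_form_mult[OF lt(1) u(1)] cA])
    then have cont: "continuous_on W (\<lambda>y. s * form_mult u ?\<tau> (W, \<psi>, F) y)" by (intro continuous_on_mult_left)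
    have "0 < integral W (\<lambda>y. s * form_mult u ?\<tau> (W, \<psi>, F) y)"
      by (rule integral_pos[OF chart_open[OF cA] cont integ[OF p(1), unfolded fst_conv] nonneg[OF p(1)] y(1) gt])
    then show ?thesis by (intro bexI[OF _ p(1)]) simp
  qed
  then obtain p where p: "p \<in> set ps" "0 < ?I p" by (rule bexE)
  have "?I p \<le> (\<Sum>p\<leftarrow>ps. ?I p)"
    by (rule member_le_sum_list) (use p I0 in auto)
  then show ?thesis using sI p(2) by auto
qed

end

section \<open>The degree homomorphism and the quotient of the filtration\<close>

definition real_group :: "real monoid" where
  "real_group = \<lparr>carrier = UNIV, monoid.mult = (+), one = 0\<rparr>"

lemma real_group_simps [simp]:
  "carrier real_group = UNIV" "x \<otimes>\<^bsub>real_group\<^esub> y = x + y" "\<one>\<^bsub>real_group\<^esub> = 0"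
  by (simp_all add: real_group_def)

lemma comm_group_real_group: "comm_group real_group"
  unfolding real_group_def by (rule comm_groupI) (auto intro: exI[of _ "- x" for x :: real])

lemma inv_real_group [simp]: "inv\<^bsub>real_group\<^esub> x = - x"
  by (rule group.inv_equality) (use comm_group_real_group in \<open>simp_all add: comm_group_def\<close>)

text \<open>Every element is \<open>h \<otimes> s0 [^] n\<close> with \<open>h\<close> in the group of differences, and \<open>D\<close>
  takes the value \<open>n d\<close> on it. So \<open>n\<close> is determined by the element, and assigning \<open>n\<close> to it
  is a surjective homomorphism whose kernel is the group of differences.\<close>

lemma (in comm_group) Mod_differences_iso_integer_group:
  assumes S: "S \<subseteq> carrier G" "carrier G = generate G S" "s0 \<in> S"
    and D: "D \<in> hom G real_group" "\<And>s. s \<in> S \<Longrightarrow> D s = d" "d \<noteq> 0"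
  shows "G Mod generate G {a \<otimes> inv b | a b. a \<in> S \<and> b \<in> S} \<cong> integer_group"
proof -
  let ?D = "{a \<otimes> inv b | a b. a \<in> S \<and> b \<in> S}"
  define H where "H = generate G ?D"
  interpret D: group_hom G real_group D
    using D(1) comm_group_real_group by (simp add: group_hom_def group_hom_axioms_def comm_group_def)
  have DS: "?D \<subseteq> carrier G" using S(1) by auto
  interpret H: subgroup H G unfolding H_def by (rule generate_is_subgroup[OF DS])
  have s0: "s0 \<in> carrier G" using S by auto
  have Dm: "D (x \<otimes> y) = D x + D y" if "x \<in> carrier G" "y \<in> carrier G" for x y
    using D.hom_mult[OF that] by simp
  have Di: "D (inv x) = - D x" if "x \<in> carrier G" for x
    using D.hom_inv[OF that] by simp
  have split: "\<exists>h\<in>H. \<exists>n :: int. x = h \<otimes> s0 [^] n \<and> D x = of_int n * d" if "x \<in> generate G S" for x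
    using that
  proof induction
    case one
    then show ?case using H.one_closed D.hom_one by (intro bexI[of _ \<one>] exI[of _ 0]) auto
  next
    case (incl s)
    have "s = (s \<otimes> inv s0) \<otimes> s0 [^] (1::int)" using incl S(1) s0 by (auto simp: m_assoc int_pow_1)
    moreover have "s \<otimes> inv s0 \<in> H" unfolding H_def using incl S(3) by (intro generate.incl) blast
    ultimately show ?case using D(2)[OF incl] by (intro bexI[of _ "s \<otimes> inv s0"] exI[of _ 1]) auto
  next
    case (inv s)
    have s: "s \<in> carrier G" using inv S(1) by auto
    have "inv s = (s0 \<otimes> inv s) \<otimes> s0 [^] (-1::int)"
      using s s0 by (simp add: int_pow_neg int_pow_1 m_comm[of s0] m_assoc)
    moreover have "s0 \<otimes> inv s \<in> H" unfolding H_def using inv S(3) by (intro generate.incl) blast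
    ultimately show ?case using D(2)[OF inv] Di[OF s] by (intro bexI[of _ "s0 \<otimes> inv s"] exI[of _ "-1"]) auto
  next
    case (eng x y)
    obtain h n h' n' where e: "h \<in> H" "x = h \<otimes> s0 [^] (n::int)" "D x = of_int n * d"
        "h' \<in> H" "y = h' \<otimes> s0 [^] (n'::int)" "D y = of_int n' * d"
      using eng.IH by blast
    have c: "h \<in> carrier G" "h' \<in> carrier G" "s0 [^] n \<in> carrier G" "s0 [^] n' \<in> carrier G"
      using e s0 H.subset by auto
    have "x \<otimes> y = (h \<otimes> h') \<otimes> s0 [^] (n + n')"
      unfolding e(2,5) int_pow_mult[OF s0] using c by (simp add: m_ac)
    moreover have "D (x \<otimes> y) = of_int (n + n') * d"
      using Dm[of x y] e c by (simp add: algebra_simps)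
    ultimately show ?case using H.m_closed[OF e(1,4)] by (intro bexI[of _ "h \<otimes> h'"] exI[of _ "n + n'"] conjI)
  qed
  have DH: "D x = 0" if "x \<in> H" for x
    using that unfolding H_def
  proof induction
    case one then show ?case using D.hom_one by simp
  next
    case (incl x) then show ?case using S(1) Dm Di D(2) by (auto simp: subset_iff)
  next
    case (inv x) then show ?case using S(1) Dm Di D(2) by (auto simp: subset_iff)
  next
    case (eng x y)
    then show ?case using Dm generate_in_carrier[OF DS] by simp
  qed
  define \<phi> where "\<phi> x = \<lfloor>D x / d\<rfloor>" for x
  have \<phi>: "\<exists>h\<in>H. x = h \<otimes> s0 [^] \<phi> x \<and> D x = of_int (\<phi> x) * d" if x: "x \<in> carrier G" for x
  proof -
    obtain h n where h: "h \<in> H" "x = h \<otimes> s0 [^] (n::int)" "D x = of_int n * d" using split x S(2) by blast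
    then have "\<phi> x = n" using D(3) by (simp add: \<phi>_def)
    then show ?thesis using h by blast
  qed
  have "\<phi> (x \<otimes> y) = \<phi> x + \<phi> y" if xy: "x \<in> carrier G" "y \<in> carrier G" for x y
  proof -
    have "D (x \<otimes> y) = of_int (\<phi> x + \<phi> y) * d"
      using \<phi>[OF xy(1)] \<phi>[OF xy(2)] Dm[OF xy] by (auto simp: algebra_simps)
    then show ?thesis using D(3) unfolding \<phi>_def[of "x \<otimes> y"] by simp
  qed
  then interpret \<phi>: group_hom G integer_group \<phi>
    by (simp add: group_hom_def group_hom_axioms_def hom_def)
  have "\<phi> ` carrier G = carrier integer_group"
  proof -
    have "\<phi> s0 = 1" using D(2)[OF S(3)] D(3) by (simp add: \<phi>_def)
    then have "\<phi> (s0 [^] n) = n" for n :: int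
      using \<phi>.hom_int_pow[OF s0, of n] by simp
    then show ?thesis using s0 by (metis (no_types, opaque_lifting) UNIV_eq_I carrier_integer_group image_eqI int_pow_closed)
  qed
  from \<phi>.FactGroup_iso[OF this] have "G Mod kernel G integer_group \<phi> \<cong> integer_group" .
  moreover have "kernel G integer_group \<phi> = H"
  proof (intro equalityI subsetI)
    fix x assume "x \<in> kernel G integer_group \<phi>"
    then have "x \<in> carrier G" "\<phi> x = 0" by (auto simp: kernel_def)
    then show "x \<in> H" using \<phi>[of x] H.subset by auto
  next
    fix x assume "x \<in> H"
    then show "x \<in> kernel G integer_group \<phi>" using DH H.subset by (auto simp: kernel_def \<phi>_def)
  qed
  ultimately show ?thesis by (simp only: H_def)
qed

lemma free_cob_hom_sum_list:
  assumes h: "h \<in> hom (free_cob \<Lambda>) real_group" and Bs: "Bs \<in> lists (branes \<Lambda>)"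
  shows "sum_list (map frag_of Bs) \<in> carrier (free_cob \<Lambda>) \<and>
    h (sum_list (map frag_of Bs)) = (\<Sum>B\<leftarrow>Bs. h (frag_of B))"
  using Bs
proof induction
  case Nil
  interpret group_hom "free_cob \<Lambda>" real_group h
    using h comm_group_real_group by (simp add: group_hom_def group_hom_axioms_def comm_group_def free_cob_def)
  show ?case using hom_one by (simp add: free_cob_def)
next
  case (Cons B Bs)
  have c: "frag_of B \<in> carrier (free_cob \<Lambda>)" using Cons by (simp add: free_cob_def)
  have "sum_list (map frag_of (B # Bs)) = frag_of B \<otimes>\<^bsub>free_cob \<Lambda>\<^esub> sum_list (map frag_of Bs)"
    by (simp add: free_cob_def)
  moreover have "frag_of B \<otimes>\<^bsub>free_cob \<Lambda>\<^esub> sum_list (map frag_of Bs) \<in> carrier (free_cob \<Lambda>)"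
    by (rule monoid.m_closed) (use c Cons in \<open>auto simp: free_cob_def intro: group.is_monoid simp del: mult_free_Abelian_group carrier_free_Abelian_group_iff\<close>)
  ultimately show ?case using hom_mult[OF h c] Cons by simp
qed

context lattice_torus
begin

lemma comm_group_free_cob: "comm_group (free_cob \<Lambda>)"
  unfolding free_cob_def by (rule abelian_free_Abelian_group)

lemma cob_relations_subgroup: "subgroup (cob_relations \<Lambda>) (free_cob \<Lambda>)"
proof -
  interpret comm_group "free_cob \<Lambda>" by (rule comm_group_free_cob)
  obtain h where h: "h \<in> hom (free_cob \<Lambda>) real_group"
    using trivial_hom comm_group_real_group by (metis comm_group_def)
  show ?thesis unfolding cob_relations_def
  proof (rule generate_is_subgroup, rule subsetI)
    fix x assume "x \<in> {sum_list (map frag_of Bs) - sum_list (map frag_of Cs) | Bs Cs.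
      Bs \<in> lists (branes \<Lambda>) \<and> Cs \<in> lists (branes \<Lambda>) \<and> cobordant \<Lambda> Bs Cs}"
    then obtain Bs Cs where x: "x = sum_list (map frag_of Bs) - sum_list (map frag_of Cs)"
        and "Bs \<in> lists (branes \<Lambda>)" "Cs \<in> lists (branes \<Lambda>)" by blast
    then have "sum_list (map frag_of Bs) \<in> carrier (free_cob \<Lambda>)" "sum_list (map frag_of Cs) \<in> carrier (free_cob \<Lambda>)"
      using free_cob_hom_sum_list[OF h] by blast+
    then show "x \<in> carrier (free_cob \<Lambda>)" unfolding x
      using keys_diff[of "sum_list (map frag_of Bs)" "sum_list (map frag_of Cs)"] by (auto simp: free_cob_def)
  qed
qed

lemma comm_group_Cob: "comm_group (Cob \<Lambda>)"
  unfolding Cob_def by (rule comm_group.abelian_FactGroup[OF comm_group_free_cob cob_relations_subgroup])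

lemma cob_class_carrier: "B \<in> branes \<Lambda> \<Longrightarrow> cob_class \<Lambda> B \<in> carrier (Cob \<Lambda>)"
  by (auto simp: cob_class_def Cob_def carrier_FactGroup free_cob_def intro!: imageI)

text \<open>The degree extends to the free abelian group of branes, and kills the relations by
  \<open>cobordant_degree\<close>.\<close>

lemma ex_degree_hom: "\<exists>D\<in>hom (Cob \<Lambda>) real_group. \<forall>B\<in>branes \<Lambda>. D (cob_class \<Lambda> B) = brane_degree \<Lambda> B"
proof -
  interpret F: comm_group "free_cob \<Lambda>" by (rule comm_group_free_cob)
  obtain h where h: "h \<in> hom (free_cob \<Lambda>) real_group" "\<And>B. B \<in> branes \<Lambda> \<Longrightarrow> h (frag_of B) = brane_degree \<Lambda> B"
    using comm_group.free_Abelian_group_universal[OF comm_group_real_group, of "brane_degree \<Lambda>" "branes \<Lambda>"]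
    unfolding free_cob_def by auto
  interpret h: group_hom "free_cob \<Lambda>" real_group h
    using h(1) comm_group_real_group F.is_group by (simp add: group_hom_def group_hom_axioms_def comm_group_def)
  note hs = free_cob_hom_sum_list[OF h(1)]
  have hsum: "h (sum_list (map frag_of Bs)) = (\<Sum>B\<leftarrow>Bs. brane_degree \<Lambda> B)" if "Bs \<in> lists (branes \<Lambda>)" for Bs
  proof -
    have "map (\<lambda>B. h (frag_of B)) Bs = map (brane_degree \<Lambda>) Bs" using that h(2) by (auto simp: in_lists_conv_set)
    then show ?thesis using hs[OF that] by (simp only:)
  qed
  have "kernel (free_cob \<Lambda>) real_group h \<supseteq> cob_relations \<Lambda>"
    unfolding cob_relations_def
  proof (rule F.generate_subgroup_incl[OF _ h.subgroup_kernel], rule subsetI)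
    fix x assume "x \<in> {sum_list (map frag_of Bs) - sum_list (map frag_of Cs) | Bs Cs.
      Bs \<in> lists (branes \<Lambda>) \<and> Cs \<in> lists (branes \<Lambda>) \<and> cobordant \<Lambda> Bs Cs}"
    then obtain Bs Cs where x: "x = sum_list (map frag_of Bs) - sum_list (map frag_of Cs)"
        and l: "Bs \<in> lists (branes \<Lambda>)" "Cs \<in> lists (branes \<Lambda>)" "cobordant \<Lambda> Bs Cs" by blast
    let ?b = "sum_list (map frag_of Bs)" and ?c = "sum_list (map frag_of Cs)"
    have c: "?b \<in> carrier (free_cob \<Lambda>)" "?c \<in> carrier (free_cob \<Lambda>)" using hs l by blast+
    then have d: "?b - ?c \<in> carrier (free_cob \<Lambda>)"
      using keys_diff[of ?b ?c] by (auto simp: free_cob_def)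
    have "?b = (?b - ?c) \<otimes>\<^bsub>free_cob \<Lambda>\<^esub> ?c" by (simp add: free_cob_def)
    then have "h ?b = h (?b - ?c) + h ?c" using h.hom_mult[OF d c(2)] by simp
    then have "h (?b - ?c) = 0" using hsum l cobordant_degree[OF lat l] by simp
    then show "x \<in> kernel (free_cob \<Lambda>) real_group h" unfolding x using d by (simp add: kernel_def)
  qed
  then have rel: "h x = 0" if "x \<in> cob_relations \<Lambda>" for x using that by (auto simp: kernel_def)
  have n: "cob_relations \<Lambda> \<lhd> free_cob \<Lambda>"
    using F.normal_iff_subgroup cob_relations_subgroup by blast
  have "h x = h y" if "x \<in> carrier (free_cob \<Lambda>)" "y \<in> carrier (free_cob \<Lambda>)"
      "cob_relations \<Lambda> #>\<^bsub>free_cob \<Lambda>\<^esub> x = cob_relations \<Lambda> #>\<^bsub>free_cob \<Lambda>\<^esub> y" for x y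
  proof -
    have "x \<in> cob_relations \<Lambda> #>\<^bsub>free_cob \<Lambda>\<^esub> y"
      using F.rcos_self[OF that(1) cob_relations_subgroup] that(3) by simp
    then obtain r where r: "r \<in> cob_relations \<Lambda>" "x = r \<otimes>\<^bsub>free_cob \<Lambda>\<^esub> y" by (auto simp: r_coset_def)
    have "r \<in> carrier (free_cob \<Lambda>)" using r(1) subgroup.subset[OF cob_relations_subgroup] by blast
    then show ?thesis using h.hom_mult[OF _ that(2)] r rel by simp
  qed
  then obtain D where "D \<in> hom (Cob \<Lambda>) real_group"
      "\<And>x. x \<in> carrier (free_cob \<Lambda>) \<Longrightarrow> D (cob_relations \<Lambda> #>\<^bsub>free_cob \<Lambda>\<^esub> x) = h x"
    using FactGroup_universal[OF h(1) n] unfolding Cob_def by metis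
  then show ?thesis
    using h(2) by (intro bexI[of _ D] ballI) (auto simp: cob_class_def free_cob_def)
qed

lemma zeroth_homology_base: "homology_group 0 (base_top \<Lambda>) \<cong> integer_group"
proof (rule isomorphic_integer_zeroth_homology_group)
  have t: "topspace (base_top \<Lambda>) = range (quot_proj \<Lambda>)" by (simp add: base_top_def topspace_quot_top)
  then show "topspace (base_top \<Lambda>) \<noteq> {}" by simp
  have "path_connectedin (base_top \<Lambda>) (quot_proj \<Lambda> ` UNIV)"
    by (rule path_connectedin_continuous_map_image[of euclidean])
       (use continuous_map_quot_proj[of \<Lambda>] in \<open>simp_all add: base_top_def convex_imp_path_connected\<close>)
  then show "path_connected_space (base_top \<Lambda>)" unfolding t[symmetric] by (simp add: path_connectedin_topspace)
qed

end

theorem lemma3p2: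
  fixes \<Lambda> :: "(real^'n) set"
    and Q :: "('n pt \<times> ('n phase, 'n::finite) vec) set"
    and \<sigma> :: "('n::finite pt, 'n phase, 'n) spin"
  assumes "full_lattice \<Lambda>"
    and "orientation (X_proj \<Lambda>) (subtopology (X_top \<Lambda>) (zero_fiber \<Lambda>)) id Q"
    and "spin_structure (subtopology (X_top \<Lambda>) (zero_fiber \<Lambda>)) Q \<sigma>"
  shows "filtration_group 0 \<Lambda> (zero_fiber \<Lambda>, Q, \<sigma>) Mod
           parallelotope_filtration 1 \<Lambda> (zero_fiber \<Lambda>, Q, \<sigma>)
         \<cong> homology_group 0 (base_top \<Lambda>)"
proof -
  interpret lattice_torus \<Lambda> by unfold_locales (rule assms(1))
  let ?B0 = "(zero_fiber \<Lambda>, Q, \<sigma>)"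
  note Q = assms(2)[unfolded zero_fiber_def] and \<sigma> = assms(3)[unfolded zero_fiber_def]
  define S where "S = fib_class \<Lambda> ?B0 ` topspace (base_top \<Lambda>)"
  define G where "G = Cob_fib \<Lambda> ?B0"
  interpret Cob: comm_group "Cob \<Lambda>" by (rule comm_group_Cob)
  have Sc: "S \<subseteq> carrier (Cob \<Lambda>)"
    using translate_brane_mem[OF Q \<sigma>]
    by (auto simp: S_def fib_class_def zero_fiber_def base_top_def topspace_quot_top intro!: cob_class_carrier)
  have G: "G = subgroup_generated (Cob \<Lambda>) S" by (simp add: G_def Cob_fib_def S_def)
  have cG: "comm_group G" unfolding G by (rule Cob.abelian_subgroup_generated) (rule comm_group_Cob)
  interpret G: comm_group G by (rule cG)
  have carG: "carrier G = generate (Cob \<Lambda>) S" unfolding G carrier_subgroup_generated using Sc by (simp add: Int_absorb1)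
  have SG: "S \<subseteq> carrier G" unfolding carG by (auto intro: generate.incl)
  have genG: "carrier G = generate G S"
    using Cob.subgroup_generated2[of S] SG unfolding G[symmetric]
    by (metis carrier_subgroup_generated inf.absorb_iff2)
  obtain D where D: "D \<in> hom (Cob \<Lambda>) real_group" "\<And>B. B \<in> branes \<Lambda> \<Longrightarrow> D (cob_class \<Lambda> B) = brane_degree \<Lambda> B"
    using ex_degree_hom by blast
  have DG: "D \<in> hom G real_group" unfolding G using D(1) by (rule Cob.hom_from_subgroup_generated)
  have DS: "D s = brane_degree \<Lambda> ?B0" if "s \<in> S" for s
    using that D(2)[OF translate_brane_mem[OF Q \<sigma>]] degree_translate[OF Q \<sigma>]
    by (auto simp: S_def fib_class_def zero_fiber_def base_top_def topspace_quot_top)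
  have d: "brane_degree \<Lambda> ?B0 \<noteq> 0" using fibre_degree_nonzero[OF Q \<sigma>] by (simp add: zero_fiber_def)
  have s0: "fib_class \<Lambda> ?B0 (quot_proj \<Lambda> 0) \<in> S" by (simp add: S_def base_top_def topspace_quot_top)
  have hom_eq: "Cob_fib_hom \<Lambda> ?B0 = generate G {a \<otimes>\<^bsub>G\<^esub> inv\<^bsub>G\<^esub> b | a b. a \<in> S \<and> b \<in> S}"
    unfolding Cob_fib_hom_def S_def G_def[symmetric] by (rule arg_cong[where f="generate G"]) blast
  have "{a \<otimes>\<^bsub>G\<^esub> inv\<^bsub>G\<^esub> b | a b. a \<in> S \<and> b \<in> S} \<subseteq> carrier G" using SG by auto
  then have sub: "subgroup (Cob_fib_hom \<Lambda> ?B0) G" unfolding hom_eq by (rule G.generate_is_subgroup)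
  have "parallelotope_filtration 1 \<Lambda> ?B0 = generate G (Cob_fib_hom \<Lambda> ?B0)"
    by (simp add: G_def)
  also have "\<dots> = Cob_fib_hom \<Lambda> ?B0"
    using G.generate_subgroup_incl[OF order_refl sub] by (auto intro: generate.incl)
  finally have F1: "parallelotope_filtration 1 \<Lambda> ?B0 = Cob_fib_hom \<Lambda> ?B0" .
  have F0: "filtration_group 0 \<Lambda> ?B0 = G" by (simp add: filtration_group_def G_def)
  have iso: "filtration_group 0 \<Lambda> ?B0 Mod parallelotope_filtration 1 \<Lambda> ?B0 \<cong> integer_group"
    unfolding F0 F1 hom_eq by (rule G.Mod_differences_iso_integer_group[OF SG genG s0 DG DS d])
  have "integer_group \<cong> homology_group 0 (base_top \<Lambda>)"
    by (rule group.iso_sym[OF _ zeroth_homology_base]) simp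
  with iso show ?thesis by (rule iso_trans)
qed

end
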